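(* Let $m,n,r\ge1$ and let $\mathcal A$ be a generic complex $3\times3$ block matrix with diagonal blocks of sizes $m,n,r$. Then $\mathcal A$ admits a factorization $\mathcal A=\mathcal A_1\mathcal A_2\mathcal A_3$ with $$\mathcal A_1=\begin{pmatrix}A_1&B_1&0\\C_1&D_1&0\\0&0&\mathbf 1\end{pmatrix},\quad \mathcal A_2=\begin{pmatrix}A_2&0&B_2\\0&\mathbf 1&0\\C_2&0&D_2\end{pmatrix},\quad \mathcal A_3=\begin{pmatrix}\mathbf 1&0&0\\0&A_3&B_3\\0&C_3&D_3\end{pmatrix}.$$ Put $\mathcal B=\mathcal A_3\mathcal A_2\mathcal A_1$. Then the invariant curve of $\mathcal B$ coincides with the invariant curve $\Gamma$ of $\mathcal A$, and if $\mathcal D$ is the divisor corresponding to $\mathcal A$, then the divisor corresponding to $\mathcal B$ is linearly equivalent to $\mathcal D+\mathcal D_1-\mathcal D_6$.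
   Context: Invariant curve: $\Gamma$ is the Zariski closure in $\mathbb{CP}^1\times\mathbb{CP}^1\times\mathbb{CP}^1$ of the set of $(u,v,w)\in\mathbb C^3$ with $\det\bigl(\mathcal A-\mathrm{diag}(u\mathbf 1_m,v\mathbf 1_n,w\mathbf 1_r)\bigr)=0$ and $v=uw$. For generic $\mathcal A$ it is a smooth irreducible curve. Over its points there is a non-zero vector $\mathcal X=(X,Y,Z)^{\mathrm T}$ (with $X,Y,Z$ of heights $m,n,r$), unique up to a scalar, with $\mathcal A(X,Y,Z)^{\mathrm T}=(uX,vY,wZ)^{\mathrm T}$. Normalized so that its first coordinate is identically $1$, $\mathcal X$ is a meromorphic vector on $\Gamma$; its pole divisor $\mathcal D$ (considered up to linear equivalence) is the divisor corresponding to $\mathcal A$. Divisors $\mathcal D_1,\dots,\mathcal D_6$: for generic $\mathcal A$ the pole and zero divisors of $u,v,w$ on $\Gamma$ are $(u)_\infty=\mathcal D_1+\mathcal D_2$, $(v)_\infty=\mathcal D_1+\mathcal D_3$, $(w)_\infty=\mathcal D_3+\mathcal D_4$, $(u)_0=\mathcal D_4+\mathcal D_6$, $(v)_0=\mathcal D_5+\mathcal D_6$, $(w)_0=\mathcal D_5+\mathcal D_2$, with effective $\mathcal D_i$ consisting of pairwise distinct points. In particular $\mathcal D_1$ is the set of points with $u=v=\infty$, $w\ne 0,\infty$, and $\mathcal D_6$ the set of points with $u=v=0$, $w\neq0,\infty$. "Generic" means: outside a proper Zariski closed subset of the space of block matrices. *)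

theory Defs
  imports
    "HOL-Complex_Analysis.Complex_Analysis"
    "HOL-Library.Poly_Mapping"
    "Jordan_Normal_Form.Determinant"
begin

unbundle no vec_syntax

section \<open>Genericity in the space of matrices\<close>

inductive matrix_polynomial :: "nat \<Rightarrow> (complex mat \<Rightarrow> complex) \<Rightarrow> bool" for N :: nat where
  const: "matrix_polynomial N (\<lambda>_. c)"
| entry: "i < N \<Longrightarrow> j < N \<Longrightarrow> matrix_polynomial N (\<lambda>M. M $$ (i, j))"
| add: "matrix_polynomial N f \<Longrightarrow> matrix_polynomial N g \<Longrightarrow> matrix_polynomial N (\<lambda>M. f M + g M)"
| mult: "matrix_polynomial N f \<Longrightarrow> matrix_polynomial N g \<Longrightarrow> matrix_polynomial N (\<lambda>M. f M * g M)"

definition zariski_closed_mats :: "nat \<Rightarrow> complex mat set \<Rightarrow> bool" where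
  "zariski_closed_mats N W \<longleftrightarrow>
     (\<exists>F. (\<forall>f\<in>F. matrix_polynomial N f) \<and> W = {M \<in> carrier_mat N N. \<forall>f\<in>F. f M = 0})"

definition for_generic_mat :: "nat \<Rightarrow> (complex mat \<Rightarrow> bool) \<Rightarrow> bool" where
  "for_generic_mat N P \<longleftrightarrow>
     (\<exists>W. zariski_closed_mats N W \<and> W \<noteq> carrier_mat N N \<and> (\<forall>M \<in> carrier_mat N N - W. P M))"

section \<open>Block matrices\<close>

text \<open>Arguments are the nine blocks, row by row.\<close>

definition three_block_mat ::
  "complex mat \<Rightarrow> complex mat \<Rightarrow> complex mat \<Rightarrow> complex mat \<Rightarrow> complex mat \<Rightarrow> complex mat \<Rightarrow>
   complex mat \<Rightarrow> complex mat \<Rightarrow> complex mat \<Rightarrow> complex mat" where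
  "three_block_mat M11 M12 M13 M21 M22 M23 M31 M32 M33 =
     four_block_mat
       (four_block_mat M11 M12
                       M21 M22)
       (four_block_mat M13 (0\<^sub>m (dim_row M13) 0)
                       M23 (0\<^sub>m (dim_row M23) 0))
       (four_block_mat M31 M32
                       (0\<^sub>m 0 (dim_col M31)) (0\<^sub>m 0 (dim_col M32)))
       M33"

definition factor12 :: "nat \<Rightarrow> nat \<Rightarrow> nat \<Rightarrow> complex mat \<Rightarrow> bool" where
  "factor12 m n r M \<longleftrightarrow>
     (\<exists>A \<in> carrier_mat m m. \<exists>B \<in> carrier_mat m n. \<exists>C \<in> carrier_mat n m. \<exists>D \<in> carrier_mat n n.
        M = three_block_mat
              A          B          (0\<^sub>m m r)
              C          D          (0\<^sub>m n r)
              (0\<^sub>m r m)   (0\<^sub>m r n)   (1\<^sub>m r))"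

definition factor13 :: "nat \<Rightarrow> nat \<Rightarrow> nat \<Rightarrow> complex mat \<Rightarrow> bool" where
  "factor13 m n r M \<longleftrightarrow>
     (\<exists>A \<in> carrier_mat m m. \<exists>B \<in> carrier_mat m r. \<exists>C \<in> carrier_mat r m. \<exists>D \<in> carrier_mat r r.
        M = three_block_mat
              A          (0\<^sub>m m n)   B
              (0\<^sub>m n m)   (1\<^sub>m n)     (0\<^sub>m n r)
              C          (0\<^sub>m r n)   D)"

definition factor23 :: "nat \<Rightarrow> nat \<Rightarrow> nat \<Rightarrow> complex mat \<Rightarrow> bool" where
  "factor23 m n r M \<longleftrightarrow>
     (\<exists>A \<in> carrier_mat n n. \<exists>B \<in> carrier_mat n r. \<exists>C \<in> carrier_mat r n. \<exists>D \<in> carrier_mat r r.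
        M = three_block_mat
              (1\<^sub>m m)     (0\<^sub>m m n)   (0\<^sub>m m r)
              (0\<^sub>m n m)   A          B
              (0\<^sub>m r m)   C          D)"

definition spectral_diag :: "nat \<Rightarrow> nat \<Rightarrow> nat \<Rightarrow> complex \<Rightarrow> complex \<Rightarrow> complex \<Rightarrow> complex mat" where
  "spectral_diag m n r u v w =
     three_block_mat
       (u \<cdot>\<^sub>m 1\<^sub>m m)  (0\<^sub>m m n)     (0\<^sub>m m r)
       (0\<^sub>m n m)     (v \<cdot>\<^sub>m 1\<^sub>m n)  (0\<^sub>m n r)
       (0\<^sub>m r m)     (0\<^sub>m r n)     (w \<cdot>\<^sub>m 1\<^sub>m r)"

section \<open>The complex projective line\<close>

datatype cp1 = Fin complex | Infty

definition cp1_of :: "complex \<Rightarrow> complex \<Rightarrow> cp1" where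
  "cp1_of x y = (if y = 0 then Infty else Fin (x / y))"

text \<open>Representatives of the homogeneous coordinates.\<close>

primrec hom0 :: "cp1 \<Rightarrow> complex" where
  "hom0 (Fin z) = z"
| "hom0 Infty = 1"

primrec hom1 :: "cp1 \<Rightarrow> complex" where
  "hom1 (Fin z) = 1"
| "hom1 Infty = 0"

text \<open>The topology glued from the two affine charts \<open>z \<mapsto> [z : 1]\<close> and \<open>z \<mapsto> [1 : z]\<close>.\<close>

instantiation cp1 :: topological_space
begin

definition open_cp1 :: "cp1 set \<Rightarrow> bool" where
  "open_cp1 U \<longleftrightarrow> open {z. cp1_of z 1 \<in> U} \<and> open {z. cp1_of 1 z \<in> U}"

instance
proof
  show "open (UNIV :: cp1 set)"
    by (simp add: open_cp1_def)
  show "open (S \<inter> T)" if "open S" "open T" for S T :: "cp1 set"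
  proof -
    have "{z. cp1_of z 1 \<in> S \<inter> T} = {z. cp1_of z 1 \<in> S} \<inter> {z. cp1_of z 1 \<in> T}"
      and "{z. cp1_of 1 z \<in> S \<inter> T} = {z. cp1_of 1 z \<in> S} \<inter> {z. cp1_of 1 z \<in> T}"
      by blast+
    then show ?thesis
      using that unfolding open_cp1_def by (metis open_Int)
  qed
  show "open (\<Union>K)" if "\<forall>S\<in>K. open S" for K :: "cp1 set set"
  proof -
    have "{z. cp1_of z 1 \<in> \<Union>K} = (\<Union>S\<in>K. {z. cp1_of z 1 \<in> S})"
      and "{z. cp1_of 1 z \<in> \<Union>K} = (\<Union>S\<in>K. {z. cp1_of 1 z \<in> S})"
      by blast+
    then show ?thesis
      using that unfolding open_cp1_def by (metis (no_types, lifting) open_UN)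
  qed
qed

end

type_synonym point = "cp1 \<times> cp1 \<times> cp1"

section \<open>Zariski closure and the invariant curve\<close>

text \<open>The multihomogeneous polynomial of multidegree \<open>(a, b, c)\<close> with coefficients \<open>\<kappa>\<close>, evaluated
  at representatives of the homogeneous coordinates; whether it vanishes does not depend on their
  choice.\<close>

fun eval_form :: "nat \<Rightarrow> nat \<Rightarrow> nat \<Rightarrow> (nat \<Rightarrow> nat \<Rightarrow> nat \<Rightarrow> complex) \<Rightarrow> point \<Rightarrow> complex" where
  "eval_form a b c \<kappa> (x, y, z) =
     (\<Sum>i\<le>a. \<Sum>j\<le>b. \<Sum>k\<le>c. \<kappa> i j k * (hom0 x ^ i * hom1 x ^ (a - i))
                               * (hom0 y ^ j * hom1 y ^ (b - j))
                               * (hom0 z ^ k * hom1 z ^ (c - k)))"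

definition zariski_closure :: "point set \<Rightarrow> point set" where
  "zariski_closure S =
     {p. \<forall>a b c \<kappa>. (\<forall>q\<in>S. eval_form a b c \<kappa> q = 0) \<longrightarrow> eval_form a b c \<kappa> p = 0}"

definition invariant_curve :: "nat \<Rightarrow> nat \<Rightarrow> nat \<Rightarrow> complex mat \<Rightarrow> point set" where
  "invariant_curve m n r A =
     zariski_closure {(Fin u, Fin v, Fin w) | u v w.
       Determinant.det (A - spectral_diag m n r u v w) = 0 \<and> v = u * w}"

section \<open>Local parameters\<close>

definition local_lift ::
  "(complex \<Rightarrow> cp1) \<Rightarrow> complex \<Rightarrow> (complex \<Rightarrow> complex) \<Rightarrow> (complex \<Rightarrow> complex) \<Rightarrow> bool" where
  "local_lift \<psi> t g h \<longleftrightarrow>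
     g analytic_on {t} \<and> h analytic_on {t} \<and> (g t, h t) \<noteq> (0, 0) \<and>
     (\<forall>\<^sub>F s in nhds t. \<psi> s = cp1_of (g s) (h s))"

definition cp1_holomorphic_at :: "(complex \<Rightarrow> cp1) \<Rightarrow> complex \<Rightarrow> bool" where
  "cp1_holomorphic_at \<psi> t \<longleftrightarrow> (\<exists>g h. local_lift \<psi> t g h)"

text \<open>The Wronskian \<open>g' h - g h'\<close> of a lift is nonzero iff the differential of \<open>[g : h]\<close> is.\<close>

definition cp1_immersive_at :: "(complex \<Rightarrow> cp1) \<Rightarrow> complex \<Rightarrow> bool" where
  "cp1_immersive_at \<psi> t \<longleftrightarrow>
     (\<exists>g h. local_lift \<psi> t g h \<and> deriv g t * h t \<noteq> g t * deriv h t)"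

text \<open>A biholomorphic parametrization, by the unit disc, of a neighbourhood of \<open>p\<close> in \<open>\<Gamma>\<close>. It
  exists precisely at the smooth points of an algebraic curve \<open>\<Gamma>\<close>; all local notions below are
  formulated through such parametrizations.\<close>

definition local_parametrization :: "point set \<Rightarrow> point \<Rightarrow> (complex \<Rightarrow> point) \<Rightarrow> bool" where
  "local_parametrization \<Gamma> p \<phi> \<longleftrightarrow>
     \<phi> 0 = p \<and>
     openin (top_of_set \<Gamma>) (\<phi> ` ball 0 1) \<and>
     (\<exists>\<theta>. homeomorphism (ball 0 1) (\<phi> ` ball 0 1) \<phi> \<theta>) \<and>
     (\<forall>t \<in> ball 0 1.
        (\<forall>\<pi> \<in> {fst, fst \<circ> snd, snd \<circ> snd}. cp1_holomorphic_at (\<pi> \<circ> \<phi>) t) \<and>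
        (\<exists>\<pi> \<in> {fst, fst \<circ> snd, snd \<circ> snd}. cp1_immersive_at (\<pi> \<circ> \<phi>) t))"

section \<open>Meromorphic functions and divisors\<close>

text \<open>Meromorphic functions are represented by total functions to the complex numbers; the values
  at the poles are irrelevant.\<close>

definition meromorphic_on_curve :: "point set \<Rightarrow> (point \<Rightarrow> complex) \<Rightarrow> bool" where
  "meromorphic_on_curve \<Gamma> f \<longleftrightarrow>
     (\<forall>p\<in>\<Gamma>. \<forall>\<phi>. local_parametrization \<Gamma> p \<phi> \<longrightarrow> (f \<circ> \<phi>) meromorphic_on {0})"

type_synonym divisor = "point \<Rightarrow>\<^sub>0 int"

definition sum_of_points :: "point set \<Rightarrow> divisor" where
  "sum_of_points S = (\<Sum>p\<in>S. Poly_Mapping.single p 1)"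

text \<open>The function in a linear equivalence must not vanish identically on (any component of)
  \<open>\<Gamma>\<close>.\<close>

definition linearly_equivalent :: "point set \<Rightarrow> divisor \<Rightarrow> divisor \<Rightarrow> bool" where
  "linearly_equivalent \<Gamma> D E \<longleftrightarrow>
     (\<exists>f. meromorphic_on_curve \<Gamma> f \<and>
        (\<forall>p\<in>\<Gamma>. \<forall>\<phi>. local_parametrization \<Gamma> p \<phi> \<longrightarrow>
           (\<forall>\<^sub>F t in at 0. f (\<phi> t) \<noteq> 0) \<and>
           zorder (f \<circ> \<phi>) 0 = Poly_Mapping.lookup D p - Poly_Mapping.lookup E p))"

definition pole_order :: "(complex \<Rightarrow> complex) \<Rightarrow> complex \<Rightarrow> int" where
  "pole_order f z = (if is_pole f z then - zorder f z else 0)"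

definition is_pole_divisor :: "point set \<Rightarrow> nat \<Rightarrow> (point \<Rightarrow> complex Matrix.vec) \<Rightarrow> divisor \<Rightarrow> bool" where
  "is_pole_divisor \<Gamma> N X D \<longleftrightarrow>
     Poly_Mapping.keys D \<subseteq> \<Gamma> \<and>
     (\<forall>p\<in>\<Gamma>. \<forall>\<phi>. local_parametrization \<Gamma> p \<phi> \<longrightarrow>
        Poly_Mapping.lookup D p = (MAX i\<in>{..<N}. pole_order (\<lambda>t. X (\<phi> t) $ i) 0))"

section \<open>The divisor corresponding to a matrix\<close>

text \<open>Over all but finitely many points of the curve, \<open>X\<close> spans the space of solutions of
  \<open>A (X, Y, Z) = (u X, v Y, w Z)\<close>. The finitely many exceptions account for the points with an
  infinite coordinate, where the equation is meaningless as it stands, and for the poles of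
  \<open>X\<close>.\<close>

definition normalized_eigenvector ::
  "nat \<Rightarrow> nat \<Rightarrow> nat \<Rightarrow> complex mat \<Rightarrow> (point \<Rightarrow> complex Matrix.vec) \<Rightarrow> bool" where
  "normalized_eigenvector m n r A X \<longleftrightarrow>
     (let \<Gamma> = invariant_curve m n r A; N = m + n + r in
      (\<forall>p\<in>\<Gamma>. X p \<in> carrier_vec N \<and> X p $ 0 = 1) \<and>
      (\<forall>i<N. meromorphic_on_curve \<Gamma> (\<lambda>p. X p $ i)) \<and>
      finite {p\<in>\<Gamma>. \<not> (\<exists>u v w. p = (Fin u, Fin v, Fin w) \<and>
        {x \<in> carrier_vec N. A *\<^sub>v x = spectral_diag m n r u v w *\<^sub>v x}
          = {c \<cdot>\<^sub>v X p | c. True})})"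

definition corresponding_divisor :: "nat \<Rightarrow> nat \<Rightarrow> nat \<Rightarrow> complex mat \<Rightarrow> divisor \<Rightarrow> bool" where
  "corresponding_divisor m n r A D \<longleftrightarrow>
     (\<exists>X. normalized_eigenvector m n r A X \<and>
          is_pole_divisor (invariant_curve m n r A) (m + n + r) X D)"

definition divisor1 :: "point set \<Rightarrow> divisor" where
  "divisor1 \<Gamma> = sum_of_points {(u, v, w) \<in> \<Gamma>. u = Infty \<and> v = Infty \<and> w \<noteq> Fin 0 \<and> w \<noteq> Infty}"

definition divisor6 :: "point set \<Rightarrow> divisor" where
  "divisor6 \<Gamma> = sum_of_points {(u, v, w) \<in> \<Gamma>. u = Fin 0 \<and> v = Fin 0 \<and> w \<noteq> Fin 0 \<and> w \<noteq> Infty}"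

end

theory Submission
  imports
    Defs
    "HOL-Computational_Algebra.Fundamental_Theorem_Algebra"
begin

text \<open>Write \<open>diag(u, uw, w) = U W\<close> with \<open>U = diag(u, u, 1)\<close> and \<open>W = diag(1, w, w)\<close>. The matrix \<open>A1\<close> commutes
  with \<open>U\<close>, and \<open>A3\<close> commutes with \<open>W\<close>. Hence, if \<open>A1 A2 A3 \<xi> = U W \<xi>\<close>, then the vector \<open>T \<xi>\<close> which consists
  of the blocks 1 and 2 of \<open>A1\<^sup>-\<^sup>1 W \<xi>\<close> and the block 3 of \<open>A3 \<xi>\<close> satisfies \<open>A3 A2 A1 (T \<xi>) = U W (T \<xi>)\<close>, and
  \<open>T\<close> is injective on eigenvectors. So \<open>A\<close> and \<open>B\<close> have the same invariant curve.

  Let \<open>X\<close> and \<open>Y\<close> be the normalized eigenvectors of \<open>A\<close> and \<open>B\<close>. Then \<open>T X = h Y\<close> for a meromorphic function \<open>h\<close>.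
  Comparing leading terms of \<open>X\<close> and \<open>T X\<close>, the map \<open>T\<close> raises the order by 1 on \<open>D2\<close>, lowers it by 1 on \<open>D4\<close> and
  preserves it elsewhere; since \<open>u\<close> has the divisor \<open>D4 + D6 - D1 - D2\<close>, the function \<open>u h\<close> has the divisor
  \<open>D' - D - D1 + D6\<close>.

  Each genericity condition is a polynomial in the entries of \<open>A\<close> that is nonzero at an example; conditions
  which quantify over points of the curve become such polynomials by eliminating these points with resultants.
  That \<open>Y\<close> exists (the first coordinate of the eigenvector of \<open>B\<close> does not vanish identically on any component)
  is a condition on \<open>A1\<close>, not directly on \<open>A\<close>: if it failed, each of \<open>m\<close> prescribed fibres \<open>w = w\<^sub>i\<close> would contain a
  point such that the first blocks of \<open>A\<^sup>-\<^sup>1\<close> applied to the blocks 1 and 2 of \<open>W \<xi>\<close> are linearly dependent at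
  these \<open>m\<close> points, which a Cauchy determinant excludes in an example.\<close>

text \<open>A factorization of \<open>A\<close> can be changed by block diagonal matrices inserted
  between the factors, and the claim concerns every factorization. Each genericity condition must
  therefore be expressed by \<open>A\<close> alone. The inverse of \<open>A\<close> sees
  \<open>A1\<close> for this reason: if \<open>y\<close> is supported in blocks 1 and 2 and the
  first block of the inverse of \<open>A\<close> applied to \<open>y\<close> is zero, then the first
  block of the inverse of \<open>A1\<close> applied to \<open>y\<close> is zero too, because the
  (3,3) block of \<open>A2\<close> is invertible. So a coordinate that vanishes for \<open>m\<close>
  independent first blocks annihilates a whole row of the inverse of \<open>A1\<close>. The
  normalization of the eigenvectors turns pole divisors into orders: with first coordinate 1, the
  multiplicity \<open>d\<close> at a point is exactly the exponent for which \<open>t ^ d\<close>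
  times the vector has a nonzero limit. Hence the effect of \<open>T\<close> only has to be found on
  vectors with a nonzero limit that satisfy the eigenvector equation, at finite points and at four
  kinds of infinite ones. Order exactly 1 of \<open>u\<close> or \<open>w\<close> at such points
  comes from the simple roots of polynomials in one variable, since a parametrization cannot be
  stationary in all coordinates.\<close>

no_notation fps_nth (infixl \<open>$\<close> 75)
no_notation fls_nth (infixl \<open>$$\<close> 75)

section \<open>Determinants with entries in algebras of functions\<close>

text \<open>Vectors are plain functions of the index, read below \<open>N\<close> only. They can
  then carry parameters and be passed to limits entry by entry; \<open>vec\<close> remains only
  where the statement is phrased with it.\<close>

definition mat_fun :: "nat \<Rightarrow> complex mat \<Rightarrow> (nat \<Rightarrow> complex) \<Rightarrow> nat \<Rightarrow> complex" where
  "mat_fun N A x i = (\<Sum>j<N. A $$ (i, j) * x j)"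

lemma mult_mat_vec_eq_mat_fun:
  assumes "M \<in> carrier_mat N N" "v \<in> carrier_vec N" "i < N"
  shows "(M *\<^sub>v v) $ i = mat_fun N M (\<lambda>j. v $ j) i"
  using assms by (auto simp: scalar_prod_def mat_fun_def lessThan_atLeast0 intro!: sum.cong)

lemma det_eq_0_iff_kernel:
  assumes M: "M \<in> carrier_mat N N"
  shows "Determinant.det M = 0 \<longleftrightarrow> (\<exists>x. (\<exists>i<N. x i \<noteq> 0) \<and> (\<forall>i<N. mat_fun N M x i = 0))"
    (is "_ \<longleftrightarrow> (\<exists>x. ?P x)")
proof -
  have "(\<exists>v. v \<in> carrier_vec N \<and> v \<noteq> 0\<^sub>v N \<and> M *\<^sub>v v = 0\<^sub>v N) \<longleftrightarrow> (\<exists>x. ?P x)"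
  proof
    assume "\<exists>v. v \<in> carrier_vec N \<and> v \<noteq> 0\<^sub>v N \<and> M *\<^sub>v v = 0\<^sub>v N"
    then obtain v where v: "v \<in> carrier_vec N" "v \<noteq> 0\<^sub>v N" "M *\<^sub>v v = 0\<^sub>v N" by blast
    have "\<exists>i<N. v $ i \<noteq> 0"
      using v(1,2) by (metis carrier_vecD eq_vecI index_zero_vec(1) index_zero_vec(2))
    moreover have "\<forall>i<N. mat_fun N M (\<lambda>j. v $ j) i = 0"
      using v mult_mat_vec_eq_mat_fun[OF M v(1)] by (metis index_zero_vec(1))
    ultimately show "\<exists>x. ?P x" by blast
  next
    assume "\<exists>x. ?P x"
    then obtain x i where x: "i < N" "x i \<noteq> 0" "\<forall>i<N. mat_fun N M x i = 0" by blast
    define v where "v = Matrix.vec N x"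
    have v: "v \<in> carrier_vec N" by (simp add: v_def)
    have "mat_fun N M (\<lambda>j. v $ j) i = mat_fun N M x i" for i
      by (simp add: mat_fun_def v_def)
    then have "M *\<^sub>v v = 0\<^sub>v N"
      using mult_mat_vec_eq_mat_fun[OF M v] x(3) M by (intro eq_vecI) auto
    moreover have "v \<noteq> 0\<^sub>v N" using x(1,2) by (auto simp: v_def dest!: arg_cong[where f = "\<lambda>v. v $ i"])
    ultimately show "\<exists>v. v \<in> carrier_vec N \<and> v \<noteq> 0\<^sub>v N \<and> M *\<^sub>v v = 0\<^sub>v N" using v by blast
  qed
  then show ?thesis using det_0_iff_vec_prod_zero[OF M] by simp
qed

text \<open>Two gradings share this interface: the degree in one polynomial variable
  (\<open>poly_functions\<close>) and the multidegree on the product of projective lines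
  (\<open>forms\<close>).\<close>

locale graded_functions =
  fixes G :: "'g::comm_monoid_add \<Rightarrow> ('b \<Rightarrow> complex) set"
  assumes const: "(\<lambda>_. c) \<in> G 0"
    and zero: "(\<lambda>_. 0) \<in> G d"
    and add: "f \<in> G d \<Longrightarrow> g \<in> G d \<Longrightarrow> (\<lambda>b. f b + g b) \<in> G d"
    and mult: "f \<in> G d \<Longrightarrow> g \<in> G e \<Longrightarrow> (\<lambda>b. f b * g b) \<in> G (d + e)"
begin

lemma sum: "(\<And>i. i \<in> I \<Longrightarrow> f i \<in> G d) \<Longrightarrow> (\<lambda>b. \<Sum>i\<in>I. f i b) \<in> G d"
  by (induction I rule: infinite_finite_induct) (auto intro: zero add)

lemma prod: "(\<And>i. i \<in> I \<Longrightarrow> f i \<in> G (d i)) \<Longrightarrow> (\<lambda>b. \<Prod>i\<in>I. f i b) \<in> G (\<Sum>i\<in>I. d i)"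
  by (induction I rule: infinite_finite_induct) (auto intro: const mult)

lemma det:
  assumes "\<And>i j. i < K \<Longrightarrow> j < K \<Longrightarrow> (\<lambda>b. E b i j) \<in> G (d i)"
  shows "(\<lambda>b. Determinant.det (Matrix.mat K K (\<lambda>(i, j). E b i j))) \<in> G (\<Sum>i<K. d i)"
proof -
  have "(\<lambda>b. \<Sum>p | p permutes {0..<K}. of_int (sign p) * (\<Prod>i = 0..<K. E b i (p i)))
      \<in> G (\<Sum>i<K. d i)"
  proof (rule sum)
    fix p assume "p \<in> {p. p permutes {0..<K}}"
    then have p: "p i < K" if "i < K" for i
      using permutes_in_image[of p "{0..<K}" i] that by auto
    \<comment> \<open>Each term has one factor from every row, so the row degrees add up whatever
      the permutation.\<close>
    have "(\<lambda>b. \<Prod>i = 0..<K. E b i (p i)) \<in> G (\<Sum>i = 0..<K. d i)"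
      by (rule prod) (use p assms in auto)
    from mult[OF const this] show "(\<lambda>b. of_int (sign p) * (\<Prod>i = 0..<K. E b i (p i))) \<in> G (\<Sum>i<K. d i)"
      by (simp add: lessThan_atLeast0)
  qed
  moreover have "(\<Prod>i = 0..<K. Matrix.mat K K (\<lambda>(i, j). E b i j) $$ (i, p i)) = (\<Prod>i = 0..<K. E b i (p i))"
    if "p permutes {0..<K}" for p b
  proof (rule prod.cong)
    fix i assume "i \<in> {0..<K}"
    moreover from this have "p i < K" using permutes_in_image[OF that, of i] by auto
    ultimately show "Matrix.mat K K (\<lambda>(i, j). E b i j) $$ (i, p i) = E b i (p i)" by simp
  qed simp
  ultimately show ?thesis by (simp add: det_def'[of _ K])
qed

end

text \<open>Determinants and adjugates arise from the entries by sums and products alone. Proved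
  once for any such \<open>S\<close>, this yields polynomiality in the matrix, polynomiality in
  \<open>w\<close>, continuity, differentiability, analyticity, meromorphy and equality of
  1-jets.\<close>

locale function_algebra =
  fixes S :: "('b \<Rightarrow> complex) set"
  assumes alg_const: "(\<lambda>_. c) \<in> S"
    and alg_add: "f \<in> S \<Longrightarrow> g \<in> S \<Longrightarrow> (\<lambda>b. f b + g b) \<in> S"
    and alg_mult: "f \<in> S \<Longrightarrow> g \<in> S \<Longrightarrow> (\<lambda>b. f b * g b) \<in> S"
begin

sublocale G: graded_functions "\<lambda>_::nat. S"
  by standard (auto intro: alg_const alg_add alg_mult)

lemma alg_uminus: "f \<in> S \<Longrightarrow> (\<lambda>b. - f b) \<in> S"
  using alg_mult[OF alg_const[of "-1"], of f] by simp

lemma alg_diff: "f \<in> S \<Longrightarrow> g \<in> S \<Longrightarrow> (\<lambda>b. f b - g b) \<in> S"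
  using alg_add[OF _ alg_uminus, of f g] by simp

lemma alg_det:
  assumes "\<And>b. M b \<in> carrier_mat K K"
    and "\<And>i j. i < K \<Longrightarrow> j < K \<Longrightarrow> (\<lambda>b. M b $$ (i, j)) \<in> S"
  shows "(\<lambda>b. Determinant.det (M b)) \<in> S"
proof -
  have "M b = Matrix.mat K K (\<lambda>(i, j). M b $$ (i, j))" for b
    using assms(1)[of b] by (intro eq_matI) auto
  then show ?thesis using G.det[of K "\<lambda>b i j. M b $$ (i, j)"] assms(2) by simp
qed

lemma alg_adj_mat:
  assumes M: "\<And>b. M b \<in> carrier_mat K K"
    and E: "\<And>i j. i < K \<Longrightarrow> j < K \<Longrightarrow> (\<lambda>b. M b $$ (i, j)) \<in> S"
    and ij: "i < K" "j < K"
  shows "(\<lambda>b. adj_mat (M b) $$ (i, j)) \<in> S"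
proof -
  obtain L where L: "K = Suc L" using ij by (cases K) auto
  have "(\<lambda>b. Determinant.det (mat_delete (M b) j i)) \<in> S"
  proof (rule alg_det)
    show "mat_delete (M b) j i \<in> carrier_mat L L" for b
      using mat_delete_carrier[OF M[of b]] L by simp
    fix k l assume kl: "k < L" "l < L"
    have "mat_delete (M b) j i $$ (k, l) = M b $$ (insert_index j k, insert_index i l)" for b
      using mat_delete_index[of "M b" L j i k l] M[of b] kl ij L by simp
    moreover have "insert_index j k < K" "insert_index i l < K"
      using kl L by (auto simp: insert_index_def)
    ultimately show "(\<lambda>b. mat_delete (M b) j i $$ (k, l)) \<in> S" using E by simp
  qed
  moreover have "adj_mat (M b) $$ (i, j) = (-1) ^ (j + i) * Determinant.det (mat_delete (M b) j i)" for b
    using ij M[of b] by (auto simp: adj_mat_def cofactor_def)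
  ultimately show ?thesis using alg_mult[OF alg_const] by simp
qed

end

subsection \<open>Elimination\<close>

text \<open>Polynomials in the last variable \<open>x\<close> with coefficients in \<open>S\<close>.
  The number \<open>d\<close> is only a bound: at special parameters \<open>a\<close> the degree may
  drop, which is why \<open>full_degree\<close> is a separate notion.\<close>

definition poly_functions :: "('a \<Rightarrow> complex) set \<Rightarrow> nat \<Rightarrow> ('a \<times> complex \<Rightarrow> complex) set" where
  "poly_functions S d = {f. \<exists>P. (\<forall>i. (\<lambda>a. coeff (P a) i) \<in> S) \<and> (\<forall>a. degree (P a) \<le> d) \<and>
     (\<forall>a x. f (a, x) = poly (P a) x)}"

lemma poly_functionsI:
  "(\<And>i. (\<lambda>a. coeff (P a) i) \<in> S) \<Longrightarrow> (\<And>a. degree (P a) \<le> d) \<Longrightarrow>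
    (\<And>a x. f (a, x) = poly (P a) x) \<Longrightarrow> f \<in> poly_functions S d"
  unfolding poly_functions_def by blast

lemma poly_functionsE:
  assumes "f \<in> poly_functions S d"
  obtains P where "\<And>i. (\<lambda>a. coeff (P a) i) \<in> S" "\<And>a. degree (P a) \<le> d"
    "\<And>a x. f (a, x) = poly (P a) x"
  using assms unfolding poly_functions_def by blast

lemma poly_functions_mono: "f \<in> poly_functions S d \<Longrightarrow> d \<le> e \<Longrightarrow> f \<in> poly_functions S e"
  by (elim poly_functionsE, rule poly_functionsI) (auto intro: order_trans)

lemma poly_functions_mono_set:
  "f \<in> poly_functions S d \<Longrightarrow> (\<And>s. s \<in> S \<Longrightarrow> (\<lambda>b. s (h b)) \<in> T) \<Longrightarrow> 
   (\<lambda>(b, x). f (h b, x)) \<in> poly_functions T d"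
proof -
  assume "f \<in> poly_functions S d" and *: "\<And>s. s \<in> S \<Longrightarrow> (\<lambda>b. s (h b)) \<in> T"
  then obtain P where P: "\<And>i. (\<lambda>a. coeff (P a) i) \<in> S" "\<And>a. degree (P a) \<le> d"
    "\<And>a x. f (a, x) = poly (P a) x"
    unfolding poly_functions_def by blast
  show ?thesis by (rule poly_functionsI[where P = "\<lambda>b. P (h b)"]) (use P *[OF P(1)] in auto)
qed

context function_algebra
begin

lemma poly_functions_base:
  assumes "s \<in> S"
  shows "(\<lambda>(a, x). s a) \<in> poly_functions S 0"
proof (rule poly_functionsI[where P = "\<lambda>a. [:s a:]"])
  show "(\<lambda>a. coeff [:s a:] i) \<in> S" for i
    using assms by (cases i) (auto simp: alg_const)
qed auto

lemma poly_functions_var: "(\<lambda>(a, x). x) \<in> poly_functions S 1"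
  by (rule poly_functionsI[where P = "\<lambda>a. [:0, 1:]"]) (auto simp: alg_const)

sublocale P: graded_functions "poly_functions S"
proof
  show "(\<lambda>_. c) \<in> poly_functions S 0" for c
    using poly_functions_base[OF alg_const[of c]] by (simp add: case_prod_unfold)
  show "(\<lambda>_. 0) \<in> poly_functions S d" for d
    by (rule poly_functionsI[where P = "\<lambda>a. 0"]) (auto simp: alg_const)
  show "(\<lambda>b. f b + g b) \<in> poly_functions S d"
    if fg: "f \<in> poly_functions S d" "g \<in> poly_functions S d" for f g d
  proof -
    obtain P where P: "\<And>i. (\<lambda>a. coeff (P a) i) \<in> S" "\<And>a. degree (P a) \<le> d"
      "\<And>a x. f (a, x) = poly (P a) x" using fg(1) unfolding poly_functions_def by blast
    obtain Q where Q: "\<And>i. (\<lambda>a. coeff (Q a) i) \<in> S" "\<And>a. degree (Q a) \<le> d"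
      "\<And>a x. g (a, x) = poly (Q a) x" using fg(2) unfolding poly_functions_def by blast
    show ?thesis
      by (rule poly_functionsI[where P = "\<lambda>a. P a + Q a"]) (use P Q in \<open>auto intro: alg_add degree_add_le\<close>)
  qed
  show "(\<lambda>b. f b * g b) \<in> poly_functions S (d + e)"
    if fg: "f \<in> poly_functions S d" "g \<in> poly_functions S e" for f g d e
  proof -
    obtain P where P: "\<And>i. (\<lambda>a. coeff (P a) i) \<in> S" "\<And>a. degree (P a) \<le> d"
      "\<And>a x. f (a, x) = poly (P a) x" using fg(1) unfolding poly_functions_def by blast
    obtain Q where Q: "\<And>i. (\<lambda>a. coeff (Q a) i) \<in> S" "\<And>a. degree (Q a) \<le> e"
      "\<And>a x. g (a, x) = poly (Q a) x" using fg(2) unfolding poly_functions_def by blast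
    show ?thesis
    proof (rule poly_functionsI[where P = "\<lambda>a. P a * Q a"])
      show "(\<lambda>a. coeff (P a * Q a) i) \<in> S" for i
        unfolding coeff_mult by (intro G.sum alg_mult P Q)
      show "degree (P a * Q a) \<le> d + e" for a
        using degree_mult_le[of "P a" "Q a"] P(2)[of a] Q(2)[of a] by linarith
    qed (use P Q in auto)
  qed
qed

end

text \<open>A resultant also vanishes when both polynomials lose degree, that is, share the root
  \<open>\<infinity>\<close>. This condition, checked at the example, rules that out;
  \<open>P \<noteq> 0\<close> matters for \<open>d = 0\<close>.\<close>

definition full_degree :: "nat \<Rightarrow> (complex \<Rightarrow> complex) \<Rightarrow> bool" where
  "full_degree d f \<longleftrightarrow> (\<exists>P. degree P = d \<and> P \<noteq> 0 \<and> (\<forall>x. f x = poly P x))"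

text \<open>Over the complex numbers the absence of common roots is coprimality. The roots of
  \<open>P\<close> are split off one by one: each is a root of \<open>b\<close>, because it is none
  of \<open>Q\<close>.\<close>

lemma dvd_mult_no_common_root:
  fixes P b Q :: "complex poly"
  assumes "P \<noteq> 0" "\<And>x. poly P x = 0 \<Longrightarrow> poly Q x \<noteq> 0" "P dvd b * Q"
  shows "P dvd b"
  using assms
proof (induction "degree P" arbitrary: P b)
  case 0
  then have "is_unit P" by (simp add: is_unit_iff_degree)
  then show ?case by (rule unit_imp_dvd)
next
  case (Suc k)
  from Suc.hyps(2) have "\<not> constant (poly P)" by (simp add: constant_degree)
  then obtain x where x: "poly P x = 0" using fundamental_theorem_of_algebra by blast
  then obtain P' where P': "P = [:- x, 1:] * P'" by (metis dvdE poly_eq_0_iff_dvd)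
  have "poly (b * Q) x = 0" using Suc.prems(3) x by (metis dvd_trans poly_eq_0_iff_dvd)
  then have "poly b x = 0" using Suc.prems(2)[OF x] by simp
  then obtain b' where b': "b = [:- x, 1:] * b'" by (metis dvdE poly_eq_0_iff_dvd)
  have P'0: "P' \<noteq> 0" using Suc.prems(1) P' by auto
  have "P' dvd b' * Q"
    using Suc.prems(3) unfolding P' b' mult.assoc by (subst (asm) dvd_times_left_cancel_iff) auto
  moreover have "degree P = Suc (degree P')" unfolding P' using P'0 by (subst degree_mult_eq) auto
  ultimately have "P' dvd b'" using Suc.hyps(1)[of P' b'] Suc.hyps(2) Suc.prems(2) P'0 P' by auto
  then show ?case unfolding P' b' by (rule mult_dvd_mono[OF dvd_refl])
qed

text \<open>\<open>g\<close> is a Sylvester determinant: its rows are the coefficients of shifts of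
  \<open>P\<close> and of \<open>Q\<close>. At a common root the powers of \<open>x\<close> form a
  kernel vector. If it vanishes, a relation between the rows reads
  \<open>b1 * P + b2 * Q = 0\<close> with \<open>b2\<close> of degree below \<open>d\<close>;
  without common roots \<open>P\<close> divides \<open>b2\<close>, so \<open>b2 = 0\<close> and then
  \<open>b1 = 0\<close>.\<close>

lemma (in function_algebra) elimination:
  assumes f: "f \<in> poly_functions S d" and q: "q \<in> poly_functions S e"
  obtains g where "g \<in> S"
    and "\<And>a x. f (a, x) = 0 \<Longrightarrow> q (a, x) = 0 \<Longrightarrow> g a = 0"
    and "\<And>a. full_degree d (\<lambda>x. f (a, x)) \<Longrightarrow> (\<And>x. f (a, x) = 0 \<Longrightarrow> q (a, x) \<noteq> 0) \<Longrightarrow> g a \<noteq> 0"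
proof -
  obtain P where P: "\<And>i. (\<lambda>a. coeff (P a) i) \<in> S" "\<And>a. degree (P a) \<le> d"
    "\<And>a x. f (a, x) = poly (P a) x" using f unfolding poly_functions_def by blast
  obtain Q where Q: "\<And>i. (\<lambda>a. coeff (Q a) i) \<in> S" "\<And>a. degree (Q a) \<le> e"
    "\<And>a x. q (a, x) = poly (Q a) x" using q unfolding poly_functions_def by blast
  \<comment> \<open>One shift of \<open>P\<close> more than in the classical size
    \<open>e + d\<close>: the matrix is then non-empty also for \<open>d = e = 0\<close>, where the
    kernel vector of powers would otherwise have no entry.\<close>
  define E where "E = Suc e"
  define K where "K = E + d"
  define R where "R a i = (if i < E then monom 1 i * P a else monom 1 (i - E) * Q a)" for a i
  have coeffR: "coeff (R a i) j = (if i < E then (if i \<le> j then coeff (P a) (j - i) else 0)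
      else if i - E \<le> j then coeff (Q a) (j - (i - E)) else 0)" for a i j
    by (simp add: R_def coeff_monom_mult)
  have degR: "degree (R a i) < K" if "i < K" for a i
  proof (cases "i < E")
    case True
    then show ?thesis using degree_mult_le[of "monom 1 i" "P a"] P(2)[of a] 
      by (simp add: R_def K_def degree_monom_eq)
  next
    case False
    then show ?thesis using degree_mult_le[of "monom 1 (i - E)" "Q a"] Q(2)[of a] that
      by (simp add: R_def K_def degree_monom_eq E_def)
  qed
  define M where "M a = Matrix.mat K K (\<lambda>(i, j). coeff (R a i) j)" for a
  have M: "M a \<in> carrier_mat K K" for a by (simp add: M_def)
  define g where "g a = Determinant.det (M a)" for a
  have "g \<in> S" unfolding g_def[abs_def]
  proof (rule alg_det[OF M])
    fix i j assume "i < K" "j < K"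
    then have "(\<lambda>a. M a $$ (i, j)) = (\<lambda>a. coeff (R a i) j)" by (simp add: M_def)
    also have "\<dots> \<in> S"
      unfolding coeffR using P(1) Q(1) alg_const[of 0] by (cases "i < E"; cases "i \<le> j"; cases "i - E \<le> j") simp_all
    finally show "(\<lambda>a. M a $$ (i, j)) \<in> S" .
  qed
  moreover have "g a = 0" if "f (a, x) = 0" "q (a, x) = 0" for a x
  proof -
    have "mat_fun K (M a) (\<lambda>j. x ^ j) i = 0" if i: "i < K" for i
    proof -
      have "mat_fun K (M a) (\<lambda>j. x ^ j) i = (\<Sum>j<K. coeff (R a i) j * x ^ j)"
        using i by (simp add: mat_fun_def M_def)
      also have "\<dots> = (\<Sum>j\<le>degree (R a i). coeff (R a i) j * x ^ j)"
        by (rule sum.mono_neutral_right) (use degR[OF i, of a] in \<open>auto simp: coeff_eq_0\<close>)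
      also have "\<dots> = poly (R a i) x" by (simp add: poly_altdef)
      also have "\<dots> = 0" using \<open>f (a, x) = 0\<close> \<open>q (a, x) = 0\<close> by (simp add: R_def P(3) Q(3))
      finally show ?thesis .
    qed
    moreover have "0 < K" by (simp add: K_def E_def)
    moreover have "x ^ 0 \<noteq> 0" by simp
    ultimately show ?thesis unfolding g_def det_eq_0_iff_kernel[OF M] by blast
  qed
  moreover have "g a \<noteq> 0" if full: "full_degree d (\<lambda>x. f (a, x))" and no: "\<And>x. f (a, x) = 0 \<Longrightarrow> q (a, x) \<noteq> 0" for a
  proof
    assume "g a = 0"
    then have "Determinant.det (transpose_mat (M a)) = 0" unfolding g_def by (simp add: det_transpose[OF M])
    then obtain y where y: "\<exists>i<K. y i \<noteq> 0" "\<forall>i<K. mat_fun K (transpose_mat (M a)) y i = 0"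
      using det_eq_0_iff_kernel[of "transpose_mat (M a)" K] M by auto
    have sum0: "(\<Sum>i<K. Polynomial.smult (y i) (R a i)) = 0"
    proof (rule poly_eqI)
      fix j
      show "coeff (\<Sum>i<K. Polynomial.smult (y i) (R a i)) j = coeff 0 j"
      proof (cases "j < K")
        case True
        then have "mat_fun K (transpose_mat (M a)) y j = (\<Sum>i<K. coeff (R a i) j * y i)"
          using M[of a] by (auto simp: mat_fun_def M_def intro!: sum.cong)
        then show ?thesis using y(2) True by (simp add: coeff_sum mult.commute)
      next
        case False
        then have "coeff (R a i) j = 0" if "i < K" for i
          using degR[OF that, of a] by (intro coeff_eq_0) linarith
        then show ?thesis by (simp add: coeff_sum)
      qed
    qed
    define b1 where "b1 = (\<Sum>i<E. monom (y i) i)"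
    define b2 where "b2 = (\<Sum>i<d. monom (y (E + i)) i)"
    have split: "(\<Sum>i<K. h i) = (\<Sum>i<E. h i) + (\<Sum>i<d. h (E + i))" for h :: "nat \<Rightarrow> complex poly"
    proof -
      have "(\<Sum>i<d. h (E + i)) = sum h {E..<K}"
        by (rule sum.reindex_bij_witness[of _ "\<lambda>i. i - E" "\<lambda>i. E + i"]) (auto simp: K_def)
      then show ?thesis
        by (simp add: lessThan_atLeast0 K_def sum.atLeastLessThan_concat)
    qed
    have "(\<Sum>i<K. Polynomial.smult (y i) (R a i)) = b1 * P a + b2 * Q a"
      unfolding split b1_def b2_def sum_distrib_right
      by (simp add: R_def smult_monom smult_monom_mult flip: mult_smult_left)
    then have eq: "b1 * P a + b2 * Q a = 0" using sum0 by simp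
    obtain P' where P': "degree P' = d" "P' \<noteq> 0" "\<And>x. f (a, x) = poly P' x"
      using full unfolding full_degree_def by blast
    have "P' = P a" using P(3) P'(3) by (metis poly_eq_poly_eq_iff ext)
    with P' have Pa: "degree (P a) = d" "P a \<noteq> 0" by auto
    have "P a dvd b2 * Q a"
      using eq by (metis add_eq_0_iff dvd_triv_right dvd_minus_iff)
    then have "P a dvd b2"
      by (rule dvd_mult_no_common_root[OF Pa(2), rotated]) (use no P(3) Q(3) in auto)
    have "b2 = 0"
    proof (cases "d = 0")
      case True then show ?thesis by (simp add: b2_def)
    next
      case False
      have "degree b2 \<le> d - 1" unfolding b2_def
        by (rule degree_sum_le) (use False in \<open>auto intro!: order_trans[OF degree_monom_le]\<close>)
      then show ?thesis using \<open>P a dvd b2\<close> dvd_imp_degree_le[of "P a" b2] Pa(1) False by linarith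
    qed
    then have "b1 = 0" using eq Pa(2) by simp
    have "y i = 0" if "i < K" for i
    proof (cases "i < E")
      case True
      have "coeff b1 i = y i" unfolding b1_def using True by (simp add: coeff_sum when_def)
      then show ?thesis using \<open>b1 = 0\<close> by simp
    next
      case False
      have "coeff b2 (i - E) = y (E + (i - E))" unfolding b2_def using False that by (simp add: coeff_sum K_def) 
      then show ?thesis using \<open>b2 = 0\<close> False by simp
    qed
    then show False using y(1) by blast
  qed
  ultimately show ?thesis using that by blast
qed

text \<open>Polynomial expressions in \<open>k\<close> unknowns over \<open>S\<close>. With this
  algebra in place of \<open>S\<close>, removing the next unknown is again an elimination in one
  variable.\<close>

inductive_set ext_functions :: "('a \<Rightarrow> complex) set \<Rightarrow> nat \<Rightarrow> ('a \<times> (nat \<Rightarrow> complex) \<Rightarrow> complex) set"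
  for S k where
  base: "s \<in> S \<Longrightarrow> (\<lambda>z. s (fst z)) \<in> ext_functions S k"
| var: "i < k \<Longrightarrow> (\<lambda>z. snd z i) \<in> ext_functions S k"
| add: "f \<in> ext_functions S k \<Longrightarrow> g \<in> ext_functions S k \<Longrightarrow> (\<lambda>z. f z + g z) \<in> ext_functions S k"
| mult: "f \<in> ext_functions S k \<Longrightarrow> g \<in> ext_functions S k \<Longrightarrow> (\<lambda>z. f z * g z) \<in> ext_functions S k"

context function_algebra
begin

lemma ext_algebra: "function_algebra (ext_functions S k)"
  by standard (use alg_const in \<open>auto intro: ext_functions.add ext_functions.mult ext_functions.base[where s = "\<lambda>_. c" for c]\<close>)

lemma ext_functions_0:
  assumes "f \<in> ext_functions S 0"
  obtains s where "s \<in> S" "f = (\<lambda>z. s (fst z))"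
proof -
  from assms have "\<exists>s\<in>S. f = (\<lambda>z. s (fst z))"
  proof induction
    case (add f g)
    then obtain s t where "s \<in> S" "t \<in> S" "f = (\<lambda>z. s (fst z))" "g = (\<lambda>z. t (fst z))" by blast
    then show ?case by (intro bexI[of _ "\<lambda>a. s a + t a"]) (auto intro: alg_add)
  next
    case (mult f g)
    then obtain s t where "s \<in> S" "t \<in> S" "f = (\<lambda>z. s (fst z))" "g = (\<lambda>z. t (fst z))" by blast
    then show ?case by (intro bexI[of _ "\<lambda>a. s a * t a"]) (auto intro: alg_mult)
  qed auto
  then show ?thesis using that by blast
qed

lemma ext_functions_Suc:
  assumes "f \<in> ext_functions S (Suc k)"
  obtains e F where "F \<in> poly_functions (ext_functions S k) e"
    "\<And>z x. F (z, x) = f (fst z, (snd z)(k := x))"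
proof -
  interpret E: function_algebra "ext_functions S k" by (rule ext_algebra)
  have "\<exists>e. (\<lambda>(z, x). f (fst z, (snd z)(k := x))) \<in> poly_functions (ext_functions S k) e"
    using assms
  proof induction
    case (base s)
    from E.poly_functions_base[OF ext_functions.base[OF this]] show ?case by auto
  next
    case (var i)
    show ?case
    proof (cases "i = k")
      case True
      then show ?thesis using E.poly_functions_var by auto
    next
      case False
      with var have "i < k" by simp
      from E.poly_functions_base[OF ext_functions.var[OF this]] show ?thesis using False by auto
    qed
  next
    case (add f g)
    then obtain d e where
      "(\<lambda>(z, x). f (fst z, (snd z)(k := x))) \<in> poly_functions (ext_functions S k) d"
      "(\<lambda>(z, x). g (fst z, (snd z)(k := x))) \<in> poly_functions (ext_functions S k) e" by blast
    then have "(\<lambda>(z, x). f (fst z, (snd z)(k := x))) \<in> poly_functions (ext_functions S k) (max d e)"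
      "(\<lambda>(z, x). g (fst z, (snd z)(k := x))) \<in> poly_functions (ext_functions S k) (max d e)"
      by (auto elim: poly_functions_mono)
    from E.P.add[OF this] show ?case by (intro exI[of _ "max d e"]) (simp add: case_prod_unfold fun_upd_def)
  next
    case (mult f g)
    then obtain d e where
      "(\<lambda>(z, x). f (fst z, (snd z)(k := x))) \<in> poly_functions (ext_functions S k) d"
      "(\<lambda>(z, x). g (fst z, (snd z)(k := x))) \<in> poly_functions (ext_functions S k) e" by blast
    from E.P.mult[OF this] show ?case by (intro exI[of _ "d + e"]) (simp add: case_prod_unfold fun_upd_def)
  qed
  then show ?thesis using that by fastforce
qed

text \<open>Each \<open>p i\<close> involves the unknown \<open>i\<close> only, so the unknowns can
  be removed from the top: a resultant over \<open>ext_functions S k\<close> eliminates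
  \<open>x k\<close>, and the induction hypothesis treats what is left.\<close>

lemma iterated_elimination:
  assumes "\<And>i. i < k \<Longrightarrow> p i \<in> poly_functions S (d i)" and "f \<in> ext_functions S k"
  shows "\<exists>g\<in>S. (\<forall>a x. (\<forall>i<k. p i (a, x i) = 0) \<longrightarrow> f (a, x) = 0 \<longrightarrow> g a = 0) \<and>
    (\<forall>a. (\<forall>i<k. full_degree (d i) (\<lambda>x. p i (a, x))) \<longrightarrow>
      (\<forall>x. (\<forall>i<k. p i (a, x i) = 0) \<longrightarrow> f (a, x) \<noteq> 0) \<longrightarrow> g a \<noteq> 0)"
  using assms
proof (induction k arbitrary: f)
  case 0
  from 0(2) obtain s where "s \<in> S" "f = (\<lambda>z. s (fst z))" by (rule ext_functions_0)
  then show ?case by (intro bexI[of _ s]) auto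
next
  case (Suc k)
  interpret E: function_algebra "ext_functions S k" by (rule ext_algebra)
  from Suc.prems(2) obtain e F where F: "F \<in> poly_functions (ext_functions S k) e"
    "\<And>z x. F (z, x) = f (fst z, (snd z)(k := x))" by (rule ext_functions_Suc) blast
  have pk: "(\<lambda>(z, x). p k (fst z, x)) \<in> poly_functions (ext_functions S k) (d k)"
    using poly_functions_mono_set[OF Suc.prems(1)[of k], of fst "ext_functions S k"]
    by (simp add: ext_functions.base)
  obtain g1 where g1: "g1 \<in> ext_functions S k"
    "\<And>z x. p k (fst z, x) = 0 \<Longrightarrow> F (z, x) = 0 \<Longrightarrow> g1 z = 0"
    "\<And>z. full_degree (d k) (\<lambda>x. p k (fst z, x)) \<Longrightarrow> (\<And>x. p k (fst z, x) = 0 \<Longrightarrow> F (z, x) \<noteq> 0)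
      \<Longrightarrow> g1 z \<noteq> 0"
    by (rule E.elimination[OF pk F(1)]) auto
  from Suc.IH[OF Suc.prems(1) g1(1)] obtain g where g: "g \<in> S"
    "\<And>a x. (\<forall>i<k. p i (a, x i) = 0) \<Longrightarrow> g1 (a, x) = 0 \<Longrightarrow> g a = 0"
    "\<And>a. (\<forall>i<k. full_degree (d i) (\<lambda>x. p i (a, x))) \<Longrightarrow>
      (\<forall>x. (\<forall>i<k. p i (a, x i) = 0) \<longrightarrow> g1 (a, x) \<noteq> 0) \<Longrightarrow> g a \<noteq> 0" by auto
  show ?case
  proof (intro bexI[OF _ g(1)] conjI allI impI)
    fix a x assume *: "\<forall>i<Suc k. p i (a, x i) = 0" "f (a, x) = 0"
    have "g1 (a, x) = 0" by (rule g1(2)[of _ "x k"]) (use * F(2) in auto)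
    then show "g a = 0" using g(2)[of a x] * by auto
  next
    fix a assume *: "\<forall>i<Suc k. full_degree (d i) (\<lambda>x. p i (a, x))"
      "\<forall>x. (\<forall>i<Suc k. p i (a, x i) = 0) \<longrightarrow> f (a, x) \<noteq> 0"
    have "g1 (a, x) \<noteq> 0" if "\<forall>i<k. p i (a, x i) = 0" for x
    proof (rule g1(3))
      fix y assume "p k (fst (a, x), y) = 0"
      then have "\<forall>i<Suc k. p i (a, (x(k := y)) i) = 0" using that by (auto simp: less_Suc_eq)
      then show "F ((a, x), y) \<noteq> 0" using *(2) F(2) by auto
    qed (use * in auto)
    then show "g a \<noteq> 0" using g(3) * by auto
  qed
qed

end

text \<open>\<open>h\<close> is the reversed polynomial, whose value at 0 is the coefficient of
  \<open>x ^ d\<close>. For a pencil this value is again a determinant, namely the one at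
  \<open>x = \<infinity>\<close>, which can be tested directly.\<close>

lemma full_degreeI:
  assumes f: "f \<in> poly_functions S d"
    and h: "\<And>s. s \<noteq> 0 \<Longrightarrow> s ^ d * f (a, 1 / s) = h s" "isCont h 0" "h 0 \<noteq> 0"
  shows "full_degree d (\<lambda>x. f (a, x))"
proof -
  obtain P where P: "\<And>a. degree (P a) \<le> d" "\<And>a x. f (a, x) = poly (P a) x"
    using f unfolding poly_functions_def by blast
  have poly: "poly (P a) x = (\<Sum>i\<le>d. coeff (P a) i * x ^ i)" for x
    unfolding poly_altdef by (rule sum.mono_neutral_left) (use P(1)[of a] in \<open>auto simp: coeff_eq_0\<close>)
  define R where "R s = (\<Sum>i\<le>d. coeff (P a) i * s ^ (d - i))" for s :: complex
  have Rh: "R s = h s" if "s \<noteq> 0" for s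
  proof -
    have "h s = (\<Sum>i\<le>d. s ^ d * (coeff (P a) i * (1 / s) ^ i))"
      by (simp add: h(1)[OF that, symmetric] P(2) poly sum_distrib_left)
    also have "\<dots> = R s" unfolding R_def
      by (rule sum.cong) (use that in \<open>auto simp: power_diff field_simps\<close>)
    finally show ?thesis ..
  qed
  have "isCont R 0" unfolding R_def[abs_def] by (intro continuous_intros)
  then have "(R \<longlongrightarrow> R 0) (at 0)" by (simp add: isCont_def)
  moreover have "(R \<longlongrightarrow> h 0) (at 0)"
    using h(2) by (subst tendsto_cong[of _ h]) (auto simp: isCont_def eventually_at_filter Rh)
  ultimately have "R 0 = h 0" by (rule LIM_unique)
  moreover have "R 0 = coeff (P a) d"
    unfolding R_def by (subst sum.remove[of _ d]) (auto simp: power_0_left intro!: sum.neutral)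
  ultimately have "coeff (P a) d \<noteq> 0" using h(3) by simp
  then have "degree (P a) = d" "P a \<noteq> 0" using P(1)[of a] le_degree[of "P a" d] by auto
  then show ?thesis unfolding full_degree_def using P(2) by blast
qed

section \<open>Genericity\<close>

text \<open>One polynomial with a witness, instead of a proper closed set given by a family of
  equations: this is what the resultants produce, and it can be multiplied.\<close>

definition generic :: "nat \<Rightarrow> (complex mat \<Rightarrow> bool) \<Rightarrow> bool" where
  "generic N P \<longleftrightarrow> (\<exists>f M0. matrix_polynomial N f \<and> M0 \<in> carrier_mat N N \<and> f M0 \<noteq> 0 \<and>
     (\<forall>M \<in> carrier_mat N N. f M \<noteq> 0 \<longrightarrow> P M))"

lemma genericI:
  "matrix_polynomial N f \<Longrightarrow> M0 \<in> carrier_mat N N \<Longrightarrow> f M0 \<noteq> 0 \<Longrightarrow>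
    (\<And>M. M \<in> carrier_mat N N \<Longrightarrow> f M \<noteq> 0 \<Longrightarrow> P M) \<Longrightarrow> generic N P"
  unfolding generic_def by blast

lemma generic_imp_for_generic_mat:
  assumes "generic N P"
  shows "for_generic_mat N P"
proof -
  obtain f M0 where f: "matrix_polynomial N f" "M0 \<in> carrier_mat N N" "f M0 \<noteq> 0"
    "\<forall>M \<in> carrier_mat N N. f M \<noteq> 0 \<longrightarrow> P M" using assms unfolding generic_def by blast
  let ?W = "{M \<in> carrier_mat N N. \<forall>f\<in>{f}. f M = 0}"
  have "zariski_closed_mats N ?W" unfolding zariski_closed_mats_def using f(1) by blast
  moreover have "?W \<noteq> carrier_mat N N" using f(2,3) by blast
  ultimately show ?thesis unfolding for_generic_mat_def using f(4) by blast
qed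

lemma generic_mono: "generic N P \<Longrightarrow> (\<And>M. M \<in> carrier_mat N N \<Longrightarrow> P M \<Longrightarrow> Q M) \<Longrightarrow> generic N Q"
  unfolding generic_def by blast

lemma matrix_polynomial_line:
  assumes "matrix_polynomial N f" "M0 \<in> carrier_mat N N" "M1 \<in> carrier_mat N N"
  shows "\<exists>p. \<forall>t. f (M0 + t \<cdot>\<^sub>m (M1 - M0)) = poly p t"
  using assms(1)
proof induction
  case (const c)
  show ?case by (rule exI[of _ "[:c:]"]) simp
next
  case (entry i j)
  show ?case
    by (rule exI[of _ "[:M0 $$ (i, j), M1 $$ (i, j) - M0 $$ (i, j):]"]) (use entry assms in auto)
next
  case (add f g)
  then obtain p q where "\<forall>t. f (M0 + t \<cdot>\<^sub>m (M1 - M0)) = poly p t"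
    "\<forall>t. g (M0 + t \<cdot>\<^sub>m (M1 - M0)) = poly q t" by blast
  then show ?case by (intro exI[of _ "p + q"]) simp
next
  case (mult f g)
  then obtain p q where "\<forall>t. f (M0 + t \<cdot>\<^sub>m (M1 - M0)) = poly p t"
    "\<forall>t. g (M0 + t \<cdot>\<^sub>m (M1 - M0)) = poly q t" by blast
  then show ?case by (intro exI[of _ "p * q"]) simp
qed

text \<open>On the complex line through the two witnesses both polynomials restrict to nonzero
  polynomials in one variable, so their product is nonzero somewhere on it.\<close>

lemma generic_conj:
  assumes "generic N P" "generic N Q"
  shows "generic N (\<lambda>M. P M \<and> Q M)"
proof -
  obtain f M0 where f: "matrix_polynomial N f" "M0 \<in> carrier_mat N N" "f M0 \<noteq> 0"
    "\<forall>M \<in> carrier_mat N N. f M \<noteq> 0 \<longrightarrow> P M" using assms(1) unfolding generic_def by blast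
  obtain g M1 where g: "matrix_polynomial N g" "M1 \<in> carrier_mat N N" "g M1 \<noteq> 0"
    "\<forall>M \<in> carrier_mat N N. g M \<noteq> 0 \<longrightarrow> Q M" using assms(2) unfolding generic_def by blast
  define L where "L t = M0 + t \<cdot>\<^sub>m (M1 - M0)" for t
  have L: "L t \<in> carrier_mat N N" for t
    using f(2) g(2) unfolding L_def by (intro add_carrier_mat smult_carrier_mat minus_carrier_mat)
  have L0: "L 0 = M0" using f(2) g(2) by (intro eq_matI) (auto simp: L_def)
  have L1: "L 1 = M1" using f(2) g(2) by (intro eq_matI) (auto simp: L_def)
  obtain p where p: "\<And>t. f (L t) = poly p t"
    using matrix_polynomial_line[OF f(1,2) g(2)] unfolding L_def by blast
  obtain q where q: "\<And>t. g (L t) = poly q t"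
    using matrix_polynomial_line[OF g(1) f(2) g(2)] unfolding L_def by blast
  have "p \<noteq> 0" using p[of 0] L0 f(3) by auto
  moreover have "q \<noteq> 0" using q[of 1] L1 g(3) by auto
  ultimately have "p * q \<noteq> 0" by simp
  then have "\<exists>t. poly (p * q) t \<noteq> 0" using poly_all_0_iff_0[of "p * q"] by blast
  then obtain t where t: "f (L t) * g (L t) \<noteq> 0" using p q by auto
  show ?thesis
    by (rule genericI[OF matrix_polynomial.mult[OF f(1) g(1)] L t]) (use f(4) g(4) in auto)
qed

lemma matrix_polynomial_algebra: "function_algebra (Collect (matrix_polynomial N))"
  by standard (auto intro: matrix_polynomial.intros)

text \<open>The eliminated polynomial is nonzero at any matrix for which the system has no solution
  and no root has escaped to infinity; that matrix is the witness.\<close>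

lemma generic_elimination:
  assumes "\<And>i. i < k \<Longrightarrow> p i \<in> poly_functions (Collect (matrix_polynomial N)) (d i)"
    and "f \<in> ext_functions (Collect (matrix_polynomial N)) k"
    and "M0 \<in> carrier_mat N N" "\<And>i. i < k \<Longrightarrow> full_degree (d i) (\<lambda>x. p i (M0, x))"
    and "\<And>x. (\<And>i. i < k \<Longrightarrow> p i (M0, x i) = 0) \<Longrightarrow> f (M0, x) \<noteq> 0"
  shows "generic N (\<lambda>M. \<forall>x. (\<forall>i<k. p i (M, x i) = 0) \<longrightarrow> f (M, x) \<noteq> 0)"
proof -
  interpret function_algebra "Collect (matrix_polynomial N)" by (rule matrix_polynomial_algebra)
  obtain g where g: "matrix_polynomial N g"
    "\<And>a x. (\<forall>i<k. p i (a, x i) = 0) \<Longrightarrow> f (a, x) = 0 \<Longrightarrow> g a = 0"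
    "\<And>a. (\<forall>i<k. full_degree (d i) (\<lambda>x. p i (a, x))) \<Longrightarrow>
      (\<forall>x. (\<forall>i<k. p i (a, x i) = 0) \<longrightarrow> f (a, x) \<noteq> 0) \<Longrightarrow> g a \<noteq> 0"
    using iterated_elimination[of k p d f, OF assms(1) assms(2)] by auto
  show ?thesis
    by (rule genericI[OF g(1) assms(3)]) (use g(2,3) assms(4,5) in auto)
qed

lemma generic_no_common_root:
  assumes p: "p \<in> poly_functions (Collect (matrix_polynomial N)) d"
    and q: "q \<in> poly_functions (Collect (matrix_polynomial N)) e"
    and M0: "M0 \<in> carrier_mat N N" "full_degree d (\<lambda>x. p (M0, x))"
    "\<And>x. p (M0, x) = 0 \<Longrightarrow> q (M0, x) \<noteq> 0"
  shows "generic N (\<lambda>M. \<forall>x. p (M, x) = 0 \<longrightarrow> q (M, x) \<noteq> 0)"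
proof -
  interpret function_algebra "Collect (matrix_polynomial N)" by (rule matrix_polynomial_algebra)
  obtain g where g: "matrix_polynomial N g"
    "\<And>a x. p (a, x) = 0 \<Longrightarrow> q (a, x) = 0 \<Longrightarrow> g a = 0"
    "\<And>a. full_degree d (\<lambda>x. p (a, x)) \<Longrightarrow> (\<And>x. p (a, x) = 0 \<Longrightarrow> q (a, x) \<noteq> 0) \<Longrightarrow> g a \<noteq> 0"
    by (rule elimination[OF p q]) auto
  show ?thesis by (rule genericI[OF g(1) M0(1)]) (use g(2,3) M0 in auto)
qed

section \<open>Block structure\<close>

lemma mat_fun_cong: "(\<And>j. j < N \<Longrightarrow> x j = y j) \<Longrightarrow> mat_fun N M x i = mat_fun N M y i"
  by (simp add: mat_fun_def)

lemma mat_fun_scale: "mat_fun N M (\<lambda>j. c * x j) i = c * mat_fun N M x i"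
  by (simp add: mat_fun_def sum_distrib_left mult_ac)

lemma mat_fun_diff: "mat_fun N M (\<lambda>j. x j - y j) i = mat_fun N M x i - mat_fun N M y i"
  by (simp add: mat_fun_def sum_subtractf algebra_simps)

lemma mat_fun_zero: "mat_fun N M (\<lambda>j. 0) i = 0"
  by (simp add: mat_fun_def)

lemma mat_fun_unit: "j < N \<Longrightarrow> mat_fun N M (\<lambda>k. if k = j then 1 else 0) i = M $$ (i, j)"
  by (simp add: mat_fun_def if_distrib cong: if_cong)

lemma mat_fun_mult:
  assumes "A \<in> carrier_mat N N" "B \<in> carrier_mat N N" "i < N"
  shows "mat_fun N (A * B) x i = mat_fun N A (mat_fun N B x) i"
proof -
  have "(A * B) $$ (i, j) = (\<Sum>k<N. A $$ (i, k) * B $$ (k, j))" if "j < N" for j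
    using assms that by (auto simp: scalar_prod_def lessThan_atLeast0 intro!: sum.cong)
  then have "mat_fun N (A * B) x i = (\<Sum>j<N. \<Sum>k<N. A $$ (i, k) * (B $$ (k, j) * x j))"
    by (simp add: mat_fun_def sum_distrib_right mult.assoc)
  also have "\<dots> = mat_fun N A (mat_fun N B x) i"
    unfolding mat_fun_def sum_distrib_left by (rule sum.swap)
  finally show ?thesis .
qed

lemma mat_fun_inverse:
  assumes M: "M \<in> carrier_mat N N" and "Determinant.det M \<noteq> 0"
  obtains M' where "M' \<in> carrier_mat N N"
    "\<And>x i. i < N \<Longrightarrow> mat_fun N M (mat_fun N M' x) i = x i"
    "\<And>x i. i < N \<Longrightarrow> mat_fun N M' (mat_fun N M x) i = x i"
proof -
  define M' where "M' = inverse (Determinant.det M) \<cdot>\<^sub>m adj_mat M"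
  have M': "M' \<in> carrier_mat N N" using adj_mat(1)[OF M] by (simp add: M'_def)
  have one: "mat_fun N (1\<^sub>m N) x i = x i" if "i < N" for x i
  proof -
    have "mat_fun N (1\<^sub>m N) x i = (\<Sum>j<N. (if i = j then x j else 0))"
      unfolding mat_fun_def using that by (intro sum.cong) auto
    then show ?thesis using that by simp
  qed
  have "M * M' = 1\<^sub>m N" "M' * M = 1\<^sub>m N"
    using adj_mat[OF M] assms by (auto simp: M'_def mult_smult_distrib[OF M] mult_smult_assoc_mat[OF _ M] intro!: eq_matI)
  then show ?thesis using that[OF M'] mat_fun_mult[OF M M'] mat_fun_mult[OF M' M] one by metis
qed

text \<open>Row \<open>i\<close> belongs to the point \<open>[g i : h i]\<close> of the projective
  line. For \<open>h i = 0\<close> it imposes \<open>x i = 0\<close>, so the same determinant covers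
  the points of the curve at infinity.\<close>

definition pencil :: "nat \<Rightarrow> complex mat \<Rightarrow> (nat \<Rightarrow> complex) \<Rightarrow> (nat \<Rightarrow> complex) \<Rightarrow> complex mat" where
  "pencil N A h g = Matrix.mat N N (\<lambda>(i, j). h i * A $$ (i, j) - (if i = j then g i else 0))"

lemma pencil_carrier [simp]: "pencil N A h g \<in> carrier_mat N N"
  by (simp add: pencil_def)

lemma mat_fun_pencil: "i < N \<Longrightarrow> mat_fun N (pencil N A h g) x i = h i * mat_fun N A x i - g i * x i"
proof -
  assume i: "i < N"
  have "mat_fun N (pencil N A h g) x i
      = (\<Sum>j<N. h i * (A $$ (i, j) * x j) - (if i = j then g j * x j else 0))"
    unfolding mat_fun_def using i by (intro sum.cong) (auto simp: pencil_def algebra_simps)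
  also have "\<dots> = h i * mat_fun N A x i - g i * x i"
    using i by (simp add: mat_fun_def sum_subtractf sum_distrib_left)
  finally show ?thesis .
qed

lemma det_pencil_eq_0_iff:
  "Determinant.det (pencil N A h g) = 0 \<longleftrightarrow>
    (\<exists>x. (\<exists>i<N. x i \<noteq> 0) \<and> (\<forall>i<N. h i * mat_fun N A x i = g i * x i))"
  unfolding det_eq_0_iff_kernel[OF pencil_carrier] by (auto simp: mat_fun_pencil)

lemma pencil_one: "A \<in> carrier_mat N N \<Longrightarrow> pencil N A (\<lambda>_. 1) (\<lambda>_. 0) = A"
  by (intro eq_matI) (auto simp: pencil_def)

text \<open>The three shapes of factors are instances with different index sets \<open>P\<close>, so
  one argument serves them all and their inverses.\<close>

definition acts_on :: "nat \<Rightarrow> (nat \<Rightarrow> bool) \<Rightarrow> complex mat \<Rightarrow> bool" where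
  "acts_on N P M \<longleftrightarrow> M \<in> carrier_mat N N \<and>
     (\<forall>i<N. \<forall>j<N. \<not> (P i \<and> P j) \<longrightarrow> M $$ (i, j) = (if i = j then 1 else 0))"

lemma acts_onD: "acts_on N P M \<Longrightarrow> M \<in> carrier_mat N N"
  by (simp add: acts_on_def)

lemma acts_on_id:
  assumes "acts_on N P M" "i < N" "\<not> P i"
  shows "mat_fun N M x i = x i"
proof -
  have "mat_fun N M x i = (\<Sum>j<N. (if i = j then x j else 0))"
    unfolding mat_fun_def using assms by (intro sum.cong) (auto simp: acts_on_def)
  then show ?thesis using assms(2) by simp
qed

lemma acts_on_cong:
  assumes "acts_on N P M" "i < N" "P i" "\<And>j. j < N \<Longrightarrow> P j \<Longrightarrow> x j = y j"
  shows "mat_fun N M x i = mat_fun N M y i"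
  unfolding mat_fun_def
proof (rule sum.cong)
  fix j assume j: "j \<in> {..<N}"
  show "M $$ (i, j) * x j = M $$ (i, j) * y j"
  proof (cases "P j")
    case True then show ?thesis using assms(4) j by simp
  next
    case False
    then have "M $$ (i, j) = 0" using assms(1,2,3) j by (auto simp: acts_on_def)
    then show ?thesis by simp
  qed
qed simp

text \<open>Commutation of \<open>M\<close> with the diagonal matrix of \<open>c\<close>, which is
  scalar on the indices where \<open>M\<close> differs from the identity.\<close>

lemma acts_on_scale:
  assumes "acts_on N P M" "i < N" "\<And>i j. i < N \<Longrightarrow> j < N \<Longrightarrow> P i \<Longrightarrow> P j \<Longrightarrow> c i = c j"
  shows "mat_fun N M (\<lambda>j. c j * x j) i = c i * mat_fun N M x i"
  unfolding mat_fun_def sum_distrib_left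
proof (rule sum.cong)
  fix j assume j: "j \<in> {..<N}"
  show "M $$ (i, j) * (c j * x j) = c i * (M $$ (i, j) * x j)"
  proof (cases "P i \<and> P j")
    case True
    then have "c i = c j" using assms(2,3) j by blast
    then show ?thesis by simp
  next
    case False
    then have "M $$ (i, j) = (if i = j then 1 else 0)" using assms(1,2) j by (simp add: acts_on_def)
    then show ?thesis by simp
  qed
qed simp

text \<open>In a row outside \<open>P\<close> the identity for \<open>M\<close> applied after
  \<open>M'\<close> reads off the entries of \<open>M'\<close>. For a column \<open>j\<close>
  outside \<open>P\<close>, the unit vector \<open>j\<close> is fixed by \<open>M\<close>, hence by
  \<open>M'\<close>.\<close>

lemma acts_on_inverse:
  assumes M: "acts_on N P M" and "Determinant.det M \<noteq> 0"
  obtains M' where "acts_on N P M'"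
    "\<And>x i. i < N \<Longrightarrow> mat_fun N M (mat_fun N M' x) i = x i"
    "\<And>x i. i < N \<Longrightarrow> mat_fun N M' (mat_fun N M x) i = x i"
proof -
  obtain M' where M': "M' \<in> carrier_mat N N"
    "\<And>x i. i < N \<Longrightarrow> mat_fun N M (mat_fun N M' x) i = x i"
    "\<And>x i. i < N \<Longrightarrow> mat_fun N M' (mat_fun N M x) i = x i"
    using mat_fun_inverse[OF acts_onD[OF M] assms(2)] by blast
  have "M' $$ (i, j) = (if i = j then 1 else 0)" if ij: "i < N" "j < N" "\<not> (P i \<and> P j)" for i j
  proof (cases "P i")
    case False
    show ?thesis
      using acts_on_id[OF M ij(1) False, of "mat_fun N M' (\<lambda>k. if k = j then 1 else 0)"]
        M'(2)[OF ij(1)] mat_fun_unit[OF ij(2), of M' i] by simp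
  next
    case True
    with ij have Pj: "\<not> P j" by simp
    have "mat_fun N M (\<lambda>k. if k = j then 1 else 0) k = (if k = j then 1 else 0)" if "k < N" for k
      using mat_fun_unit[OF ij(2), of M k] M Pj that ij(2) by (simp add: acts_on_def)
    then have "mat_fun N M' (mat_fun N M (\<lambda>k. if k = j then 1 else 0)) i
        = mat_fun N M' (\<lambda>k. if k = j then 1 else 0) i" by (intro mat_fun_cong)
    then show ?thesis using M'(3)[OF ij(1)] mat_fun_unit[OF ij(2), of M' i] by simp
  qed
  then have "acts_on N P M'" using M'(1) by (simp add: acts_on_def)
  then show ?thesis using that M' by blast
qed

definition sel :: "nat \<Rightarrow> nat \<Rightarrow> 'a \<Rightarrow> 'a \<Rightarrow> 'a \<Rightarrow> nat \<Rightarrow> 'a" where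
  "sel m n a b c i = (if i < m then a else if i < m + n then b else c)"

lemma three_block_mat_carrier:
  assumes "M11 \<in> carrier_mat m m" "M33 \<in> carrier_mat r r" "M22 \<in> carrier_mat n n"
  shows "three_block_mat M11 M12 M13 M21 M22 M23 M31 M32 M33 \<in> carrier_mat (m + n + r) (m + n + r)"
  using assms by (auto simp: three_block_mat_def)

lemma three_block_mat_index:
  assumes "M11 \<in> carrier_mat m m" "M12 \<in> carrier_mat m n" "M13 \<in> carrier_mat m r"
    "M21 \<in> carrier_mat n m" "M22 \<in> carrier_mat n n" "M23 \<in> carrier_mat n r"
    "M31 \<in> carrier_mat r m" "M32 \<in> carrier_mat r n" "M33 \<in> carrier_mat r r"
    and "i < m + n + r" "j < m + n + r"
  shows "three_block_mat M11 M12 M13 M21 M22 M23 M31 M32 M33 $$ (i, j) =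
    (if i < m then if j < m then M11 $$ (i, j) else if j < m + n then M12 $$ (i, j - m)
                   else M13 $$ (i, j - (m + n))
     else if i < m + n then if j < m then M21 $$ (i - m, j) else if j < m + n then M22 $$ (i - m, j - m)
                   else M23 $$ (i - m, j - (m + n))
     else if j < m then M31 $$ (i - (m + n), j) else if j < m + n then M32 $$ (i - (m + n), j - m)
                   else M33 $$ (i - (m + n), j - (m + n)))"
  using assms by (auto simp: three_block_mat_def)

lemma factor12_iff: "factor12 m n r M \<longleftrightarrow> acts_on (m + n + r) (\<lambda>i. i < m + n) M"
proof
  assume "factor12 m n r M"
  then show "acts_on (m + n + r) (\<lambda>i. i < m + n) M"
    unfolding factor12_def acts_on_def
    by (auto intro!: three_block_mat_carrier simp: three_block_mat_index[where m = m and n = n and r = r])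
next
  assume M: "acts_on (m + n + r) (\<lambda>i. i < m + n) M"
  let ?A = "Matrix.mat m m (\<lambda>(i, j). M $$ (i, j))"
  let ?B = "Matrix.mat m n (\<lambda>(i, j). M $$ (i, m + j))"
  let ?C = "Matrix.mat n m (\<lambda>(i, j). M $$ (m + i, j))"
  let ?D = "Matrix.mat n n (\<lambda>(i, j). M $$ (m + i, m + j))"
  let ?T = "three_block_mat ?A ?B (0\<^sub>m m r) ?C ?D (0\<^sub>m n r) (0\<^sub>m r m) (0\<^sub>m r n) (1\<^sub>m r)"
  have "M = ?T"
  proof (rule eq_matI)
    have T: "?T \<in> carrier_mat (m + n + r) (m + n + r)" by (rule three_block_mat_carrier) auto
    show "dim_row M = dim_row ?T" "dim_col M = dim_col ?T" using T acts_onD[OF M] by auto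
    fix i j assume "i < dim_row ?T" "j < dim_col ?T"
    then have "i < m + n + r" "j < m + n + r" using T by auto
    then show "M $$ (i, j) = ?T $$ (i, j)"
      using M by (subst three_block_mat_index[where m = m and n = n and r = r]) (auto simp: acts_on_def)
  qed
  then show "factor12 m n r M" unfolding factor12_def
    by (intro bexI[of _ ?A] bexI[of _ ?B] bexI[of _ ?C] bexI[of _ ?D]) auto
qed

lemma factor13_iff: "factor13 m n r M \<longleftrightarrow> acts_on (m + n + r) (\<lambda>i. i < m \<or> m + n \<le> i) M"
proof
  assume "factor13 m n r M"
  then show "acts_on (m + n + r) (\<lambda>i. i < m \<or> m + n \<le> i) M"
    unfolding factor13_def acts_on_def
    by (auto intro!: three_block_mat_carrier simp: three_block_mat_index[where m = m and n = n and r = r])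
next
  assume M: "acts_on (m + n + r) (\<lambda>i. i < m \<or> m + n \<le> i) M"
  let ?A = "Matrix.mat m m (\<lambda>(i, j). M $$ (i, j))"
  let ?B = "Matrix.mat m r (\<lambda>(i, j). M $$ (i, m + n + j))"
  let ?C = "Matrix.mat r m (\<lambda>(i, j). M $$ (m + n + i, j))"
  let ?D = "Matrix.mat r r (\<lambda>(i, j). M $$ (m + n + i, m + n + j))"
  let ?T = "three_block_mat ?A (0\<^sub>m m n) ?B (0\<^sub>m n m) (1\<^sub>m n) (0\<^sub>m n r) ?C (0\<^sub>m r n) ?D"
  have "M = ?T"
  proof (rule eq_matI)
    have T: "?T \<in> carrier_mat (m + n + r) (m + n + r)" by (rule three_block_mat_carrier) auto
    show "dim_row M = dim_row ?T" "dim_col M = dim_col ?T" using T acts_onD[OF M] by auto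
    fix i j assume "i < dim_row ?T" "j < dim_col ?T"
    then have "i < m + n + r" "j < m + n + r" using T by auto
    then show "M $$ (i, j) = ?T $$ (i, j)"
      using M by (subst three_block_mat_index[where m = m and n = n and r = r]) (auto simp: acts_on_def)
  qed
  then show "factor13 m n r M" unfolding factor13_def
    by (intro bexI[of _ ?A] bexI[of _ ?B] bexI[of _ ?C] bexI[of _ ?D]) auto
qed

lemma factor23_iff: "factor23 m n r M \<longleftrightarrow> acts_on (m + n + r) (\<lambda>i. m \<le> i) M"
proof
  assume "factor23 m n r M"
  then show "acts_on (m + n + r) (\<lambda>i. m \<le> i) M"
    unfolding factor23_def acts_on_def
    by (auto intro!: three_block_mat_carrier simp: three_block_mat_index[where m = m and n = n and r = r])
next
  assume M: "acts_on (m + n + r) (\<lambda>i. m \<le> i) M"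
  let ?A = "Matrix.mat n n (\<lambda>(i, j). M $$ (m + i, m + j))"
  let ?B = "Matrix.mat n r (\<lambda>(i, j). M $$ (m + i, m + n + j))"
  let ?C = "Matrix.mat r n (\<lambda>(i, j). M $$ (m + n + i, m + j))"
  let ?D = "Matrix.mat r r (\<lambda>(i, j). M $$ (m + n + i, m + n + j))"
  let ?T = "three_block_mat (1\<^sub>m m) (0\<^sub>m m n) (0\<^sub>m m r) (0\<^sub>m n m) ?A ?B (0\<^sub>m r m) ?C ?D"
  have "M = ?T"
  proof (rule eq_matI)
    have T: "?T \<in> carrier_mat (m + n + r) (m + n + r)" by (rule three_block_mat_carrier) auto
    show "dim_row M = dim_row ?T" "dim_col M = dim_col ?T" using T acts_onD[OF M] by auto
    fix i j assume "i < dim_row ?T" "j < dim_col ?T"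
    then have "i < m + n + r" "j < m + n + r" using T by auto
    then show "M $$ (i, j) = ?T $$ (i, j)"
      using M by (subst three_block_mat_index[where m = m and n = n and r = r]) (auto simp: acts_on_def)
  qed
  then show "factor23 m n r M" unfolding factor23_def
    by (intro bexI[of _ ?A] bexI[of _ ?B] bexI[of _ ?C] bexI[of _ ?D]) auto
qed

section \<open>Refactorization and eigenvectors\<close>

text \<open>The blocks are given by predicates rather than bounds, so that the map back from
  \<open>B\<close> to \<open>A\<close> is the same one with blocks 1 and 3 exchanged, and
  \<open>u\<close> in place of \<open>w\<close>.\<close>

definition transfer :: "nat \<Rightarrow> (nat \<Rightarrow> bool) \<Rightarrow> (nat \<Rightarrow> bool) \<Rightarrow> complex mat \<Rightarrow> complex mat \<Rightarrow> complex \<Rightarrow>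
    (nat \<Rightarrow> complex) \<Rightarrow> nat \<Rightarrow> complex" where
  "transfer N p1 p3 A1' A3 w x i =
    (if p3 i then mat_fun N A3 x i else mat_fun N A1' (\<lambda>j. (if p1 j then 1 else w) * x j) i)"

lemma transfer_eigenvector:
  fixes u w :: complex
  assumes part: "\<And>i. i < N \<Longrightarrow> (p1 i \<and> \<not> p2 i \<and> \<not> p3 i) \<or> (\<not> p1 i \<and> p2 i \<and> \<not> p3 i) \<or> (\<not> p1 i \<and> \<not> p2 i \<and> p3 i)"
    and A1: "acts_on N (\<lambda>i. p1 i \<or> p2 i) A1" and A2: "acts_on N (\<lambda>i. p1 i \<or> p3 i) A2"
    and A3: "acts_on N (\<lambda>i. p2 i \<or> p3 i) A3" and A1': "acts_on N (\<lambda>i. p1 i \<or> p2 i) A1'"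
    and inv: "\<And>x i. i < N \<Longrightarrow> mat_fun N A1 (mat_fun N A1' x) i = x i"
      "\<And>x i. i < N \<Longrightarrow> mat_fun N A1' (mat_fun N A1 x) i = x i"
    and eig: "\<And>i. i < N \<Longrightarrow> mat_fun N (A1 * A2 * A3) x i = (if p1 i then u else if p2 i then u * w else w) * x i"
  defines "\<eta> \<equiv> transfer N p1 p3 A1' A3 w x"
  shows "\<And>i. i < N \<Longrightarrow> mat_fun N (A3 * A2 * A1) \<eta> i = (if p1 i then u else if p2 i then u * w else w) * \<eta> i"
    and "\<And>i. i < N \<Longrightarrow> \<not> p3 i \<Longrightarrow> mat_fun N A2 (mat_fun N A3 x) i = u * \<eta> i"
    and "\<And>i. i < N \<Longrightarrow> p3 i \<Longrightarrow> mat_fun N A2 (mat_fun N A3 x) i = w * x i"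
    and "\<And>i. i < N \<Longrightarrow> \<not> p3 i \<Longrightarrow> mat_fun N A1 \<eta> i = (if p1 i then 1 else w) * x i"
    and "(\<And>i. i < N \<Longrightarrow> \<eta> i = 0) \<Longrightarrow> Determinant.det A3 \<noteq> 0 \<Longrightarrow> (\<And>i. i < N \<Longrightarrow> x i = 0)"
proof -
  note C = acts_onD[OF A1] acts_onD[OF A2] acts_onD[OF A3]
  define W where "W i = (if p1 i then 1 else w)" for i
  define U where "U i = (if p3 i then 1 else u)" for i
  define \<zeta> where "\<zeta> = mat_fun N A3 x"
  define y where "y = mat_fun N A2 \<zeta>"
  define \<theta> where "\<theta> = mat_fun N A1 \<eta>"
  have \<eta>: "\<eta> i = (if p3 i then \<zeta> i else mat_fun N A1' (\<lambda>j. W j * x j) i)" for i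
    by (simp add: \<eta>_def transfer_def \<zeta>_def W_def)
  have \<zeta>1: "\<zeta> i = x i" if "i < N" "p1 i" for i
    using acts_on_id[OF A3 that(1)] part[OF that(1)] that(2) by (auto simp: \<zeta>_def)
  have y2: "y i = \<zeta> i" if "i < N" "p2 i" for i
    using acts_on_id[OF A2 that(1)] part[OF that(1)] that(2) by (auto simp: y_def)
  have A1y: "mat_fun N A1 y i = U i * (W i * x i)" if "i < N" for i
  proof -
    have "mat_fun N (A1 * A2 * A3) x i = mat_fun N (A1 * A2) \<zeta> i"
      unfolding \<zeta>_def by (rule mat_fun_mult) (use C that in auto)
    also have "\<dots> = mat_fun N A1 y i"
      unfolding y_def by (rule mat_fun_mult) (use C that in auto)
    finally show ?thesis using eig[OF that] part[OF that] by (auto simp: U_def W_def mult.assoc)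
  qed
  \<comment> \<open>\<open>A1\<close> commutes with \<open>U\<close>: its inverse, applied to
    \<open>A1 y = U W x\<close>, yields \<open>U\<close> times \<open>A1' (W x)\<close>.\<close>
  have y: "y i = U i * mat_fun N A1' (\<lambda>j. W j * x j) i" if "i < N" for i
  proof -
    have "y i = mat_fun N A1' (mat_fun N A1 y) i" using inv(2)[OF that] by simp
    also have "\<dots> = mat_fun N A1' (\<lambda>j. U j * (W j * x j)) i" by (rule mat_fun_cong) (rule A1y)
    also have "\<dots> = U i * mat_fun N A1' (\<lambda>j. W j * x j) i"
      by (rule acts_on_scale[OF A1' that]) (use part in \<open>force simp: U_def\<close>)
    finally show ?thesis .
  qed
  have y12: "y i = u * \<eta> i" if "i < N" "\<not> p3 i" for i
    using y[OF that(1)] that by (simp add: \<eta> U_def)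
  have y3: "y i = w * x i" if "i < N" "p3 i" for i
    using y[OF that(1)] acts_on_id[OF A1' that(1)] part[OF that(1)] that(2) by (auto simp: U_def W_def)
  have \<theta>12: "\<theta> i = W i * x i" if i: "i < N" "\<not> p3 i" for i
  proof -
    have P: "p1 i \<or> p2 i" using part[OF i(1)] i(2) by auto
    have "\<theta> i = mat_fun N A1 (mat_fun N A1' (\<lambda>j. W j * x j)) i"
      unfolding \<theta>_def by (rule acts_on_cong[OF A1 i(1) P]) (use part in \<open>force simp: \<eta>\<close>)
    then show ?thesis using inv(1)[OF i(1)] by simp
  qed
  have \<theta>3: "\<theta> i = \<zeta> i" if i: "i < N" "p3 i" for i
    using acts_on_id[OF A1 i(1)] part[OF i(1)] i(2) by (auto simp: \<theta>_def \<eta>)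
  define \<sigma> where "\<sigma> = mat_fun N A2 \<theta>"
  have \<sigma>2: "\<sigma> i = w * x i" if i: "i < N" "p2 i" for i
    using acts_on_id[OF A2 i(1), of \<theta>] part[OF i(1)] i(2) \<theta>12[OF i(1)] by (auto simp: \<sigma>_def W_def)
  \<comment> \<open>\<open>A2\<close> mixes blocks 1 and 3 only, and there \<open>A1 \<eta>\<close>
    agrees with \<open>A3 x\<close>: both have \<open>x\<close> in block 1, where \<open>W\<close>
    is 1, and \<open>\<zeta>\<close> in block 3.\<close>
  have \<sigma>13: "\<sigma> i = y i" if i: "i < N" "p1 i \<or> p3 i" for i
    unfolding \<sigma>_def y_def
  proof (rule acts_on_cong[OF A2 i])
    fix j assume j: "j < N" "p1 j \<or> p3 j"
    show "\<theta> j = \<zeta> j"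
    proof (cases "p3 j")
      case True then show ?thesis using \<theta>3 j by simp
    next
      case False
      then show ?thesis using \<theta>12[OF j(1)] \<zeta>1[OF j(1)] j(2) by (auto simp: W_def)
    qed
  qed
  \<comment> \<open>In blocks 2 and 3, all that \<open>A3\<close> mixes, \<open>\<sigma>\<close> is
    \<open>w x\<close>. This is where the commutation of \<open>A3\<close> with \<open>W\<close>
    enters.\<close>
  have \<sigma>23: "mat_fun N A3 \<sigma> i = w * \<zeta> i" if i: "i < N" "p2 i \<or> p3 i" for i
  proof -
    have "mat_fun N A3 \<sigma> i = mat_fun N A3 (\<lambda>j. w * x j) i"
      by (rule acts_on_cong[OF A3 i]) (use \<sigma>2 \<sigma>13 y3 in auto)
    then show ?thesis by (simp add: mat_fun_scale \<zeta>_def)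
  qed
  show "mat_fun N (A3 * A2 * A1) \<eta> i = (if p1 i then u else if p2 i then u * w else w) * \<eta> i" if i: "i < N" for i
  proof -
    have "mat_fun N (A3 * A2 * A1) \<eta> i = mat_fun N (A3 * A2) \<theta> i"
      unfolding \<theta>_def by (rule mat_fun_mult) (use C i in auto)
    also have "\<dots> = mat_fun N A3 \<sigma> i"
      unfolding \<sigma>_def by (rule mat_fun_mult) (use C i in auto)
    finally have *: "mat_fun N (A3 * A2 * A1) \<eta> i = mat_fun N A3 \<sigma> i" .
    consider "p1 i" "\<not> p2 i" "\<not> p3 i" | "p2 i" "\<not> p1 i" "\<not> p3 i" | "p3 i" "\<not> p1 i" "\<not> p2 i"
      using part[OF i] by blast
    then show ?thesis
    proof cases
      case 1
      then show ?thesis using * acts_on_id[OF A3 i, of \<sigma>] \<sigma>13[OF i] y12[OF i] by simp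
    next
      case 2
      then show ?thesis using * \<sigma>23[OF i] y2[OF i] y12[OF i] by simp
    next
      case 3
      then show ?thesis using * \<sigma>23[OF i] by (simp add: \<eta>)
    qed
  qed
  show "mat_fun N A2 (mat_fun N A3 x) i = u * \<eta> i" if "i < N" "\<not> p3 i" for i
    using y12[OF that] by (simp add: y_def \<zeta>_def)
  show "mat_fun N A2 (mat_fun N A3 x) i = w * x i" if "i < N" "p3 i" for i
    using y3[OF that] by (simp add: y_def \<zeta>_def)
  show "mat_fun N A1 \<eta> i = (if p1 i then 1 else w) * x i" if "i < N" "\<not> p3 i" for i
    using \<theta>12[OF that] by (simp add: \<theta>_def W_def)
  assume 0: "\<And>i. i < N \<Longrightarrow> \<eta> i = 0" and det: "Determinant.det A3 \<noteq> 0"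
  show "x i = 0" if i: "i < N" for i
  proof -
    have \<theta>0: "\<theta> j = 0" if "j < N" for j
      unfolding \<theta>_def using mat_fun_cong[of N \<eta> "\<lambda>_. 0" A1 j] 0 by (simp add: mat_fun_zero)
    \<comment> \<open>\<open>A3 x\<close> vanishes block by block: block 1 through
      \<open>A1 \<eta>\<close>, block 2 as \<open>u \<eta>\<close>, block 3 as \<open>\<eta>\<close>
      itself.\<close>
    have "\<zeta> j = 0" if j: "j < N" for j
    proof -
      consider "p1 j" "\<not> p2 j" "\<not> p3 j" | "p2 j" "\<not> p1 j" "\<not> p3 j" | "p3 j" "\<not> p1 j" "\<not> p2 j"
        using part[OF j] by blast
      then show ?thesis
      proof cases
        case 1
        then show ?thesis using \<theta>12[OF j] \<theta>0[OF j] \<zeta>1[OF j] by (simp add: W_def)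
      next
        case 2
        then show ?thesis using y2[OF j] y12[OF j] 0[OF j] by simp
      next
        case 3
        then show ?thesis using 0[OF j] by (simp add: \<eta>)
      qed
    qed
    obtain A3' where "\<And>x i. i < N \<Longrightarrow> mat_fun N A3' (mat_fun N A3 x) i = x i"
      by (rule mat_fun_inverse[OF C(3) det]) (rule that)
    then have "x i = mat_fun N A3' \<zeta> i" using i by (simp add: \<zeta>_def)
    also have "\<dots> = 0" using mat_fun_cong[of N \<zeta> "\<lambda>_. 0" A3' i] \<open>\<And>j. j < N \<Longrightarrow> \<zeta> j = 0\<close>
      by (simp add: mat_fun_zero)
    finally show ?thesis .
  qed
qed

section \<open>Adjugates and pencils\<close>

lemma adj_mat_kernel:
  assumes M: "M \<in> carrier_mat N N" "Determinant.det M = 0" and "i < N" "c < N"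
  shows "mat_fun N M (\<lambda>k. adj_mat M $$ (k, c)) i = 0"
proof -
  have "(M * adj_mat M) $$ (i, c) = 0"
    using adj_mat(2)[OF M(1)] assms by simp
  moreover have "(M * adj_mat M) $$ (i, c) = mat_fun N M (\<lambda>k. adj_mat M $$ (k, c)) i"
    using assms adj_mat(1)[OF M(1)]
    by (auto simp: scalar_prod_def mat_fun_def lessThan_atLeast0 intro!: sum.cong)
  ultimately show ?thesis by simp
qed

lemma adj_mat_mat_fun:
  assumes M: "M \<in> carrier_mat N N" and "i < N"
  shows "mat_fun N (adj_mat M) (mat_fun N M x) i = Determinant.det M * x i"
proof -
  have "mat_fun N (adj_mat M) (mat_fun N M x) i = mat_fun N (adj_mat M * M) x i"
    by (rule mat_fun_mult[symmetric]) (use M adj_mat(1) assms in auto)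
  also have "\<dots> = (\<Sum>j<N. if i = j then Determinant.det M * x j else 0)"
    unfolding mat_fun_def by (rule sum.cong) (use adj_mat(3)[OF M] assms in auto)
  finally show ?thesis using assms(2) by simp
qed

lemma mat_fun_adj_mat:
  assumes M: "M \<in> carrier_mat N N" and "i < N"
  shows "mat_fun N M (mat_fun N (adj_mat M) x) i = Determinant.det M * x i"
proof -
  have "mat_fun N M (mat_fun N (adj_mat M) x) i = mat_fun N (M * adj_mat M) x i"
    by (rule mat_fun_mult[symmetric]) (use M adj_mat(1) assms in auto)
  also have "\<dots> = (\<Sum>j<N. if i = j then Determinant.det M * x j else 0)"
    unfolding mat_fun_def by (rule sum.cong) (use adj_mat(2)[OF M] assms in auto)
  finally show ?thesis using assms(2) by simp
qed

text \<open>Laplace expansion along row \<open>c\<close>, replaced by the \<open>a\<close>-th unit vector.\<close>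

lemma adj_mat_eq_0_iff:
  assumes M: "M \<in> carrier_mat N N" and ac: "a < N" "c < N"
  shows "adj_mat M $$ (a, c) = 0 \<longleftrightarrow>
    (\<exists>x. (\<exists>i<N. x i \<noteq> 0) \<and> x a = 0 \<and> (\<forall>i<N. i \<noteq> c \<longrightarrow> mat_fun N M x i = 0))"
proof -
  define R where "R = Matrix.mat N N (\<lambda>(i, j). if i = c then (if j = a then 1 else 0) else M $$ (i, j))"
  have R: "R \<in> carrier_mat N N" by (simp add: R_def)
  have cof: "cofactor R c a = cofactor M c a"
  proof -
    have "mat_delete R c a = mat_delete M c a"
      using M by (intro eq_matI) (auto simp: mat_delete_def R_def)
    then show ?thesis by (simp add: cofactor_def)
  qed
  have "Determinant.det R = (\<Sum>j<N. R $$ (c, j) * cofactor R c j)"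
    by (rule laplace_expansion_row[OF R ac(2)])
  also have "\<dots> = (\<Sum>j<N. if j = a then cofactor R c a else 0)"
    by (rule sum.cong) (use ac in \<open>auto simp: R_def\<close>)
  also have "\<dots> = adj_mat M $$ (a, c)" using ac M cof by (simp add: adj_mat_def)
  finally have det: "adj_mat M $$ (a, c) = Determinant.det R" ..
  have "mat_fun N R x i = (if i = c then x a else mat_fun N M x i)" if "i < N" for x i
  proof (cases "i = c")
    case True
    have "mat_fun N R x i = (\<Sum>j<N. if j = a then x j else 0)"
      unfolding mat_fun_def by (rule sum.cong) (use that True in \<open>auto simp: R_def\<close>)
    then show ?thesis using True ac by simp
  next
    case False
    then show ?thesis unfolding mat_fun_def using that by (auto simp: R_def intro!: sum.cong)
  qed
  then show ?thesis unfolding det det_eq_0_iff_kernel[OF R] using ac(2) by (metis (full_types))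
qed

lemma det_mat_scale_rows:
  "Determinant.det (Matrix.mat N N (\<lambda>(i, j). c i * E i j)) =
    (\<Prod>i<N. c i) * Determinant.det (Matrix.mat N N (\<lambda>(i, j). E i j :: complex))"
proof -
  have entry: "(\<Prod>i = 0..<N. Matrix.mat N N (\<lambda>(i, j). F i j :: complex) $$ (i, p i)) = (\<Prod>i = 0..<N. F i (p i))"
    if "p permutes {0..<N}" for p F
  proof (rule prod.cong)
    fix i assume "i \<in> {0..<N}"
    moreover from this have "p i < N" using permutes_in_image[OF that, of i] by auto
    ultimately show "Matrix.mat N N (\<lambda>(i, j). F i j) $$ (i, p i) = F i (p i)" by simp
  qed simp
  show ?thesis
    by (simp add: det_def'[of _ N] entry prod.distrib sum_distrib_left lessThan_atLeast0 mult_ac)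
qed

lemma det_pencil_scale:
  "Determinant.det (pencil N A (\<lambda>i. c i * h i) (\<lambda>i. c i * g i)) =
    (\<Prod>i<N. c i) * Determinant.det (pencil N A h g)"
proof -
  have "pencil N A (\<lambda>i. c i * h i) (\<lambda>i. c i * g i) =
      Matrix.mat N N (\<lambda>(i, j). c i * (h i * A $$ (i, j) - (if i = j then g i else 0)))"
    by (intro eq_matI) (auto simp: pencil_def algebra_simps)
  then show ?thesis by (simp only: det_mat_scale_rows) (simp add: pencil_def)
qed

lemma det_pencil_cong:
  "(\<And>i. i < N \<Longrightarrow> h i = h' i) \<Longrightarrow> (\<And>i. i < N \<Longrightarrow> g i = g' i) \<Longrightarrow>
    Determinant.det (pencil N A h g) = Determinant.det (pencil N A h' g')"
  by (rule arg_cong[where f = Determinant.det], rule eq_matI) (auto simp: pencil_def)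

lemma (in function_algebra) pencil_alg:
  assumes "\<And>i j. i < N \<Longrightarrow> j < N \<Longrightarrow> (\<lambda>b. A b $$ (i, j)) \<in> S"
    "\<And>i. i < N \<Longrightarrow> (\<lambda>b. h b i) \<in> S" "\<And>i. i < N \<Longrightarrow> (\<lambda>b. g b i) \<in> S"
    and ij: "i < N" "j < N"
  shows "(\<lambda>b. pencil N (A b) (h b) (g b) $$ (i, j)) \<in> S"
proof -
  have "(\<lambda>b. h b i * A b $$ (i, j) - (if i = j then g b i else 0)) \<in> S"
    using ij assms alg_const by (cases "i = j") (auto intro!: alg_diff alg_mult)
  then show ?thesis using ij by (simp add: pencil_def)
qed

lemma (in function_algebra) pencil_poly_functions:
  assumes A: "\<And>i j. i < N \<Longrightarrow> j < N \<Longrightarrow> (\<lambda>a. A a $$ (i, j)) \<in> S"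
    and h: "\<And>i. i < N \<Longrightarrow> (\<lambda>b. h b i) \<in> poly_functions S (d i)"
    and g: "\<And>i. i < N \<Longrightarrow> (\<lambda>b. g b i) \<in> poly_functions S (d i)"
  shows "(\<lambda>b. Determinant.det (pencil N (A (fst b)) (h b) (g b))) \<in> poly_functions S (\<Sum>i<N. d i)"
  unfolding pencil_def
proof (rule P.det)
  fix i j assume ij: "i < N" "j < N"
  have "(\<lambda>b. A (fst b) $$ (i, j)) \<in> poly_functions S 0"
    using poly_functions_base[OF A[OF ij]] by (simp add: case_prod_unfold)
  from P.mult[OF h[OF ij(1)] this]
  have 1: "(\<lambda>b. h b i * A (fst b) $$ (i, j)) \<in> poly_functions S (d i)" by simp
  have "(\<lambda>b. - 1 * (if i = j then g b i else 0)) \<in> poly_functions S (0 + d i)"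
    by (rule P.mult[OF P.const]) (use g[OF ij(1)] P.zero in \<open>cases "i = j"; simp\<close>)
  from P.add[OF 1 this[simplified]]
  show "(\<lambda>b. h b i * A (fst b) $$ (i, j) - (if i = j then g b i else 0)) \<in> poly_functions S (d i)"
    by simp
qed

lemma (in function_algebra) poly_functions_algebra: "function_algebra (\<Union>e. poly_functions S e)"
proof
  show "(\<lambda>_. c) \<in> (\<Union>e. poly_functions S e)" for c using P.const by blast
  fix f g assume "f \<in> (\<Union>e. poly_functions S e)" "g \<in> (\<Union>e. poly_functions S e)"
  then obtain d e where fg: "f \<in> poly_functions S d" "g \<in> poly_functions S e" by blast
  show "(\<lambda>b. f b * g b) \<in> (\<Union>e. poly_functions S e)" using P.mult[OF fg] by blast
  have "f \<in> poly_functions S (max d e)" "g \<in> poly_functions S (max d e)"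
    using fg by (auto elim: poly_functions_mono)
  from P.add[OF this] show "(\<lambda>b. f b + g b) \<in> (\<Union>e. poly_functions S e)" by blast
qed

lemma isCont_algebra: "function_algebra {f :: complex \<Rightarrow> complex. isCont f z}"
  by standard auto

lemma isCont_det_pencil:
  assumes "\<And>i. i < N \<Longrightarrow> isCont (\<lambda>s. h s i) z" "\<And>i. i < N \<Longrightarrow> isCont (\<lambda>s. g s i) (z :: complex)"
  shows "isCont (\<lambda>s. Determinant.det (pencil N A (h s) (g s))) z"
proof -
  interpret function_algebra "{f :: complex \<Rightarrow> complex. isCont f z}" by (rule isCont_algebra)
  have "(\<lambda>s. Determinant.det (pencil N A (h s) (g s))) \<in> {f. isCont f z}"
    by (rule alg_det[OF pencil_carrier], rule pencil_alg) (use assms in auto)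
  then show ?thesis by simp
qed

section \<open>Generic properties of pencils\<close>

lemma matrix_polynomial_entry: "i < N \<Longrightarrow> j < N \<Longrightarrow> (\<lambda>M. M $$ (i, j)) \<in> Collect (matrix_polynomial N)"
  by (auto intro: matrix_polynomial.entry)

lemma mat_fun_one: "i < N \<Longrightarrow> mat_fun N (1\<^sub>m N) x i = x i"
  using acts_on_id[of N "\<lambda>_. False" "1\<^sub>m N" i x] by (auto simp: acts_on_def)

lemma generic_det_pencil:
  assumes "M0 \<in> carrier_mat N N" "Determinant.det (pencil N M0 h g) \<noteq> 0"
  shows "generic N (\<lambda>A. Determinant.det (pencil N A h g) \<noteq> 0)"
proof -
  interpret function_algebra "Collect (matrix_polynomial N)" by (rule matrix_polynomial_algebra)
  have "(\<lambda>A. Determinant.det (pencil N A h g)) \<in> Collect (matrix_polynomial N)"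
    by (rule alg_det[OF pencil_carrier], rule pencil_alg) (auto simp: matrix_polynomial.intros)
  then have "matrix_polynomial N (\<lambda>A. Determinant.det (pencil N A h g))" by simp
  then show ?thesis
    by (intro genericI[of N "\<lambda>A. Determinant.det (pencil N A h g)" M0] assms) auto
qed

lemma generic_det_pencil_one:
  assumes "\<And>i. i < N \<Longrightarrow> h i \<noteq> g i"
  shows "generic N (\<lambda>A. Determinant.det (pencil N A h g) \<noteq> 0)"
  by (rule generic_det_pencil[of "1\<^sub>m N"]) (use assms in \<open>auto simp: det_pencil_eq_0_iff mat_fun_one\<close>)

lemma generic_ball:
  assumes "finite I" "\<And>i. i \<in> I \<Longrightarrow> generic N (P i)"
  shows "generic N (\<lambda>A. \<forall>i\<in>I. P i A)"
  using assms
proof induction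
  case empty
  show ?case by (rule genericI[OF matrix_polynomial.const[of _ 1], of "1\<^sub>m N"]) auto
next
  case (insert i I)
  then show ?case using generic_conj[of N "P i" "\<lambda>A. \<forall>i\<in>I. P i A"] by (simp add: insertI1)
qed

lemma deriv_poly_functions:
  assumes "f \<in> poly_functions S d" and "function_algebra S"
  shows "(\<lambda>(a, x). deriv (\<lambda>x. f (a, x)) x) \<in> poly_functions S d"
proof -
  interpret function_algebra S by fact
  obtain P where P: "\<And>i. (\<lambda>a. coeff (P a) i) \<in> S" "\<And>a. degree (P a) \<le> d"
    "\<And>a x. f (a, x) = poly (P a) x"
    using assms(1) unfolding poly_functions_def by blast
  show ?thesis
  proof (rule poly_functionsI[where P = "\<lambda>a. pderiv (P a)"])
    show "(\<lambda>a. coeff (pderiv (P a)) i) \<in> S" for i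
      unfolding coeff_pderiv by (intro alg_mult alg_const P)
    show "degree (pderiv (P a)) \<le> d" for a using P(2)[of a] by (simp add: degree_pderiv)
    show "(case (a, x) of (a, x) \<Rightarrow> deriv (\<lambda>x. f (a, x)) x) = poly (pderiv (P a)) x" for a x
      by (simp add: P(3) DERIV_imp_deriv[OF poly_DERIV])
  qed
qed

text \<open>Distinct nonzero diagonal entries turn the determinants of pencils into products of
  linear factors with distinct roots.\<close>

definition diag_example :: "nat \<Rightarrow> complex mat" where
  "diag_example N = Matrix.mat N N (\<lambda>(i, j). if i = j then of_nat (Suc i) else 0)"

lemma det_pencil_diag_example:
  "Determinant.det (pencil N (diag_example N) h g) = (\<Prod>i<N. h i * of_nat (Suc i) - g i)"
proof -
  have "Determinant.det (pencil N (diag_example N) h g) = prod_list (diag_mat (pencil N (diag_example N) h g))"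
    by (rule det_upper_triangular[OF _ pencil_carrier])
      (auto simp: upper_triangular_def pencil_def diag_example_def)
  also have "\<dots> = (\<Prod>i<N. h i * of_nat (Suc i) - g i)"
    by (simp add: prod_list_diag_prod lessThan_atLeast0 pencil_def diag_example_def)
  finally show ?thesis .
qed

text \<open>In the pencil below the indices in \<open>\<beta>\<close> carry the variable \<open>x\<close>. Its leading coefficient
  is the pencil at \<open>x = \<infinity>\<close>.\<close>

lemma block_pencil_poly_functions:
  "(\<lambda>(A, x). Determinant.det (pencil N A (\<lambda>i. if \<beta> i then 1 else h i) (\<lambda>i. if \<beta> i then x else g i)))
    \<in> poly_functions (Collect (matrix_polynomial N)) (\<Sum>i<N. if \<beta> i then 1 else 0)"
proof -
  interpret function_algebra "Collect (matrix_polynomial N)" by (rule matrix_polynomial_algebra)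
  have "(\<lambda>b. Determinant.det (pencil N (fst b) (\<lambda>i. if \<beta> i then 1 else h i) (\<lambda>i. if \<beta> i then snd b else g i)))
    \<in> poly_functions (Collect (matrix_polynomial N)) (\<Sum>i<N. if \<beta> i then 1 else 0)"
  proof (rule pencil_poly_functions[where A = "\<lambda>A. A"])
    fix i
    have "(\<lambda>b. 1) \<in> poly_functions (Collect (matrix_polynomial N)) 1"
      by (rule poly_functions_mono[OF P.const]) simp
    then show "(\<lambda>b. if \<beta> i then 1 else h i) \<in> poly_functions (Collect (matrix_polynomial N)) (if \<beta> i then 1 else 0)"
      using P.const by simp
    show "(\<lambda>b. if \<beta> i then snd b else g i) \<in> poly_functions (Collect (matrix_polynomial N)) (if \<beta> i then 1 else 0)"
      using P.const poly_functions_var by (simp add: case_prod_unfold)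
  qed (rule matrix_polynomial_entry)
  then show ?thesis by (simp add: case_prod_unfold)
qed

lemma block_pencil_full_degree:
  assumes "Determinant.det (pencil N A (\<lambda>i. if \<beta> i then 0 else h i) (\<lambda>i. if \<beta> i then 1 else g i)) \<noteq> 0"
  shows "full_degree (\<Sum>i<N. if \<beta> i then 1 else 0)
    (\<lambda>x. Determinant.det (pencil N A (\<lambda>i. if \<beta> i then 1 else h i) (\<lambda>i. if \<beta> i then x else g i)))"
proof -
  let ?d = "\<Sum>i<N. if \<beta> i then 1 else 0"
  let ?h = "\<lambda>s. Determinant.det (pencil N A (\<lambda>i. if \<beta> i then s else h i) (\<lambda>i. if \<beta> i then 1 else g i))"
  have "full_degree ?d (\<lambda>x. (\<lambda>(A, x). Determinant.det (pencil N A (\<lambda>i. if \<beta> i then 1 else h i)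
      (\<lambda>i. if \<beta> i then x else g i))) (A, x))"
  proof (rule full_degreeI[OF block_pencil_poly_functions, where h = ?h])
    fix s :: complex assume s: "s \<noteq> 0"
    have "?h s = Determinant.det (pencil N A (\<lambda>i. (if \<beta> i then s else 1) * (if \<beta> i then 1 else h i))
        (\<lambda>i. (if \<beta> i then s else 1) * (if \<beta> i then 1 / s else g i)))"
      by (rule det_pencil_cong) (use s in auto)
    also have "\<dots> = (\<Prod>i<N. if \<beta> i then s else 1) * Determinant.det (pencil N A
        (\<lambda>i. if \<beta> i then 1 else h i) (\<lambda>i. if \<beta> i then 1 / s else g i))"
      by (rule det_pencil_scale)
    also have "(\<Prod>i<N. if \<beta> i then s else 1) = (\<Prod>i<N. s ^ (if \<beta> i then 1 else 0))"
      by (rule prod.cong) auto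
    also have "\<dots> = s ^ ?d" by (rule power_sum[symmetric])
    finally show "s ^ ?d * (\<lambda>(A, x). Determinant.det (pencil N A (\<lambda>i. if \<beta> i then 1 else h i)
      (\<lambda>i. if \<beta> i then x else g i))) (A, 1 / s) = ?h s" by simp
  next
    show "isCont ?h 0" 
    proof (rule isCont_det_pencil)
      show "isCont (\<lambda>s. if \<beta> i then s else h i) 0" for i by (cases "\<beta> i") auto
    qed auto
    show "?h 0 \<noteq> 0" using assms by simp
  qed
  then show ?thesis by simp
qed

text \<open>A discriminant: the resultant of the determinant and its derivative. At the diagonal
  example the root \<open>Suc k\<close> belongs to the factor \<open>k\<close> alone. Simple roots
  will give order exactly 1 at the distinguished points of the curve.\<close>

lemma generic_simple_roots:
  assumes gh: "\<And>i. i < N \<Longrightarrow> \<not> \<beta> i \<Longrightarrow> (h i, g i) = (1, 0) \<or> (h i, g i) = (0, 1)"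
  shows "generic N (\<lambda>A. \<forall>x.
    Determinant.det (pencil N A (\<lambda>i. if \<beta> i then 1 else h i) (\<lambda>i. if \<beta> i then x else g i)) = 0 \<longrightarrow>
    deriv (\<lambda>x. Determinant.det (pencil N A (\<lambda>i. if \<beta> i then 1 else h i) (\<lambda>i. if \<beta> i then x else g i))) x \<noteq> 0)"
proof -
  let ?D = "diag_example N"
  let ?q = "\<lambda>(A, x). Determinant.det (pencil N A (\<lambda>i. if \<beta> i then 1 else h i) (\<lambda>i. if \<beta> i then x else g i))"
  have D: "?D \<in> carrier_mat N N" by (simp add: diag_example_def)
  let ?t = "\<lambda>x i. (if \<beta> i then 1 else h i) * of_nat (Suc i) - (if \<beta> i then x else g i) :: complex"
  have q: "?q (?D, x) = (\<Prod>i<N. ?t x i)" for x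
    by (simp add: det_pencil_diag_example)
  have gh': "h i * of_nat (Suc i) - g i \<noteq> 0" if "i < N" "\<not> \<beta> i" for i
    using gh[OF that] by (auto simp del: of_nat_Suc)
  have "generic N (\<lambda>A. \<forall>x. ?q (A, x) = 0 \<longrightarrow> (\<lambda>(A, x). deriv (\<lambda>x. ?q (A, x)) x) (A, x) \<noteq> 0)"
  proof (rule generic_no_common_root[OF block_pencil_poly_functions
        deriv_poly_functions[OF block_pencil_poly_functions matrix_polynomial_algebra] D])
    have "Determinant.det (pencil N ?D (\<lambda>i. if \<beta> i then 0 else h i) (\<lambda>i. if \<beta> i then 1 else g i)) \<noteq> 0"
      unfolding det_pencil_diag_example using gh' by auto
    from block_pencil_full_degree[OF this]
    show "full_degree (\<Sum>i<N. if \<beta> i then 1 else 0) (\<lambda>x. ?q (?D, x))" by simp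
  next
    fix x assume "?q (?D, x) = 0"
    then obtain k where k: "k < N" "?t x k = 0" unfolding q by auto
    with gh' have \<beta>k: "\<beta> k" and x: "x = of_nat (Suc k)" by (auto split: if_splits)
    define R where "R y = (\<Prod>i\<in>{..<N} - {k}. ?t y i)" for y
    have R: "R x \<noteq> 0"
    proof -
      have "?t x i \<noteq> 0" if "i \<in> {..<N} - {k}" for i
        using that gh'[of i] x by (auto simp del: of_nat_Suc)
      then show ?thesis unfolding R_def by auto
    qed
    have qR: "?q (?D, y) = (of_nat (Suc k) - y) * R y" for y
      unfolding q R_def using k \<beta>k by (subst prod.remove[of _ k]) auto
    have "(\<lambda>y. ?t y i) holomorphic_on UNIV" for i
      by (cases "\<beta> i") (auto intro!: holomorphic_intros)
    then have "R holomorphic_on UNIV" unfolding R_def[abs_def] by (intro holomorphic_on_prod)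
    then have "R field_differentiable at x" by (simp add: holomorphic_on_def)
    then obtain R' where R': "(R has_field_derivative R') (at x)" unfolding field_differentiable_def by blast
    have "((\<lambda>y. (of_nat (Suc k) - y) * R y) has_field_derivative (0 - 1) * R x + R' * (of_nat (Suc k) - x)) (at x)"
      by (intro DERIV_mult DERIV_diff DERIV_const DERIV_ident R')
    then have "deriv (\<lambda>x. ?q (?D, x)) x = - R x"
      unfolding qR using x by (intro DERIV_imp_deriv) simp
    then show "(\<lambda>(A, x). deriv (\<lambda>x. ?q (A, x)) x) (?D, x) \<noteq> 0" using R by simp
  qed
  then show ?thesis by simp
qed

section \<open>The curve in the coordinates \<open>u\<close> and \<open>w\<close>, its leading
  coefficient and its eigenvector\<close>

locale block_sizes =
  fixes m n r :: nat
  assumes m: "m \<ge> 1" and n: "n \<ge> 1" and r: "r \<ge> 1"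
begin

abbreviation N :: nat where "N \<equiv> m + n + r"

definition spec :: "complex mat \<Rightarrow> complex \<Rightarrow> complex \<Rightarrow> complex mat" where
  "spec A u w = pencil N A (\<lambda>_. 1) (sel m n u (u * w) w)"

definition F :: "complex mat \<Rightarrow> complex \<Rightarrow> complex \<Rightarrow> complex" where
  "F A u w = Determinant.det (spec A u w)"

text \<open>The coefficient of \<open>u ^ (m + n)\<close> in \<open>F A u w\<close>, found by
  dividing the rows of blocks 1 and 2 by \<open>u\<close> and setting
  \<open>u = \<infinity>\<close>. Up to sign it is \<open>w ^ n\<close> times the characteristic
  polynomial of the (3,3) block at \<open>w\<close>.\<close>

definition lead :: "complex mat \<Rightarrow> complex \<Rightarrow> complex" where
  "lead A w = Determinant.det (pencil N A (sel m n 0 0 1) (sel m n 1 w w))"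

text \<open>Column \<open>m + n - 1\<close> of the adjugate; the choice makes the example below easy.\<close>

definition col :: "complex mat \<Rightarrow> complex \<Rightarrow> complex \<Rightarrow> nat \<Rightarrow> complex" where
  "col A u w k = adj_mat (spec A u w) $$ (k, m + n - 1)"

definition deg :: nat where "deg = (\<Sum>i<N. if i < m + n then 1 else 0)"

lemma spec_carrier [simp]: "spec A u w \<in> carrier_mat N N"
  by (simp add: spec_def)

lemma F_eq_0_iff:
  "F A u w = 0 \<longleftrightarrow> (\<exists>x. (\<exists>i<N. x i \<noteq> 0) \<and> (\<forall>i<N. mat_fun N A x i = sel m n u (u * w) w i * x i))"
  by (simp add: F_def spec_def det_pencil_eq_0_iff)

lemma col_eigenvector:
  assumes "F A u w = 0" "i < N"
  shows "mat_fun N A (col A u w) i = sel m n u (u * w) w i * col A u w i"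
proof -
  have "mat_fun N (spec A u w) (col A u w) i = 0"
    unfolding col_def[abs_def] by (rule adj_mat_kernel) (use assms n in \<open>auto simp: F_def\<close>)
  then show ?thesis using assms(2) by (simp add: spec_def mat_fun_pencil)
qed

lemma col_eq_0_iff:
  assumes "a < N"
  shows "col A u w a = 0 \<longleftrightarrow> (\<exists>x. (\<exists>i<N. x i \<noteq> 0) \<and> x a = 0 \<and>
    (\<forall>i<N. i \<noteq> m + n - 1 \<longrightarrow> mat_fun N A x i = sel m n u (u * w) w i * x i))"
proof -
  have "m + n - 1 < N" using n by simp
  note * = adj_mat_eq_0_iff[OF spec_carrier assms this, of A u w]
  show ?thesis unfolding col_def * by (auto simp: spec_def mat_fun_pencil)
qed

lemma F_poly_functions:
  assumes "function_algebra S" "\<And>i j. i < N \<Longrightarrow> j < N \<Longrightarrow> (\<lambda>a. A a $$ (i, j)) \<in> S" "w \<in> S"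
  shows "(\<lambda>(a, u). F (A a) u (w a)) \<in> poly_functions S deg"
proof -
  interpret function_algebra S by fact
  have "(\<lambda>b. Determinant.det (pencil N (A (fst b)) (\<lambda>_. 1) (sel m n (snd b) (snd b * w (fst b)) (w (fst b)))))
      \<in> poly_functions S deg"
    unfolding deg_def
  proof (rule pencil_poly_functions[OF assms(2)])
    fix i
    show "(\<lambda>b. 1) \<in> poly_functions S (if i < m + n then 1 else 0)"
      by (rule poly_functions_mono[OF P.const]) simp
    have u: "snd \<in> poly_functions S 1" using poly_functions_var by (simp add: case_prod_unfold)
    have w: "(\<lambda>b. w (fst b)) \<in> poly_functions S 0"
      using poly_functions_base[OF assms(3)] by (simp add: case_prod_unfold)
    show "(\<lambda>b. sel m n (snd b) (snd b * w (fst b)) (w (fst b)) i) \<in> poly_functions S (if i < m + n then 1 else 0)"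
      using u w P.mult[OF u w] by (cases "i < m"; cases "i < m + n") (simp_all add: sel_def)
  qed
  then show ?thesis by (simp add: case_prod_unfold F_def spec_def)
qed

lemma F_scale: "s \<noteq> 0 \<Longrightarrow> s ^ deg * F A (1 / s) w = Determinant.det (pencil N A (sel m n s s 1) (sel m n 1 w w))"
proof -
  assume s: "s \<noteq> 0"
  have "Determinant.det (pencil N A (sel m n s s 1) (sel m n 1 w w)) =
      Determinant.det (pencil N A (\<lambda>i. (if i < m + n then s else 1) * 1)
        (\<lambda>i. (if i < m + n then s else 1) * sel m n (1 / s) (1 / s * w) w i))"
    by (rule det_pencil_cong) (use s in \<open>auto simp: sel_def\<close>)
  also have "\<dots> = (\<Prod>i<N. if i < m + n then s else 1) * F A (1 / s) w"
    unfolding F_def spec_def by (rule det_pencil_scale)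
  also have "(\<Prod>i<N. if i < m + n then s else 1) = (\<Prod>i<N. s ^ (if i < m + n then 1 else 0))"
    by (rule prod.cong) auto
  also have "\<dots> = s ^ deg" unfolding deg_def by (rule power_sum[symmetric])
  finally show ?thesis by simp
qed

lemma isCont_lead: "isCont (\<lambda>s. Determinant.det (pencil N A (sel m n s s 1) (sel m n 1 w w))) 0"
proof (rule isCont_det_pencil)
  show "isCont (\<lambda>s. sel m n s s 1 i) 0" for i
    by (cases "i < m"; cases "i < m + n") (simp_all add: sel_def)
qed auto

lemma F_full_degree:
  assumes "lead A w \<noteq> 0"
  shows "full_degree deg (\<lambda>u. F A u w)"
proof -
  have "(\<lambda>(a, u). F A u w) \<in> poly_functions (UNIV :: (unit \<Rightarrow> complex) set) deg"
    by (rule F_poly_functions) (auto intro: function_algebra.intro)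
  from full_degreeI[OF this, of "()", OF _ isCont_lead] F_scale assms show ?thesis
    by (simp add: lead_def)
qed

lemma lead_eq_0:
  assumes "\<And>u. F A u w = 0"
  shows "lead A w = 0"
proof -
  let ?h = "\<lambda>s. Determinant.det (pencil N A (sel m n s s 1) (sel m n 1 w w))"
  have "(?h \<longlongrightarrow> ?h 0) (at 0)" using isCont_lead by (simp add: isCont_def)
  moreover have "(?h \<longlongrightarrow> 0) (at 0)"
    by (rule tendsto_eventually) (use F_scale[of _ A w] assms in \<open>auto simp: eventually_at_filter\<close>)
  ultimately show ?thesis unfolding lead_def by (rule LIM_unique)
qed

lemma col_alg:
  assumes "function_algebra S" "\<And>i j. i < N \<Longrightarrow> j < N \<Longrightarrow> (\<lambda>b. A b $$ (i, j)) \<in> S" "u \<in> S" "w \<in> S" "k < N"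
  shows "(\<lambda>b. col (A b) (u b) (w b) k) \<in> S"
proof -
  interpret function_algebra S by fact
  show ?thesis unfolding col_def
  proof (rule alg_adj_mat[OF spec_carrier])
    fix i j assume ij: "i < N" "j < N"
    show "(\<lambda>b. spec (A b) (u b) (w b) $$ (i, j)) \<in> S" unfolding spec_def
    proof (rule pencil_alg[OF assms(2) _ _ ij])
      show "(\<lambda>b. sel m n (u b) (u b * w b) (w b) i) \<in> S" for i
        using assms(3,4) alg_mult[OF assms(3,4)] by (cases "i < m"; cases "i < m + n") (simp_all add: sel_def)
    qed (auto intro: alg_const)
  qed (use assms n in auto)
qed

lemma col_poly_functions:
  assumes "function_algebra S" "\<And>i j. i < N \<Longrightarrow> j < N \<Longrightarrow> (\<lambda>a. A a $$ (i, j)) \<in> S" "w \<in> S" "k < N"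
  shows "\<exists>e. (\<lambda>(a, u). col (A a) u (w a) k) \<in> poly_functions S e"
proof -
  interpret function_algebra S by fact
  have base: "(\<lambda>b. s (fst b)) \<in> (\<Union>e. poly_functions S e)" if "s \<in> S" for s
    using poly_functions_base[OF that] by (auto simp: case_prod_unfold)
  have "snd \<in> (\<Union>e. poly_functions S e)"
    using poly_functions_var by (auto simp: case_prod_unfold)
  from col_alg[OF poly_functions_algebra base[OF assms(2)] this base[OF assms(3)] assms(4)]
  show ?thesis by (auto simp: case_prod_unfold)
qed

subsection \<open>An example\<close>

text \<open>Made to have explicit eigenvectors. Block 2 is a chain, which forces
  \<open>x (m + k) = (u * w) ^ k * x m\<close>; block 1 forces
  \<open>x j = x m / (u - (j + 1))\<close>, the entries of a Cauchy matrix; row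
  \<open>m + n - 1\<close> closes the chain with the sum over block 1; block 3, minus the identity,
  forces zeros unless \<open>w = -1\<close>.\<close>

definition ex0 :: "complex mat" where
  "ex0 = Matrix.mat N N (\<lambda>(i, j).
     if i < m then (if j = i then of_nat (Suc i) else if j = m then 1 else 0)
     else if Suc i < m + n then (if j = Suc i then 1 else 0)
     else if i < m + n then (if j < m then 1 else 0)
     else (if j = i then - 1 else 0))"

lemma ex0_carrier [simp]: "ex0 \<in> carrier_mat N N"
  by (simp add: ex0_def)

lemma mat_fun_ex0_1: 
  assumes "i < m"
  shows "mat_fun N ex0 x i = of_nat (Suc i) * x i + x m"
proof -
  have "mat_fun N ex0 x i = (\<Sum>j<N. (if j = i then of_nat (Suc i) * x j else 0) + (if j = m then x j else 0))"
    unfolding mat_fun_def by (rule sum.cong) (use assms in \<open>auto simp: ex0_def\<close>)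
  then show ?thesis using assms n by (simp add: sum.distrib)
qed

lemma mat_fun_ex0_2:
  assumes "m \<le> i" "Suc i < m + n"
  shows "mat_fun N ex0 x i = x (Suc i)"
proof -
  have "mat_fun N ex0 x i = (\<Sum>j<N. (if j = Suc i then x j else 0))"
    unfolding mat_fun_def by (rule sum.cong) (use assms in \<open>auto simp: ex0_def\<close>)
  then show ?thesis using assms by simp
qed

lemma mat_fun_ex0_3: "mat_fun N ex0 x (m + n - 1) = (\<Sum>j<m. x j)"
proof -
  have "(\<Sum>j<m. x j) = (\<Sum>j<N. if j < m then x j else 0)"
    by (rule sum.mono_neutral_cong_left) auto
  also have "\<dots> = mat_fun N ex0 x (m + n - 1)"
    unfolding mat_fun_def by (rule sum.cong) (use n in \<open>auto simp: ex0_def\<close>)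
  finally show ?thesis ..
qed

lemma mat_fun_ex0_4:
  assumes "m + n \<le> i" "i < N"
  shows "mat_fun N ex0 x i = - x i"
proof -
  have "mat_fun N ex0 x i = (\<Sum>j<N. (if j = i then - x j else 0))"
    unfolding mat_fun_def by (rule sum.cong) (use assms in \<open>auto simp: ex0_def\<close>)
  then show ?thesis using assms by simp
qed

lemma ex0_eigenvector:
  assumes "\<exists>i<N. x i \<noteq> 0" and w: "w \<noteq> -1"
    and eig: "\<And>i. i < N \<Longrightarrow> mat_fun N ex0 x i = sel m n u (u * w) w i * x i"
  shows "x m \<noteq> 0" "u \<noteq> 0" "\<And>j. j < m \<Longrightarrow> u \<noteq> of_nat (Suc j)"
    "\<And>j. j < m \<Longrightarrow> x j = x m / (u - of_nat (Suc j))"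
    "\<And>i. m + n \<le> i \<Longrightarrow> i < N \<Longrightarrow> x i = 0"
    "(u * w) ^ n = (\<Sum>j<m. 1 / (u - of_nat (Suc j)))"
proof -
  show x3: "x i = 0" if "m + n \<le> i" "i < N" for i
  proof -
    have "- x i = w * x i" using eig[OF that(2)] mat_fun_ex0_4[OF that, of x] that by (simp add: sel_def)
    then have "(w + 1) * x i = 0" by (simp add: distrib_right flip: \<open>- x i = w * x i\<close>)
    moreover have "w + 1 \<noteq> 0" using w by (simp add: add_eq_0_iff2)
    ultimately show ?thesis by simp
  qed
  have x2: "x (m + k) = (u * w) ^ k * x m" if "k < n" for k
    using that
  proof (induction k)
    case (Suc k)
    have "x (Suc (m + k)) = u * w * x (m + k)"
      using eig[of "m + k"] mat_fun_ex0_2[of "m + k" x] Suc.prems by (simp add: sel_def)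
    then show ?case using Suc by simp
  qed simp
  have sum: "(\<Sum>j<m. x j) = (u * w) ^ n * x m"
  proof -
    obtain k where k: "n = Suc k" using n by (cases n) auto
    then show ?thesis
      using eig[of "m + k"] mat_fun_ex0_3[of x] x2[of k] by (simp add: sel_def mult.assoc)
  qed
  have x1: "(u - of_nat (Suc j)) * x j = x m" if "j < m" for j
    using eig[of j] mat_fun_ex0_1[OF that, of x] that by (simp add: sel_def algebra_simps)
  \<comment> \<open>Otherwise the chain vanishes and block 1 has exactly one nonzero entry; but the
    closing row makes the sum over block 1 zero.\<close>
  show xm: "x m \<noteq> 0"
  proof
    assume 0: "x m = 0"
    obtain i where i: "i < N" "x i \<noteq> 0" using assms(1) by blast
    have "\<not> m + n \<le> i" using x3 i by auto
    moreover have "\<not> (m \<le> i \<and> i < m + n)"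
    proof
      assume "m \<le> i \<and> i < m + n"
      then have "i - m < n" "m + (i - m) = i" by auto
      then show False using x2[of "i - m"] 0 i by simp
    qed
    ultimately have im: "i < m" by auto
    then have u: "u = of_nat (Suc i)" using x1[of i] 0 i by simp
    have "x j = 0" if "j < m" "j \<noteq> i" for j
      using x1[OF that(1)] that(2) unfolding u 0 by (simp del: of_nat_Suc)
    then have "(\<Sum>j<m. x j) = (\<Sum>j<m. if j = i then x i else 0)" by (intro sum.cong) auto
    also have "\<dots> = x i" using im by simp
    finally show False using sum 0 i by simp
  qed
  show uj: "u \<noteq> of_nat (Suc j)" if "j < m" for j using x1[OF that] xm by auto
  show xj: "x j = x m / (u - of_nat (Suc j))" if "j < m" for j
    using x1[OF that] uj[OF that] by (simp add: field_simps)
  have "(u * w) ^ n * x m = (\<Sum>j<m. 1 / (u - of_nat (Suc j))) * x m"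
    unfolding sum[symmetric] sum_distrib_right using xj by (intro sum.cong) auto
  then show *: "(u * w) ^ n = (\<Sum>j<m. 1 / (u - of_nat (Suc j)))" using xm by simp
  \<comment> \<open>At \<open>u = 0\<close> the right-hand side is minus a harmonic number, the
    left-hand side is 0.\<close>
  show "u \<noteq> 0"
  proof
    assume "u = 0"
    then have "0 = (\<Sum>j<m. 1 / (0 - of_nat (Suc j)) :: complex)" using * n by (simp add: power_0_left)
    also have "\<dots> = - of_real (\<Sum>j<m. 1 / real (Suc j))"
      by (simp add: sum_negf del: of_nat_Suc)
    finally have "complex_of_real (\<Sum>j<m. 1 / real (Suc j)) = 0" by (metis neg_0_equal_iff_equal)
    then have "(\<Sum>j<m. 1 / real (Suc j)) = 0" by (simp only: of_real_eq_0_iff)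
    moreover have "(\<Sum>j<m. 1 / real (Suc j)) > 0" using m by (intro sum_pos) (auto simp: lessThan_empty_iff)
    ultimately show False by simp
  qed
qed

text \<open>Singularity would put the point \<open>u = w = 0\<close> on the curve of
  \<open>ex0\<close>.\<close>

lemma det_ex0: "Determinant.det ex0 \<noteq> 0"
proof
  assume "Determinant.det ex0 = 0"
  then have "F ex0 0 0 = 0" unfolding F_def spec_def
    using pencil_one[OF ex0_carrier] by (simp add: sel_def[abs_def] cong: if_cong)
  then obtain x where "\<exists>i<N. x i \<noteq> 0" "\<forall>i<N. mat_fun N ex0 x i = sel m n 0 (0 * 0) 0 i * x i"
    unfolding F_eq_0_iff by blast
  then show False using ex0_eigenvector(2)[of x 0 0] by simp
qed

lemma ex0_lead:
  assumes "w \<noteq> -1" "w \<noteq> 0"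
  shows "lead ex0 w \<noteq> 0"
proof
  assume "lead ex0 w = 0"
  then obtain x where x: "\<exists>i<N. x i \<noteq> 0"
    "\<forall>i<N. sel m n 0 0 1 i * mat_fun N ex0 x i = sel m n 1 w w i * x i"
    unfolding lead_def det_pencil_eq_0_iff by blast
  have "x i = 0" if i: "i < N" for i
  proof (cases "i < m + n")
    case True
    then show ?thesis using x(2)[rule_format, OF i] assms by (auto simp: sel_def split: if_splits)
  next
    case False
    then have "- x i = w * x i" using x(2)[rule_format, OF i] mat_fun_ex0_4[of i x] i by (simp add: sel_def)
    then have "(w + 1) * x i = 0" by (simp add: distrib_right flip: \<open>- x i = w * x i\<close>)
    moreover have "w + 1 \<noteq> 0" using assms by (simp add: add_eq_0_iff2)
    ultimately show ?thesis by simp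
  qed
  then show False using x(1) by blast
qed

text \<open>Column \<open>m + n - 1\<close> of the adjugate belongs to omitting the closing row. The
  other equations propagate \<open>x m = 0\<close> along the chain and, as no \<open>u\<close> on
  the curve is one of \<open>1, ..., m\<close>, to block 1 as well.\<close>

lemma ex0_col:
  assumes F: "F ex0 u w = 0" and w: "w \<noteq> -1" "w \<noteq> 0"
  shows "col ex0 u w m \<noteq> 0"
proof
  assume "col ex0 u w m = 0"
  moreover have "m < N" using n by simp
  ultimately obtain x where x: "\<exists>i<N. x i \<noteq> 0" "x m = 0"
    "\<forall>i<N. i \<noteq> m + n - 1 \<longrightarrow> mat_fun N ex0 x i = sel m n u (u * w) w i * x i"
    using col_eq_0_iff by blast
  from F obtain y where y: "\<exists>i<N. y i \<noteq> 0" "\<And>i. i < N \<Longrightarrow> mat_fun N ex0 y i = sel m n u (u * w) w i * y i"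
    unfolding F_eq_0_iff by blast
  have uj: "u \<noteq> of_nat (Suc j)" if "j < m" for j
    by (rule ex0_eigenvector(3)[of y w u j]) (use y w that in auto)
  have x3: "x i = 0" if "m + n \<le> i" "i < N" for i
  proof -
    have "- x i = w * x i" using x(3)[rule_format, OF that(2)] mat_fun_ex0_4[OF that, of x] that n by (simp add: sel_def)
    then have "(w + 1) * x i = 0" by (simp add: distrib_right flip: \<open>- x i = w * x i\<close>)
    moreover have "w + 1 \<noteq> 0" using w by (simp add: add_eq_0_iff2)
    ultimately show ?thesis by simp
  qed
  have x2: "x (m + k) = 0" if "k < n" for k
    using that
  proof (induction k)
    case 0 then show ?case using x(2) by simp
  next
    case (Suc k)
    have "x (Suc (m + k)) = u * w * x (m + k)"
      using x(3)[rule_format, of "m + k"] mat_fun_ex0_2[of "m + k" x] Suc.prems by (simp add: sel_def)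
    then show ?case using Suc by simp
  qed
  have x1: "x j = 0" if "j < m" for j
  proof -
    have "(u - of_nat (Suc j)) * x j = 0"
      using x(3)[rule_format, of j] mat_fun_ex0_1[OF that, of x] that x(2) n by (simp add: sel_def algebra_simps)
    then show ?thesis using uj[OF that] by (simp del: of_nat_Suc)
  qed
  have "x i = 0" if "i < N" for i
    using x1[of i] x2[of "i - m"] x3[of i] that by (cases "i < m"; cases "i < m + n") auto
  then show False using x(1) by blast
qed

text \<open>The fibres \<open>w = 2, 3, ...\<close> avoid the exceptional values \<open>0\<close>
  and \<open>-1\<close> of the example, and their \<open>n\<close>-th powers are pairwise
  distinct.\<close>

definition wpt :: "nat \<Rightarrow> complex" where "wpt i = of_nat (i + 2)"

lemma wpt: "wpt i \<noteq> -1" "wpt i \<noteq> 0"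
proof -
  have "Re (wpt i) > 0" by (simp add: wpt_def)
  then show "wpt i \<noteq> -1" "wpt i \<noteq> 0" by auto
qed

lemma ex0_col_formula:
  assumes F: "F ex0 u w = 0" and w: "w \<noteq> -1" "w \<noteq> 0"
  shows "\<And>j. j < m \<Longrightarrow> u \<noteq> of_nat (Suc j)" "u \<noteq> 0"
    "\<And>j. j < m \<Longrightarrow> col ex0 u w j = col ex0 u w m / (u - of_nat (Suc j))"
    "\<And>i. m + n \<le> i \<Longrightarrow> i < N \<Longrightarrow> col ex0 u w i = 0"
    "(u * w) ^ n = (\<Sum>j<m. 1 / (u - of_nat (Suc j)))"
proof -
  have "m < N" using n by simp
  then have 1: "\<exists>i<N. col ex0 u w i \<noteq> 0" using ex0_col[OF assms] by blast
  note * = ex0_eigenvector[of "col ex0 u w" w u, OF 1 w(1) col_eigenvector[OF F]]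
  show "\<And>j. j < m \<Longrightarrow> u \<noteq> of_nat (Suc j)" "u \<noteq> 0"
    "\<And>j. j < m \<Longrightarrow> col ex0 u w j = col ex0 u w m / (u - of_nat (Suc j))"
    "\<And>i. m + n \<le> i \<Longrightarrow> i < N \<Longrightarrow> col ex0 u w i = 0"
    "(u * w) ^ n = (\<Sum>j<m. 1 / (u - of_nat (Suc j)))"
    using * by blast+
qed

end

text \<open>After clearing denominators the relations give a polynomial of degree at most
  \<open>m - 1\<close> with the \<open>m\<close> roots \<open>u i\<close>. It is therefore zero, and
  its value at \<open>d k\<close> isolates \<open>l k\<close>. In other words, the Cauchy
  determinant is nonzero.\<close>

lemma cauchy_independent:
  fixes l u d :: "nat \<Rightarrow> complex"
  assumes d: "inj_on d {..<m}" and u: "inj_on u {..<m}"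
    and ud: "\<And>i j. i < m \<Longrightarrow> j < m \<Longrightarrow> u i \<noteq> d j"
    and eq: "\<And>i. i < m \<Longrightarrow> (\<Sum>j<m. l j / (u i - d j)) = 0"
    and "k < m"
  shows "l k = 0"
proof -
  define p where "p = (\<Sum>j<m. Polynomial.smult (l j) (\<Prod>i\<in>{..<m} - {j}. [:- d i, 1:]))"
  have pu: "poly p (u i) = 0" if i: "i < m" for i
  proof -
    define P where "P = (\<Prod>j<m. u i - d j)"
    have "poly p (u i) = (\<Sum>j<m. l j * (\<Prod>k\<in>{..<m} - {j}. u i - d k))"
      by (simp add: p_def poly_sum poly_prod)
    also have "\<dots> = (\<Sum>j<m. P * (l j / (u i - d j)))"
    proof (rule sum.cong)
      fix j assume j: "j \<in> {..<m}"
      then have "P = (u i - d j) * (\<Prod>k\<in>{..<m} - {j}. u i - d k)"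
        unfolding P_def by (subst prod.remove[of _ j]) auto
      then show "l j * (\<Prod>k\<in>{..<m} - {j}. u i - d k) = P * (l j / (u i - d j))"
        using ud[OF i, of j] j by simp
    qed simp
    also have "\<dots> = 0" unfolding sum_distrib_left[symmetric] by (simp only: eq[OF i] mult_zero_right)
    finally show ?thesis .
  qed
  have "degree p \<le> m - 1" unfolding p_def
  proof (rule degree_sum_le)
    fix j assume j: "j \<in> {..<m}"
    have "degree (\<Prod>i\<in>{..<m} - {j}. [:- d i, 1:]) \<le> (\<Sum>i\<in>{..<m} - {j}. degree [:- d i, 1:])"
      using degree_prod_sum_le[of "{..<m} - {j}" "\<lambda>i. [:- d i, 1:]"] by (simp add: o_def)
    also have "\<dots> = m - 1" using j by simp
    finally show "degree (Polynomial.smult (l j) (\<Prod>i\<in>{..<m} - {j}. [:- d i, 1:])) \<le> m - 1"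
      by (rule order_trans[OF degree_smult_le])
  qed simp
  have "p = 0"
  proof (rule ccontr)
    assume p: "p \<noteq> 0"
    have "m = card (u ` {..<m})" using u by (simp add: card_image)
    also have "\<dots> \<le> card {x. poly p x = 0}"
      by (rule card_mono[OF poly_roots_finite[OF p]]) (use pu in auto)
    also have "\<dots> \<le> degree p" by (rule card_poly_roots_bound[OF p])
    finally show False using \<open>degree p \<le> m - 1\<close> \<open>k < m\<close> by linarith
  qed
  then have "0 = poly p (d k)" by simp
  also have "\<dots> = (\<Sum>j<m. l j * (\<Prod>i\<in>{..<m} - {j}. d k - d i))"
    by (simp add: p_def poly_sum poly_prod)
  also have "\<dots> = (\<Sum>j<m. if j = k then l k * (\<Prod>i\<in>{..<m} - {k}. d k - d i) else 0)"
  proof (rule sum.cong)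
    fix j assume j: "j \<in> {..<m}"
    show "l j * (\<Prod>i\<in>{..<m} - {j}. d k - d i) = (if j = k then l k * (\<Prod>i\<in>{..<m} - {k}. d k - d i) else 0)"
      using \<open>k < m\<close> by auto
  qed simp
  also have "\<dots> = l k * (\<Prod>i\<in>{..<m} - {k}. d k - d i)" using \<open>k < m\<close> by simp
  finally have "l k * (\<Prod>i\<in>{..<m} - {k}. d k - d i) = 0" ..
  moreover have "(\<Prod>i\<in>{..<m} - {k}. d k - d i) \<noteq> 0"
    using d \<open>k < m\<close> by (auto simp: inj_on_def)
  ultimately show ?thesis by simp
qed

section \<open>Independence of the eigenvectors in \<open>m\<close> prescribed fibres\<close>

context block_sizes
begin

text \<open>Row \<open>i\<close> is the first block of the adjugate of \<open>A\<close> applied to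
  blocks 1 and 2 of \<open>W \<xi>\<close>, at the point \<open>x i\<close> of the fibre
  \<open>wpt i\<close>. The adjugate replaces the inverse to stay polynomial, and \<open>A\<close>
  is written as a pencil because that has size \<open>N\<close> for every argument.\<close>

definition Kmat :: "complex mat \<Rightarrow> (nat \<Rightarrow> complex) \<Rightarrow> complex mat" where
  "Kmat A x = Matrix.mat m m (\<lambda>(i, j). \<Sum>k<m + n. adj_mat (pencil N A (\<lambda>_. 1) (\<lambda>_. 0)) $$ (j, k) *
      ((if k < m then 1 else wpt i) * col A (x i) (wpt i) k))"

lemma Kmat_carrier [simp]: "Kmat A x \<in> carrier_mat m m"
  by (simp add: Kmat_def)

text \<open>For the example block 3 of \<open>\<xi>\<close> vanishes, so the truncation loses
  nothing and \<open>u W \<xi> = A \<xi>\<close>. Row \<open>i\<close> times \<open>x i\<close> is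
  then the determinant of \<open>ex0\<close> times block 1 of \<open>\<xi>\<close>, a nonzero
  multiple of a Cauchy row.\<close>

lemma det_Kmat_ex0:
  assumes x: "\<And>i. i < m \<Longrightarrow> F ex0 (x i) (wpt i) = 0"
  shows "Determinant.det (Kmat ex0 x) \<noteq> 0"
proof
  assume "Determinant.det (Kmat ex0 x) = 0"
  then obtain l where l: "\<exists>j<m. l j \<noteq> 0" "\<forall>i<m. mat_fun m (Kmat ex0 x) l i = 0"
    unfolding det_eq_0_iff_kernel[OF Kmat_carrier] by blast
  note f = ex0_col_formula[OF x wpt]
  have K: "x i * Kmat ex0 x $$ (i, j) = Determinant.det ex0 * col ex0 (x i) (wpt i) j"
    if i: "i < m" and j: "j < m" for i j
  proof -
    let ?c = "col ex0 (x i) (wpt i)"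
    have "x i * Kmat ex0 x $$ (i, j) =
        (\<Sum>k<m + n. adj_mat ex0 $$ (j, k) * (sel m n (x i) (x i * wpt i) (wpt i) k * ?c k))"
      using i j by (auto simp: Kmat_def pencil_one sum_distrib_left sel_def intro!: sum.cong)
    also have "\<dots> = (\<Sum>k<N. adj_mat ex0 $$ (j, k) * (sel m n (x i) (x i * wpt i) (wpt i) k * ?c k))"
      by (rule sum.mono_neutral_left) (use f(4)[OF i] in auto)
    also have "\<dots> = mat_fun N (adj_mat ex0) (mat_fun N ex0 ?c) j"
      unfolding mat_fun_def[of N "adj_mat ex0"]
      by (rule sum.cong) (use col_eigenvector[OF x[OF i]] in auto)
    also have "\<dots> = Determinant.det ex0 * ?c j" by (rule adj_mat_mat_fun) (use j in auto)
    finally show ?thesis .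
  qed
  have zero: "(\<Sum>j<m. l j / (x i - of_nat (Suc j))) = 0" if i: "i < m" for i
  proof -
    have "0 = x i * mat_fun m (Kmat ex0 x) l i" using l(2) i by simp
    also have "\<dots> = (\<Sum>j<m. (x i * Kmat ex0 x $$ (i, j)) * l j)"
      by (simp add: mat_fun_def sum_distrib_left mult.assoc)
    also have "\<dots> = (\<Sum>j<m. Determinant.det ex0 * col ex0 (x i) (wpt i) m * (l j / (x i - of_nat (Suc j))))"
    proof (rule sum.cong)
      fix j assume "j \<in> {..<m}"
      then have j: "j < m" by simp
      show "(x i * Kmat ex0 x $$ (i, j)) * l j =
          Determinant.det ex0 * col ex0 (x i) (wpt i) m * (l j / (x i - of_nat (Suc j)))"
        unfolding K[OF i j] f(3)[OF i j] by simp
    qed simp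
    also have "\<dots> = Determinant.det ex0 * col ex0 (x i) (wpt i) m * (\<Sum>j<m. l j / (x i - of_nat (Suc j)))"
      by (simp add: sum_distrib_left)
    finally show ?thesis using det_ex0 ex0_col[OF x[OF i] wpt] by simp
  qed
  \<comment> \<open>Equal \<open>x i\<close> have equal values of the rational function in
    \<open>u\<close>, hence equal \<open>(x i * w) ^ n\<close>, although the \<open>n\<close>-th
    powers of the \<open>wpt i\<close> differ.\<close>
  have "inj_on x {..<m}"
  proof (rule inj_onI)
    fix i j assume ij: "i \<in> {..<m}" "j \<in> {..<m}" "x i = x j"
    then have "(x i * wpt i) ^ n = (x i * wpt j) ^ n" using f(5)[of i] f(5)[of j] by simp
    then have "wpt i ^ n = wpt j ^ n" using f(2)[of i] ij by (simp add: power_mult_distrib)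
    then have "of_nat ((i + 2) ^ n) = (of_nat ((j + 2) ^ n) :: complex)" by (simp add: wpt_def)
    then have "(i + 2) ^ n = (j + 2) ^ n" by (simp only: of_nat_eq_iff)
    then show "i = j" using n by (simp add: power_eq_iff_eq_base)
  qed
  then have "l j = 0" if "j < m" for j
    by (rule cauchy_independent[where u = x and d = "\<lambda>j. of_nat (Suc j)", rotated])
      (use that f(1) zero in \<open>auto simp: inj_on_def\<close>)
  then show False using l(1) by blast
qed

lemma Kmat_ext: "(\<lambda>z. Determinant.det (Kmat (fst z) (snd z))) \<in> ext_functions (Collect (matrix_polynomial N)) m"
proof -
  interpret function_algebra "Collect (matrix_polynomial N)" by (rule matrix_polynomial_algebra)
  interpret E: function_algebra "ext_functions (Collect (matrix_polynomial N)) m" by (rule ext_algebra)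
  have fst: "(\<lambda>z. fst z $$ (i, j)) \<in> ext_functions (Collect (matrix_polynomial N)) m" if "i < N" "j < N" for i j
    by (rule ext_functions.base[of "\<lambda>A. A $$ (i, j)"]) (use matrix_polynomial_entry[OF that] in auto)
  show ?thesis
  proof (rule E.alg_det[OF Kmat_carrier])
    fix i j assume ij: "i < m" "j < m"
    have "(\<lambda>z. \<Sum>k<m + n. adj_mat (pencil N (fst z) (\<lambda>_. 1) (\<lambda>_. 0)) $$ (j, k) *
      ((if k < m then 1 else wpt i) * col (fst z) (snd z i) (wpt i) k))
      \<in> ext_functions (Collect (matrix_polynomial N)) m"
    proof (rule E.G.sum, intro E.alg_mult)
      fix k assume "k \<in> {..<m + n}"
      then have k: "k < N" by simp
      show "(\<lambda>z. adj_mat (pencil N (fst z) (\<lambda>_. 1) (\<lambda>_. 0)) $$ (j, k)) \<in> ext_functions (Collect (matrix_polynomial N)) m"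
        by (rule E.alg_adj_mat[OF pencil_carrier], rule E.pencil_alg[OF fst]) (use k ij E.alg_const in auto)
      show "(\<lambda>z. if k < m then 1 else wpt i) \<in> ext_functions (Collect (matrix_polynomial N)) m"
        by (rule E.alg_const)
      show "(\<lambda>z. col (fst z) (snd z i) (wpt i) k) \<in> ext_functions (Collect (matrix_polynomial N)) m"
        by (rule col_alg[OF E.function_algebra_axioms fst ext_functions.var[OF ij(1)] E.alg_const k])
    qed
    then show "(\<lambda>z. Kmat (fst z) (snd z) $$ (i, j)) \<in> ext_functions (Collect (matrix_polynomial N)) m"
      using ij by (simp add: Kmat_def)
  qed
qed

lemma F_wpt_poly_functions: "(\<lambda>(A, u). F A u w) \<in> poly_functions (Collect (matrix_polynomial N)) deg"
proof -
  interpret function_algebra "Collect (matrix_polynomial N)" by (rule matrix_polynomial_algebra)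
  show ?thesis
    by (rule F_poly_functions[OF matrix_polynomial_algebra matrix_polynomial_entry alg_const])
qed

text \<open>The eliminated unknowns are the \<open>m\<close> points, one in each fibre; at
  \<open>ex0\<close> no root of the fibre equation escapes to infinity because \<open>lead\<close>
  does not vanish there.\<close>

lemma generic_Kmat:
  "generic N (\<lambda>A. \<forall>x. (\<forall>i<m. F A (x i) (wpt i) = 0) \<longrightarrow> Determinant.det (Kmat A x) \<noteq> 0)"
proof -
  have "generic N (\<lambda>A. \<forall>x. (\<forall>i<m. (\<lambda>i (A, u). F A u (wpt i)) i (A, x i) = 0) \<longrightarrow>
      (\<lambda>z. Determinant.det (Kmat (fst z) (snd z))) (A, x) \<noteq> 0)"
  proof (rule generic_elimination[OF F_wpt_poly_functions Kmat_ext ex0_carrier])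
    show "full_degree deg (\<lambda>u. (\<lambda>(A, u). F A u (wpt i)) (ex0, u))" for i
      using F_full_degree[OF ex0_lead[OF wpt]] by simp
  qed (use det_Kmat_ex0 in auto)
  then show ?thesis by simp
qed

lemma generic_first_coordinate:
  "generic N (\<lambda>A. \<forall>u. F A u (wpt 0) = 0 \<longrightarrow> col A u (wpt 0) 0 \<noteq> 0)"
proof -
  interpret function_algebra "Collect (matrix_polynomial N)" by (rule matrix_polynomial_algebra)
  obtain e where e: "(\<lambda>(A, u). col A u (wpt 0) 0) \<in> poly_functions (Collect (matrix_polynomial N)) e"
    using col_poly_functions[OF matrix_polynomial_algebra matrix_polynomial_entry alg_const, of 0 "wpt 0"] m
    by auto
  have "generic N (\<lambda>A. \<forall>u. (\<lambda>(A, u). F A u (wpt 0)) (A, u) = 0 \<longrightarrow> (\<lambda>(A, u). col A u (wpt 0) 0) (A, u) \<noteq> 0)"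
  proof (rule generic_no_common_root[OF F_wpt_poly_functions e ex0_carrier])
    show "full_degree deg (\<lambda>u. (\<lambda>(A, u). F A u (wpt 0)) (ex0, u))"
      using F_full_degree[OF ex0_lead[OF wpt]] by simp
    fix u assume "(\<lambda>(A, u). F A u (wpt 0)) (ex0, u) = 0"
    then have F: "F ex0 u (wpt 0) = 0" by simp
    from m have "0 < m" by simp
    with ex0_col_formula(1,3)[OF F wpt this] ex0_col[OF F wpt]
    show "(\<lambda>(A, u). col A u (wpt 0) 0) (ex0, u) \<noteq> 0" by auto
  qed
  then show ?thesis by simp
qed

lemma generic_lead: "generic N (\<lambda>A. \<forall>i<m. lead A (wpt i) \<noteq> 0)"
proof -
  have "generic N (\<lambda>A. \<forall>i\<in>{..<m}. lead A (wpt i) \<noteq> 0)"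
    by (rule generic_ball) (auto simp: lead_def intro!: generic_det_pencil[OF ex0_carrier] ex0_lead[OF wpt, unfolded lead_def])
  then show ?thesis by (rule generic_mono) auto
qed

subsection \<open>No vertical lines\<close>

text \<open>The (3,3) block is a nilpotent shift, so \<open>lead\<close> can vanish at
  \<open>w = 0\<close> only; the two entries that link block 3 with the index \<open>m\<close>
  nevertheless make the whole matrix invertible.\<close>

definition ex1 :: "complex mat" where
  "ex1 = Matrix.mat N N (\<lambda>(i, j).
     if i < m + n then (if j = i \<or> (i = m \<and> j = m + n) then 1 else 0)
     else if Suc i < N then (if j = Suc i then 1 else 0)
     else (if j = m then 1 else 0))"

lemma ex1_carrier [simp]: "ex1 \<in> carrier_mat N N"
  by (simp add: ex1_def)

lemma mat_fun_ex1_1: 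
  assumes "i < m + n"
  shows "mat_fun N ex1 x i = x i + (if i = m then x (m + n) else 0)"
proof -
  have "mat_fun N ex1 x i = (\<Sum>j<N. (if j = i then x j else 0) + (if j = m + n then if i = m then x j else 0 else 0))"
    unfolding mat_fun_def by (rule sum.cong) (use assms in \<open>auto simp: ex1_def\<close>)
  then show ?thesis using assms r by (simp add: sum.distrib)
qed

lemma mat_fun_ex1_2:
  assumes "m + n \<le> i" "Suc i < N"
  shows "mat_fun N ex1 x i = x (Suc i)"
proof -
  have "mat_fun N ex1 x i = (\<Sum>j<N. (if j = Suc i then x j else 0))"
    unfolding mat_fun_def by (rule sum.cong) (use assms in \<open>auto simp: ex1_def\<close>)
  then show ?thesis using assms by simp
qed

lemma mat_fun_ex1_3: "mat_fun N ex1 x (N - 1) = x m"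
proof -
  have "mat_fun N ex1 x (N - 1) = (\<Sum>j<N. (if j = m then x j else 0))"
    unfolding mat_fun_def by (rule sum.cong) (use r in \<open>auto simp: ex1_def\<close>)
  then show ?thesis using n by simp
qed

lemma ex1_lead:
  assumes "w \<noteq> 0"
  shows "lead ex1 w \<noteq> 0"
proof
  assume "lead ex1 w = 0"
  then obtain x where x: "\<exists>i<N. x i \<noteq> 0"
    "\<And>i. i < N \<Longrightarrow> sel m n 0 0 1 i * mat_fun N ex1 x i = sel m n 1 w w i * x i"
    unfolding lead_def det_pencil_eq_0_iff by blast
  have x12: "x i = 0" if i: "i < m + n" for i
    using x(2)[of i] assms i by (auto simp: sel_def split: if_splits)
  obtain k where k: "N = Suc k" using r by (cases N) auto
  have last: "x k = 0"
    using x(2)[of k] mat_fun_ex1_3[of x] k x12[of m] n r assms by (simp add: sel_def split: if_splits)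
  have x3: "x (k - l) = 0" if "m + n \<le> k - l" for l
    using that
  proof (induction l)
    case 0 then show ?case using last by simp
  next
    case (Suc l)
    show ?case
    proof (cases "k - l = 0")
      case True with Suc show ?thesis by simp
    next
      case False
      then have *: "Suc (k - Suc l) = k - l" by simp
      have "x (k - l) = w * x (k - Suc l)"
        using x(2)[of "k - Suc l"] mat_fun_ex1_2[of "k - Suc l" x] Suc.prems k False * by (simp add: sel_def)
      moreover have "x (k - l) = 0" using Suc * by simp
      ultimately show ?thesis using assms by simp
    qed
  qed
  have "x i = 0" if "i < N" for i
    using x12[of i] x3[of "k - i"] that k by (cases "i < m + n") auto
  then show False using x(1) by blast
qed

lemma det_ex1: "Determinant.det (pencil N ex1 (\<lambda>_. 1) (sel m n 0 0 0)) \<noteq> 0"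
proof
  assume "Determinant.det (pencil N ex1 (\<lambda>_. 1) (sel m n 0 0 0)) = 0"
  then obtain x where x: "\<exists>i<N. x i \<noteq> 0" "\<And>i. i < N \<Longrightarrow> mat_fun N ex1 x i = 0"
    unfolding det_pencil_eq_0_iff sel_def if_cancel mult_zero_left mult_1_left by blast
  have "x m = 0" using x(2)[of "N - 1"] mat_fun_ex1_3[of x] r by simp
  then have mn: "x (m + n) = 0" using x(2)[of m] mat_fun_ex1_1[of m x] n by simp
  have "x i = 0" if "i < N" for i
  proof (cases "i < m + n")
    case True
    then show ?thesis using x(2)[of i] mat_fun_ex1_1[of i x] mn by (simp split: if_splits)
  next
    case False
    show ?thesis
    proof (cases "i = m + n")
      case True then show ?thesis using mn by simp
    next
      case F: False
      then obtain k where "i = Suc k" using False by (cases i) auto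
      then show ?thesis using x(2)[of k] mat_fun_ex1_2[of k x] False F that by simp
    qed
  qed
  then show False using x(1) by blast
qed

text \<open>A line \<open>w = const\<close> in the curve makes \<open>F A u w\<close> vanish for all
  \<open>u\<close>, in particular at \<open>u = 0\<close> and in its leading coefficient. These are
  two polynomials in \<open>w\<close>, which a resultant separates.\<close>

lemma generic_no_vertical_line:
  "generic N (\<lambda>A. \<forall>w. Determinant.det (pencil N A (\<lambda>_. 1) (sel m n 0 0 w)) = 0 \<longrightarrow> lead A w \<noteq> 0)"
proof -
  interpret function_algebra "Collect (matrix_polynomial N)" by (rule matrix_polynomial_algebra)
  let ?\<beta> = "\<lambda>i. \<not> i < m + n"
  have sel0: "Determinant.det (pencil N A (\<lambda>_. 1) (sel m n 0 0 w)) =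
      (\<lambda>(A, x). Determinant.det (pencil N A (\<lambda>i. if ?\<beta> i then 1 else 1) (\<lambda>i. if ?\<beta> i then x else 0))) (A, w)" for A w
    by (simp, rule det_pencil_cong) (auto simp: sel_def)
  have "(\<lambda>b. Determinant.det (pencil N (fst b) (sel m n 0 0 1) (sel m n 1 (snd b) (snd b))))
      \<in> poly_functions (Collect (matrix_polynomial N)) (\<Sum>i<N. 1)"
  proof (rule pencil_poly_functions[where A = "\<lambda>A. A"])
    fix i
    have c: "(\<lambda>b. c) \<in> poly_functions (Collect (matrix_polynomial N)) 1" for c
      by (rule poly_functions_mono[OF P.const]) simp
    then show "(\<lambda>b. sel m n 0 0 1 i) \<in> poly_functions (Collect (matrix_polynomial N)) 1" .
    show "(\<lambda>b. sel m n 1 (snd b) (snd b) i) \<in> poly_functions (Collect (matrix_polynomial N)) 1"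
      using c poly_functions_var by (cases "i < m"; cases "i < m + n") (simp_all add: sel_def case_prod_unfold)
  qed (rule matrix_polynomial_entry)
  then have lead: "(\<lambda>(A, w). lead A w) \<in> poly_functions (Collect (matrix_polynomial N)) (\<Sum>i<N. 1)"
    by (simp add: lead_def case_prod_unfold)
  have "generic N (\<lambda>A. \<forall>w. (\<lambda>(A, x). Determinant.det (pencil N A (\<lambda>i. if ?\<beta> i then 1 else 1) (\<lambda>i. if ?\<beta> i then x else 0))) (A, w) = 0
      \<longrightarrow> (\<lambda>(A, w). lead A w) (A, w) \<noteq> 0)"
  proof (rule generic_no_common_root[OF block_pencil_poly_functions lead ex1_carrier])
    \<comment> \<open>The leading coefficient in \<open>w\<close>: up to sign the minor of blocks 1
      and 2.\<close>
    have "Determinant.det (pencil N ex1 (\<lambda>i. if ?\<beta> i then 0 else 1) (\<lambda>i. if ?\<beta> i then 1 else 0)) \<noteq> 0"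
    proof
      assume "Determinant.det (pencil N ex1 (\<lambda>i. if ?\<beta> i then 0 else 1) (\<lambda>i. if ?\<beta> i then 1 else 0)) = 0"
      then obtain x where x: "\<exists>i<N. x i \<noteq> 0"
        "\<And>i. i < N \<Longrightarrow> (if ?\<beta> i then 0 else 1) * mat_fun N ex1 x i = (if ?\<beta> i then 1 else 0) * x i"
        unfolding det_pencil_eq_0_iff by blast
      have x3: "x i = 0" if "m + n \<le> i" "i < N" for i using x(2)[OF that(2)] that by simp
      have "x i = 0" if "i < N" for i
        using x3[of i] x3[of "m + n"] x(2)[OF that] mat_fun_ex1_1[of i x] that r
        by (cases "i < m + n") (auto split: if_splits)
      then show False using x(1) by blast
    qed
    from block_pencil_full_degree[OF this]
    show "full_degree (\<Sum>i<N. if ?\<beta> i then 1 else 0) (\<lambda>x. (\<lambda>(A, x). Determinant.det (pencil N A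
       (\<lambda>i. if ?\<beta> i then 1 else 1) (\<lambda>i. if ?\<beta> i then x else 0))) (ex1, x))" by simp
  next
    fix w assume "(\<lambda>(A, x). Determinant.det (pencil N A (\<lambda>i. if ?\<beta> i then 1 else 1) (\<lambda>i. if ?\<beta> i then x else 0))) (ex1, w) = 0"
    then have "Determinant.det (pencil N ex1 (\<lambda>_. 1) (sel m n 0 0 w)) = 0" unfolding sel0 .
    then have "w \<noteq> 0" using det_ex1 by auto
    then show "(\<lambda>(A, w). lead A w) (ex1, w) \<noteq> 0" using ex1_lead by simp
  qed
  then show ?thesis unfolding sel0 by simp
qed

end

section \<open>Existence of the factorization\<close>

lemma mult_mat_index:
  assumes "A \<in> carrier_mat N N" "B \<in> carrier_mat N N" "i < N" "j < N"
  shows "(A * B) $$ (i, j) = (\<Sum>k<N. A $$ (i, k) * B $$ (k, j))"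
  using assms by (auto simp: scalar_prod_def lessThan_atLeast0 intro!: sum.cong)

lemma adj_mat_mult_index:
  assumes "A \<in> carrier_mat N N" "i < N" "j < N"
  shows "(\<Sum>k<N. adj_mat A $$ (i, k) * A $$ (k, j)) = (if i = j then Determinant.det A else 0)"
  using mult_mat_index[OF adj_mat(1)[OF assms(1)] assms] adj_mat(3)[OF assms(1)] assms by (cases "i = j") simp_all

lemma adj_mat_one: "adj_mat (1\<^sub>m N :: complex mat) = 1\<^sub>m N"
proof -
  have "1\<^sub>m N * adj_mat (1\<^sub>m N :: complex mat) = 1 \<cdot>\<^sub>m 1\<^sub>m N"
    using adj_mat(2)[of "1\<^sub>m N :: complex mat" N] by simp
  then show ?thesis using adj_mat(1)[of "1\<^sub>m N :: complex mat" N] by (auto intro!: eq_matI)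
qed

context block_sizes
begin

text \<open>The first two block rows of \<open>Lmat\<close> are chosen such that \<open>Lmat A * A\<close> has the shape of a product
  \<open>A2 * A3\<close>: its \<open>(2,1)\<close> block vanishes, and its first block row is, in the columns of the blocks 2
  and 3, a combination of the third block row of \<open>A\<close>.\<close>

definition Cmat :: "complex mat \<Rightarrow> complex mat" where
  "Cmat A = Matrix.mat N N (\<lambda>(i, j). if j < m \<and> i < m + n then A $$ (i, j) else if i = j then 1 else 0)"

definition Lmat :: "complex mat \<Rightarrow> complex mat" where
  "Lmat A = Matrix.mat N N (\<lambda>(i, j).
     if i < m then if j < m + n then adj_mat (pencil N A (\<lambda>_. 1) (\<lambda>_. 0)) $$ (i, j) else 0
     else if i < m + n then adj_mat (Cmat A) $$ (i, j)
     else if i = j then 1 else 0)"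

lemma generic_Lmat: "generic N (\<lambda>A. Determinant.det (Lmat A) \<noteq> 0)"
proof -
  interpret function_algebra "Collect (matrix_polynomial N)" by (rule matrix_polynomial_algebra)
  note entry = matrix_polynomial_entry
  have C: "(\<lambda>A. Cmat A $$ (i, j)) \<in> Collect (matrix_polynomial N)" if "i < N" "j < N" for i j
  proof (cases "j < m \<and> i < m + n")
    case True then show ?thesis using entry[OF that] that by (simp add: Cmat_def)
  next
    case False
    then have "(\<lambda>A. Cmat A $$ (i, j)) = (\<lambda>A. if i = j then 1 else 0)" using that by (auto simp: Cmat_def)
    then show ?thesis using alg_const by simp
  qed
  have adjC: "(\<lambda>A. adj_mat (Cmat A) $$ (i, j)) \<in> Collect (matrix_polynomial N)" if "i < N" "j < N" for i j
    by (rule alg_adj_mat[OF _ C that]) (auto simp: Cmat_def)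
  have adjA: "(\<lambda>A. adj_mat (pencil N A (\<lambda>_. 1) (\<lambda>_. 0)) $$ (i, j)) \<in> Collect (matrix_polynomial N)"
    if "i < N" "j < N" for i j
    by (rule alg_adj_mat[OF pencil_carrier _ that], rule pencil_alg[OF entry]) (rule alg_const | simp)+
  have "(\<lambda>A. Determinant.det (Lmat A)) \<in> Collect (matrix_polynomial N)"
  proof (rule alg_det)
    show "Lmat A \<in> carrier_mat N N" for A by (simp add: Lmat_def)
    fix i j assume ij: "i < N" "j < N"
    show "(\<lambda>A. Lmat A $$ (i, j)) \<in> Collect (matrix_polynomial N)"
    proof (cases "i < m")
      case True
      then show ?thesis using adjA[OF ij] alg_const ij by (cases "j < m + n") (simp_all add: Lmat_def)
    next
      case False
      then show ?thesis using adjC[OF ij] alg_const ij by (cases "i < m + n") (simp_all add: Lmat_def)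
    qed
  qed
  then have *: "matrix_polynomial N (\<lambda>A. Determinant.det (Lmat A))" by simp
  have "pencil N (1\<^sub>m N) (\<lambda>_. 1) (\<lambda>_. 0) = 1\<^sub>m N" by (rule pencil_one) simp
  moreover have "Cmat (1\<^sub>m N) = 1\<^sub>m N" by (intro eq_matI) (auto simp: Cmat_def)
  ultimately have "Lmat (1\<^sub>m N) = 1\<^sub>m N"
    by (intro eq_matI) (auto simp: Lmat_def adj_mat_one)
  then have "Determinant.det (Lmat (1\<^sub>m N)) \<noteq> 0" by simp
  then show ?thesis
    by (intro genericI[of N "\<lambda>A. Determinant.det (Lmat A)" "1\<^sub>m N"] *) auto
qed

text \<open>\<open>L\<close> alters blocks 1 and 2 only and serves as the inverse of
  \<open>A1\<close>; it remains to split \<open>Q = L A\<close> as \<open>A2 * A3\<close>. The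
  factors are normalized by taking the identity as (3,3) block of \<open>A2\<close>, so that the
  last block row of \<open>A3\<close> comes from block row 3 of \<open>A\<close>.\<close>

lemma factorization_exists:
  assumes A: "A \<in> carrier_mat N N" and L0: "Determinant.det (Lmat A) \<noteq> 0"
  obtains A1 A2 A3 where "factor12 m n r A1" "factor13 m n r A2" "factor23 m n r A3" "A = A1 * A2 * A3"
proof -
  define L where "L = Lmat A"
  have L: "L \<in> carrier_mat N N" by (simp add: L_def Lmat_def)
  have C: "Cmat A \<in> carrier_mat N N" by (simp add: Cmat_def)
  \<comment> \<open>Outside block 1 the columns of \<open>Cmat A\<close> are unit vectors, and so
    are, up to the determinant, those of its adjugate. Hence the rows of \<open>L\<close> in block 2
    do not reach block 3.\<close>
  have adjC3: "adj_mat (Cmat A) $$ (i, j) = (if i = j then Determinant.det (Cmat A) else 0)"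
    if "i < N" "m \<le> j" "j < N" for i j
  proof -
    have "(\<Sum>k<N. adj_mat (Cmat A) $$ (i, k) * Cmat A $$ (k, j)) = (\<Sum>k<N. if k = j then adj_mat (Cmat A) $$ (i, k) else 0)"
      by (rule sum.cong) (use that in \<open>auto simp: Cmat_def\<close>)
    also have "\<dots> = adj_mat (Cmat A) $$ (i, j)" using that by simp
    finally show ?thesis using adj_mat_mult_index[OF C that(1,3)] by simp
  qed
  have L1: "L $$ (i, j) = (if j < m + n then adj_mat A $$ (i, j) else 0)" if "i < m" "j < N" for i j
    using that A by (simp add: L_def Lmat_def pencil_one)
  have L2: "L $$ (i, j) = adj_mat (Cmat A) $$ (i, j)" if "m \<le> i" "i < m + n" "j < N" for i j
    using that by (simp add: L_def Lmat_def)
  have L3: "L $$ (i, j) = (if i = j then 1 else 0)" if "m + n \<le> i" "i < N" "j < N" for i j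
    using that by (simp add: L_def Lmat_def)
  have actsL: "acts_on N (\<lambda>i. i < m + n) L"
    unfolding acts_on_def
  proof (intro conjI allI impI L)
    fix i j assume ij: "i < N" "j < N" "\<not> (i < m + n \<and> j < m + n)"
    show "L $$ (i, j) = (if i = j then 1 else 0)"
    proof (cases "i < m + n")
      case True
      with ij have "\<not> j < m + n" by simp
      then show ?thesis using True ij L1[of i j] L2[of i j] adjC3[of i j] by (cases "i < m") auto
    qed (use L3 ij in auto)
  qed
  define Q where "Q = L * A"
  have Q: "Q \<in> carrier_mat N N" using L A by (simp add: Q_def)
  have Qij: "Q $$ (i, j) = (\<Sum>k<N. L $$ (i, k) * A $$ (k, j))" if "i < N" "j < N" for i j
    unfolding Q_def by (rule mult_mat_index[OF L A that])
  \<comment> \<open>The adjugate times \<open>A\<close> is diagonal. Dropping the columns of block 3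
    from the adjugate leaves, off the diagonal, minus the dropped part, which is a combination of
    block row 3 of \<open>A\<close>.\<close>
  have Q1: "Q $$ (i, j) = (\<Sum>k<N. if k < m + n then 0 else - adj_mat A $$ (i, k) * A $$ (k, j))"
    if "i < m" "m \<le> j" "j < N" for i j
  proof -
    have "Q $$ (i, j) = (\<Sum>k<N. adj_mat A $$ (i, k) * A $$ (k, j)
        + (if k < m + n then 0 else - adj_mat A $$ (i, k) * A $$ (k, j)))"
      using Qij[of i j] that by (auto simp: L1 intro!: sum.cong)
    then show ?thesis using adj_mat_mult_index[OF A, of i j] that by (simp add: sum.distrib)
  qed
  \<comment> \<open>\<open>Cmat A\<close> and \<open>A\<close> share the first block column in
    blocks 1 and 2, and the product of \<open>Cmat A\<close> with its adjugate has no off-diagonal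
    entries.\<close>
  have Q2: "Q $$ (i, j) = 0" if i: "m \<le> i" "i < m + n" and j: "j < m" for i j
  proof -
    have "Q $$ (i, j) = (\<Sum>k<N. adj_mat (Cmat A) $$ (i, k) * Cmat A $$ (k, j))"
      unfolding Qij[of i j, OF trans_less_add1[OF i(2)] trans_less_add1[OF trans_less_add1[OF j]]]
    proof (rule sum.cong)
      fix k assume "k \<in> {..<N}"
      then have k: "k < N" by simp
      show "L $$ (i, k) * A $$ (k, j) = adj_mat (Cmat A) $$ (i, k) * Cmat A $$ (k, j)"
      proof (cases "k < m + n")
        case True then show ?thesis using L2[OF i k] j k by (simp add: Cmat_def)
      next
        case False then show ?thesis using L2[OF i k] adjC3[of i k] i k by simp
      qed
    qed simp
    then show ?thesis using adj_mat_mult_index[OF C, of i j] i j by simp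
  qed
  have Q3: "Q $$ (i, j) = A $$ (i, j)" if "m + n \<le> i" "i < N" "j < N" for i j
  proof -
    have "Q $$ (i, j) = (\<Sum>k<N. if k = i then A $$ (k, j) else 0)"
      unfolding Qij[OF that(2,3)] using that by (intro sum.cong) (auto simp: L3)
    then show ?thesis using that by simp
  qed
  define A2 where "A2 = Matrix.mat N N (\<lambda>(i, j).
     if i < m then if j < m then Q $$ (i, j) else if j < m + n then 0 else - adj_mat A $$ (i, j)
     else if i < m + n then if i = j then 1 else 0
     else if j < m then A $$ (i, j) else if i = j then 1 else 0)"
  define A3 where "A3 = Matrix.mat N N (\<lambda>(i, j).
     if i < m then if i = j then 1 else 0
     else if j < m then 0 else Q $$ (i, j))"
  have A2: "A2 \<in> carrier_mat N N" and A3: "A3 \<in> carrier_mat N N" by (simp_all add: A2_def A3_def)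
  have prod: "A2 * A3 = Q"
  proof (rule eq_matI)
    show "dim_row (A2 * A3) = dim_row Q" "dim_col (A2 * A3) = dim_col Q" using A2 A3 Q by auto
    fix i j assume "i < dim_row Q" "j < dim_col Q"
    then have ij: "i < N" "j < N" using Q by auto
    have "(\<Sum>k<N. A2 $$ (i, k) * A3 $$ (k, j)) = Q $$ (i, j)"
    proof (cases "i < m")
      case i: True
      show ?thesis
      proof (cases "j < m")
        case True
        have "(\<Sum>k<N. A2 $$ (i, k) * A3 $$ (k, j)) = (\<Sum>k<N. if k = j then Q $$ (i, k) else 0)"
          by (rule sum.cong) (use i True ij in \<open>auto simp: A2_def A3_def\<close>)
        then show ?thesis using ij by simp
      next
        case False
        have "(\<Sum>k<N. A2 $$ (i, k) * A3 $$ (k, j)) =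
            (\<Sum>k<N. if k < m + n then 0 else - adj_mat A $$ (i, k) * A $$ (k, j))"
          by (rule sum.cong) (use i False ij Q3 in \<open>auto simp: A2_def A3_def\<close>)
        then show ?thesis using Q1[OF i, of j] False ij by simp
      qed
    next
      case i: False
      show ?thesis
      proof (cases "i < m + n")
        case True
        have "(\<Sum>k<N. A2 $$ (i, k) * A3 $$ (k, j)) = (\<Sum>k<N. if k = i then A3 $$ (k, j) else 0)"
          by (rule sum.cong) (use i True ij in \<open>auto simp: A2_def\<close>)
        also have "\<dots> = A3 $$ (i, j)" using ij by simp
        finally show ?thesis using Q2[of i j] i True ij by (simp add: A3_def)
      next
        case i3: False
        show ?thesis
        proof (cases "j < m")
          case True
          have "(\<Sum>k<N. A2 $$ (i, k) * A3 $$ (k, j)) = (\<Sum>k<N. if k = j then A $$ (i, k) else 0)"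
            by (rule sum.cong) (use i i3 True ij in \<open>auto simp: A2_def A3_def\<close>)
          then show ?thesis using Q3[of i j] i3 ij by simp
        next
          case False
          have "(\<Sum>k<N. A2 $$ (i, k) * A3 $$ (k, j)) = (\<Sum>k<N. if k = i then Q $$ (k, j) else 0)"
            by (rule sum.cong) (use i i3 False ij in \<open>auto simp: A2_def A3_def\<close>)
          then show ?thesis using ij by simp
        qed
      qed
    qed
    then show "(A2 * A3) $$ (i, j) = Q $$ (i, j)" using mult_mat_index[OF A2 A3 ij] by simp
  qed
  obtain L' where L': "acts_on N (\<lambda>i. i < m + n) L'"
    "\<And>x i. i < N \<Longrightarrow> mat_fun N L' (mat_fun N L x) i = x i"
    by (rule acts_on_inverse[OF actsL]) (use L0 in \<open>auto simp: L_def\<close>)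
  have eq: "A = L' * A2 * A3"
  proof (rule eq_matI)
    have c: "L' * A2 * A3 = L' * (L * A)"
      using assoc_mult_mat[OF acts_onD[OF L'(1)] A2 A3] prod by (simp add: Q_def)
    have c': "L' * (L * A) \<in> carrier_mat N N" using acts_onD[OF L'(1)] L A by (intro mult_carrier_mat)
    show "dim_row A = dim_row (L' * A2 * A3)" "dim_col A = dim_col (L' * A2 * A3)"
      unfolding c using c' A by auto
    fix i j assume "i < dim_row (L' * A2 * A3)" "j < dim_col (L' * A2 * A3)"
    then have ij: "i < N" "j < N" using c' unfolding c by auto
    let ?e = "\<lambda>k. if k = j then 1 else 0"
    have "mat_fun N (L' * (L * A)) ?e i = mat_fun N L' (mat_fun N (L * A) ?e) i"
      by (rule mat_fun_mult) (use acts_onD[OF L'(1)] L A ij in auto)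
    also have "\<dots> = mat_fun N L' (mat_fun N L (mat_fun N A ?e)) i"
      by (rule mat_fun_cong, rule mat_fun_mult) (use L A in auto)
    also have "\<dots> = mat_fun N A ?e i" by (rule L'(2)[OF ij(1)])
    finally show "A $$ (i, j) = (L' * A2 * A3) $$ (i, j)"
      unfolding c mat_fun_unit[OF ij(2)] by simp
  qed
  have "acts_on N (\<lambda>i. i < m \<or> m + n \<le> i) A2" unfolding acts_on_def
    using A2 by (auto simp: A2_def)
  moreover have "acts_on N (\<lambda>i. m \<le> i) A3" unfolding acts_on_def
    using A3 by (auto simp: A3_def)
  ultimately show ?thesis using that L'(1) eq by (simp add: factor12_iff factor13_iff factor23_iff)
qed

end

section \<open>The genericity condition and the finiteness of exceptional points\<close>

lemma polynomial_function_algebra: "function_algebra (range (poly :: complex poly \<Rightarrow> complex \<Rightarrow> complex))"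
proof
  show "(\<lambda>_. c) \<in> range poly" for c :: complex by (rule range_eqI[of _ _ "[:c:]"]) auto
  fix f g :: "complex \<Rightarrow> complex" assume "f \<in> range poly" "g \<in> range poly"
  then obtain p q where "f = poly p" "g = poly q" by blast
  then show "(\<lambda>b. f b + g b) \<in> range poly" "(\<lambda>b. f b * g b) \<in> range poly"
    using range_eqI[of _ poly "p + q"] range_eqI[of _ poly "p * q"] by (auto simp: fun_eq_iff)
qed

lemma ident_in_range_poly: "(\<lambda>w :: complex. w) \<in> range poly"
  by (rule range_eqI[of _ _ "[:0, 1:]"]) auto

lemma acts_on_pred_cong: "acts_on N P M \<Longrightarrow> (\<And>i. i < N \<Longrightarrow> P i \<longleftrightarrow> Q i) \<Longrightarrow> acts_on N Q M"
  by (simp add: acts_on_def)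

context block_sizes
begin

abbreviation pdet :: "complex mat \<Rightarrow> (nat \<Rightarrow> complex) \<Rightarrow> (nat \<Rightarrow> complex) \<Rightarrow> complex" where
  "pdet A h g \<equiv> Determinant.det (pencil N A h g)"

text \<open>The pencils \<open>pdet A (sel m n h1 h2 h3) (sel m n g1 g2 g3)\<close> are the equation of the curve in the homogeneous
  coordinates \<open>u = [g1 : h1]\<close>, \<open>v = [g2 : h2]\<close>, \<open>w = [g3 : h3]\<close>.\<close>

definition good :: "complex mat \<Rightarrow> bool" where
  "good A \<longleftrightarrow>
    pdet A (\<lambda>_. 1) (\<lambda>_. 0) \<noteq> 0 \<and>
    pdet A (sel m n 0 0 1) (sel m n 1 1 0) \<noteq> 0 \<and>
    pdet A (sel m n 0 1 1) (sel m n 1 0 0) \<noteq> 0 \<and>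
    pdet A (sel m n 1 0 0) (sel m n 0 1 1) \<noteq> 0 \<and>
    pdet A (sel m n 1 1 0) (sel m n 0 0 1) \<noteq> 0 \<and>
    (\<forall>x. pdet A (sel m n 0 0 1) (sel m n 1 1 x) = 0 \<longrightarrow>
      deriv (\<lambda>x. pdet A (sel m n 0 0 1) (sel m n 1 1 x)) x \<noteq> 0) \<and>
    (\<forall>x. pdet A (sel m n 0 1 1) (sel m n 1 x 0) = 0 \<longrightarrow>
      deriv (\<lambda>x. pdet A (sel m n 0 1 1) (sel m n 1 x 0)) x \<noteq> 0) \<and>
    (\<forall>x. pdet A (sel m n 1 1 1) (sel m n 0 0 x) = 0 \<longrightarrow>
      deriv (\<lambda>x. pdet A (sel m n 1 1 1) (sel m n 0 0 x)) x \<noteq> 0) \<and>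
    (\<forall>x. pdet A (sel m n 1 1 0) (sel m n 0 x 1) = 0 \<longrightarrow>
      deriv (\<lambda>x. pdet A (sel m n 1 1 0) (sel m n 0 x 1)) x \<noteq> 0) \<and>
    (\<forall>w. pdet A (\<lambda>_. 1) (sel m n 0 0 w) = 0 \<longrightarrow> lead A w \<noteq> 0) \<and>
    (\<forall>i<m. lead A (wpt i) \<noteq> 0) \<and>
    (\<forall>u. F A u (wpt 0) = 0 \<longrightarrow> col A u (wpt 0) 0 \<noteq> 0) \<and>
    (\<forall>x. (\<forall>i<m. F A (x i) (wpt i) = 0) \<longrightarrow> Determinant.det (Kmat A x) \<noteq> 0) \<and>
    Determinant.det (Lmat A) \<noteq> 0"

lemma generic_simple_roots_sel:
  assumes "\<And>i. i < N \<Longrightarrow> \<not> \<beta> i \<Longrightarrow> (h i, g i) = (1, 0) \<or> (h i, g i) = (0, 1)"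
    and "\<And>i. i < N \<Longrightarrow> (if \<beta> i then 1 else h i) = h' i"
    and "\<And>i x. i < N \<Longrightarrow> (if \<beta> i then x else g i) = g' x i"
  shows "generic N (\<lambda>A. \<forall>x. pdet A h' (g' x) = 0 \<longrightarrow> deriv (\<lambda>x. pdet A h' (g' x)) x \<noteq> 0)"
proof -
  have "pdet A (\<lambda>i. if \<beta> i then 1 else h i) (\<lambda>i. if \<beta> i then x else g i) = pdet A h' (g' x)" for A x
    by (rule det_pencil_cong) (use assms in auto)
  with generic_simple_roots[of N \<beta> h g, OF assms(1)] show ?thesis by simp
qed

text \<open>The five determinants exclude points of the curve whose coordinates all lie in
  \<open>{0, \<infinity>}\<close>. The simple roots concern \<open>D1\<close>, \<open>D2\<close>,
  \<open>D6\<close>, \<open>D4\<close> in this order. The conditions on \<open>lead\<close> exclude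
  lines \<open>w = const\<close> and roots at infinity in the chosen fibres, those on
  \<open>col\<close> and \<open>Kmat\<close> serve the normalization of the eigenvectors of
  \<open>A\<close> and \<open>B\<close>, and the last one serves the factorization.\<close>

lemma generic_good: "generic N good"
  unfolding good_def[abs_def]
proof (intro generic_conj)
  show "generic N (\<lambda>A. pdet A (\<lambda>_. 1) (\<lambda>_. 0) \<noteq> 0)" by (rule generic_det_pencil_one) simp
  show "generic N (\<lambda>A. pdet A (sel m n 0 0 1) (sel m n 1 1 0) \<noteq> 0)"
    "generic N (\<lambda>A. pdet A (sel m n 0 1 1) (sel m n 1 0 0) \<noteq> 0)"
    "generic N (\<lambda>A. pdet A (sel m n 1 0 0) (sel m n 0 1 1) \<noteq> 0)"
    "generic N (\<lambda>A. pdet A (sel m n 1 1 0) (sel m n 0 0 1) \<noteq> 0)"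
    by (rule generic_det_pencil_one, simp add: sel_def)+
  show "generic N (\<lambda>A. \<forall>x. pdet A (sel m n 0 0 1) (sel m n 1 1 x) = 0 \<longrightarrow>
      deriv (\<lambda>x. pdet A (sel m n 0 0 1) (sel m n 1 1 x)) x \<noteq> 0)"
    by (rule generic_simple_roots_sel[where \<beta> = "\<lambda>i. m + n \<le> i" and h = "sel m n 0 0 1" and g = "sel m n 1 1 0"])
      (auto simp: sel_def)
  show "generic N (\<lambda>A. \<forall>x. pdet A (sel m n 0 1 1) (sel m n 1 x 0) = 0 \<longrightarrow>
      deriv (\<lambda>x. pdet A (sel m n 0 1 1) (sel m n 1 x 0)) x \<noteq> 0)"
    by (rule generic_simple_roots_sel[where \<beta> = "\<lambda>i. m \<le> i \<and> i < m + n" and h = "sel m n 0 1 1" and g = "sel m n 1 0 0"])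
      (auto simp: sel_def)
  show "generic N (\<lambda>A. \<forall>x. pdet A (sel m n 1 1 1) (sel m n 0 0 x) = 0 \<longrightarrow>
      deriv (\<lambda>x. pdet A (sel m n 1 1 1) (sel m n 0 0 x)) x \<noteq> 0)"
    by (rule generic_simple_roots_sel[where \<beta> = "\<lambda>i. m + n \<le> i" and h = "sel m n 1 1 1" and g = "sel m n 0 0 0"])
      (auto simp: sel_def)
  show "generic N (\<lambda>A. \<forall>x. pdet A (sel m n 1 1 0) (sel m n 0 x 1) = 0 \<longrightarrow>
      deriv (\<lambda>x. pdet A (sel m n 1 1 0) (sel m n 0 x 1)) x \<noteq> 0)"
    by (rule generic_simple_roots_sel[where \<beta> = "\<lambda>i. m \<le> i \<and> i < m + n" and h = "sel m n 1 1 0" and g = "sel m n 0 0 1"])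
      (auto simp: sel_def)
  show "generic N (\<lambda>A. \<forall>w. pdet A (\<lambda>_. 1) (sel m n 0 0 w) = 0 \<longrightarrow> lead A w \<noteq> 0)"
    by (rule generic_no_vertical_line)
  show "generic N (\<lambda>A. \<forall>i<m. lead A (wpt i) \<noteq> 0)" by (rule generic_lead)
  show "generic N (\<lambda>A. \<forall>u. F A u (wpt 0) = 0 \<longrightarrow> col A u (wpt 0) 0 \<noteq> 0)" by (rule generic_first_coordinate)
  show "generic N (\<lambda>A. \<forall>x. (\<forall>i<m. F A (x i) (wpt i) = 0) \<longrightarrow> Determinant.det (Kmat A x) \<noteq> 0)"
    by (rule generic_Kmat)
  show "generic N (\<lambda>A. Determinant.det (Lmat A) \<noteq> 0)" by (rule generic_Lmat)
qed

text \<open>A resultant in \<open>u\<close> is a polynomial in \<open>w\<close>. One fibre without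
  common zeros shows that it is nonzero, so finitely many \<open>w\<close> occur, and above each of
  them finitely many \<open>u\<close>, because the curve contains no line
  \<open>w = const\<close>.\<close>

lemma finite_common_zeros:
  assumes A: "good A" and R: "(\<lambda>(w, u). R w u) \<in> poly_functions (range poly) e"
    and i: "i < m" "\<And>u. F A u (wpt i) = 0 \<Longrightarrow> R (wpt i) u \<noteq> 0"
  shows "finite {(u, w). F A u w = 0 \<and> R w u = 0}"
proof -
  interpret W: function_algebra "range (poly :: complex poly \<Rightarrow> _)" by (rule polynomial_function_algebra)
  have F: "(\<lambda>(w, u). F A u w) \<in> poly_functions (range poly) deg"
    by (rule F_poly_functions[OF polynomial_function_algebra, of "\<lambda>_. A" "\<lambda>w. w"])
      (rule W.alg_const ident_in_range_poly)+
  obtain g where g: "g \<in> range poly"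
    "\<And>w u. F A u w = 0 \<Longrightarrow> R w u = 0 \<Longrightarrow> g w = 0"
    "\<And>w. full_degree deg (\<lambda>u. F A u w) \<Longrightarrow> (\<And>u. F A u w = 0 \<Longrightarrow> R w u \<noteq> 0) \<Longrightarrow> g w \<noteq> 0"
    by (rule W.elimination[OF F R]) auto
  obtain p where p: "g = poly p" using g(1) by blast
  have "g (wpt i) \<noteq> 0"
    by (rule g(3)[OF F_full_degree]) (use A i in \<open>auto simp: good_def\<close>)
  then have "p \<noteq> 0" using p by auto
  then have finw: "finite {w. g w = 0}" unfolding p by (rule poly_roots_finite)
  have finu: "finite {u. F A u w = 0}" for w
  proof -
    obtain P where P: "\<And>u. F A u w = poly P u" using F unfolding poly_functions_def by auto
    have "P \<noteq> 0"
    proof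
      assume "P = 0"
      then have 0: "F A u w = 0" for u by (simp add: P)
      then have "lead A w = 0" by (rule lead_eq_0)
      moreover have "pdet A (\<lambda>_. 1) (sel m n 0 0 w) = 0" using 0[of 0] by (simp add: F_def spec_def)
      ultimately show False using A by (simp add: good_def)
    qed
    then show ?thesis unfolding P by (rule poly_roots_finite)
  qed
  have "{(u, w). F A u w = 0 \<and> R w u = 0} \<subseteq> (\<lambda>(w, u). (u, w)) ` (SIGMA w:{w. g w = 0}. {u. F A u w = 0})"
    using g(2) by (auto simp: image_iff)
  then show ?thesis by (rule finite_subset) (use finw finu in auto)
qed

lemma finite_col_0:
  assumes "good A"
  shows "finite {(u, w). F A u w = 0 \<and> col A u w 0 = 0}"
proof -
  interpret W: function_algebra "range (poly :: complex poly \<Rightarrow> _)" by (rule polynomial_function_algebra)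
  obtain e where "(\<lambda>(w, u). col A u w 0) \<in> poly_functions (range poly) e"
    using col_poly_functions[where A = "\<lambda>_. A" and k = 0, OF polynomial_function_algebra W.alg_const ident_in_range_poly] m
    by auto
  from finite_common_zeros[OF assms this, of 0] show ?thesis
    using m assms by (auto simp: good_def)
qed

text \<open>\<open>col A u w 0\<close> is, up to sign, the minor of the spectral matrix without row
  \<open>m + n - 1\<close> and column 0. If it is nonzero, coordinate 0 determines an
  eigenvector.\<close>

lemma eigenvector_unique:
  assumes "col A u w 0 \<noteq> 0" "x 0 = 0"
    and "\<And>i. i < N \<Longrightarrow> mat_fun N A x i = sel m n u (u * w) w i * x i" and "i < N"
  shows "x i = 0"
  using col_eq_0_iff[of 0 A u w] assms m by auto

end

section \<open>The refactorized matrix\<close>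

locale refactorization = block_sizes +
  fixes A A1 A2 A3 A1' :: "complex mat"
  assumes good: "good A" and A: "A = A1 * A2 * A3"
    and A1: "acts_on (m + n + r) (\<lambda>i. i < m + n) A1"
    and A2: "acts_on (m + n + r) (\<lambda>i. i < m \<or> m + n \<le> i) A2"
    and A3: "acts_on (m + n + r) (\<lambda>i. m \<le> i) A3"
    and A1': "acts_on (m + n + r) (\<lambda>i. i < m + n) A1'"
    and A1_A1': "\<And>x i. i < m + n + r \<Longrightarrow> mat_fun (m + n + r) A1 (mat_fun (m + n + r) A1' x) i = x i"
    and A1'_A1: "\<And>x i. i < m + n + r \<Longrightarrow> mat_fun (m + n + r) A1' (mat_fun (m + n + r) A1 x) i = x i"
begin

abbreviation B :: "complex mat" where "B \<equiv> A3 * A2 * A1"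

definition T :: "complex \<Rightarrow> (nat \<Rightarrow> complex) \<Rightarrow> nat \<Rightarrow> complex" where
  "T w = transfer N (\<lambda>i. i < m) (\<lambda>i. m + n \<le> i) A1' A3 w"

lemma carriers: "A1 \<in> carrier_mat N N" "A2 \<in> carrier_mat N N" "A3 \<in> carrier_mat N N" "A1' \<in> carrier_mat N N"
  "A \<in> carrier_mat N N" "B \<in> carrier_mat N N"
  using acts_onD[OF A1] acts_onD[OF A2] acts_onD[OF A3] acts_onD[OF A1'] A by auto

lemma det_A: "Determinant.det A \<noteq> 0"
  using good pencil_one[OF carriers(5)] by (simp add: good_def)

lemma det_factors: "Determinant.det A1 \<noteq> 0" "Determinant.det A2 \<noteq> 0" "Determinant.det A3 \<noteq> 0"
proof -
  have "Determinant.det A = Determinant.det A1 * Determinant.det A2 * Determinant.det A3"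
    unfolding A using carriers by (simp add: det_mult[of _ N])
  then show "Determinant.det A1 \<noteq> 0" "Determinant.det A2 \<noteq> 0" "Determinant.det A3 \<noteq> 0" using det_A by auto
qed

lemma mat_fun_A:
  assumes "i < N"
  shows "mat_fun N A x i = mat_fun N A1 (mat_fun N A2 (mat_fun N A3 x)) i"
proof -
  have "mat_fun N A x i = mat_fun N (A1 * A2) (mat_fun N A3 x) i"
    unfolding A by (rule mat_fun_mult) (use carriers assms in auto)
  also have "\<dots> = mat_fun N A1 (mat_fun N A2 (mat_fun N A3 x)) i"
    by (rule mat_fun_mult) (use carriers assms in auto)
  finally show ?thesis .
qed

lemma mat_fun_A_3:
  assumes "m + n \<le> i" "i < N"
  shows "mat_fun N A x i = mat_fun N A2 (mat_fun N A3 x) i"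
  using mat_fun_A[OF assms(2), of x] acts_on_id[OF A1 assms(2)] assms(1) by simp

lemma mat_fun_A2_3:
  assumes "m + n \<le> i" "i < N"
  shows "mat_fun N A2 z i = (\<Sum>l<m. A2 $$ (i, l) * z l) + (\<Sum>l\<in>{m + n..<N}. A2 $$ (i, l) * z l)"
proof -
  have "mat_fun N A2 z i = (\<Sum>l\<in>{..<m} \<union> {m + n..<N}. A2 $$ (i, l) * z l)"
    unfolding mat_fun_def
    by (rule sum.mono_neutral_right) (use A2 assms in \<open>auto simp: acts_on_def\<close>)
  also have "\<dots> = (\<Sum>l<m. A2 $$ (i, l) * z l) + (\<Sum>l\<in>{m + n..<N}. A2 $$ (i, l) * z l)"
    by (rule sum.union_disjoint) auto
  finally show ?thesis .
qed

text \<open>The block \<open>D2\<close> of \<open>A2\<close> is invertible, because \<open>D2 * D3\<close> is the \<open>(3,3)\<close> block of \<open>A\<close>.\<close>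

lemma D2_inverse:
  obtains E where "\<And>z i. m + n \<le> i \<Longrightarrow> i < N \<Longrightarrow>
    mat_fun N E (\<lambda>k. if m + n \<le> k then mat_fun N A2 z k - (\<Sum>l<m. A2 $$ (k, l) * z l) else 0) i = z i"
proof -
  let ?P = "\<lambda>i. m + n \<le> i"
  \<comment> \<open>The (3,3) block of \<open>M\<close>, completed by the identity to size
    \<open>N\<close> so that the lemmas on \<open>acts_on\<close> provide its inverse.\<close>
  define D where "D M = Matrix.mat N N (\<lambda>(i, j). if ?P i \<and> ?P j then M $$ (i, j) else if i = j then 1 else 0)" for M :: "complex mat"
  have D: "acts_on N ?P (D M)" for M by (auto simp: acts_on_def D_def)
  note Dc = acts_onD[OF D]
  have D3: "mat_fun N (D M) z i = (\<Sum>l\<in>{m + n..<N}. M $$ (i, l) * z l)" if "?P i" "i < N" for M z i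
  proof -
    have "mat_fun N (D M) z i = (\<Sum>l\<in>{m + n..<N}. D M $$ (i, l) * z l)"
      unfolding mat_fun_def by (rule sum.mono_neutral_right) (use that in \<open>auto simp: D_def\<close>)
    also have "\<dots> = (\<Sum>l\<in>{m + n..<N}. M $$ (i, l) * z l)"
      by (rule sum.cong) (use that in \<open>auto simp: D_def\<close>)
    finally show ?thesis .
  qed
  have "Determinant.det (D A2 * D A3) \<noteq> 0"
  proof
    assume "Determinant.det (D A2 * D A3) = 0"
    then obtain x where x: "\<exists>i<N. x i \<noteq> 0" "\<And>i. i < N \<Longrightarrow> mat_fun N (D A2 * D A3) x i = 0"
      using det_eq_0_iff_kernel[OF mult_carrier_mat[OF Dc[of A2] Dc[of A3]]] by auto
    have x': "mat_fun N (D A2) (mat_fun N (D A3) x) i = 0" if "i < N" for i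
      using x(2)[OF that] mat_fun_mult[OF Dc Dc that] by simp
    have x12: "x i = 0" if "i < m + n" for i
      using x'[of i] acts_on_id[OF D, of i] that by auto
    have z1: "mat_fun N A3 x i = 0" if "i < m" for i
      using acts_on_id[OF A3, of i x] x12[of i] that by auto
    have z3: "mat_fun N A3 x i = mat_fun N (D A3) x i" if "?P i" "i < N" for i
      by (subst D3[OF that], unfold mat_fun_def, rule sum.mono_neutral_right) (use x12 in auto)
    have "mat_fun N A x i = 0" if i: "?P i" "i < N" for i
    proof -
      have "mat_fun N A x i = (\<Sum>l\<in>{m + n..<N}. A2 $$ (i, l) * mat_fun N A3 x l)"
        unfolding mat_fun_A_3[OF i] mat_fun_A2_3[OF i] by (simp add: z1)
      also have "\<dots> = mat_fun N (D A2) (mat_fun N (D A3) x) i"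
        unfolding D3[OF i] by (rule sum.cong) (auto simp: z3)
      finally show ?thesis using x'[OF i(2)] by simp
    qed
    \<comment> \<open>\<open>x\<close> lives in block 3 and is annihilated by the (3,3) block of
      \<open>A\<close>: this is the excluded point \<open>u = v = \<infinity>\<close>,
      \<open>w = 0\<close>.\<close>
    then have "pdet A (sel m n 0 0 1) (sel m n 1 1 0) = 0"
      unfolding det_pencil_eq_0_iff using x(1) x12 by (intro exI[of _ x]) (auto simp: sel_def)
    then show False using good by (simp add: good_def)
  qed
  then have "Determinant.det (D A2) \<noteq> 0" using det_mult[OF Dc[of A2] Dc[of A3]] by auto
  then obtain E where E: "acts_on N ?P E" "\<And>x i. i < N \<Longrightarrow> mat_fun N E (mat_fun N (D A2) x) i = x i"
    using acts_on_inverse[OF D, of A2] by metis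
  show ?thesis
  proof (rule that)
    fix z i assume i: "?P i" "i < N"
    have "mat_fun N E (\<lambda>k. if m + n \<le> k then mat_fun N A2 z k - (\<Sum>l<m. A2 $$ (k, l) * z l) else 0) i =
        mat_fun N E (mat_fun N (D A2) z) i"
      by (rule acts_on_cong[OF E(1) i(2,1)]) (auto simp: mat_fun_A2_3 D3)
    then show "mat_fun N E (\<lambda>k. if m + n \<le> k then mat_fun N A2 z k - (\<Sum>l<m. A2 $$ (k, l) * z l) else 0) i = z i"
      using E(2)[OF i(2)] by simp
  qed
qed

lemma D2_injective:
  assumes "\<And>i. i < m \<Longrightarrow> z i = 0" "\<And>i. m + n \<le> i \<Longrightarrow> i < N \<Longrightarrow> mat_fun N A2 z i = 0"
    and "m + n \<le> i" "i < N"
  shows "z i = 0"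
proof -
  obtain E where E: "\<And>z i. m + n \<le> i \<Longrightarrow> i < N \<Longrightarrow>
    mat_fun N E (\<lambda>k. if m + n \<le> k then mat_fun N A2 z k - (\<Sum>l<m. A2 $$ (k, l) * z l) else 0) i = z i"
    by (rule D2_inverse) auto
  have "z i = mat_fun N E (\<lambda>k. if m + n \<le> k then mat_fun N A2 z k - (\<Sum>l<m. A2 $$ (k, l) * z l) else 0) i"
    using E[OF assms(3,4)] by simp
  also have "\<dots> = mat_fun N E (\<lambda>k. 0) i"
    by (rule mat_fun_cong) (use assms in auto)
  finally show ?thesis by (simp add: mat_fun_zero)
qed

lemma T_eigenvector:
  assumes "\<And>i. i < N \<Longrightarrow> mat_fun N A x i = sel m n u (u * w) w i * x i"
  shows "\<And>i. i < N \<Longrightarrow> mat_fun N B (T w x) i = sel m n u (u * w) w i * T w x i"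
    and "\<And>i. i < m + n \<Longrightarrow> mat_fun N A2 (mat_fun N A3 x) i = u * T w x i"
    and "\<And>i. m + n \<le> i \<Longrightarrow> i < N \<Longrightarrow> mat_fun N A2 (mat_fun N A3 x) i = w * x i"
    and "(\<And>i. i < N \<Longrightarrow> T w x i = 0) \<Longrightarrow> (\<And>i. i < N \<Longrightarrow> x i = 0)"
proof -
  let ?p1 = "\<lambda>i. i < m" and ?p2 = "\<lambda>i. m \<le> i \<and> i < m + n" and ?p3 = "\<lambda>i. m + n \<le> i"
  have acts: "acts_on N (\<lambda>i. ?p1 i \<or> ?p2 i) A1" "acts_on N (\<lambda>i. ?p1 i \<or> ?p3 i) A2"
    "acts_on N (\<lambda>i. ?p2 i \<or> ?p3 i) A3" "acts_on N (\<lambda>i. ?p1 i \<or> ?p2 i) A1'"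
    by (rule acts_on_pred_cong[OF A1], auto) (rule A2, rule acts_on_pred_cong[OF A3], auto,
      rule acts_on_pred_cong[OF A1'], auto)
  have s: "sel m n u (u * w) w i = (if ?p1 i then u else if ?p2 i then u * w else w)" for i
    by (simp add: sel_def)
  note t = transfer_eigenvector[where N = N and ?p1.0 = ?p1 and ?p2.0 = ?p2 and ?p3.0 = ?p3, OF _ acts A1_A1' A1'_A1, of x u w,
      folded A T_def, folded s]
  show "\<And>i. i < N \<Longrightarrow> mat_fun N B (T w x) i = sel m n u (u * w) w i * T w x i"
    by (rule t(1)) (use assms in auto)
  show "\<And>i. i < m + n \<Longrightarrow> mat_fun N A2 (mat_fun N A3 x) i = u * T w x i"
    by (rule t(2)) (use assms in auto)
  show "\<And>i. m + n \<le> i \<Longrightarrow> i < N \<Longrightarrow> mat_fun N A2 (mat_fun N A3 x) i = w * x i"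
    by (rule t(3)) (use assms in auto)
  show "(\<And>i. i < N \<Longrightarrow> T w x i = 0) \<Longrightarrow> (\<And>i. i < N \<Longrightarrow> x i = 0)"
    by (rule t(5)) (use assms det_factors in auto)
qed

text \<open>\<open>B = A3 * A2 * A1\<close> is a factorization of the same kind with blocks 1 and 3
  exchanged, and the diagonal \<open>u, u w, w\<close> is symmetric if \<open>u\<close> and
  \<open>w\<close> are exchanged as well. So the map back is again a \<open>transfer\<close>; what
  is recorded of it is linearity and injectivity.\<close>

lemma inverse_transfer:
  obtains V where
    "\<And>u w y. (\<And>i. i < N \<Longrightarrow> mat_fun N B y i = sel m n u (u * w) w i * y i) \<Longrightarrow>
      (\<forall>i<N. mat_fun N A (V u w y) i = sel m n u (u * w) w i * V u w y i) \<and>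
      ((\<forall>i<N. V u w y i = 0) \<longrightarrow> (\<forall>i<N. y i = 0))"
    "\<And>u w y z c i. V u w (\<lambda>j. y j - c * z j) i = V u w y i - c * V u w z i"
proof -
  let ?p1 = "\<lambda>i. i < m" and ?p2 = "\<lambda>i. m \<le> i \<and> i < m + n" and ?p3 = "\<lambda>i. m + n \<le> i"
  obtain A3' where A3': "acts_on N (\<lambda>i. m \<le> i) A3'"
    "\<And>x i. i < N \<Longrightarrow> mat_fun N A3 (mat_fun N A3' x) i = x i"
    "\<And>x i. i < N \<Longrightarrow> mat_fun N A3' (mat_fun N A3 x) i = x i"
    using acts_on_inverse[OF A3 det_factors(3)] by blast
  have acts: "acts_on N (\<lambda>i. ?p3 i \<or> ?p2 i) A3" "acts_on N (\<lambda>i. ?p3 i \<or> ?p1 i) A2"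
    "acts_on N (\<lambda>i. ?p2 i \<or> ?p1 i) A1" "acts_on N (\<lambda>i. ?p3 i \<or> ?p2 i) A3'"
    by (rule acts_on_pred_cong[OF A3], auto) (rule acts_on_pred_cong[OF A2], auto,
      rule acts_on_pred_cong[OF A1], auto, rule acts_on_pred_cong[OF A3'(1)], auto)
  have s: "i < N \<Longrightarrow> sel m n u (u * w) w i = (if ?p3 i then w else if ?p2 i then w * u else u)" for i and u w :: complex
    by (auto simp: sel_def mult.commute[of u w])
  note t = transfer_eigenvector[where N = N and ?p1.0 = ?p3 and ?p2.0 = ?p2 and ?p3.0 = ?p1, OF _ acts A3'(2,3), folded A]
  define V where "V u w = transfer N ?p3 ?p1 A3' A1 u" for u w :: complex
  show ?thesis
  proof (rule that[of V])
    fix u w y assume y: "\<And>i. i < N \<Longrightarrow> mat_fun N B y i = sel m n u (u * w) w i * y i"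
    have "mat_fun N A (V u w y) i = sel m n u (u * w) w i * V u w y i" if "i < N" for i
      unfolding V_def s[OF that] by (rule t(1)) (use y s that in auto)
    moreover have "y i = 0" if "\<forall>i<N. V u w y i = 0" "i < N" for i
      by (rule t(5)[of y w u]) (use y s that det_factors in \<open>auto simp: V_def\<close>)
    ultimately show "(\<forall>i<N. mat_fun N A (V u w y) i = sel m n u (u * w) w i * V u w y i) \<and>
      ((\<forall>i<N. V u w y i = 0) \<longrightarrow> (\<forall>i<N. y i = 0))" by blast
  next
    show "V u w (\<lambda>j. y j - c * z j) i = V u w y i - c * V u w z i" for u w y z c i
      by (simp add: V_def transfer_def right_diff_distrib mult.left_commute[of _ c] mat_fun_diff mat_fun_scale)
  qed
qed

lemma F_B_eq_0_iff: "F B u w = 0 \<longleftrightarrow> F A u w = 0"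
proof
  assume "F A u w = 0"
  then obtain x where x: "\<exists>i<N. x i \<noteq> 0" "\<And>i. i < N \<Longrightarrow> mat_fun N A x i = sel m n u (u * w) w i * x i"
    unfolding F_eq_0_iff by blast
  note t = T_eigenvector[OF x(2)]
  show "F B u w = 0" unfolding F_eq_0_iff using t(1,4) x(1) by blast
next
  assume "F B u w = 0"
  then obtain y where y: "\<exists>i<N. y i \<noteq> 0" "\<And>i. i < N \<Longrightarrow> mat_fun N B y i = sel m n u (u * w) w i * y i"
    unfolding F_eq_0_iff by blast
  obtain V where V: "\<And>u w y. (\<And>i. i < N \<Longrightarrow> mat_fun N B y i = sel m n u (u * w) w i * y i) \<Longrightarrow>
      (\<forall>i<N. mat_fun N A (V u w y) i = sel m n u (u * w) w i * V u w y i) \<and>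
      ((\<forall>i<N. V u w y i = 0) \<longrightarrow> (\<forall>i<N. y i = (0 :: complex)))"
    by (rule inverse_transfer) blast
  show "F A u w = 0" unfolding F_eq_0_iff using V[OF y(2)] y(1) by blast
qed

text \<open>\<open>V\<close> takes eigenvectors of \<open>B\<close> injectively to those of
  \<open>A\<close>, which coordinate 0 determines. Subtracting a suitable multiple of
  \<open>T w (col A u w)\<close> from \<open>y\<close> gives a vector killed by \<open>V\<close>,
  hence zero; coordinate 0 then shows that the multiple is 0.\<close>

lemma eigenvector_B_unique:
  assumes "F A u w = 0" "col A u w 0 \<noteq> 0" "T w (col A u w) 0 \<noteq> 0" "y 0 = 0"
    and y: "\<And>i. i < N \<Longrightarrow> mat_fun N B y i = sel m n u (u * w) w i * y i" and "i < N"
  shows "y i = 0"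
proof -
  obtain V where V: "\<And>u w y. (\<And>i. i < N \<Longrightarrow> mat_fun N B y i = sel m n u (u * w) w i * y i) \<Longrightarrow>
      (\<forall>i<N. mat_fun N A (V u w y) i = sel m n u (u * w) w i * V u w y i) \<and>
      ((\<forall>i<N. V u w y i = 0) \<longrightarrow> (\<forall>i<N. y i = (0 :: complex)))"
      "\<And>u w y z c i. V u w (\<lambda>j. y j - c * z j) i = V u w y i - c * V u w z i"
    by (rule inverse_transfer) blast
  let ?t = "T w (col A u w)"
  have t: "mat_fun N B ?t i = sel m n u (u * w) w i * ?t i" if "i < N" for i
    by (rule T_eigenvector(1)[OF col_eigenvector[OF assms(1)] that])
  have "V u w ?t 0 \<noteq> 0"
  proof
    assume "V u w ?t 0 = 0"
    then have "\<forall>i<N. V u w ?t i = 0"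
      using eigenvector_unique[OF assms(2), of "V u w ?t"] V(1)[OF t] by auto
    then show False using V(1)[OF t] assms(3) m by auto
  qed
  define c where "c = V u w y 0 / V u w ?t 0"
  define z where "z = (\<lambda>j. y j - c * ?t j)"
  have z: "mat_fun N B z i = sel m n u (u * w) w i * z i" if "i < N" for i
    unfolding z_def mat_fun_diff mat_fun_scale y[OF that] t[OF that] by (simp add: algebra_simps)
  have "V u w z 0 = 0" unfolding z_def V(2) c_def using \<open>V u w ?t 0 \<noteq> 0\<close> by simp
  then have "\<forall>i<N. V u w z i = 0"
    using eigenvector_unique[OF assms(2), of "V u w z"] V(1)[OF z] by auto
  then have zero: "z i = 0" if "i < N" for i using V(1)[OF z] that by blast
  have "c = 0" using zero[of 0] assms(3,4) m by (simp add: z_def)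
  then show ?thesis using zero[OF assms(6)] by (simp add: z_def)
qed

text \<open>For \<open>z\<close> supported in blocks 1 and 2 let \<open>x\<close> be the adjugate of
  \<open>A\<close> applied to \<open>z\<close>. If block 1 of \<open>x\<close> is zero, then so are
  blocks 1 and 3 of \<open>A3 x\<close>, the latter because \<open>D2\<close> is injective, and
  hence coordinate 0 of \<open>A2 (A3 x)\<close> and of \<open>A1' z\<close>. Zeros in all
  \<open>m\<close> fibres, where the first blocks are independent, would therefore make row 0 of
  \<open>A1'\<close> vanish.\<close>

lemma finite_T_col_0: "finite {(u, w). F A u w = 0 \<and> T w (col A u w) 0 = 0}"
proof -
  interpret W: function_algebra "range (poly :: complex poly \<Rightarrow> _)" by (rule polynomial_function_algebra)
  define y where "y u w k = (if k < m then 1 else if k < m + n then w else 0) * col A u w k" for u w k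
  have T0: "T w (col A u w) 0 = mat_fun N A1' (y u w) 0" for u w
    unfolding T_def transfer_def using m
    by (auto intro!: acts_on_cong[OF A1'] simp: y_def)
  have poly: "\<exists>e. (\<lambda>(w, u). mat_fun N A1' (y u w) 0) \<in> poly_functions (range poly) e"
  proof -
    interpret E: function_algebra "\<Union>e. poly_functions (range (poly :: complex poly \<Rightarrow> _)) e"
      by (rule W.poly_functions_algebra)
    have fst: "fst \<in> (\<Union>e. poly_functions (range (poly :: complex poly \<Rightarrow> _)) e)"
      using W.poly_functions_base[OF ident_in_range_poly] by (auto simp: case_prod_unfold)
    have snd: "snd \<in> (\<Union>e. poly_functions (range (poly :: complex poly \<Rightarrow> _)) e)"
      using W.poly_functions_var by (auto simp: case_prod_unfold)
    have "(\<lambda>b. \<Sum>k<N. A1' $$ (0, k) * ((if k < m then 1 else if k < m + n then fst b else 0) * col A (snd b) (fst b) k))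
        \<in> (\<Union>e. poly_functions (range (poly :: complex poly \<Rightarrow> _)) e)"
    proof (rule E.G.sum, intro E.alg_mult E.alg_const)
      fix k assume "k \<in> {..<N}"
      show "(\<lambda>b. if k < m then 1 else if k < m + n then fst b else 0) \<in> (\<Union>e. poly_functions (range (poly :: complex poly \<Rightarrow> _)) e)"
        using E.alg_const fst by (cases "k < m"; cases "k < m + n") simp_all
      show "(\<lambda>b. col A (snd b) (fst b) k) \<in> (\<Union>e. poly_functions (range (poly :: complex poly \<Rightarrow> _)) e)"
        by (rule col_alg[OF E.function_algebra_axioms E.alg_const snd fst]) (use \<open>k \<in> {..<N}\<close> in auto)
    qed
    then show ?thesis by (auto simp: mat_fun_def y_def case_prod_unfold)
  qed
  have "\<exists>i<m. \<forall>u. F A u (wpt i) = 0 \<longrightarrow> mat_fun N A1' (y u (wpt i)) 0 \<noteq> 0"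
  proof (rule ccontr)
    assume "\<not> ?thesis"
    then have "\<forall>i. \<exists>u. i < m \<longrightarrow> F A u (wpt i) = 0 \<and> mat_fun N A1' (y u (wpt i)) 0 = 0" by blast
    then obtain u where u: "\<And>i. i < m \<Longrightarrow> F A (u i) (wpt i) = 0 \<and> mat_fun N A1' (y (u i) (wpt i)) 0 = 0"
      by metis
    let ?y = "\<lambda>i. y (u i) (wpt i)"
    have "Determinant.det (transpose_mat (Kmat A u)) \<noteq> 0"
      using good u by (auto simp: good_def det_transpose[OF Kmat_carrier])
    moreover have "transpose_mat (Kmat A u) \<in> carrier_mat m m" using Kmat_carrier[of A u] by simp
    ultimately obtain K' where K': "\<And>b j. j < m \<Longrightarrow> mat_fun m (transpose_mat (Kmat A u)) (mat_fun m K' b) j = b j"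
      by (elim mat_fun_inverse[rotated]) auto
    have Kmat: "Kmat A u $$ (i, j) = mat_fun N (adj_mat A) (?y i) j" if "i < m" "j < m" for i j
    proof -
      have "Kmat A u $$ (i, j) = (\<Sum>k<m + n. adj_mat A $$ (j, k) * ?y i k)"
        using that carriers by (auto simp: Kmat_def y_def pencil_one intro!: sum.cong)
      also have "\<dots> = mat_fun N (adj_mat A) (?y i) j"
        unfolding mat_fun_def by (rule sum.mono_neutral_left) (auto simp: y_def)
      finally show ?thesis .
    qed
    have row: "A1' $$ (0, k) = 0" if k: "k < m + n" for k
    proof -
      define e where "e = (\<lambda>j. if j = k then 1 else (0 :: complex))"
      \<comment> \<open>The coefficients that express the first block of the adjugate applied to
        \<open>e\<close> through the rows of \<open>Kmat A u\<close>; they make the first block of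
        \<open>x\<close> zero.\<close>
      define c where "c = mat_fun m K' (mat_fun N (adj_mat A) e)"
      define z where "z = (\<lambda>j. e j - (\<Sum>i<m. c i * ?y i j))"
      define x where "x = mat_fun N (adj_mat A) z"
      have lin: "mat_fun N M z j = mat_fun N M e j - (\<Sum>i<m. c i * mat_fun N M (?y i) j)" for M j
      proof -
        have "mat_fun N M (\<lambda>k. \<Sum>i<m. c i * ?y i k) j = (\<Sum>i<m. c i * mat_fun N M (?y i) j)"
          unfolding mat_fun_def sum_distrib_left by (subst sum.swap) (simp add: mult_ac)
        then show ?thesis unfolding z_def mat_fun_diff by simp
      qed
      have x1: "x j = 0" if "j < m" for j
      proof -
        have "mat_fun N (adj_mat A) e j = mat_fun m (transpose_mat (Kmat A u)) c j"
          unfolding c_def using K'[OF that] by simp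
        also have "\<dots> = (\<Sum>i<m. c i * mat_fun N (adj_mat A) (?y i) j)"
          unfolding mat_fun_def[of m] by (rule sum.cong) (use that Kmat carrier_matD[OF Kmat_carrier[of A u]] in \<open>auto simp: mult.commute\<close>)
        finally show ?thesis unfolding x_def lin by simp
      qed
      have Ax: "mat_fun N A x j = Determinant.det A * z j" if "j < N" for j
        unfolding x_def by (rule mat_fun_adj_mat[OF carriers(5) that])
      let ?z = "mat_fun N A3 x"
      have z1: "?z j = 0" if "j < m" for j
        using acts_on_id[OF A3, of j x] x1[OF that] that by simp
      have "mat_fun N A2 ?z j = 0" if "m + n \<le> j" "j < N" for j
      proof -
        have "z j = 0" using that k by (auto simp: z_def e_def y_def)
        then show ?thesis using Ax[OF that(2)] mat_fun_A_3[OF that] by simp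
      qed
      then have z3: "?z j = 0" if "m + n \<le> j" "j < N" for j
        using D2_injective[of ?z] z1 that by blast
      have "mat_fun N A2 ?z 0 = mat_fun N A2 (\<lambda>_. 0) 0"
        by (rule acts_on_cong[OF A2]) (use m z1 z3 in auto)
      then have A20: "mat_fun N A2 ?z 0 = 0" by (simp add: mat_fun_zero)
      have "Determinant.det A * mat_fun N A1' z 0 = mat_fun N A1' (\<lambda>j. Determinant.det A * z j) 0"
        by (simp add: mat_fun_scale)
      also have "\<dots> = mat_fun N A1' (mat_fun N A1 (mat_fun N A2 ?z)) 0"
        by (rule mat_fun_cong) (simp add: Ax[symmetric] mat_fun_A)
      also have "\<dots> = 0" using A1'_A1[of 0] A20 m by simp
      finally have "mat_fun N A1' z 0 = 0" using det_A by simp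
      then have "mat_fun N A1' e 0 = 0" unfolding lin using u by simp
      then show ?thesis unfolding e_def using mat_fun_unit[of k N A1' 0] k by simp
    qed
    have "mat_fun N A1' (mat_fun N A1 (\<lambda>_. 1)) 0 = mat_fun N A1' (mat_fun N A1 (\<lambda>_. 1)) 0 * 0"
    proof -
      have "A1' $$ (0, k) = 0" if "k < N" for k
        using row[of k] A1' that m by (cases "k < m + n") (auto simp: acts_on_def)
      then show ?thesis unfolding mat_fun_def[of N A1'] by simp
    qed
    then show False using A1'_A1[of 0 "\<lambda>_. 1"] m by simp
  qed
  then obtain i where i: "i < m" "\<And>u. F A u (wpt i) = 0 \<Longrightarrow> mat_fun N A1' (y u (wpt i)) 0 \<noteq> 0" by blast
  obtain e where e: "(\<lambda>(w, u). mat_fun N A1' (y u w) 0) \<in> poly_functions (range poly) e" using poly by blast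
  show ?thesis unfolding T0 using finite_common_zeros[OF good e i] by simp
qed

end

section \<open>The invariant curve\<close>

text \<open>Values at the fixed representatives \<open>hom0\<close> and \<open>hom1\<close>, so that
  forms become functions on points, graded by their multidegree.\<close>

definition forms :: "nat \<times> nat \<times> nat \<Rightarrow> (point \<Rightarrow> complex) set" where
  "forms d = {f. \<exists>\<kappa>. \<forall>p. f p = eval_form (fst d) (fst (snd d)) (snd (snd d)) \<kappa> p}"

lemma forms_zero: "(\<lambda>_. 0) \<in> forms d"
  unfolding forms_def by (intro CollectI exI[of _ "\<lambda>_ _ _. 0"]) auto

lemma forms_add: "f \<in> forms d \<Longrightarrow> g \<in> forms d \<Longrightarrow> (\<lambda>p. f p + g p) \<in> forms d"
proof -
  assume "f \<in> forms d" "g \<in> forms d"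
  then obtain \<kappa> \<mu> where "\<forall>p. f p = eval_form (fst d) (fst (snd d)) (snd (snd d)) \<kappa> p"
    "\<forall>p. g p = eval_form (fst d) (fst (snd d)) (snd (snd d)) \<mu> p" unfolding forms_def by blast
  then show ?thesis unfolding forms_def
    by (intro CollectI exI[of _ "\<lambda>i j k. \<kappa> i j k + \<mu> i j k"]) (auto simp: sum.distrib algebra_simps)
qed

lemma forms_scale: "f \<in> forms d \<Longrightarrow> (\<lambda>p. c * f p) \<in> forms d"
proof -
  assume "f \<in> forms d"
  then obtain \<kappa> where "\<forall>p. f p = eval_form (fst d) (fst (snd d)) (snd (snd d)) \<kappa> p"
    unfolding forms_def by blast
  then show ?thesis unfolding forms_def
    by (intro CollectI exI[of _ "\<lambda>i j k. c * \<kappa> i j k"]) (auto simp: sum_distrib_left mult_ac)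
qed

lemma forms_sum: "(\<And>i. i \<in> I \<Longrightarrow> f i \<in> forms d) \<Longrightarrow> (\<lambda>p. \<Sum>i\<in>I. f i p) \<in> forms d"
  by (induction I rule: infinite_finite_induct) (auto intro: forms_zero forms_add)

definition hmono :: "nat \<Rightarrow> nat \<Rightarrow> cp1 \<Rightarrow> complex" where
  "hmono a i x = hom0 x ^ i * hom1 x ^ (a - i)"

lemma eval_form_hmono:
  "eval_form a b c \<kappa> p = (\<Sum>i\<le>a. \<Sum>j\<le>b. \<Sum>k\<le>c. \<kappa> i j k *
    (hmono a i (fst p) * hmono b j (fst (snd p)) * hmono c k (snd (snd p))))"
  by (cases p) (simp add: hmono_def mult.assoc)

lemma hmono_mult: "i \<le> a \<Longrightarrow> i' \<le> a' \<Longrightarrow> hmono a i x * hmono a' i' x = hmono (a + a') (i + i') x"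
proof -
  assume "i \<le> a" "i' \<le> a'"
  then have "a + a' - (i + i') = (a - i) + (a' - i')" by simp
  then show ?thesis by (simp add: hmono_def power_add mult_ac)
qed

lemma forms_hmono:
  assumes "i \<le> a" "j \<le> b" "k \<le> c"
  shows "(\<lambda>p. hmono a i (fst p) * hmono b j (fst (snd p)) * hmono c k (snd (snd p))) \<in> forms (a, b, c)"
proof -
  let ?\<kappa> = "\<lambda>i' j' k'. if i' = i then if j' = j then if k' = k then 1 else 0 else 0 else (0 :: complex)"
  have "eval_form a b c ?\<kappa> p = hmono a i (fst p) * hmono b j (fst (snd p)) * hmono c k (snd (snd p))" for p
  proof -
    let ?E = "\<lambda>i j k. hmono a i (fst p) * hmono b j (fst (snd p)) * hmono c k (snd (snd p))"
    have 3: "(\<Sum>k'\<le>c. ?\<kappa> i' j' k' * ?E i' j' k') = (if j' = j then if i' = i then ?E i j k else 0 else 0)" for i' j'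
    proof -
      have "(\<Sum>k'\<le>c. ?\<kappa> i' j' k' * ?E i' j' k') =
          (\<Sum>k'\<le>c. if k' = k then if j' = j then if i' = i then ?E i j k else 0 else 0 else 0)"
        by (rule sum.cong) auto
      then show ?thesis using assms(3) by simp
    qed
    show ?thesis unfolding eval_form_hmono 3 using assms by simp
  qed
  then show ?thesis unfolding forms_def by (intro CollectI exI[of _ ?\<kappa>]) simp
qed

lemma forms_mult:
  assumes "f \<in> forms d" "g \<in> forms e"
  shows "(\<lambda>p. f p * g p) \<in> forms (d + e)"
proof -
  obtain a b c where d: "d = (a, b, c)" by (cases d) auto
  obtain a' b' c' where e: "e = (a', b', c')" by (cases e) auto
  obtain \<kappa> \<mu> where f: "\<And>p. f p = eval_form a b c \<kappa> p" and g: "\<And>p. g p = eval_form a' b' c' \<mu> p"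
    using assms unfolding forms_def d e by auto
  have "(\<lambda>p. f p * g p) = (\<lambda>p. \<Sum>i\<le>a. \<Sum>j\<le>b. \<Sum>k\<le>c. \<Sum>i'\<le>a'. \<Sum>j'\<le>b'. \<Sum>k'\<le>c'. (\<kappa> i j k * \<mu> i' j' k') *
      (hmono (a + a') (i + i') (fst p) * hmono (b + b') (j + j') (fst (snd p)) * hmono (c + c') (k + k') (snd (snd p))))"
  proof
    fix p
    show "f p * g p = (\<Sum>i\<le>a. \<Sum>j\<le>b. \<Sum>k\<le>c. \<Sum>i'\<le>a'. \<Sum>j'\<le>b'. \<Sum>k'\<le>c'. (\<kappa> i j k * \<mu> i' j' k') *
      (hmono (a + a') (i + i') (fst p) * hmono (b + b') (j + j') (fst (snd p)) * hmono (c + c') (k + k') (snd (snd p))))"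
      unfolding f g eval_form_hmono sum_distrib_right
      unfolding sum_distrib_left
      by (intro sum.cong refl) (simp add: hmono_mult[symmetric] mult_ac)
  qed
  also have "\<dots> \<in> forms (a + a', b + b', c + c')"
    by (intro forms_sum forms_scale forms_hmono) auto
  finally show ?thesis by (simp add: d e)
qed

lemma forms_const: "(\<lambda>_. c) \<in> forms 0"
  unfolding forms_def by (intro CollectI exI[of _ "\<lambda>_ _ _. c"]) (auto simp: zero_prod_def)

interpretation forms: graded_functions forms
  by standard (simp_all add: forms_const forms_zero forms_add forms_mult)

lemma forms_vanish_on_closure:
  assumes "f \<in> forms d" "\<And>q. q \<in> S \<Longrightarrow> f q = 0" "p \<in> zariski_closure S"
  shows "f p = 0"
proof -
  obtain \<kappa> where \<kappa>: "\<And>p. f p = eval_form (fst d) (fst (snd d)) (snd (snd d)) \<kappa> p"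
    using assms(1) unfolding forms_def by blast
  show ?thesis using assms(2,3) unfolding zariski_closure_def \<kappa> by blast
qed

lemma forms_hom:
  "(\<lambda>p. hom0 (fst p)) \<in> forms (1, 0, 0)" "(\<lambda>p. hom1 (fst p)) \<in> forms (1, 0, 0)"
  "(\<lambda>p. hom0 (fst (snd p))) \<in> forms (0, 1, 0)" "(\<lambda>p. hom1 (fst (snd p))) \<in> forms (0, 1, 0)"
  "(\<lambda>p. hom0 (snd (snd p))) \<in> forms (0, 0, 1)" "(\<lambda>p. hom1 (snd (snd p))) \<in> forms (0, 0, 1)"
  using forms_hmono[of 1 1 0 0 0 0] forms_hmono[of 0 1 0 0 0 0] forms_hmono[of 0 0 1 1 0 0]
    forms_hmono[of 0 0 0 1 0 0] forms_hmono[of 0 0 0 0 1 1] forms_hmono[of 0 0 0 0 0 1]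
  by (simp_all add: hmono_def)

lemma spectral_diag_carrier: "spectral_diag m n r u v w \<in> carrier_mat (m + n + r) (m + n + r)"
  unfolding spectral_diag_def by (rule three_block_mat_carrier) auto

lemma spectral_diag_index:
  assumes "i < m + n + r" "j < m + n + r"
  shows "spectral_diag m n r u v w $$ (i, j) = (if i = j then sel m n u v w i else 0)"
  unfolding spectral_diag_def
  by (subst three_block_mat_index[where m = m and n = n and r = r]) (use assms in \<open>auto simp: sel_def\<close>)

lemma mat_fun_spectral_diag:
  assumes "i < m + n + r"
  shows "mat_fun (m + n + r) (spectral_diag m n r u v w) x i = sel m n u v w i * x i"
proof -
  have "mat_fun (m + n + r) (spectral_diag m n r u v w) x i = (\<Sum>j<m + n + r. if i = j then sel m n u v w i * x j else 0)"
    unfolding mat_fun_def by (rule sum.cong) (use assms in \<open>auto simp: spectral_diag_index\<close>)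
  then show ?thesis using assms by simp
qed

context block_sizes
begin

lemma det_spectral:
  assumes "A \<in> carrier_mat N N"
  shows "Determinant.det (A - spectral_diag m n r u v w) = pdet A (\<lambda>_. 1) (sel m n u v w)"
proof -
  have "A - spectral_diag m n r u v w = pencil N A (\<lambda>_. 1) (sel m n u v w)"
    using assms spectral_diag_carrier[of m n r u v w]
    by (intro eq_matI) (auto simp: pencil_def spectral_diag_index)
  then show ?thesis by simp
qed

abbreviation curve :: "complex mat \<Rightarrow> point set" where
  "curve A \<equiv> invariant_curve m n r A"

lemma invariant_curve_eq:
  assumes "A \<in> carrier_mat N N"
  shows "curve A = zariski_closure {(Fin u, Fin (u * w), Fin w) | u w. F A u w = 0}"
proof -
  have "{(Fin u, Fin v, Fin w) | u v w. Determinant.det (A - spectral_diag m n r u v w) = 0 \<and> v = u * w}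
      = {(Fin u, Fin (u * w), Fin w) | u w. F A u w = 0}"
    by (auto simp: det_spectral[OF assms] F_def spec_def)
  then show ?thesis by (simp add: invariant_curve_def)
qed

definition cdet :: "complex mat \<Rightarrow> point \<Rightarrow> complex" where
  "cdet A p = pdet A (sel m n (hom1 (fst p)) (hom1 (fst (snd p))) (hom1 (snd (snd p))))
    (sel m n (hom0 (fst p)) (hom0 (fst (snd p))) (hom0 (snd (snd p))))"

text \<open>The rows of each block are linear in the homogeneous coordinates of one of the three
  projective lines, so the determinant has multidegree \<open>(m, n, r)\<close>.\<close>

lemma cdet_forms: "\<exists>d. cdet A \<in> forms d"
proof -
  have "(\<lambda>p. cdet A p) \<in> forms (\<Sum>i<N. sel m n (1, 0, 0) (0, 1, 0) (0, 0, 1) i)"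
    unfolding cdet_def pencil_def
  proof (rule forms.det)
    fix i j assume "i < N" "j < N"
    let ?d = "sel m n (1, 0, 0) (0, 1, 0) (0, 0, 1) i :: nat \<times> nat \<times> nat"
    have "(\<lambda>p. sel m n (hom1 (fst p)) (hom1 (fst (snd p))) (hom1 (snd (snd p))) i) \<in> forms ?d"
      by (cases "i < m"; cases "i < m + n") (use forms_hom in \<open>simp_all add: sel_def\<close>)
    then have 1: "(\<lambda>p. A $$ (i, j) * sel m n (hom1 (fst p)) (hom1 (fst (snd p))) (hom1 (snd (snd p))) i) \<in> forms ?d"
      by (rule forms_scale)
    have "(\<lambda>p. sel m n (hom0 (fst p)) (hom0 (fst (snd p))) (hom0 (snd (snd p))) i) \<in> forms ?d"
      by (cases "i < m"; cases "i < m + n") (use forms_hom in \<open>simp_all add: sel_def\<close>)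
    then have "(\<lambda>p. (if i = j then -1 else 0) * sel m n (hom0 (fst p)) (hom0 (fst (snd p))) (hom0 (snd (snd p))) i) \<in> forms ?d"
      by (rule forms_scale)
    from forms_add[OF 1 this]
    show "(\<lambda>p. sel m n (hom1 (fst p)) (hom1 (fst (snd p))) (hom1 (snd (snd p))) i * A $$ (i, j) -
      (if i = j then sel m n (hom0 (fst p)) (hom0 (fst (snd p))) (hom0 (snd (snd p))) i else 0)) \<in> forms ?d"
      by (cases "i = j") (simp_all add: mult.commute)
  qed
  then show ?thesis by blast
qed

lemma cdet_Fin: "cdet A (Fin u, Fin (u * w), Fin w) = F A u w"
  unfolding cdet_def F_def spec_def by (rule det_pencil_cong) (auto simp: sel_def)

definition crel :: "point \<Rightarrow> complex" where
  "crel p = hom0 (fst (snd p)) * hom1 (fst p) * hom1 (snd (snd p))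
    - hom1 (fst (snd p)) * hom0 (fst p) * hom0 (snd (snd p))"

lemma crel_forms: "crel \<in> forms (1, 1, 1)"
proof -
  have a: "(\<lambda>p. hom0 (fst (snd p)) * hom1 (fst p) * hom1 (snd (snd p))) \<in> forms (1, 1, 1)"
    using forms_mult[OF forms_mult[OF forms_hom(3,2)] forms_hom(6)] by simp
  have b: "(\<lambda>p. (-1) * (hom1 (fst (snd p)) * hom0 (fst p) * hom0 (snd (snd p)))) \<in> forms (1, 1, 1)"
    using forms_scale[OF forms_mult[OF forms_mult[OF forms_hom(4,1)] forms_hom(5)], of "-1"] by simp
  show ?thesis using forms_add[OF a b] by (simp add: crel_def[abs_def])
qed

lemma curve_equations:
  assumes "A \<in> carrier_mat N N" "p \<in> curve A"
  shows "cdet A p = 0" "crel p = 0"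
proof -
  obtain d where d: "cdet A \<in> forms d" using cdet_forms by blast
  show "cdet A p = 0"
    by (rule forms_vanish_on_closure[OF d _ assms(2)[unfolded invariant_curve_eq[OF assms(1)]]])
      (auto simp: cdet_Fin)
  show "crel p = 0"
    by (rule forms_vanish_on_closure[OF crel_forms _ assms(2)[unfolded invariant_curve_eq[OF assms(1)]]])
      (auto simp: crel_def)
qed

text \<open>Both equations extend to forms, hence hold on the Zariski closure, which so acquires no
  further points with finite coordinates.\<close>

lemma Fin_in_curve_iff:
  assumes "A \<in> carrier_mat N N"
  shows "(Fin u, Fin v, Fin w) \<in> curve A \<longleftrightarrow> v = u * w \<and> F A u w = 0"
proof
  assume "(Fin u, Fin v, Fin w) \<in> curve A"
  from curve_equations[OF assms this] show "v = u * w \<and> F A u w = 0"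
    using cdet_Fin[of A u w] by (simp add: crel_def)
next
  assume "v = u * w \<and> F A u w = 0"
  then have "(Fin u, Fin v, Fin w) \<in> {(Fin u, Fin (u * w), Fin w) | u w. F A u w = 0}" by blast
  then show "(Fin u, Fin v, Fin w) \<in> curve A"
    unfolding invariant_curve_eq[OF assms] zariski_closure_def by blast
qed

text \<open>Apart from three infinite coordinates, the homogenized relation \<open>v = u w\<close>
  leaves four patterns at infinity. In each of them one of the determinants in \<open>good\<close>
  keeps the remaining coordinate away from 0. The case names are those of the divisors.\<close>

lemma curve_cases [consumes 3, case_names finite D1 D2 D3 D4]:
  assumes A: "A \<in> carrier_mat N N" "good A" and p: "p \<in> curve A"
  obtains (finite) u w where "p = (Fin u, Fin (u * w), Fin w)" "F A u w = 0"
  | (D1) w where "p = (Infty, Infty, Fin w)" "w \<noteq> 0" "pdet A (sel m n 0 0 1) (sel m n 1 1 w) = 0"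
  | (D2) v where "p = (Infty, Fin v, Fin 0)" "v \<noteq> 0" "pdet A (sel m n 0 1 1) (sel m n 1 v 0) = 0"
  | (D3) u where "p = (Fin u, Infty, Infty)" "u \<noteq> 0" "pdet A (sel m n 1 0 0) (sel m n u 1 1) = 0"
  | (D4) v where "p = (Fin 0, Fin v, Infty)" "v \<noteq> 0" "pdet A (sel m n 1 1 0) (sel m n 0 v 1) = 0"
proof -
  obtain x y z where xyz: "p = (x, y, z)" by (cases p) auto
  note eqs = curve_equations[OF A(1) p, unfolded xyz cdet_def crel_def, simplified]
  note g = A(2)[unfolded good_def]
  show ?thesis
  proof (cases x)
    case x: (Fin u)
    show ?thesis
    proof (cases y)
      case y: (Fin v)
      show ?thesis
      proof (cases z)
        case z: (Fin w)
        show ?thesis using p Fin_in_curve_iff[OF A(1)] by (intro finite[of u w]) (auto simp: xyz x y z)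
      next
        case z: Infty
        have "u = 0" using eqs(2) by (simp add: x y z)
        moreover have "v \<noteq> 0" using eqs(1) g \<open>u = 0\<close> by (auto simp: x y z)
        ultimately show ?thesis using eqs(1) by (intro D4[of v]) (auto simp: xyz x y z)
      qed
    next
      case y: Infty
      show ?thesis
      proof (cases z)
        case z: (Fin w)
        show ?thesis using eqs(2) by (simp add: x y z)
      next
        case z: Infty
        have "u \<noteq> 0" using eqs(1) g by (auto simp: x y z)
        then show ?thesis using eqs(1) by (intro D3[of u]) (auto simp: xyz x y z)
      qed
    qed
  next
    case x: Infty
    show ?thesis
    proof (cases y)
      case y: (Fin v)
      show ?thesis
      proof (cases z)
        case z: (Fin w)
        have "w = 0" using eqs(2) by (simp add: x y z)
        moreover have "v \<noteq> 0" using eqs(1) g \<open>w = 0\<close> by (auto simp: x y z)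
        ultimately show ?thesis using eqs(1) by (intro D2[of v]) (auto simp: xyz x y z)
      next
        case z: Infty
        show ?thesis using eqs(2) by (simp add: x y z)
      qed
    next
      case y: Infty
      show ?thesis
      proof (cases z)
        case z: (Fin w)
        have "w \<noteq> 0" using eqs(1) g by (auto simp: x y z)
        then show ?thesis using eqs(1) by (intro D1[of w]) (auto simp: xyz x y z)
      next
        case z: Infty
        \<comment> \<open>At three infinite coordinates the pencil is minus the identity.\<close>
        have "pdet A (sel m n 0 0 0) (sel m n 1 1 1) \<noteq> 0"
          unfolding det_pencil_eq_0_iff by (auto simp: sel_def)
        then show ?thesis using eqs(1) by (simp add: x y z)
      qed
    qed
  qed
qed

lemma finite_block_roots:
  assumes "\<And>i. i < N \<Longrightarrow> (if \<beta> i then 1 else h i) = h' i"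
    and "\<And>i x. i < N \<Longrightarrow> (if \<beta> i then x else g i) = g' x i"
    and "pdet A h' (g' 0) \<noteq> 0"
  shows "finite {x. pdet A h' (g' x) = 0}"
proof -
  have eq: "pdet A (\<lambda>i. if \<beta> i then 1 else h i) (\<lambda>i. if \<beta> i then x else g i) = pdet A h' (g' x)" for x
    by (rule det_pencil_cong) (use assms in auto)
  have "\<exists>P. \<forall>x. pdet A h' (g' x) = poly P x"
    using block_pencil_poly_functions[of N \<beta> h g] unfolding poly_functions_def by (auto simp: eq[symmetric])
  then obtain P where P: "\<And>x. pdet A h' (g' x) = poly P x" by blast
  have "P \<noteq> 0" using assms(3) P[of 0] by auto
  then show ?thesis unfolding P by (rule poly_roots_finite)
qed

lemma finite_infinite_points:
  assumes A: "A \<in> carrier_mat N N" "good A"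
  shows "finite {p \<in> curve A. \<not> (\<exists>u v w. p = (Fin u, Fin v, Fin w))}"
proof -
  note g = A(2)[unfolded good_def]
  have "finite {x. pdet A (sel m n 0 0 1) (sel m n 1 1 x) = 0}" (is "finite ?Q1")
    by (rule finite_block_roots[where \<beta> = "\<lambda>i. m + n \<le> i" and h = "sel m n 0 0 1" and g = "sel m n 1 1 0"])
      (use g in \<open>auto simp: sel_def\<close>)
  moreover have "finite {x. pdet A (sel m n 0 1 1) (sel m n 1 x 0) = 0}" (is "finite ?Q2")
    by (rule finite_block_roots[where \<beta> = "\<lambda>i. m \<le> i \<and> i < m + n" and h = "sel m n 0 1 1" and g = "sel m n 1 0 0"])
      (use g in \<open>auto simp: sel_def\<close>)
  moreover have "finite {x. pdet A (sel m n 1 1 0) (sel m n 0 x 1) = 0}" (is "finite ?Q4")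
    by (rule finite_block_roots[where \<beta> = "\<lambda>i. m \<le> i \<and> i < m + n" and h = "sel m n 1 1 0" and g = "sel m n 0 0 1"])
      (use g in \<open>auto simp: sel_def\<close>)
  moreover have "finite {x. pdet A (sel m n 1 0 0) (sel m n x 1 1) = 0}" (is "finite ?Q5")
    by (rule finite_block_roots[where \<beta> = "\<lambda>i. i < m" and h = "sel m n 1 0 0" and g = "sel m n 0 1 1"])
      (use g in \<open>auto simp: sel_def\<close>)
  moreover have "{p \<in> curve A. \<not> (\<exists>u v w. p = (Fin u, Fin v, Fin w))} \<subseteq>
      (\<lambda>w. (Infty, Infty, Fin w)) ` ?Q1 \<union> (\<lambda>v. (Infty, Fin v, Fin 0)) ` ?Q2 \<union>
      (\<lambda>v. (Fin 0, Fin v, Infty)) ` ?Q4 \<union> (\<lambda>u. (Fin u, Infty, Infty)) ` ?Q5"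
  proof safe
    fix x y z assume p: "(x, y, z) \<in> curve A" and nf: "\<nexists>u v w. (x, y, z) = (Fin u, Fin v, Fin w)"
      and n4: "(x, y, z) \<notin> (\<lambda>u. (Fin u, Infty, Infty)) ` ?Q5"
      and n3: "(x, y, z) \<notin> (\<lambda>v. (Fin 0, Fin v, Infty)) ` ?Q4"
      and n2: "(x, y, z) \<notin> (\<lambda>v. (Infty, Fin v, Fin 0)) ` ?Q2"
    from A p show "(x, y, z) \<in> (\<lambda>w. (Infty, Infty, Fin w)) ` ?Q1"
      by (cases rule: curve_cases) (use nf n2 n3 n4 in auto)
  qed
  ultimately show ?thesis by (meson finite_UnI finite_imageI finite_subset)
qed

lemma finite_D6:
  assumes A: "A \<in> carrier_mat N N" "good A"
  shows "finite {w. F A 0 w = 0}"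
proof -
  have "finite {x. pdet A (sel m n 1 1 1) (sel m n 0 0 x) = 0}"
  proof (rule finite_block_roots[where \<beta> = "\<lambda>i. m + n \<le> i" and h = "sel m n 1 1 1" and g = "sel m n 0 0 0"])
    have "pdet A (sel m n 1 1 1) (sel m n 0 0 0) = pdet A (\<lambda>_. 1) (\<lambda>_. 0)"
      by (rule det_pencil_cong) (auto simp: sel_def)
    then show "pdet A (sel m n 1 1 1) (sel m n 0 0 0) \<noteq> 0" using A(2) by (simp add: good_def)
  qed (auto simp: sel_def)
  moreover have "F A 0 w = pdet A (sel m n 1 1 1) (sel m n 0 0 w)" for w
    unfolding F_def spec_def by (rule det_pencil_cong) (auto simp: sel_def)
  ultimately show ?thesis by simp
qed

end

section \<open>Orders at the origin\<close>

text \<open>The order is read off from a limit, so it suffices to exhibit one; this suits the limits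
  of vectors below. For meromorphic functions it is \<open>zorder\<close>.\<close>

definition has_order :: "(complex \<Rightarrow> complex) \<Rightarrow> int \<Rightarrow> bool" where
  "has_order f k \<longleftrightarrow> (\<exists>c. c \<noteq> 0 \<and> ((\<lambda>t. f t * t powi (- k)) \<longlongrightarrow> c) (at 0))"

lemma has_orderI: "((\<lambda>t. f t * t powi (- k)) \<longlongrightarrow> c) (at 0) \<Longrightarrow> c \<noteq> 0 \<Longrightarrow> has_order f k"
  unfolding has_order_def by blast

lemma tendsto_powi_pos: "0 < k \<Longrightarrow> ((\<lambda>t :: complex. t powi k) \<longlongrightarrow> 0) (at 0)"
proof -
  assume k: "0 < k"
  have "((\<lambda>t :: complex. t powi k) \<longlongrightarrow> 0 powi k) (at 0)"
    by (rule tendsto_power_int') (use k in auto)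
  then show ?thesis using k by simp
qed

lemma has_order_unique_aux:
  assumes f: "has_order f k" and g: "has_order f l" and "k < l"
  shows False
proof -
  obtain c where c: "c \<noteq> 0" "((\<lambda>t. f t * t powi (- k)) \<longlongrightarrow> c) (at 0)" using f unfolding has_order_def by blast
  obtain d where d: "d \<noteq> 0" "((\<lambda>t. f t * t powi (- l)) \<longlongrightarrow> d) (at 0)" using g unfolding has_order_def by blast
  have "((\<lambda>t. (f t * t powi (- l)) * t powi (l - k)) \<longlongrightarrow> d * 0) (at 0)"
    by (intro tendsto_mult d tendsto_powi_pos) (use assms in auto)
  moreover have "\<forall>\<^sub>F t in at 0. (f t * t powi (- l)) * t powi (l - k) = f t * t powi (- k)"
    unfolding eventually_at_filter by (auto simp: mult.assoc simp flip: power_int_add)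
  ultimately have "((\<lambda>t. f t * t powi (- k)) \<longlongrightarrow> d * 0) (at 0)" by (rule Lim_transform_eventually)
  then have "c = d * 0" using c(2) by (intro tendsto_unique[of "at (0 :: complex)"]) auto
  then show False using c(1) by simp
qed

lemma has_order_unique: "has_order f k \<Longrightarrow> has_order f l \<Longrightarrow> k = l"
  using has_order_unique_aux by (metis linorder_neqE)

lemma has_order_imp_eventually_nonzero:
  assumes "has_order f k"
  shows "\<forall>\<^sub>F t in at 0. f t \<noteq> 0"
proof -
  obtain c where c: "c \<noteq> 0" "((\<lambda>t. f t * t powi (- k)) \<longlongrightarrow> c) (at 0)"
    using assms unfolding has_order_def by blast
  have "\<forall>\<^sub>F t in at 0. f t * t powi (- k) \<noteq> 0"
    using tendsto_imp_eventually_ne[OF c(2,1)] .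
  then show ?thesis by eventually_elim auto
qed

lemma meromorphic_has_order:
  assumes "f meromorphic_on {0}" "\<exists>\<^sub>F t in at 0. f t \<noteq> 0"
  shows "has_order f (zorder f 0)"
proof -
  have "isolated_singularity_at f 0" "not_essential f 0"
    using assms(1) by (auto simp: meromorphic_at_iff)
  from zorder_exist[OF this assms(2)] obtain r where r: "zor_poly f 0 0 \<noteq> 0" "0 < r"
    "zor_poly f 0 holomorphic_on cball 0 r"
    "\<And>w. w \<in> cball 0 r - {0} \<Longrightarrow> f w = zor_poly f 0 w * (w - 0) powi zorder f 0" by blast
  have "isCont (zor_poly f 0) 0"
    using holomorphic_on_imp_continuous_on[OF r(3)] r(2)
    by (auto intro: continuous_on_interior simp: interior_cball)
  then have "(zor_poly f 0 \<longlongrightarrow> zor_poly f 0 0) (at 0)" by (simp add: isCont_def)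
  moreover have "\<forall>\<^sub>F t in at 0. zor_poly f 0 t = f t * t powi (- zorder f 0)"
  proof -
    have "\<forall>\<^sub>F t in at 0. t \<in> cball 0 r - {0}"
      using r(2) eventually_at_ball[of r 0 UNIV] by (auto simp: eventually_at_filter elim: eventually_mono)
    then show ?thesis
    proof eventually_elim
      case (elim t)
      then show ?case using r(4)[of t] by (simp add: power_int_minus)
    qed
  qed
  ultimately have "((\<lambda>t. f t * t powi (- zorder f 0)) \<longlongrightarrow> zor_poly f 0 0) (at 0)"
    by (rule Lim_transform_eventually)
  then show ?thesis using r(1) by (rule has_orderI)
qed

lemma zorder_eq_has_order:
  assumes "f meromorphic_on {0}" "has_order f k"
  shows "zorder f 0 = k"
proof -
  have "\<exists>\<^sub>F t in at 0. f t \<noteq> 0"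
    using has_order_imp_eventually_nonzero[OF assms(2)] by (rule eventually_frequently[rotated]) simp
  from meromorphic_has_order[OF assms(1) this] show ?thesis using assms(2) by (rule has_order_unique)
qed

lemma pole_order_eventually_0:
  assumes "\<forall>\<^sub>F t in at 0. f t = 0"
  shows "pole_order f 0 = 0"
proof -
  have "(f \<longlongrightarrow> 0) (at 0)" using assms by (rule tendsto_eventually)
  then have "\<not> is_pole f 0" using not_tendsto_and_filterlim_at_infinity[of "at (0::complex)" f 0]
    by (auto simp: is_pole_def)
  then show ?thesis by (simp add: pole_order_def)
qed

lemma pole_order_has_order:
  assumes "f meromorphic_on {0}" "has_order f k"
  shows "pole_order f 0 = max 0 (- k)"
proof -
  have z: "zorder f 0 = k" by (rule zorder_eq_has_order[OF assms])
  have i: "isolated_singularity_at f 0" "not_essential f 0"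
    using assms(1) by (auto simp: meromorphic_at_iff)
  have freq: "\<exists>\<^sub>F t in at 0. f t \<noteq> 0"
    using has_order_imp_eventually_nonzero[OF assms(2)] by (rule eventually_frequently[rotated]) simp
  have "is_pole f 0 \<longleftrightarrow> k < 0"
    using isolated_pole_imp_neg_zorder[OF i(1)] neg_zorder_imp_is_pole[OF i _ freq] z by auto
  then show ?thesis by (auto simp: pole_order_def z)
qed

lemma pole_order_cases:
  assumes "f meromorphic_on {0}"
  obtains "\<forall>\<^sub>F t in at 0. f t = 0" "pole_order f 0 = 0"
  | k where "has_order f k" "pole_order f 0 = max 0 (- k)"
proof (cases "\<exists>\<^sub>F t in at 0. f t \<noteq> 0")
  case True
  from meromorphic_has_order[OF assms this] show ?thesis using that(2) pole_order_has_order[OF assms] by blast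
next
  case False
  then have "\<forall>\<^sub>F t in at 0. f t = 0" by (simp add: frequently_def)
  then show ?thesis using that(1) pole_order_eventually_0 by blast
qed

lemma pole_order_nonneg: "f meromorphic_on {0} \<Longrightarrow> pole_order f 0 \<ge> 0"
  by (rule pole_order_cases) auto

text \<open>For \<open>D > 0\<close> a coordinate with a pole of maximal order keeps a nonzero
  limit; for \<open>D = 0\<close> the coordinate 0 does, being identically 1. This is where the
  normalization enters.\<close>

lemma leading_vector:
  fixes f :: "nat \<Rightarrow> complex \<Rightarrow> complex"
  assumes mer: "\<And>i. i < N \<Longrightarrow> f i meromorphic_on {0}" and N: "0 < N"
    and one: "\<forall>\<^sub>F t in at 0. f 0 t = 1"
    and D: "D = (MAX i\<in>{..<N}. pole_order (f i) 0)"
  obtains L where "\<And>i. i < N \<Longrightarrow> ((\<lambda>t. t powi D * f i t) \<longlongrightarrow> L i) (at 0)" "\<exists>i<N. L i \<noteq> 0"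
proof -
  have le: "pole_order (f i) 0 \<le> D" if "i < N" for i unfolding D by (rule Max_ge) (use that in auto)
  have "D \<in> (\<lambda>i. pole_order (f i) 0) ` {..<N}" unfolding D by (rule Max_in) (use N in auto)
  then obtain j where j: "j < N" "pole_order (f j) 0 = D" by auto
  have D0: "D \<ge> 0" using le[OF N] pole_order_nonneg[OF mer[OF N]] by linarith
  have ex: "\<exists>l. ((\<lambda>t. t powi D * f i t) \<longlongrightarrow> l) (at 0) \<and> (0 < D \<longrightarrow> pole_order (f i) 0 = D \<longrightarrow> l \<noteq> 0)"
    if i: "i < N" for i
  proof (rule pole_order_cases[OF mer[OF i]])
    assume 0: "\<forall>\<^sub>F t in at 0. f i t = 0" "pole_order (f i) 0 = 0"
    then have "((\<lambda>t. t powi D * f i t) \<longlongrightarrow> 0) (at 0)"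
      by (intro tendsto_eventually) (auto elim: eventually_mono)
    then show ?thesis using 0 by auto
  next
    fix k assume k: "has_order (f i) k" "pole_order (f i) 0 = max 0 (- k)"
    then obtain c where c: "c \<noteq> 0" "((\<lambda>t. f i t * t powi (- k)) \<longlongrightarrow> c) (at 0)"
      unfolding has_order_def by blast
    have eq: "\<forall>\<^sub>F t in at 0. (f i t * t powi (- k)) * t powi (D + k) = t powi D * f i t"
      unfolding eventually_at_filter by (auto simp: mult.assoc mult.commute simp flip: power_int_add)
    have Dk: "D + k \<ge> 0" using le[OF i] k(2) by auto
    show ?thesis
    proof (cases "D + k = 0")
      case True
      have "((\<lambda>t. t powi D * f i t) \<longlongrightarrow> c) (at 0)"
        using c(2) eq True by (intro Lim_transform_eventually[OF c(2)]) (auto elim: eventually_mono)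
      then show ?thesis using c(1) by blast
    next
      case False
      then have "((\<lambda>t. (f i t * t powi (- k)) * t powi (D + k)) \<longlongrightarrow> c * 0) (at 0)"
        by (intro tendsto_mult c tendsto_powi_pos) (use Dk in auto)
      from Lim_transform_eventually[OF this eq] show ?thesis using False k(2) by auto
    qed
  qed
  then obtain L where L: "\<And>i. i < N \<Longrightarrow> ((\<lambda>t. t powi D * f i t) \<longlongrightarrow> L i) (at 0) \<and>
      (0 < D \<longrightarrow> pole_order (f i) 0 = D \<longrightarrow> L i \<noteq> 0)" by metis
  have "\<exists>i<N. L i \<noteq> 0"
  proof (cases "0 < D")
    case True
    then show ?thesis using L j by blast
  next
    case False
    then have D: "D = 0" using D0 by simp
    have "((\<lambda>t. t powi D * f 0 t) \<longlongrightarrow> 1) (at 0)"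
      using one by (intro tendsto_eventually) (simp add: D)
    then have "L 0 = 1" using L[OF N] by (intro tendsto_unique[of "at (0 :: complex)"]) auto
    then show ?thesis using N by auto
  qed
  then show ?thesis using that L by blast
qed

text \<open>\<open>\<tau>\<close> has a simple zero, so \<open>\<tau> t / t\<close> has a nonzero
  limit and substitution preserves orders.\<close>

lemma pole_order_compose:
  assumes f1: "f1 meromorphic_on {0}" and f2: "f2 meromorphic_on {0}"
    and \<tau>: "\<tau> analytic_on {0}" "\<tau> 0 = 0" "deriv \<tau> 0 \<noteq> 0"
    and eq: "\<forall>\<^sub>F t in at 0. f1 t = f2 (\<tau> t)"
  shows "pole_order f1 0 = pole_order f2 0"
proof -
  have "(\<tau> has_field_derivative deriv \<tau> 0) (at 0)"
    using \<tau>(1) by (simp add: analytic_on_imp_differentiable_at DERIV_deriv_iff_field_differentiable)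
  then have q: "((\<lambda>t. \<tau> t / t) \<longlongrightarrow> deriv \<tau> 0) (at 0)"
    using \<tau>(2) by (auto dest: DERIV_D)
  have ne: "\<forall>\<^sub>F t in at 0. \<tau> t \<noteq> 0"
    using tendsto_imp_eventually_ne[OF q \<tau>(3)] by eventually_elim auto
  have "(\<tau> \<longlongrightarrow> 0) (at 0)"
    using analytic_at_imp_isCont[OF \<tau>(1)] \<tau>(2) by (simp add: isCont_def)
  then have lim: "filterlim \<tau> (at 0) (at 0)" using ne by (simp add: filterlim_at)
  show ?thesis
  proof (rule pole_order_cases[OF f2])
    assume 0: "\<forall>\<^sub>F t in at 0. f2 t = 0" "pole_order f2 0 = 0"
    have "\<forall>\<^sub>F t in at 0. f2 (\<tau> t) = 0" using eventually_compose_filterlim[OF 0(1) lim] .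
    with eq have "\<forall>\<^sub>F t in at 0. f1 t = 0" by eventually_elim simp
    then show ?thesis using 0(2) pole_order_eventually_0 by simp
  next
    fix k assume k: "has_order f2 k" "pole_order f2 0 = max 0 (- k)"
    then obtain c where c: "c \<noteq> 0" "((\<lambda>t. f2 t * t powi (- k)) \<longlongrightarrow> c) (at 0)"
      unfolding has_order_def by blast
    have "((\<lambda>t. f2 (\<tau> t) * (\<tau> t) powi (- k)) \<longlongrightarrow> c) (at 0)"
      using filterlim_compose[OF c(2) lim] .
    then have "((\<lambda>t. (f2 (\<tau> t) * (\<tau> t) powi (- k)) * (\<tau> t / t) powi k) \<longlongrightarrow> c * deriv \<tau> 0 powi k) (at 0)"
      by (intro tendsto_mult tendsto_power_int q \<tau>(3))
    moreover have "\<forall>\<^sub>F t in at 0. (f2 (\<tau> t) * (\<tau> t) powi (- k)) * (\<tau> t / t) powi k = f1 t * t powi (- k)"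
      using eq ne by eventually_elim (simp add: power_int_divide_distrib power_int_minus field_simps)
    ultimately have "((\<lambda>t. f1 t * t powi (- k)) \<longlongrightarrow> c * deriv \<tau> 0 powi k) (at 0)"
      by (rule Lim_transform_eventually)
    then have "has_order f1 k" by (rule has_orderI) (use c(1) \<tau>(3) in auto)
    then show ?thesis using pole_order_has_order[OF f1] k(2) by simp
  qed
qed

section \<open>Local coordinates\<close>

text \<open>The affine coordinate of \<open>q\<close> near \<open>p\<close>: \<open>1 / z\<close>
  near \<open>Infty\<close>, and near a finite point \<open>z\<close> itself, without a shift to
  0.\<close>

definition chart :: "cp1 \<Rightarrow> cp1 \<Rightarrow> complex" where
  "chart p q = (if p = Infty then hom1 q / hom0 q else hom0 q / hom1 q)"

lemma chart_cp1_of: "chart p (cp1_of g h) = (if p = Infty then h / g else g / h)"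
  by (auto simp: chart_def cp1_of_def)

lemma chart_self: "chart p p = (case p of Fin z \<Rightarrow> z | Infty \<Rightarrow> 0)"
  by (cases p) (auto simp: chart_def)

text \<open>The coordinate is the quotient of the lift whose denominator is nonzero at 0. Its
  derivative is, up to sign, the Wronskian over the square of that denominator.\<close>

lemma local_lift_chart:
  assumes "local_lift \<psi> 0 g h"
  shows "(\<lambda>t. chart (\<psi> 0) (\<psi> t)) analytic_on {0}"
    and "\<forall>\<^sub>F t in nhds 0. \<psi> t = (if \<psi> 0 = Infty then cp1_of 1 (chart (\<psi> 0) (\<psi> t)) else Fin (chart (\<psi> 0) (\<psi> t)))"
    and "deriv g 0 * h 0 \<noteq> g 0 * deriv h 0 \<Longrightarrow> deriv (\<lambda>t. chart (\<psi> 0) (\<psi> t)) 0 \<noteq> 0"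
proof -
  have gh: "g analytic_on {0}" "h analytic_on {0}" "(g 0, h 0) \<noteq> (0, 0)"
    and \<psi>: "\<forall>\<^sub>F s in nhds 0. \<psi> s = cp1_of (g s) (h s)" using assms by (auto simp: local_lift_def)
  have \<psi>0: "\<psi> 0 = cp1_of (g 0) (h 0)" using \<psi> by (rule eventually_nhds_x_imp_x)
  let ?c = "if \<psi> 0 = Infty then (\<lambda>t. h t / g t) else (\<lambda>t. g t / h t)"
  have c: "\<forall>\<^sub>F t in nhds 0. chart (\<psi> 0) (\<psi> t) = ?c t"
    using \<psi> by eventually_elim (simp add: chart_cp1_of)
  have inf: "\<psi> 0 = Infty \<longleftrightarrow> h 0 = 0" by (simp add: \<psi>0 cp1_of_def)
  have an: "?c analytic_on {0}" using gh inf by (auto intro!: analytic_on_divide)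
  then show "(\<lambda>t. chart (\<psi> 0) (\<psi> t)) analytic_on {0}"
    using analytic_at_cong[OF c refl] by simp
  have d: "(g has_field_derivative deriv g 0) (at 0)" "(h has_field_derivative deriv h 0) (at 0)"
    using gh by (simp_all add: analytic_on_imp_differentiable_at DERIV_deriv_iff_field_differentiable)
  show "deriv (\<lambda>t. chart (\<psi> 0) (\<psi> t)) 0 \<noteq> 0" if "deriv g 0 * h 0 \<noteq> g 0 * deriv h 0"
  proof (cases "h 0 = 0")
    case True
    then have g0: "g 0 \<noteq> 0" using gh by auto
    have "deriv (\<lambda>t. h t / g t) 0 = (deriv h 0 * g 0 - h 0 * deriv g 0) / (g 0 * g 0)"
      by (rule DERIV_imp_deriv, rule DERIV_divide[OF d(2,1) g0])
    then show ?thesis using deriv_cong_ev[OF c refl] inf True that g0 by (simp add: mult.commute)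
  next
    case False
    have "deriv (\<lambda>t. g t / h t) 0 = (deriv g 0 * h 0 - g 0 * deriv h 0) / (h 0 * h 0)"
      by (rule DERIV_imp_deriv, rule DERIV_divide[OF d False])
    then show ?thesis using deriv_cong_ev[OF c refl] inf False that by simp
  qed
  have "\<forall>\<^sub>F t in nhds 0. (if \<psi> 0 = Infty then g t else h t) \<noteq> 0"
  proof (cases "\<psi> 0 = Infty")
    case True
    then have "g 0 \<noteq> 0" using gh inf by auto
    then show ?thesis using True analytic_at_imp_isCont[OF gh(1)]
      by (auto simp: isCont_def eventually_nhds_conv_at intro: tendsto_imp_eventually_ne)
  next
    case False
    then have "h 0 \<noteq> 0" using inf by auto
    then show ?thesis using False analytic_at_imp_isCont[OF gh(2)]
      by (auto simp: isCont_def eventually_nhds_conv_at intro: tendsto_imp_eventually_ne)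
  qed
  with c \<psi> show "\<forall>\<^sub>F t in nhds 0. \<psi> t = (if \<psi> 0 = Infty then cp1_of 1 (chart (\<psi> 0) (\<psi> t)) else Fin (chart (\<psi> 0) (\<psi> t)))"
    by eventually_elim (auto simp: cp1_of_def split: if_splits)
qed

lemma cp1_holomorphic_chart:
  assumes "cp1_holomorphic_at \<psi> 0"
  shows "(\<lambda>t. chart (\<psi> 0) (\<psi> t)) analytic_on {0}"
    and "\<forall>\<^sub>F t in nhds 0. \<psi> t = (if \<psi> 0 = Infty then cp1_of 1 (chart (\<psi> 0) (\<psi> t)) else Fin (chart (\<psi> 0) (\<psi> t)))"
    and "cp1_immersive_at \<psi> 0 \<Longrightarrow> deriv (\<lambda>t. chart (\<psi> 0) (\<psi> t)) 0 \<noteq> 0"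
  using assms local_lift_chart unfolding cp1_holomorphic_at_def cp1_immersive_at_def by blast+

section \<open>Local parametrizations\<close>

context
  fixes \<Gamma> :: "point set" and p :: point and \<phi> :: "complex \<Rightarrow> point"
  assumes \<phi>: "local_parametrization \<Gamma> p \<phi>"
begin

lemma local_parametrization_0: "\<phi> 0 = p"
  using \<phi> by (simp add: local_parametrization_def)

lemma local_parametrization_in: "t \<in> ball 0 1 \<Longrightarrow> \<phi> t \<in> \<Gamma>"
  using \<phi> unfolding local_parametrization_def openin_open by blast

lemma local_parametrization_inj: "inj_on \<phi> (ball 0 1)"
  using \<phi> unfolding local_parametrization_def homeomorphism_def by (metis inj_on_inverseI)

lemma eventually_ball_0_1: "\<forall>\<^sub>F t in at 0. t \<in> ball (0 :: complex) 1"
  by (rule eventually_at_in_open') auto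

text \<open>The preimage of a finite set under the injective \<open>\<phi>\<close> is finite, so a
  punctured neighbourhood of 0 misses it.\<close>

lemma local_parametrization_avoids:
  assumes "finite S"
  shows "\<forall>\<^sub>F t in at 0. \<phi> t \<in> \<Gamma> - S"
proof -
  have "finite (\<phi> -` S \<inter> ball 0 1)"
    by (rule finite_vimage_IntI[OF assms local_parametrization_inj])
  then have fin: "finite (\<phi> -` S \<inter> ball 0 1 - {0})" by simp
  then have "open (- (\<phi> -` S \<inter> ball 0 1 - {0}))" by (intro open_Compl finite_imp_closed)
  then have "\<forall>\<^sub>F t in at 0. t \<in> - (\<phi> -` S \<inter> ball 0 1 - {0})"
    by (rule eventually_at_in_open') auto
  moreover have "\<forall>\<^sub>F t in at 0. t \<noteq> (0 :: complex)" by (simp add: eventually_at_filter)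
  ultimately show ?thesis using eventually_ball_0_1
    by eventually_elim (use local_parametrization_in in auto)
qed

lemma local_parametrization_holomorphic:
  "cp1_holomorphic_at (fst \<circ> \<phi>) 0" "cp1_holomorphic_at (fst \<circ> snd \<circ> \<phi>) 0" "cp1_holomorphic_at (snd \<circ> snd \<circ> \<phi>) 0"
  using \<phi> unfolding local_parametrization_def by auto

lemma local_parametrization_immersive:
  "cp1_immersive_at (fst \<circ> \<phi>) 0 \<or> cp1_immersive_at (fst \<circ> snd \<circ> \<phi>) 0 \<or> cp1_immersive_at (snd \<circ> snd \<circ> \<phi>) 0"
  using \<phi> unfolding local_parametrization_def by auto

end

text \<open>The homeomorphisms provide a continuous injective \<open>\<tau>\<close>, the inverse of
  \<open>\<phi>2\<close> after \<open>\<phi>1\<close>. It is holomorphic because, in a coordinate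
  where \<open>\<phi>2\<close> is immersive, it is a local inverse of \<open>c2\<close> after
  \<open>c1\<close>. Injective holomorphic maps have nonzero derivative.\<close>

lemma transition:
  assumes \<phi>1: "local_parametrization \<Gamma> p \<phi>1" and \<phi>2: "local_parametrization \<Gamma> p \<phi>2"
  obtains \<tau> where "\<tau> analytic_on {0}" "\<tau> 0 = 0" "deriv \<tau> 0 \<noteq> 0" "\<forall>\<^sub>F t in nhds 0. \<phi>1 t = \<phi>2 (\<tau> t)"
proof -
  let ?B = "ball (0 :: complex) 1"
  obtain \<theta> where \<theta>: "homeomorphism ?B (\<phi>2 ` ?B) \<phi>2 \<theta>"
    using \<phi>2 unfolding local_parametrization_def by blast
  obtain \<theta>1 where \<theta>1: "homeomorphism ?B (\<phi>1 ` ?B) \<phi>1 \<theta>1"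
    using \<phi>1 unfolding local_parametrization_def by blast
  obtain U where U: "open U" "\<phi>2 ` ?B = \<Gamma> \<inter> U"
    using \<phi>2 unfolding local_parametrization_def openin_open by blast
  have cont1: "continuous_on ?B \<phi>1" using \<theta>1 by (simp add: homeomorphism_def)
  have "open (\<phi>1 -` U \<inter> ?B)"
    using continuous_on_open_vimage[of ?B \<phi>1] cont1 U(1) by auto
  then obtain V where V: "V = \<phi>1 -` U \<inter> ?B" "open V" by blast
  have p0: "\<phi>1 0 = p" "\<phi>2 0 = p"
    using local_parametrization_0[OF \<phi>1] local_parametrization_0[OF \<phi>2] .
  have "p \<in> \<phi>2 ` ?B" using p0 by (auto intro!: image_eqI[of _ _ 0])
  then have 0: "0 \<in> V" using p0 U(2) V(1) by auto
  have V\<phi>: "\<phi>1 t \<in> \<phi>2 ` ?B" if "t \<in> V" for t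
    using that V(1) U(2) local_parametrization_in[OF \<phi>1, of t] by auto
  define \<tau> where "\<tau> t = \<theta> (\<phi>1 t)" for t
  have \<tau>: "\<phi>2 (\<tau> t) = \<phi>1 t" "\<tau> t \<in> ?B" if "t \<in> V" for t
    using \<theta> V\<phi>[OF that] unfolding homeomorphism_def \<tau>_def by auto
  have "0 \<in> ?B" by simp
  then have "\<theta> (\<phi>2 0) = 0" using \<theta> unfolding homeomorphism_def by blast
  then have \<tau>0: "\<tau> 0 = 0" by (simp add: \<tau>_def p0)
  have cont: "continuous_on V \<tau>"
    unfolding \<tau>_def
  proof (rule continuous_on_compose2[of "\<phi>2 ` ?B" \<theta>])
    show "continuous_on (\<phi>2 ` ?B) \<theta>" using \<theta> by (simp add: homeomorphism_def)
    show "continuous_on V \<phi>1" by (rule continuous_on_subset[OF cont1]) (use V(1) in auto)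
    show "\<phi>1 ` V \<subseteq> \<phi>2 ` ?B" using V\<phi> by blast
  qed
  have inj: "inj_on \<tau> V"
  proof (rule inj_onI)
    fix s t assume st: "s \<in> V" "t \<in> V" "\<tau> s = \<tau> t"
    then have "\<phi>1 s = \<phi>1 t" using \<tau>(1) by metis
    then show "s = t" using local_parametrization_inj[OF \<phi>1] st V(1) by (auto dest: inj_onD)
  qed
  obtain \<pi> :: "point \<Rightarrow> cp1" where hol: "cp1_holomorphic_at (\<pi> \<circ> \<phi>1) 0" "cp1_holomorphic_at (\<pi> \<circ> \<phi>2) 0"
    and imm: "cp1_immersive_at (\<pi> \<circ> \<phi>2) 0"
    using local_parametrization_holomorphic[OF \<phi>1] local_parametrization_holomorphic[OF \<phi>2]
      local_parametrization_immersive[OF \<phi>2] by blast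
  define c1 where "c1 t = chart (\<pi> p) (\<pi> (\<phi>1 t))" for t
  define c2 where "c2 t = chart (\<pi> p) (\<pi> (\<phi>2 t))" for t
  have an: "c1 analytic_on {0}" "c2 analytic_on {0}" and dc2: "deriv c2 0 \<noteq> 0"
    using cp1_holomorphic_chart(1)[OF hol(1)] cp1_holomorphic_chart(1,3)[OF hol(2)] imm p0
    by (simp_all add: c1_def[abs_def] c2_def[abs_def])
  have c12: "c1 t = c2 (\<tau> t)" if "t \<in> V" for t using \<tau>(1)[OF that] by (simp add: c1_def c2_def)
  obtain e where e: "0 < e" "c2 holomorphic_on ball 0 e" using an(2) by (auto simp: analytic_at_ball)
  have z0: "0 \<in> ball (0 :: complex) e" using e(1) by simp
  obtain r where r: "0 < r" "ball 0 r \<subseteq> ball (0 :: complex) e" "open (c2 ` ball 0 r)" "inj_on c2 (ball 0 r)"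
    by (rule has_complex_derivative_locally_invertible[OF e(2) z0 open_ball dc2]) (rule that)
  have c2r: "c2 holomorphic_on ball 0 r" using e(2) r(2) by (rule holomorphic_on_subset)
  obtain g where g: "g holomorphic_on c2 ` ball 0 r" "\<And>z. z \<in> ball 0 r \<Longrightarrow> g (c2 z) = z"
    by (rule holomorphic_has_inverse[OF c2r open_ball r(4)]) (rule that)
  obtain e1 where e1: "0 < e1" "c1 holomorphic_on ball 0 e1" using an(1) by (auto simp: analytic_at_ball)
  define V' where "V' = (\<tau> -` ball 0 r \<inter> V) \<inter> ball 0 e1"
  have "open (\<tau> -` ball 0 r \<inter> V)"
    using continuous_on_open_vimage[OF V(2), of \<tau>] cont by auto
  then have V': "open V'" by (auto simp: V'_def)
  have zV': "0 \<in> V'" using 0 \<tau>0 r(1) e1(1) by (simp add: V'_def)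
  have "(\<lambda>t. g (c1 t)) holomorphic_on V'"
    by (rule holomorphic_on_compose_gen[OF _ g(1), unfolded o_def])
      (use e1(2) c12 in \<open>auto simp: V'_def intro: holomorphic_on_subset\<close>)
  moreover have "g (c1 t) = \<tau> t" if "t \<in> V'" for t using that c12[of t] g(2)[of "\<tau> t"] by (simp add: V'_def)
  ultimately have hol\<tau>: "\<tau> holomorphic_on V'" by (rule holomorphic_transform)
  show ?thesis
  proof (rule that[of \<tau>])
    show "\<tau> analytic_on {0}" using hol\<tau> V' zV' by (auto simp: analytic_at)
    show "\<tau> 0 = 0" by (rule \<tau>0)
    show "deriv \<tau> 0 \<noteq> 0"
      by (rule holomorphic_injective_imp_regular[OF hol\<tau> V' _ zV'])
        (use inj in \<open>auto simp: V'_def intro: inj_on_subset\<close>)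
    show "\<forall>\<^sub>F t in nhds 0. \<phi>1 t = \<phi>2 (\<tau> t)"
      using eventually_nhds_in_open[OF V(2) 0] by eventually_elim (use \<tau> in auto)
  qed
qed

text \<open>A pole divisor has to match the pole orders in every parametrization at once. This
  independence allows it to be defined by an arbitrary one.\<close>

lemma pole_order_parametrization:
  assumes \<phi>1: "local_parametrization \<Gamma> p \<phi>1" and \<phi>2: "local_parametrization \<Gamma> p \<phi>2"
    and f: "meromorphic_on_curve \<Gamma> f" and p: "p \<in> \<Gamma>"
  shows "pole_order (\<lambda>t. f (\<phi>1 t)) 0 = pole_order (\<lambda>t. f (\<phi>2 t)) 0"
proof -
  obtain \<tau> where \<tau>: "\<tau> analytic_on {0}" "\<tau> 0 = 0" "deriv \<tau> 0 \<noteq> 0" "\<forall>\<^sub>F t in nhds 0. \<phi>1 t = \<phi>2 (\<tau> t)"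
    by (rule transition[OF \<phi>1 \<phi>2])
  have "\<forall>\<^sub>F t in at 0. f (\<phi>1 t) = f (\<phi>2 (\<tau> t))"
    using \<tau>(4) unfolding eventually_at_filter by eventually_elim simp
  moreover have "(\<lambda>t. f (\<phi>1 t)) meromorphic_on {0}" "(\<lambda>t. f (\<phi>2 t)) meromorphic_on {0}"
    using f p \<phi>1 \<phi>2 unfolding meromorphic_on_curve_def o_def by blast+
  ultimately show ?thesis using \<tau> by (intro pole_order_compose[of _ _ \<tau>])
qed

section \<open>The curve in local coordinates\<close>

definition same_jet :: "(complex \<Rightarrow> complex) \<Rightarrow> (complex \<Rightarrow> complex) \<Rightarrow> bool" where
  "same_jet f g \<longleftrightarrow> f 0 = g 0 \<and> (\<exists>d. (f has_field_derivative d) (at 0) \<and> (g has_field_derivative d) (at 0))"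

text \<open>A pair of functions is coded as one function on \<open>bool \<times> complex\<close>.
  Pairs with equal 1-jets then form a function algebra, and \<open>alg_det\<close> compares two
  determinants at once.\<close>

lemma same_jet_algebra: "function_algebra {f :: bool \<times> complex \<Rightarrow> complex. same_jet (\<lambda>t. f (True, t)) (\<lambda>t. f (False, t))}"
proof
  show "(\<lambda>_. c) \<in> {f :: bool \<times> complex \<Rightarrow> complex. same_jet (\<lambda>t. f (True, t)) (\<lambda>t. f (False, t))}" for c
    unfolding same_jet_def by (auto intro!: exI[of _ 0] DERIV_const)
  fix f g assume "f \<in> {f :: bool \<times> complex \<Rightarrow> complex. same_jet (\<lambda>t. f (True, t)) (\<lambda>t. f (False, t))}"
    "g \<in> {f :: bool \<times> complex \<Rightarrow> complex. same_jet (\<lambda>t. f (True, t)) (\<lambda>t. f (False, t))}"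
  then obtain d e where f: "f (True, 0) = f (False, 0)" "((\<lambda>t. f (True, t)) has_field_derivative d) (at 0)"
      "((\<lambda>t. f (False, t)) has_field_derivative d) (at 0)"
    and g: "g (True, 0) = g (False, 0)" "((\<lambda>t. g (True, t)) has_field_derivative e) (at 0)"
      "((\<lambda>t. g (False, t)) has_field_derivative e) (at 0)" unfolding same_jet_def by blast
  show "(\<lambda>b. f b + g b) \<in> {f. same_jet (\<lambda>t. f (True, t)) (\<lambda>t. f (False, t))}"
    unfolding same_jet_def using f g by (auto intro!: exI[of _ "d + e"] DERIV_add)
  have "((\<lambda>t. f (True, t) * g (True, t)) has_field_derivative d * g (True, 0) + e * f (True, 0)) (at 0)"
    "((\<lambda>t. f (False, t) * g (False, t)) has_field_derivative d * g (False, 0) + e * f (False, 0)) (at 0)"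
    by (intro DERIV_mult f g)+
  then show "(\<lambda>b. f b * g b) \<in> {f. same_jet (\<lambda>t. f (True, t)) (\<lambda>t. f (False, t))}"
    unfolding same_jet_def using f(1) g(1) by auto
qed

lemma same_jet_const: "same_jet (\<lambda>_. c) (\<lambda>_. c)"
  unfolding same_jet_def by (auto intro!: exI[of _ 0] DERIV_const)

lemma same_jet_refl: "f analytic_on {0} \<Longrightarrow> same_jet f f"
  unfolding same_jet_def by (auto simp: analytic_on_imp_differentiable_at field_differentiable_def[symmetric])

lemma same_jet_stationary: "f analytic_on {0} \<Longrightarrow> deriv f 0 = 0 \<Longrightarrow> f 0 = c \<Longrightarrow> same_jet f (\<lambda>_. c)"
  unfolding same_jet_def
  by (metis DERIV_const DERIV_deriv_iff_field_differentiable analytic_on_imp_differentiable_at insertI1)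

definition hom_num :: "cp1 \<Rightarrow> complex \<Rightarrow> complex" where
  "hom_num x s = (if x = Infty then 1 else s)"

definition hom_den :: "cp1 \<Rightarrow> complex \<Rightarrow> complex" where
  "hom_den x s = (if x = Infty then s else 1)"

text \<open>The default 0 at \<open>Infty\<close> is the value of the coordinate
  \<open>1 / z\<close> there and agrees with the convention \<open>1 / 0 = 0\<close>. So the
  formulas for \<open>u\<close> and \<open>w\<close> in local coordinates hold at
  \<open>t = 0\<close> as well.\<close>

definition aff :: "cp1 \<Rightarrow> complex" where
  "aff q = (case q of Fin z \<Rightarrow> z | Infty \<Rightarrow> 0)"

lemma aff_Fin [simp]: "aff (Fin z) = z"
  by (simp add: aff_def)

lemma hom_coordinates:
  assumes "q = (if x = Infty then cp1_of 1 s else Fin s)"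
  obtains k where "k \<noteq> 0" "hom_num x s = k * hom0 q" "hom_den x s = k * hom1 q"
  using assms by (cases "x = Infty"; cases "s = 0")
    (fastforce simp: hom_num_def hom_den_def cp1_of_def)+

context block_sizes
begin

lemma pdet_same_jet:
  assumes "same_jet h1 k1" "same_jet h2 k2" "same_jet h3 k3" "same_jet g1 l1" "same_jet g2 l2" "same_jet g3 l3"
  shows "same_jet (\<lambda>t. pdet A (sel m n (h1 t) (h2 t) (h3 t)) (sel m n (g1 t) (g2 t) (g3 t)))
    (\<lambda>t. pdet A (sel m n (k1 t) (k2 t) (k3 t)) (sel m n (l1 t) (l2 t) (l3 t)))"
proof -
  let ?S = "{f :: bool \<times> complex \<Rightarrow> complex. same_jet (\<lambda>t. f (True, t)) (\<lambda>t. f (False, t))}"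
  interpret function_algebra ?S by (rule same_jet_algebra)
  define h where "h b = (if fst b then sel m n (h1 (snd b)) (h2 (snd b)) (h3 (snd b))
    else sel m n (k1 (snd b)) (k2 (snd b)) (k3 (snd b)))" for b :: "bool \<times> complex"
  define g where "g b = (if fst b then sel m n (g1 (snd b)) (g2 (snd b)) (g3 (snd b))
    else sel m n (l1 (snd b)) (l2 (snd b)) (l3 (snd b)))" for b :: "bool \<times> complex"
  have hg: "(\<lambda>b. h b i) \<in> ?S" "(\<lambda>b. g b i) \<in> ?S" for i
    using assms by (cases "i < m"; cases "i < m + n"; simp add: h_def g_def sel_def)+
  have "(\<lambda>b. pdet A (h b) (g b)) \<in> ?S"
    by (rule alg_det[OF pencil_carrier], rule pencil_alg) (rule alg_const hg | assumption)+
  then show ?thesis by (simp add: h_def g_def)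
qed

lemma pdet_differentiable: "(\<lambda>x. pdet A (sel m n h1 h2 h3) (sel m n g1 g2 x)) field_differentiable at z"
  "(\<lambda>x. pdet A (sel m n h1 h2 h3) (sel m n g1 x g3)) field_differentiable at z"
proof -
  have alg: "function_algebra {f. f field_differentiable at z}"
    by standard (auto intro: field_differentiable_add field_differentiable_mult)
  interpret function_algebra "{f. f field_differentiable at z}" by (rule alg)
  have id: "(\<lambda>x. x) \<in> {f. f field_differentiable at z}" by simp
  have "(\<lambda>x. pdet A (sel m n h1 h2 h3) (sel m n g1 g2 x)) \<in> {f. f field_differentiable at z}"
  proof (rule alg_det[OF pencil_carrier], rule pencil_alg)
    show "(\<lambda>x. sel m n g1 g2 x i) \<in> {f. f field_differentiable at z}" for i
      using id alg_const by (cases "i < m"; cases "i < m + n") (simp_all add: sel_def)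
  qed (rule alg_const | assumption)+
  then show "(\<lambda>x. pdet A (sel m n h1 h2 h3) (sel m n g1 g2 x)) field_differentiable at z" by simp
  have "(\<lambda>x. pdet A (sel m n h1 h2 h3) (sel m n g1 x g3)) \<in> {f. f field_differentiable at z}"
  proof (rule alg_det[OF pencil_carrier], rule pencil_alg)
    show "(\<lambda>x. sel m n g1 x g3 i) \<in> {f. f field_differentiable at z}" for i
      using id alg_const by (cases "i < m"; cases "i < m + n") (simp_all add: sel_def)
  qed (rule alg_const | assumption)+
  then show "(\<lambda>x. pdet A (sel m n h1 h2 h3) (sel m n g1 x g3)) field_differentiable at z" by simp
qed

text \<open>If the equation \<open>f = 0\<close> has to first order the form \<open>q (x t) = 0\<close> and \<open>q\<close> has only simple
  roots, then \<open>x\<close> is stationary.\<close>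

lemma stationary_at_simple_root:
  assumes "\<forall>\<^sub>F t in nhds 0. f t = 0" "same_jet f (\<lambda>t. q (x t))" "x analytic_on {0}"
    "q field_differentiable at (x 0)" "\<And>z. q z = 0 \<Longrightarrow> deriv q z \<noteq> 0"
  shows "deriv x 0 = 0"
proof -
  have f0: "f 0 = 0" using assms(1) by (rule eventually_nhds_x_imp_x)
  have "(f has_field_derivative 0) (at 0)"
    using DERIV_cong_ev[OF refl assms(1) refl, of "0 :: complex"] by simp
  then have "((\<lambda>t. q (x t)) has_field_derivative 0) (at 0)"
    using assms(2) unfolding same_jet_def by (metis DERIV_unique)
  moreover have "(x has_field_derivative deriv x 0) (at 0)"
    using assms(3) by (simp add: analytic_on_imp_differentiable_at DERIV_deriv_iff_field_differentiable)
  moreover have "(q has_field_derivative deriv q (x 0)) (at (x 0))"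
    using assms(4) by (simp add: DERIV_deriv_iff_field_differentiable)
  ultimately have "deriv q (x 0) * deriv x 0 = 0" by (metis DERIV_chain2 DERIV_unique)
  moreover have "q (x 0) = 0" using assms(2) f0 by (simp add: same_jet_def)
  ultimately show ?thesis using assms(5) by simp
qed

end

locale curve_point = block_sizes +
  fixes A :: "complex mat" and p :: point and \<phi> :: "complex \<Rightarrow> point" and x y z :: cp1
  assumes A: "A \<in> carrier_mat (m + n + r) (m + n + r)" and good: "good A"
    and p: "p \<in> invariant_curve m n r A" "p = (x, y, z)"
    and \<phi>: "local_parametrization (invariant_curve m n r A) p \<phi>"
begin

definition a :: "complex \<Rightarrow> complex" where "a t = chart x (fst (\<phi> t))"
definition b :: "complex \<Rightarrow> complex" where "b t = chart y (fst (snd (\<phi> t)))"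
definition c :: "complex \<Rightarrow> complex" where "c t = chart z (snd (snd (\<phi> t)))"

lemma analytic: "a analytic_on {0}" "b analytic_on {0}" "c analytic_on {0}"
  using cp1_holomorphic_chart(1)[OF local_parametrization_holomorphic(1)[OF \<phi>]]
    cp1_holomorphic_chart(1)[OF local_parametrization_holomorphic(2)[OF \<phi>]]
    cp1_holomorphic_chart(1)[OF local_parametrization_holomorphic(3)[OF \<phi>]]
    local_parametrization_0[OF \<phi>] p(2)
  by (simp_all add: a_def[abs_def] b_def[abs_def] c_def[abs_def])

lemma value_0: "a 0 = aff x" "b 0 = aff y" "c 0 = aff z"
  using local_parametrization_0[OF \<phi>] p(2) by (simp_all add: a_def b_def c_def chart_self aff_def)

lemma not_stationary: "\<not> (deriv a 0 = 0 \<and> deriv b 0 = 0 \<and> deriv c 0 = 0)"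
  using local_parametrization_immersive[OF \<phi>]
    cp1_holomorphic_chart(3)[OF local_parametrization_holomorphic(1)[OF \<phi>]]
    cp1_holomorphic_chart(3)[OF local_parametrization_holomorphic(2)[OF \<phi>]]
    cp1_holomorphic_chart(3)[OF local_parametrization_holomorphic(3)[OF \<phi>]]
    local_parametrization_0[OF \<phi>] p(2)
  by (auto simp: a_def[abs_def] b_def[abs_def] c_def[abs_def])

lemma near: "\<forall>\<^sub>F t in nhds 0. \<phi> t \<in> curve A \<and>
    fst (\<phi> t) = (if x = Infty then cp1_of 1 (a t) else Fin (a t)) \<and>
    fst (snd (\<phi> t)) = (if y = Infty then cp1_of 1 (b t) else Fin (b t)) \<and>
    snd (snd (\<phi> t)) = (if z = Infty then cp1_of 1 (c t) else Fin (c t))"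
proof -
  have "\<forall>\<^sub>F t in nhds 0. t \<in> ball (0 :: complex) 1" by (rule eventually_nhds_in_open) auto
  then have in_curve: "\<forall>\<^sub>F t in nhds 0. \<phi> t \<in> curve A"
    by eventually_elim (rule local_parametrization_in[OF \<phi>])
  have "\<phi> 0 = (x, y, z)" using local_parametrization_0[OF \<phi>] p(2) by simp
  then show ?thesis
    unfolding a_def b_def c_def
    using in_curve cp1_holomorphic_chart(2)[OF local_parametrization_holomorphic(1)[OF \<phi>]]
      cp1_holomorphic_chart(2)[OF local_parametrization_holomorphic(2)[OF \<phi>]]
      cp1_holomorphic_chart(2)[OF local_parametrization_holomorphic(3)[OF \<phi>]]
    by (intro eventually_conj) (simp_all only: o_def fst_conv snd_conv)
qed

text \<open>The homogeneous coordinates formed from \<open>a\<close>, \<open>b\<close>,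
  \<open>c\<close> differ from \<open>hom0\<close> and \<open>hom1\<close> by nonzero factors, which
  the determinant releases as factors of its rows.\<close>

lemma equations:
  "\<forall>\<^sub>F t in nhds 0. pdet A (sel m n (hom_den x (a t)) (hom_den y (b t)) (hom_den z (c t)))
      (sel m n (hom_num x (a t)) (hom_num y (b t)) (hom_num z (c t))) = 0 \<and>
    hom_num y (b t) * hom_den x (a t) * hom_den z (c t) = hom_den y (b t) * hom_num x (a t) * hom_num z (c t)"
  using near
proof eventually_elim
  case (elim t)
  obtain k1 where k1: "k1 \<noteq> 0" "hom_num x (a t) = k1 * hom0 (fst (\<phi> t))" "hom_den x (a t) = k1 * hom1 (fst (\<phi> t))"
    by (rule hom_coordinates[of "fst (\<phi> t)" x "a t"]) (use elim in auto)
  obtain k2 where k2: "k2 \<noteq> 0" "hom_num y (b t) = k2 * hom0 (fst (snd (\<phi> t)))" "hom_den y (b t) = k2 * hom1 (fst (snd (\<phi> t)))"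
    by (rule hom_coordinates[of "fst (snd (\<phi> t))" y "b t"]) (use elim in auto)
  obtain k3 where k3: "k3 \<noteq> 0" "hom_num z (c t) = k3 * hom0 (snd (snd (\<phi> t)))" "hom_den z (c t) = k3 * hom1 (snd (snd (\<phi> t)))"
    by (rule hom_coordinates[of "snd (snd (\<phi> t))" z "c t"]) (use elim in auto)
  have e: "cdet A (\<phi> t) = 0" "crel (\<phi> t) = 0" using curve_equations[OF A] elim by auto
  have "pdet A (sel m n (hom_den x (a t)) (hom_den y (b t)) (hom_den z (c t)))
      (sel m n (hom_num x (a t)) (hom_num y (b t)) (hom_num z (c t))) =
    pdet A (\<lambda>i. sel m n k1 k2 k3 i * sel m n (hom1 (fst (\<phi> t))) (hom1 (fst (snd (\<phi> t)))) (hom1 (snd (snd (\<phi> t)))) i)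
      (\<lambda>i. sel m n k1 k2 k3 i * sel m n (hom0 (fst (\<phi> t))) (hom0 (fst (snd (\<phi> t)))) (hom0 (snd (snd (\<phi> t)))) i)"
    by (rule det_pencil_cong) (auto simp: sel_def k1 k2 k3)
  also have "\<dots> = 0" unfolding det_pencil_scale using e(1) by (simp add: cdet_def)
  finally show ?case using e(2) by (simp add: k1 k2 k3 crel_def mult.assoc)
qed

lemma det_equation:
  "\<forall>\<^sub>F t in nhds 0. pdet A (sel m n (hom_den x (a t)) (hom_den y (b t)) (hom_den z (c t)))
      (sel m n (hom_num x (a t)) (hom_num y (b t)) (hom_num z (c t))) = 0"
  using equations by eventually_elim blast

definition u :: "complex \<Rightarrow> complex" where "u t = aff (fst (\<phi> t))"
definition w :: "complex \<Rightarrow> complex" where "w t = aff (snd (snd (\<phi> t)))"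

lemma u_eq: "\<forall>\<^sub>F t in nhds 0. u t = (if x = Infty then 1 / a t else a t)"
  using near by eventually_elim (auto simp: u_def cp1_of_def aff_def)

lemma w_eq: "\<forall>\<^sub>F t in nhds 0. w t = (if z = Infty then 1 / c t else c t)"
  using near by eventually_elim (auto simp: w_def cp1_of_def aff_def)

lemma meromorphic_u: "u meromorphic_on {0}"
proof -
  have "(if x = Infty then (\<lambda>t. 1 / a t) else a) meromorphic_on {0}"
    using analytic_on_imp_meromorphic_on[OF analytic(1)] analytic_on_imp_meromorphic_on[OF analytic(3)]
    by (auto intro!: meromorphic_intros)
  moreover have "\<forall>\<^sub>F t in at 0. (if x = Infty then (\<lambda>t. 1 / a t) else a) t = u t"
    using u_eq unfolding eventually_at_filter by eventually_elim auto
  ultimately show ?thesis using meromorphic_on_cong[of "{0}" _ u "{0}"] by blast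
qed

lemma meromorphic_w: "w meromorphic_on {0}"
proof -
  have "(if z = Infty then (\<lambda>t. 1 / c t) else c) meromorphic_on {0}"
    using analytic_on_imp_meromorphic_on[OF analytic(1)] analytic_on_imp_meromorphic_on[OF analytic(3)]
    by (auto intro!: meromorphic_intros)
  moreover have "\<forall>\<^sub>F t in at 0. (if z = Infty then (\<lambda>t. 1 / c t) else c) t = w t"
    using w_eq unfolding eventually_at_filter by eventually_elim auto
  ultimately show ?thesis using meromorphic_on_cong[of "{0}" _ w "{0}"] by blast
qed

lemma analytic_u: "x \<noteq> Infty \<Longrightarrow> u analytic_on {0}"
  using analytic_at_cong[OF u_eq refl] analytic(1) by simp

lemma analytic_w: "z \<noteq> Infty \<Longrightarrow> w analytic_on {0}"
  using analytic_at_cong[OF w_eq refl] analytic(3) by simp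

lemma has_field_derivative_abc:
  "(a has_field_derivative deriv a 0) (at 0)" "(b has_field_derivative deriv b 0) (at 0)"
  "(c has_field_derivative deriv c 0) (at 0)"
  using analytic by (simp_all add: analytic_on_imp_differentiable_at DERIV_deriv_iff_field_differentiable)

lemma deriv_product_cong:
  assumes "\<forall>\<^sub>F t in nhds 0. f t = g t * (h t :: complex)" "(g has_field_derivative g') (at 0)" "(h has_field_derivative h') (at 0)"
  shows "deriv f 0 = g' * h 0 + h' * g 0"
  using deriv_cong_ev[OF assms(1) refl] DERIV_imp_deriv[OF DERIV_mult[OF assms(2,3)]] by simp

text \<open>If \<open>a\<close> is stationary, then so is \<open>b\<close>, by
  \<open>a = b c\<close> with \<open>c 0 \<noteq> 0\<close>. To first order the curve equation is
  then a polynomial equation with simple roots for \<open>c\<close> alone, so \<open>c\<close> is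
  stationary too, against immersivity. The places \<open>D2\<close>, \<open>D6\<close> and
  \<open>D4\<close> follow the same scheme.\<close>

lemma simple_pole_D1:
  assumes "x = Infty" "y = Infty" "z = Fin w0" "w0 \<noteq> 0"
  shows "deriv a 0 \<noteq> 0"
proof
  assume a': "deriv a 0 = 0"
  have "\<forall>\<^sub>F t in nhds 0. a t = b t * c t"
    using equations by eventually_elim (simp add: assms hom_num_def hom_den_def)
  from deriv_product_cong[OF this has_field_derivative_abc(2,3)]
  have b': "deriv b 0 = 0" using a' assms value_0 by (simp add: aff_def)
  have "deriv c 0 = 0"
  proof (rule stationary_at_simple_root[where q = "\<lambda>x. pdet A (sel m n 0 0 1) (sel m n 1 1 x)"])
    show "\<forall>\<^sub>F t in nhds 0. pdet A (sel m n (a t) (b t) 1) (sel m n 1 1 (c t)) = 0"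
      using det_equation by eventually_elim (simp add: assms hom_num_def hom_den_def)
    show "same_jet (\<lambda>t. pdet A (sel m n (a t) (b t) 1) (sel m n 1 1 (c t)))
       (\<lambda>t. pdet A (sel m n 0 0 1) (sel m n 1 1 (c t)))"
      by (intro pdet_same_jet same_jet_const same_jet_refl same_jet_stationary analytic a' b')
        (use value_0 assms in \<open>simp_all add: aff_def\<close>)
  qed (use analytic good pdet_differentiable in \<open>auto simp: good_def\<close>)
  then show False using a' b' not_stationary by simp
qed

lemma simple_pole_D2:
  assumes "x = Infty" "y = Fin v0" "z = Fin 0" "v0 \<noteq> 0"
  shows "deriv a 0 \<noteq> 0"
proof
  assume a': "deriv a 0 = 0"
  have "\<forall>\<^sub>F t in nhds 0. c t = b t * a t"
    using equations by eventually_elim (simp add: assms hom_num_def hom_den_def)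
  from deriv_product_cong[OF this has_field_derivative_abc(2,1)]
  have c': "deriv c 0 = 0" using a' assms value_0 by (simp add: aff_def)
  have "deriv b 0 = 0"
  proof (rule stationary_at_simple_root[where q = "\<lambda>x. pdet A (sel m n 0 1 1) (sel m n 1 x 0)"])
    show "\<forall>\<^sub>F t in nhds 0. pdet A (sel m n (a t) 1 1) (sel m n 1 (b t) (c t)) = 0"
      using det_equation by eventually_elim (simp add: assms hom_num_def hom_den_def)
    show "same_jet (\<lambda>t. pdet A (sel m n (a t) 1 1) (sel m n 1 (b t) (c t)))
       (\<lambda>t. pdet A (sel m n 0 1 1) (sel m n 1 (b t) 0))"
      by (intro pdet_same_jet same_jet_const same_jet_refl same_jet_stationary analytic a' c')
        (use value_0 assms in \<open>simp_all add: aff_def\<close>)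
  qed (use analytic good pdet_differentiable in \<open>auto simp: good_def\<close>)
  then show False using a' c' not_stationary by simp
qed

lemma simple_zero_D6:
  assumes "x = Fin 0" "y = Fin 0" "z = Fin w0"
  shows "deriv a 0 \<noteq> 0"
proof
  assume a': "deriv a 0 = 0"
  have "\<forall>\<^sub>F t in nhds 0. b t = a t * c t"
    using equations by eventually_elim (simp add: assms hom_num_def hom_den_def)
  from deriv_product_cong[OF this has_field_derivative_abc(1,3)]
  have b': "deriv b 0 = 0" using a' assms value_0 by (simp add: aff_def)
  have "deriv c 0 = 0"
  proof (rule stationary_at_simple_root[where q = "\<lambda>x. pdet A (sel m n 1 1 1) (sel m n 0 0 x)"])
    show "\<forall>\<^sub>F t in nhds 0. pdet A (sel m n 1 1 1) (sel m n (a t) (b t) (c t)) = 0"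
      using det_equation by eventually_elim (simp add: assms hom_num_def hom_den_def)
    show "same_jet (\<lambda>t. pdet A (sel m n 1 1 1) (sel m n (a t) (b t) (c t)))
       (\<lambda>t. pdet A (sel m n 1 1 1) (sel m n 0 0 (c t)))"
      by (intro pdet_same_jet same_jet_const same_jet_refl same_jet_stationary analytic a' b')
        (use value_0 assms in \<open>simp_all add: aff_def\<close>)
  qed (use analytic good pdet_differentiable in \<open>auto simp: good_def\<close>)
  then show False using a' b' not_stationary by simp
qed

lemma simple_pole_D4:
  assumes "x = Fin 0" "y = Fin v0" "z = Infty" "v0 \<noteq> 0"
  shows "deriv c 0 \<noteq> 0" "\<forall>\<^sub>F t in nhds 0. a t = b t * c t"
proof -
  show rel: "\<forall>\<^sub>F t in nhds 0. a t = b t * c t"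
    using equations by eventually_elim (simp add: assms hom_num_def hom_den_def)
  show "deriv c 0 \<noteq> 0"
  proof
    assume c': "deriv c 0 = 0"
    from deriv_product_cong[OF rel has_field_derivative_abc(2,3)]
    have a': "deriv a 0 = 0" using c' assms value_0 by (simp add: aff_def)
    have "deriv b 0 = 0"
    proof (rule stationary_at_simple_root[where q = "\<lambda>x. pdet A (sel m n 1 1 0) (sel m n 0 x 1)"])
      show "\<forall>\<^sub>F t in nhds 0. pdet A (sel m n 1 1 (c t)) (sel m n (a t) (b t) 1) = 0"
        using det_equation by eventually_elim (simp add: assms hom_num_def hom_den_def)
      show "same_jet (\<lambda>t. pdet A (sel m n 1 1 (c t)) (sel m n (a t) (b t) 1))
         (\<lambda>t. pdet A (sel m n 1 1 0) (sel m n 0 (b t) 1))"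
        by (intro pdet_same_jet same_jet_const same_jet_refl same_jet_stationary analytic a' c')
          (use value_0 assms in \<open>simp_all add: aff_def\<close>)
    qed (use analytic good pdet_differentiable in \<open>auto simp: good_def\<close>)
    then show False using a' c' not_stationary by simp
  qed
qed

end

section \<open>The divisors\<close>

lemma lookup_sum_of_points:
  "finite S \<Longrightarrow> Poly_Mapping.lookup (sum_of_points S) p = (if p \<in> S then 1 else 0)"
  by (simp add: sum_of_points_def lookup_sum lookup_single when_def)

lemma pole_order_tendsto:
  assumes "(f \<longlongrightarrow> l) (at 0)"
  shows "pole_order f 0 = 0"
proof -
  have "\<not> is_pole f 0" using not_tendsto_and_filterlim_at_infinity[of "at (0::complex)" f l] assms
    by (auto simp: is_pole_def)
  then show ?thesis by (simp add: pole_order_def)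
qed

lemma meromorphic_at_0_cong:
  "f meromorphic_on {0} \<Longrightarrow> \<forall>\<^sub>F t in at 0. f t = g t \<Longrightarrow> g meromorphic_on {0}"
  using meromorphic_on_cong[of "{0}" f g "{0}"] by auto

lemma analytic_algebra: "function_algebra {f :: complex \<Rightarrow> complex. f analytic_on {0}}"
  by standard (auto intro: analytic_on_add analytic_on_mult)

lemma meromorphic_algebra: "function_algebra {f :: complex \<Rightarrow> complex. f meromorphic_on {0}}"
  by standard (auto intro: meromorphic_intros)

context block_sizes
begin

lemma curve_points_cofinite:
  assumes "A \<in> carrier_mat N N" "good A" "finite Z"
  obtains E where "finite E"
    "\<And>p. p \<in> curve A \<Longrightarrow> p \<notin> E \<Longrightarrow> \<exists>u w. p = (Fin u, Fin (u * w), Fin w) \<and> F A u w = 0 \<and> (u, w) \<notin> Z"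
proof (rule that)
  let ?E = "{p \<in> curve A. \<not> (\<exists>u v w. p = (Fin u, Fin v, Fin w))} \<union> (\<lambda>(u, w). (Fin u, Fin (u * w), Fin w)) ` Z"
  show "finite ?E" using finite_infinite_points[OF assms(1,2)] assms(3) by simp
  fix p assume p: "p \<in> curve A" "p \<notin> ?E"
  then obtain u v w where uvw: "p = (Fin u, Fin v, Fin w)" by blast
  then have "v = u * w" "F A u w = 0" using p Fin_in_curve_iff[OF assms(1)] by auto
  moreover have "(u, w) \<notin> Z" using p(2) uvw \<open>v = u * w\<close> by auto
  ultimately show "\<exists>u w. p = (Fin u, Fin (u * w), Fin w) \<and> F A u w = 0 \<and> (u, w) \<notin> Z" using uvw by blast
qed

lemma eigenspace_iff:
  assumes "M \<in> carrier_mat N N" "v \<in> carrier_vec N"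
  shows "M *\<^sub>v v = spectral_diag m n r u (u * w) w *\<^sub>v v \<longleftrightarrow>
    (\<forall>i<N. mat_fun N M (\<lambda>j. v $ j) i = sel m n u (u * w) w i * v $ i)"
proof -
  note S = spectral_diag_carrier[of m n r u "u * w" w]
  have "M *\<^sub>v v = spectral_diag m n r u (u * w) w *\<^sub>v v \<longleftrightarrow>
      (\<forall>i<N. (M *\<^sub>v v) $ i = (spectral_diag m n r u (u * w) w *\<^sub>v v) $ i)"
    using assms S by (auto simp: vec_eq_iff[where 'a = complex] intro!: eq_vecI)
  then show ?thesis
    by (simp add: mult_mat_vec_eq_mat_fun[OF assms] mult_mat_vec_eq_mat_fun[OF S assms(2)]
        mat_fun_spectral_diag)
qed

text \<open>Serves \<open>A\<close>, with the adjugate column as \<open>R\<close>, and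
  \<open>B\<close>, with its image under \<open>T\<close>. The closure of \<open>R\<close> under
  every function algebra stands for polynomiality in \<open>u\<close> and \<open>w\<close>; it is
  used for meromorphic functions at all points and for analytic ones at the finite points outside
  \<open>E\<close>. There \<open>R 0\<close> does not vanish, so poles occur in \<open>E\<close>
  only.\<close>

lemma corresponding_divisor_exists:
  fixes R :: "nat \<Rightarrow> complex \<Rightarrow> complex \<Rightarrow> complex"
  assumes A: "A \<in> carrier_mat N N" "good A" and M: "M \<in> carrier_mat N N" "curve M = curve A"
    and alg: "\<And>S i u w. i < N \<Longrightarrow> function_algebra S \<Longrightarrow> u \<in> S \<Longrightarrow> w \<in> S \<Longrightarrow> (\<lambda>b :: complex. R i (u b) (w b)) \<in> S"
    and Z: "finite Z" "\<And>u w. F A u w = 0 \<Longrightarrow> (u, w) \<notin> Z \<Longrightarrow> R 0 u w \<noteq> 0"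
    and eig: "\<And>u w i. F A u w = 0 \<Longrightarrow> i < N \<Longrightarrow>
      mat_fun N M (\<lambda>j. R j u w) i = sel m n u (u * w) w i * R i u w"
    and unique: "\<And>u w y i. F A u w = 0 \<Longrightarrow> (u, w) \<notin> Z \<Longrightarrow>
      (\<And>i. i < N \<Longrightarrow> mat_fun N M y i = sel m n u (u * w) w i * y i) \<Longrightarrow> y 0 = 0 \<Longrightarrow> i < N \<Longrightarrow> y i = 0"
  shows "\<exists>D. corresponding_divisor m n r M D"
proof -
  have N0: "0 < N" using m by simp
  obtain E where E: "finite E"
    "\<And>p. p \<in> curve A \<Longrightarrow> p \<notin> E \<Longrightarrow> \<exists>u w. p = (Fin u, Fin (u * w), Fin w) \<and> F A u w = 0 \<and> (u, w) \<notin> Z"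
    by (rule curve_points_cofinite[OF A Z(1)]) (rule that)
  define q where "q i p = R i (aff (fst p)) (aff (snd (snd p))) / R 0 (aff (fst p)) (aff (snd (snd p)))"
    for i and p :: point
  \<comment> \<open>On \<open>E\<close> the unit vector is a placeholder, since coordinate 0 has to
    be 1 at every point of the curve.\<close>
  define X where "X p = Matrix.vec N (\<lambda>i. if p \<in> curve A - E then q i p else if i = 0 then 1 else 0)" for p
  have X_in: "X p $ i = q i p" if "p \<in> curve A - E" "i < N" for p i using that by (simp add: X_def)
  have mer: "meromorphic_on_curve (curve A) (\<lambda>p. X p $ i)" if i: "i < N" for i
    unfolding meromorphic_on_curve_def
  proof (intro ballI allI impI)
    fix p \<phi> assume p: "p \<in> curve A" and \<phi>: "local_parametrization (curve A) p \<phi>"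
    obtain x y z where xyz: "p = (x, y, z)" by (cases p) auto
    interpret C: curve_point m n r A p \<phi> x y z
      using A p xyz \<phi> by unfold_locales
    have "(\<lambda>t. R i (C.u t) (C.w t)) meromorphic_on {0}" "(\<lambda>t. R 0 (C.u t) (C.w t)) meromorphic_on {0}"
      using alg[OF i meromorphic_algebra, of C.u C.w] alg[OF N0 meromorphic_algebra, of C.u C.w]
        C.meromorphic_u C.meromorphic_w by auto
    then have "(\<lambda>t. R i (C.u t) (C.w t) / R 0 (C.u t) (C.w t)) meromorphic_on {0}"
      by (rule meromorphic_on_divide)
    moreover have "\<forall>\<^sub>F t in at 0. R i (C.u t) (C.w t) / R 0 (C.u t) (C.w t) = ((\<lambda>p. X p $ i) \<circ> \<phi>) t"
      using local_parametrization_avoids[OF \<phi> E(1)]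
      by eventually_elim (use X_in i in \<open>auto simp: q_def C.u_def C.w_def\<close>)
    ultimately show "((\<lambda>p. X p $ i) \<circ> \<phi>) meromorphic_on {0}"
      by (rule meromorphic_at_0_cong)
  qed
  have X0: "X p $ 0 = 1" for p
    using E(2)[of p] Z(2) N0 by (cases "p \<in> curve A - E") (auto simp: X_def q_def)
  have eigX: "mat_fun N M (\<lambda>j. X p $ j) i = sel m n u (u * w) w i * X p $ i"
    if "p \<in> curve A - E" "p = (Fin u, Fin (u * w), Fin w)" "F A u w = 0" "i < N" for p u w i
  proof -
    have "mat_fun N M (\<lambda>j. X p $ j) i = mat_fun N M (\<lambda>j. (1 / R 0 u w) * R j u w) i"
      by (rule mat_fun_cong) (use that X_in in \<open>auto simp: q_def\<close>)
    also have "\<dots> = sel m n u (u * w) w i * X p $ i"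
      unfolding mat_fun_scale eig[OF that(3,4)] X_in[OF that(1,4)] by (simp add: that(2) q_def)
    finally show ?thesis .
  qed
  have "normalized_eigenvector m n r M X"
    unfolding normalized_eigenvector_def Let_def M(2)
  proof (intro conjI ballI allI impI)
    show "X p \<in> carrier_vec N" for p by (simp add: X_def)
    show "X p $ 0 = 1" for p by (rule X0)
    show "meromorphic_on_curve (curve A) (\<lambda>p. X p $ i)" if "i < N" for i by (rule mer[OF that])
    have "\<exists>u v w. p = (Fin u, Fin v, Fin w) \<and>
        {x \<in> carrier_vec N. M *\<^sub>v x = spectral_diag m n r u v w *\<^sub>v x} = {c \<cdot>\<^sub>v X p | c. True}"
      if p: "p \<in> curve A - E" for p
    proof -
      obtain u w where uw: "p = (Fin u, Fin (u * w), Fin w)" "F A u w = 0" "(u, w) \<notin> Z"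
        using E(2) p by blast
      have "{x \<in> carrier_vec N. M *\<^sub>v x = spectral_diag m n r u (u * w) w *\<^sub>v x} = {c \<cdot>\<^sub>v X p | c. True}"
      proof safe
        fix v :: "complex Matrix.vec" assume v: "v \<in> carrier_vec N" "M *\<^sub>v v = spectral_diag m n r u (u * w) w *\<^sub>v v"
        then have ev: "mat_fun N M (\<lambda>j. v $ j) i = sel m n u (u * w) w i * v $ i" if "i < N" for i
          using eigenspace_iff[OF M(1) v(1)] that by blast
        define y where "y = (\<lambda>j. v $ j - v $ 0 * X p $ j)"
        have "mat_fun N M y i = sel m n u (u * w) w i * y i" if "i < N" for i
          unfolding y_def mat_fun_diff mat_fun_scale ev[OF that] eigX[OF p uw(1,2) that] by (simp add: algebra_simps)
        then have "y i = 0" if "i < N" for i by (rule unique[OF uw(2,3) _ _ that]) (simp_all add: y_def X0)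
        then have "v = v $ 0 \<cdot>\<^sub>v X p" using v(1) by (intro eq_vecI) (auto simp: y_def X_def)
        then show "\<exists>c. v = c \<cdot>\<^sub>v X p \<and> True" by blast
      next
        fix c
        show c: "c \<cdot>\<^sub>v X p \<in> carrier_vec N" by (simp add: X_def)
        have "mat_fun N M (\<lambda>j. (c \<cdot>\<^sub>v X p) $ j) i = sel m n u (u * w) w i * (c \<cdot>\<^sub>v X p) $ i" if "i < N" for i
        proof -
          have "mat_fun N M (\<lambda>j. (c \<cdot>\<^sub>v X p) $ j) i = mat_fun N M (\<lambda>j. c * X p $ j) i"
            by (rule mat_fun_cong) (simp add: X_def)
          then show ?thesis using eigX[OF p uw(1,2) that] that by (simp add: mat_fun_scale X_def)
        qed
        then show "M *\<^sub>v (c \<cdot>\<^sub>v X p) = spectral_diag m n r u (u * w) w *\<^sub>v (c \<cdot>\<^sub>v X p)"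
          using eigenspace_iff[OF M(1) c] by blast
      qed
      then show ?thesis using uw(1) by blast
    qed
    then have "{p \<in> curve A. \<not> (\<exists>u v w. p = (Fin u, Fin v, Fin w) \<and>
        {x \<in> carrier_vec N. M *\<^sub>v x = spectral_diag m n r u v w *\<^sub>v x} = {c \<cdot>\<^sub>v X p | c. True})} \<subseteq> E" by blast
    then show "finite {p \<in> curve A. \<not> (\<exists>u v w. p = (Fin u, Fin v, Fin w) \<and>
        {x \<in> carrier_vec N. M *\<^sub>v x = spectral_diag m n r u v w *\<^sub>v x} = {c \<cdot>\<^sub>v X p | c. True})}"
      using E(1) by (rule finite_subset)
  qed
  \<comment> \<open>Any chosen parametrization gives the same pole orders. Points without one get
    the value 0.\<close>
  moreover define d where "d p = (if p \<in> curve A \<inter> E \<and> (\<exists>\<phi>. local_parametrization (curve A) p \<phi>)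
    then MAX i\<in>{..<N}. pole_order (\<lambda>t. X ((SOME \<phi>. local_parametrization (curve A) p \<phi>) t) $ i) 0 else 0)" for p
  have "finite {p. d p \<noteq> 0}" using E(1) by (rule finite_subset[rotated]) (auto simp: d_def)
  then have lookup: "Poly_Mapping.lookup (Abs_poly_mapping d) = d" by simp
  have "is_pole_divisor (curve A) N X (Abs_poly_mapping d)"
    unfolding is_pole_divisor_def
  proof (intro conjI ballI allI impI)
    show "Poly_Mapping.keys (Abs_poly_mapping d) \<subseteq> curve A"
      by (auto simp: in_keys_iff lookup d_def split: if_splits)
    fix p \<phi> assume p: "p \<in> curve A" and \<phi>: "local_parametrization (curve A) p \<phi>"
    show "Poly_Mapping.lookup (Abs_poly_mapping d) p = (MAX i\<in>{..<N}. pole_order (\<lambda>t. X (\<phi> t) $ i) 0)"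
    proof (cases "p \<in> E")
      case True
      have some: "local_parametrization (curve A) p (SOME \<phi>. local_parametrization (curve A) p \<phi>)"
        using someI[of "local_parametrization (curve A) p" \<phi>] \<phi> by simp
      have "(\<lambda>i. pole_order (\<lambda>t. X ((SOME \<phi>. local_parametrization (curve A) p \<phi>) t) $ i) 0) ` {..<N} =
          (\<lambda>i. pole_order (\<lambda>t. X (\<phi> t) $ i) 0) ` {..<N}"
        by (rule image_cong[OF refl]) (rule pole_order_parametrization[OF some \<phi> mer p], simp)
      then show ?thesis unfolding lookup using True p \<phi> by (auto simp: d_def)
    next
      case False
      then obtain u0 w0 where uw: "p = (Fin u0, Fin (u0 * w0), Fin w0)" "F A u0 w0 = 0" "(u0, w0) \<notin> Z"
        using E(2) p by blast
      interpret C: curve_point m n r A p \<phi> "Fin u0" "Fin (u0 * w0)" "Fin w0"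
        using A p uw(1) \<phi> by unfold_locales
      have an: "C.u analytic_on {0}" "C.w analytic_on {0}" using C.analytic_u C.analytic_w by auto
      have uw0: "C.u 0 = u0" "C.w 0 = w0"
        using local_parametrization_0[OF \<phi>] uw(1) by (simp_all add: C.u_def C.w_def)
      have "pole_order (\<lambda>t. X (\<phi> t) $ i) 0 = 0" if i: "i < N" for i
      proof -
        have "(\<lambda>t. R i (C.u t) (C.w t)) analytic_on {0}" "(\<lambda>t. R 0 (C.u t) (C.w t)) analytic_on {0}"
          using alg[OF i analytic_algebra, of C.u C.w] alg[OF N0 analytic_algebra, of C.u C.w] an by auto
        then have "(\<lambda>t. R i (C.u t) (C.w t) / R 0 (C.u t) (C.w t)) analytic_on {0}"
          by (rule analytic_on_divide) (use Z(2)[OF uw(2,3)] uw0 in auto)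
        from analytic_at_imp_isCont[OF this] obtain l where
          "((\<lambda>t. R i (C.u t) (C.w t) / R 0 (C.u t) (C.w t)) \<longlongrightarrow> l) (at 0)" unfolding isCont_def by blast
        moreover have "\<forall>\<^sub>F t in at 0. R i (C.u t) (C.w t) / R 0 (C.u t) (C.w t) = X (\<phi> t) $ i"
          using local_parametrization_avoids[OF \<phi> E(1)]
          by eventually_elim (use X_in i in \<open>auto simp: q_def C.u_def C.w_def\<close>)
        ultimately have "((\<lambda>t. X (\<phi> t) $ i) \<longlongrightarrow> l) (at 0)" by (rule Lim_transform_eventually)
        then show ?thesis by (rule pole_order_tendsto)
      qed
      then have "(\<lambda>i. pole_order (\<lambda>t. X (\<phi> t) $ i) 0) ` {..<N} = {0}" using N0 by auto
      then show ?thesis unfolding lookup using False by (simp add: d_def)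
    qed
  qed
  ultimately show ?thesis unfolding corresponding_divisor_def M(2) by blast
qed

lemma corresponding_divisor_A:
  assumes A: "A \<in> carrier_mat N N" "good A"
  shows "\<exists>D. corresponding_divisor m n r A D"
proof (rule corresponding_divisor_exists[OF A A(1) refl, where R = "\<lambda>i u w. col A u w i"])
  show "finite {(u, w). F A u w = 0 \<and> col A u w 0 = 0}" by (rule finite_col_0[OF A(2)])
  show "(\<lambda>b. col A (u b) (w b) i) \<in> S" if "i < N" "function_algebra S" "u \<in> S" "w \<in> S"
    for S i and u w :: "complex \<Rightarrow> complex"
    using col_alg[OF that(2) _ that(3,4,1), of "\<lambda>_. A"] function_algebra.alg_const[OF that(2)] by simp
  show "mat_fun N A (\<lambda>j. col A u w j) i = sel m n u (u * w) w i * col A u w i"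
    if "F A u w = 0" "i < N" for u w i
    using col_eigenvector[OF that] .
  show "y i = 0" if "F A u w = 0" "(u, w) \<notin> {(u, w). F A u w = 0 \<and> col A u w 0 = 0}"
    "\<And>i. i < N \<Longrightarrow> mat_fun N A y i = sel m n u (u * w) w i * y i" "y 0 = 0" "i < N" for u w y i
    by (rule eigenvector_unique[of A u w y]) (use that in auto)
qed auto

end

context refactorization
begin

lemma T_eq: "T w x i = (if m + n \<le> i then mat_fun N A3 x i else mat_fun N A1' (\<lambda>j. (if j < m then 1 else w) * x j) i)"
  by (simp add: T_def transfer_def)

lemma curve_B: "curve B = curve A"
  unfolding invariant_curve_eq[OF carriers(5)] invariant_curve_eq[OF carriers(6)] F_B_eq_0_iff ..

text \<open>The exceptional set contains the zeros of coordinate 0 for \<open>A\<close> as well,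
  since uniqueness of the eigenvectors of \<open>B\<close> is inherited from
  \<open>A\<close>.\<close>

lemma corresponding_divisor_B: "\<exists>D. corresponding_divisor m n r B D"
proof (rule corresponding_divisor_exists[OF carriers(5) good carriers(6) curve_B,
      where R = "\<lambda>i u w. T w (col A u w) i" and
        Z = "{(u, w). F A u w = 0 \<and> col A u w 0 = 0} \<union> {(u, w). F A u w = 0 \<and> T w (col A u w) 0 = 0}"])
  show "finite ({(u, w). F A u w = 0 \<and> col A u w 0 = 0} \<union> {(u, w). F A u w = 0 \<and> T w (col A u w) 0 = 0})"
    using finite_col_0[OF good] finite_T_col_0 by simp
  show "(\<lambda>b. T (w b) (col A (u b) (w b)) i) \<in> S" if "i < N" "function_algebra S" "u \<in> S" "w \<in> S"
    for S i and u w :: "complex \<Rightarrow> complex"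
  proof -
    interpret S: function_algebra S by fact
    have c: "(\<lambda>b. col A (u b) (w b) k) \<in> S" if "k < N" for k
      using col_alg[OF S.function_algebra_axioms S.alg_const \<open>u \<in> S\<close> \<open>w \<in> S\<close> that] .
    have 1: "(\<lambda>b. mat_fun N A3 (col A (u b) (w b)) i) \<in> S"
      unfolding mat_fun_def by (intro S.G.sum S.alg_mult S.alg_const c) simp
    have 2: "(\<lambda>b. if j < m then 1 else w b) \<in> S" for j using S.alg_const \<open>w \<in> S\<close> by (cases "j < m") auto
    have "(\<lambda>b. mat_fun N A1' (\<lambda>j. (if j < m then 1 else w b) * col A (u b) (w b) j) i) \<in> S"
      unfolding mat_fun_def by (intro S.G.sum S.alg_mult S.alg_const c 2) simp
    with 1 show ?thesis unfolding T_eq by (cases "m + n \<le> i") auto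
  qed
  show "mat_fun N B (\<lambda>j. T w (col A u w) j) i = sel m n u (u * w) w i * T w (col A u w) i"
    if "F A u w = 0" "i < N" for u w i
    by (rule T_eigenvector(1)[OF col_eigenvector[OF that(1)] that(2)])
  show "y i = 0" if "F A u w = 0"
    "(u, w) \<notin> {(u, w). F A u w = 0 \<and> col A u w 0 = 0} \<union> {(u, w). F A u w = 0 \<and> T w (col A u w) 0 = 0}"
    "\<And>i. i < N \<Longrightarrow> mat_fun N B y i = sel m n u (u * w) w i * y i" "y 0 = 0" "i < N" for u w y i
    by (rule eigenvector_B_unique[of u w y]) (use that in auto)
qed auto

end

section \<open>The orders of the transferred eigenvector\<close>

lemma mat_fun_tendsto:
  assumes "\<And>j. j < N \<Longrightarrow> ((\<lambda>t. x t j) \<longlongrightarrow> y j) G"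
  shows "((\<lambda>t. mat_fun N M (x t) i) \<longlongrightarrow> mat_fun N M y i) G"
  unfolding mat_fun_def by (intro tendsto_sum tendsto_mult tendsto_const assms) simp

lemma has_order_mult:
  assumes "has_order f k" "has_order g l"
  shows "has_order (\<lambda>t. f t * g t) (k + l)"
proof -
  obtain c d where c: "c \<noteq> 0" "((\<lambda>t. f t * t powi (- k)) \<longlongrightarrow> c) (at 0)"
    and d: "d \<noteq> 0" "((\<lambda>t. g t * t powi (- l)) \<longlongrightarrow> d) (at 0)" using assms unfolding has_order_def by blast
  have "\<forall>\<^sub>F t in at 0. (f t * t powi (- k)) * (g t * t powi (- l)) = (f t * g t) * t powi (- (k + l))"
    unfolding eventually_at_filter by (auto simp: mult_ac simp flip: power_int_add)
  with tendsto_mult[OF c(2) d(2)] have "((\<lambda>t. (f t * g t) * t powi (- (k + l))) \<longlongrightarrow> c * d) (at 0)"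
    by (rule Lim_transform_eventually)
  then show ?thesis by (rule has_orderI) (use c d in auto)
qed

lemma has_order_cong:
  assumes "\<forall>\<^sub>F t in at 0. f t = g t" "has_order f k"
  shows "has_order g k"
proof -
  obtain c where c: "c \<noteq> 0" "((\<lambda>t. f t * t powi (- k)) \<longlongrightarrow> c) (at 0)" using assms unfolding has_order_def by blast
  have "\<forall>\<^sub>F t in at 0. f t * t powi (- k) = g t * t powi (- k)" using assms(1) by eventually_elim simp
  from Lim_transform_eventually[OF c(2) this] c(1) show ?thesis by (rule has_orderI)
qed

lemma has_order_0: "(f \<longlongrightarrow> c) (at 0) \<Longrightarrow> c \<noteq> 0 \<Longrightarrow> has_order f 0"
  by (rule has_orderI[of _ _ c]) auto

lemma difference_quotient:
  assumes "f analytic_on {0}" "f 0 = (0 :: complex)"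
  shows "((\<lambda>t. f t / t) \<longlongrightarrow> deriv f 0) (at 0)"
proof -
  have "(f has_field_derivative deriv f 0) (at 0)"
    using assms(1) by (simp add: analytic_on_imp_differentiable_at DERIV_deriv_iff_field_differentiable)
  then show ?thesis using assms(2) by (auto dest: DERIV_D)
qed

lemma analytic_tendsto: "f analytic_on {0} \<Longrightarrow> (f \<longlongrightarrow> f (0 :: complex)) (at 0)"
  using analytic_at_imp_isCont[of f 0] by (simp add: isCont_def)

context refactorization
begin

lemma T_scale: "T w (\<lambda>j. s * x j) i = s * T w x i"
  unfolding T_eq by (simp add: mat_fun_scale mult.left_commute[of _ s])

lemma T_tendsto:
  assumes "\<And>j. j < N \<Longrightarrow> ((\<lambda>t. x t j) \<longlongrightarrow> y j) G" "(w \<longlongrightarrow> w0) G"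
  shows "((\<lambda>t. T (w t) (x t) i) \<longlongrightarrow> T w0 y i) G"
proof (cases "m + n \<le> i")
  case True
  then show ?thesis unfolding T_eq using mat_fun_tendsto[OF assms(1)] by simp
next
  case False
  have "((\<lambda>t. (if j < m then 1 else w t) * x t j) \<longlongrightarrow> (if j < m then 1 else w0) * y j) G" if "j < N" for j
    using assms(1)[OF that] assms(2) by (cases "j < m") (auto intro!: tendsto_mult)
  from mat_fun_tendsto[where M = A1' and i = i, OF this] show ?thesis unfolding T_eq using False by simp
qed

lemma A1'_kernel:
  assumes "\<And>i. i < m + n \<Longrightarrow> mat_fun N A1' y i = 0" "j < m + n"
  shows "y j = 0"
proof -
  have j: "j < N" using assms(2) by simp
  have "y j = mat_fun N A1 (mat_fun N A1' y) j" using A1_A1'[OF j] by simp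
  also have "\<dots> = mat_fun N A1 (\<lambda>_. 0) j"
    by (rule acts_on_cong[OF A1 j assms(2)]) (use assms(1) in auto)
  finally show ?thesis by (simp add: mat_fun_zero)
qed

lemma lookup_divisors:
  "Poly_Mapping.lookup (divisor1 (curve A)) (x, y, z) =
    (if (x, y, z) \<in> curve A \<and> x = Infty \<and> y = Infty \<and> z \<noteq> Fin 0 \<and> z \<noteq> Infty then 1 else 0)"
  "Poly_Mapping.lookup (divisor6 (curve A)) (x, y, z) =
    (if (x, y, z) \<in> curve A \<and> x = Fin 0 \<and> y = Fin 0 \<and> z \<noteq> Fin 0 \<and> z \<noteq> Infty then 1 else 0)"
proof -
  have 1: "finite {(u, v, w) \<in> curve A. u = Infty \<and> v = Infty \<and> w \<noteq> Fin 0 \<and> w \<noteq> Infty}"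
    by (rule finite_subset[OF _ finite_infinite_points[OF carriers(5) good]]) auto
  have "{(u, v, w) \<in> curve A. u = Fin 0 \<and> v = Fin 0 \<and> w \<noteq> Fin 0 \<and> w \<noteq> Infty} \<subseteq>
      (\<lambda>w. (Fin 0, Fin 0, Fin w)) ` {w. F A 0 w = 0}"
  proof safe
    fix w assume "(Fin 0, Fin 0, w) \<in> curve A" "w \<noteq> Infty"
    then show "(Fin 0, Fin 0, w) \<in> (\<lambda>w. (Fin 0, Fin 0, Fin w)) ` {w. F A 0 w = 0}"
      using Fin_in_curve_iff[OF carriers(5), of 0 0] by (cases w) auto
  qed
  then have 6: "finite {(u, v, w) \<in> curve A. u = Fin 0 \<and> v = Fin 0 \<and> w \<noteq> Fin 0 \<and> w \<noteq> Infty}"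
    by (rule finite_subset) (use finite_D6[OF carriers(5) good] in simp)
  show "Poly_Mapping.lookup (divisor1 (curve A)) (x, y, z) =
    (if (x, y, z) \<in> curve A \<and> x = Infty \<and> y = Infty \<and> z \<noteq> Fin 0 \<and> z \<noteq> Infty then 1 else 0)"
    "Poly_Mapping.lookup (divisor6 (curve A)) (x, y, z) =
    (if (x, y, z) \<in> curve A \<and> x = Fin 0 \<and> y = Fin 0 \<and> z \<noteq> Fin 0 \<and> z \<noteq> Infty then 1 else 0)"
    unfolding divisor1_def divisor6_def lookup_sum_of_points[OF 1] lookup_sum_of_points[OF 6] by auto
qed

text \<open>The order \<open>k\<close> of \<open>T \<xi>\<close> is 1 on \<open>D2\<close>, -1 on \<open>D4\<close>, and 0 elsewhere.\<close>

lemma local_order: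
  assumes p: "p \<in> curve A" and \<phi>: "local_parametrization (curve A) p \<phi>"
    and u: "u = (\<lambda>t. aff (fst (\<phi> t)))" and w: "w = (\<lambda>t. aff (snd (snd (\<phi> t))))"
    and lim: "\<And>i. i < N \<Longrightarrow> ((\<lambda>t. \<xi> t i) \<longlongrightarrow> L i) (at 0)" and L: "\<exists>i<N. L i \<noteq> 0"
    and eig: "\<forall>\<^sub>F t in at 0. \<forall>i<N. mat_fun N A (\<xi> t) i = sel m n (u t) (u t * w t) (w t) i * \<xi> t i"
  shows "\<exists>k s M. has_order u s \<and> (\<forall>i<N. ((\<lambda>t. t powi (- k) * T (w t) (\<xi> t) i) \<longlongrightarrow> M i) (at 0)) \<and>
    (\<exists>i<N. M i \<noteq> 0) \<and>
    s + k = Poly_Mapping.lookup (divisor6 (curve A)) p - Poly_Mapping.lookup (divisor1 (curve A)) p"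
proof -
  have fin: "\<forall>\<^sub>F t in at 0. \<exists>u v w. \<phi> t = (Fin u, Fin v, Fin w)"
    using local_parametrization_avoids[OF \<phi> finite_infinite_points[OF carriers(5) good]]
    by eventually_elim blast
  have limA: "((\<lambda>t. mat_fun N A (\<xi> t) i) \<longlongrightarrow> mat_fun N A L i) (at 0)" for i
    by (rule mat_fun_tendsto[OF lim])
  have limA3: "((\<lambda>t. mat_fun N A3 (\<xi> t) i) \<longlongrightarrow> mat_fun N A3 L i) (at 0)" for i
    by (rule mat_fun_tendsto[OF lim])
  note uniq = tendsto_unique[OF trivial_limit_at[of "0 :: complex"]]
  from carriers(5) good p show ?thesis
  proof (cases rule: curve_cases)
    case (finite u0 w0)
    interpret C: curve_point m n r A p \<phi> "Fin u0" "Fin (u0 * w0)" "Fin w0"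
      using carriers(5) good p \<phi> finite by unfold_locales auto
    have an: "u analytic_on {0}" "w analytic_on {0}"
      using C.analytic_u C.analytic_w by (simp_all add: u w C.u_def[abs_def] C.w_def[abs_def])
    have 0: "u 0 = u0" "w 0 = w0" using local_parametrization_0[OF \<phi>] finite by (simp_all add: u w)
    have ulim: "(u \<longlongrightarrow> u0) (at 0)" and wlim: "(w \<longlongrightarrow> w0) (at 0)"
      using analytic_tendsto[OF an(1)] analytic_tendsto[OF an(2)] 0 by auto
    have eigL: "mat_fun N A L i = sel m n u0 (u0 * w0) w0 i * L i" if i: "i < N" for i
    proof (rule uniq[OF limA])
      have "((\<lambda>t. sel m n (u t) (u t * w t) (w t) i * \<xi> t i) \<longlongrightarrow> sel m n u0 (u0 * w0) w0 i * L i) (at 0)"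
        using ulim wlim lim[OF i] unfolding sel_def
        by (cases "i < m"; cases "i < m + n") (auto intro!: tendsto_mult)
      moreover have "\<forall>\<^sub>F t in at 0. sel m n (u t) (u t * w t) (w t) i * \<xi> t i = mat_fun N A (\<xi> t) i"
        using eig by eventually_elim (use i in auto)
      ultimately show "((\<lambda>t. mat_fun N A (\<xi> t) i) \<longlongrightarrow> sel m n u0 (u0 * w0) w0 i * L i) (at 0)"
        by (rule Lim_transform_eventually)
    qed
    \<comment> \<open>At a finite point \<open>L\<close> is itself an eigenvector of
      \<open>A\<close>, and \<open>T\<close> is injective on those.\<close>
    have ne: "\<exists>i<N. T w0 L i \<noteq> 0" using T_eigenvector(4)[OF eigL] L by blast
    have limT: "((\<lambda>t. t powi (- 0) * T (w t) (\<xi> t) i) \<longlongrightarrow> T w0 L i) (at 0)" for i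
      using T_tendsto[OF lim wlim] by simp
    show ?thesis
    proof (cases "u0 = 0")
      case True
      \<comment> \<open>The point with \<open>u = v = w = 0\<close> is excluded by the invertibility
        of \<open>A\<close>, so \<open>u = 0\<close> means a point of \<open>D6\<close>.\<close>
      have "w0 \<noteq> 0"
      proof
        assume "w0 = 0"
        then have "pdet A (\<lambda>_. 1) (sel m n 0 0 0) = 0" using finite(2) True by (simp add: F_def spec_def)
        moreover have "pdet A (\<lambda>_. 1) (sel m n 0 0 0) = pdet A (\<lambda>_. 1) (\<lambda>_. 0)"
          by (rule det_pencil_cong) (auto simp: sel_def)
        ultimately show False using good by (simp add: good_def)
      qed
      have "deriv C.a 0 \<noteq> 0" using True by (intro C.simple_zero_D6[of w0]) auto
      moreover have "((\<lambda>t. C.a t / t) \<longlongrightarrow> deriv C.a 0) (at 0)"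
        by (rule difference_quotient[OF C.analytic(1)]) (use C.value_0 True in auto)
      ultimately have "has_order C.a 1" by (intro has_orderI[of _ _ "deriv C.a 0"]) (auto simp: power_int_minus divide_inverse)
      moreover have "\<forall>\<^sub>F t in at 0. C.a t = u t"
        using C.u_eq unfolding eventually_at_filter u by eventually_elim (auto simp: C.u_def)
      ultimately have "has_order u 1" by (rule has_order_cong[rotated])
      moreover have "1 + 0 = Poly_Mapping.lookup (divisor6 (curve A)) p - Poly_Mapping.lookup (divisor1 (curve A)) p"
        using p \<open>w0 \<noteq> 0\<close> True unfolding finite(1) lookup_divisors by simp
      ultimately show ?thesis using limT ne by blast
    next
      case False
      have "has_order u 0" using has_order_0[OF ulim False] .
      moreover have "0 + 0 = Poly_Mapping.lookup (divisor6 (curve A)) p - Poly_Mapping.lookup (divisor1 (curve A)) p"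
        using False unfolding finite(1) lookup_divisors by simp
      ultimately show ?thesis using limT ne by blast
    qed
  next
    case (D1 w0)
    interpret C: curve_point m n r A p \<phi> Infty Infty "Fin w0"
      using carriers(5) good p \<phi> D1 by unfold_locales auto
    have an: "w analytic_on {0}" using C.analytic_w by (simp add: w C.w_def[abs_def])
    have wlim: "(w \<longlongrightarrow> w0) (at 0)"
      using analytic_tendsto[OF an] local_parametrization_0[OF \<phi>] D1(1) by (simp add: w)
    have ua: "\<forall>\<^sub>F t in at 0. u t = 1 / C.a t"
      using C.u_eq unfolding eventually_at_filter u by eventually_elim (auto simp: C.u_def)
    have alim: "(C.a \<longlongrightarrow> 0) (at 0)" using analytic_tendsto[OF C.analytic(1)] C.value_0 by (simp add: aff_def)
    have q: "((\<lambda>t. C.a t / t) \<longlongrightarrow> deriv C.a 0) (at 0)"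
      by (rule difference_quotient[OF C.analytic(1)]) (use C.value_0 in \<open>auto simp: aff_def\<close>)
    have a': "deriv C.a 0 \<noteq> 0" using C.simple_pole_D1[OF refl refl refl D1(2)] .
    have a0: "\<forall>\<^sub>F t in at 0. C.a t \<noteq> 0"
      using tendsto_imp_eventually_ne[OF q a'] by (auto elim: eventually_mono)
    have "has_order u (- 1)"
    proof (rule has_orderI)
      have "((\<lambda>t. inverse (C.a t / t)) \<longlongrightarrow> inverse (deriv C.a 0)) (at 0)" by (rule tendsto_inverse[OF q a'])
      moreover have "\<forall>\<^sub>F t in at 0. inverse (C.a t / t) = u t * t powi (- (- 1))"
        using ua by eventually_elim simp
      ultimately show "((\<lambda>t. u t * t powi (- (- 1))) \<longlongrightarrow> inverse (deriv C.a 0)) (at 0)"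
        by (rule Lim_transform_eventually)
    qed (use a' in simp)
    \<comment> \<open>\<open>u\<close> has a pole while \<open>A \<xi>\<close> stays
      bounded.\<close>
    have L12: "L i = 0" if i: "i < m + n" for i
    proof -
      have iN: "i < N" using i by simp
      have "((\<lambda>t. (C.a t / sel m n 1 (w t) 1 i) * mat_fun N A (\<xi> t) i) \<longlongrightarrow> (0 / sel m n 1 w0 1 i) * mat_fun N A L i) (at 0)"
        by (intro tendsto_mult tendsto_divide alim limA) (use wlim D1(2) in \<open>auto simp: sel_def\<close>)
      moreover have "\<forall>\<^sub>F t in at 0. (C.a t / sel m n 1 (w t) 1 i) * mat_fun N A (\<xi> t) i = \<xi> t i"
        using eig ua a0 tendsto_imp_eventually_ne[OF wlim D1(2)]
        by eventually_elim (use iN i in \<open>auto simp: sel_def\<close>)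
      ultimately have "((\<lambda>t. \<xi> t i) \<longlongrightarrow> (0 / sel m n 1 w0 1 i) * mat_fun N A L i) (at 0)" by (rule Lim_transform_eventually)
      then show ?thesis using uniq[OF lim[OF iN]] by simp
    qed
    have AL3: "mat_fun N A L i = w0 * L i" if i: "m + n \<le> i" "i < N" for i
    proof (rule uniq[OF limA])
      have "((\<lambda>t. w t * \<xi> t i) \<longlongrightarrow> w0 * L i) (at 0)" by (intro tendsto_mult wlim lim i)
      moreover have "\<forall>\<^sub>F t in at 0. w t * \<xi> t i = mat_fun N A (\<xi> t) i"
        using eig by eventually_elim (use i in \<open>auto simp: sel_def\<close>)
      ultimately show "((\<lambda>t. mat_fun N A (\<xi> t) i) \<longlongrightarrow> w0 * L i) (at 0)" by (rule Lim_transform_eventually)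
    qed
    \<comment> \<open>If \<open>T w0 L\<close> were zero, blocks 1 and 3 of \<open>A3 L\<close>
      would vanish, hence block 3 of \<open>A L\<close>, which is \<open>w0 L\<close> with
      \<open>w0 \<noteq> 0\<close>.\<close>
    have ne: "\<exists>i<N. T w0 L i \<noteq> 0"
    proof (rule ccontr)
      assume "\<not> ?thesis"
      then have "mat_fun N A3 L i = 0" if "m + n \<le> i" "i < N" for i using that by (auto simp: T_eq)
      moreover have "mat_fun N A3 L i = 0" if "i < m" for i
        using acts_on_id[OF A3, of i L] L12[of i] that by simp
      ultimately have "mat_fun N A2 (mat_fun N A3 L) i = mat_fun N A2 (\<lambda>_. 0) i" if "m + n \<le> i" "i < N" for i
        by (intro acts_on_cong[OF A2]) (use that in auto)
      then have "L i = 0" if "m + n \<le> i" "i < N" for i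
        using AL3[OF that] mat_fun_A_3[OF that, of L] D1(2) that by (simp add: mat_fun_zero)
      with L12 L show False by (metis not_le)
    qed
    have "((\<lambda>t. t powi (- 0) * T (w t) (\<xi> t) i) \<longlongrightarrow> T w0 L i) (at 0)" for i
      using T_tendsto[OF lim wlim] by simp
    moreover have "- 1 + 0 = Poly_Mapping.lookup (divisor6 (curve A)) p - Poly_Mapping.lookup (divisor1 (curve A)) p"
      using p D1(2) unfolding D1(1) lookup_divisors by simp
    ultimately show ?thesis using \<open>has_order u (- 1)\<close> ne by blast
  next
    case (D2 v0)
    interpret C: curve_point m n r A p \<phi> Infty "Fin v0" "Fin 0"
      using carriers(5) good p \<phi> D2 by unfold_locales auto
    define \<sigma> where "\<sigma> = deriv C.a 0"
    have \<sigma>: "\<sigma> \<noteq> 0" unfolding \<sigma>_def using C.simple_pole_D2[OF refl refl refl D2(2)] .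
    have q: "((\<lambda>t. C.a t / t) \<longlongrightarrow> \<sigma>) (at 0)" unfolding \<sigma>_def
      by (rule difference_quotient[OF C.analytic(1)]) (use C.value_0 in \<open>auto simp: aff_def\<close>)
    have ua: "\<forall>\<^sub>F t in at 0. u t = 1 / C.a t"
      using C.u_eq unfolding eventually_at_filter u by eventually_elim (auto simp: C.u_def)
    have a0: "\<forall>\<^sub>F t in at 0. C.a t \<noteq> 0"
      using tendsto_imp_eventually_ne[OF q \<sigma>] by (auto elim: eventually_mono)
    have blim: "(C.b \<longlongrightarrow> v0) (at 0)" using analytic_tendsto[OF C.analytic(2)] C.value_0 by simp
    have wc: "\<forall>\<^sub>F t in at 0. w t = C.b t * C.a t"
    proof -
      have "\<forall>\<^sub>F t in nhds 0. w t = C.b t * C.a t"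
        using C.w_eq C.equations by eventually_elim (auto simp: w C.w_def hom_num_def hom_den_def)
      then show ?thesis unfolding eventually_at_filter by eventually_elim auto
    qed
    have "has_order u (- 1)"
    proof (rule has_orderI)
      have "((\<lambda>t. inverse (C.a t / t)) \<longlongrightarrow> inverse \<sigma>) (at 0)" by (rule tendsto_inverse[OF q \<sigma>])
      moreover have "\<forall>\<^sub>F t in at 0. inverse (C.a t / t) = u t * t powi (- (- 1))"
        using ua by eventually_elim simp
      ultimately show "((\<lambda>t. u t * t powi (- (- 1))) \<longlongrightarrow> inverse \<sigma>) (at 0)"
        by (rule Lim_transform_eventually)
    qed (use \<sigma> in simp)
    \<comment> \<open>Block 1 of \<open>\<xi>\<close> is \<open>A \<xi> / u\<close>, and
      \<open>w\<close> has a zero itself. So \<open>W \<xi>\<close> is divisible by \<open>t\<close>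
      in blocks 1 and 2, which are all that the first two blocks of \<open>T \<xi>\<close> depend
      on.\<close>
    have X1: "((\<lambda>t. \<xi> t i / t) \<longlongrightarrow> \<sigma> * mat_fun N A L i) (at 0)" if i: "i < m" for i
    proof (rule Lim_transform_eventually)
      show "((\<lambda>t. (C.a t / t) * mat_fun N A (\<xi> t) i) \<longlongrightarrow> \<sigma> * mat_fun N A L i) (at 0)"
        by (intro tendsto_mult q limA)
      show "\<forall>\<^sub>F t in at 0. (C.a t / t) * mat_fun N A (\<xi> t) i = \<xi> t i / t"
        using eig ua a0 by eventually_elim (use i in \<open>auto simp: sel_def\<close>)
    qed
    have wx: "((\<lambda>t. w t * \<xi> t i / t) \<longlongrightarrow> \<sigma> * v0 * L i) (at 0)" if i: "i < N" for i
    proof (rule Lim_transform_eventually)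
      show "((\<lambda>t. (C.a t / t) * C.b t * \<xi> t i) \<longlongrightarrow> \<sigma> * v0 * L i) (at 0)"
        by (intro tendsto_mult q blim lim i)
      show "\<forall>\<^sub>F t in at 0. (C.a t / t) * C.b t * \<xi> t i = w t * \<xi> t i / t"
        using wc by eventually_elim simp
    qed
    have L1: "L i = 0" if i: "i < m" for i
    proof -
      have "((\<lambda>t. t * (\<xi> t i / t)) \<longlongrightarrow> 0 * (\<sigma> * mat_fun N A L i)) (at 0)"
        by (intro tendsto_mult X1 i tendsto_ident_at)
      moreover have "\<forall>\<^sub>F t in at 0. t * (\<xi> t i / t) = \<xi> t i" by (simp add: eventually_at_filter)
      ultimately have "((\<lambda>t. \<xi> t i) \<longlongrightarrow> 0 * (\<sigma> * mat_fun N A L i)) (at 0)" by (rule Lim_transform_eventually)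
      then show ?thesis using uniq[OF lim[of i]] i by simp
    qed
    \<comment> \<open>Block 3 of \<open>A3 \<xi>\<close> is not visibly small. It is recovered by
      the inverse of \<open>D2\<close> from block 3 of \<open>A2 (A3 \<xi>) = w \<xi>\<close> and
      block 1 of \<open>\<xi>\<close>, both divisible by \<open>t\<close>.\<close>
    obtain E where E: "\<And>z i. m + n \<le> i \<Longrightarrow> i < N \<Longrightarrow>
      mat_fun N E (\<lambda>k. if m + n \<le> k then mat_fun N A2 z k - (\<Sum>l<m. A2 $$ (k, l) * z l) else 0) i = z i"
      by (rule D2_inverse) (rule that)
    define y where "y j = (if j < m then \<sigma> * mat_fun N A L j else \<sigma> * v0 * L j)" for j
    define g where "g k = (if m + n \<le> k then \<sigma> * v0 * L k - (\<Sum>l<m. A2 $$ (k, l) * (\<sigma> * mat_fun N A L l)) else 0)" for k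
    define M where "M i = (if m + n \<le> i then mat_fun N E g i else mat_fun N A1' y i)" for i
    have glim: "((\<lambda>t. if m + n \<le> k then (w t * \<xi> t k / t) - (\<Sum>l<m. A2 $$ (k, l) * (\<xi> t l / t)) else 0) \<longlongrightarrow> g k) (at 0)"
      if "k < N" for k
      unfolding g_def using wx[OF that] X1
      by (cases "m + n \<le> k") (auto simp del: times_divide_eq_right intro!: tendsto_diff tendsto_sum tendsto_mult tendsto_const)
    have A2A3: "\<forall>\<^sub>F t in at 0. \<forall>k<N. m + n \<le> k \<longrightarrow>
        mat_fun N A2 (mat_fun N A3 (\<xi> t)) k = w t * \<xi> t k"
      using eig by eventually_elim (use T_eigenvector(3) in blast)
    have A3_1: "mat_fun N A3 x l = x l" if "l < m" for x l
      using acts_on_id[OF A3, of l x] that by simp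
    have limM: "((\<lambda>t. t powi (- 1) * T (w t) (\<xi> t) i) \<longlongrightarrow> M i) (at 0)" if i: "i < N" for i
    proof (cases "m + n \<le> i")
      case True
      show ?thesis
      proof (rule Lim_transform_eventually)
        show "((\<lambda>t. mat_fun N E (\<lambda>k. if m + n \<le> k then (w t * \<xi> t k / t) - (\<Sum>l<m. A2 $$ (k, l) * (\<xi> t l / t)) else 0) i) \<longlongrightarrow> M i) (at 0)"
          unfolding M_def using True by (simp only: if_True) (rule mat_fun_tendsto[OF glim])
        show "\<forall>\<^sub>F t in at 0. mat_fun N E (\<lambda>k. if m + n \<le> k then (w t * \<xi> t k / t) - (\<Sum>l<m. A2 $$ (k, l) * (\<xi> t l / t)) else 0) i =
            t powi (- 1) * T (w t) (\<xi> t) i"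
          using A2A3
        proof eventually_elim
          case (elim t)
          have "mat_fun N E (\<lambda>k. if m + n \<le> k then (w t * \<xi> t k / t) - (\<Sum>l<m. A2 $$ (k, l) * (\<xi> t l / t)) else 0) i =
              mat_fun N E (\<lambda>k. inverse t * (if m + n \<le> k then mat_fun N A2 (mat_fun N A3 (\<xi> t)) k
                - (\<Sum>l<m. A2 $$ (k, l) * mat_fun N A3 (\<xi> t) l) else 0)) i"
            by (rule mat_fun_cong) (use elim A3_1 in \<open>auto simp: divide_inverse right_diff_distrib sum_distrib_left mult_ac\<close>)
          also have "\<dots> = inverse t * mat_fun N A3 (\<xi> t) i"
            unfolding mat_fun_scale using E[OF True i] by simp
          finally show ?case using True by (simp add: T_eq power_int_minus)
        qed
      qed
    next
      case False
      show ?thesis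
      proof (rule Lim_transform_eventually)
        have "((\<lambda>t. (if j < m then \<xi> t j / t else w t * \<xi> t j / t)) \<longlongrightarrow> y j) (at 0)" if "j < N" for j
          unfolding y_def using X1 wx that by (cases "j < m") auto
        then show "((\<lambda>t. mat_fun N A1' (\<lambda>j. if j < m then \<xi> t j / t else w t * \<xi> t j / t) i) \<longlongrightarrow> M i) (at 0)"
          unfolding M_def using False by (simp only: if_False) (rule mat_fun_tendsto)
        have "mat_fun N A1' (\<lambda>j. if j < m then \<xi> t j / t else w t * \<xi> t j / t) i = t powi (- 1) * T (w t) (\<xi> t) i" for t
        proof -
          have "mat_fun N A1' (\<lambda>j. if j < m then \<xi> t j / t else w t * \<xi> t j / t) i =
              mat_fun N A1' (\<lambda>j. inverse t * ((if j < m then 1 else w t) * \<xi> t j)) i"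
            by (rule mat_fun_cong) (auto simp: divide_inverse)
          then show ?thesis using False by (simp add: T_eq power_int_minus mat_fun_scale)
        qed
        then show "\<forall>\<^sub>F t in at 0. mat_fun N A1' (\<lambda>j. if j < m then \<xi> t j / t else w t * \<xi> t j / t) i = t powi (- 1) * T (w t) (\<xi> t) i"
          by simp
      qed
    qed
    have ne: "\<exists>i<N. M i \<noteq> 0"
    proof (rule ccontr)
      assume "\<not> ?thesis"
      then have M0: "M i = 0" if "i < N" for i using that by blast
      have "mat_fun N A1' y i = 0" if "i < m + n" for i using M0[of i] that by (simp add: M_def)
      from A1'_kernel[OF this] have y0: "y j = 0" if "j < m + n" for j using that by blast
      have AL1: "mat_fun N A L j = 0" if "j < m" for j using y0[of j] that \<sigma> by (simp add: y_def)
      have L2: "L j = 0" if "j < m + n" for j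
        using y0[of j] L1[of j] that \<sigma> D2(2) by (cases "j < m") (auto simp: y_def)
      \<comment> \<open>Multiplying back by \<open>D2\<close>: a zero limit in block 3 makes
        \<open>g\<close> zero, and since block 1 of \<open>A L\<close> vanishes, \<open>g k\<close>
        is a nonzero multiple of \<open>L k\<close>.\<close>
      have L3: "L k = 0" if k: "m + n \<le> k" "k < N" for k
      proof -
        have "((\<lambda>t. \<Sum>l\<in>{m + n..<N}. A2 $$ (k, l) * (t powi (- 1) * T (w t) (\<xi> t) l)) \<longlongrightarrow> (\<Sum>l\<in>{m + n..<N}. A2 $$ (k, l) * M l)) (at 0)"
          by (intro tendsto_sum tendsto_mult tendsto_const limM) simp
        moreover have "\<forall>\<^sub>F t in at 0. (\<Sum>l\<in>{m + n..<N}. A2 $$ (k, l) * (t powi (- 1) * T (w t) (\<xi> t) l)) =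
            (w t * \<xi> t k / t) - (\<Sum>l<m. A2 $$ (k, l) * (\<xi> t l / t))"
          using A2A3
        proof eventually_elim
          case (elim t)
          have "w t * \<xi> t k = (\<Sum>l<m. A2 $$ (k, l) * \<xi> t l) + (\<Sum>l\<in>{m + n..<N}. A2 $$ (k, l) * mat_fun N A3 (\<xi> t) l)"
            using elim k mat_fun_A2_3[OF k, of "mat_fun N A3 (\<xi> t)"] A3_1 by simp
          then have "(w t * \<xi> t k / t) = inverse t * (\<Sum>l<m. A2 $$ (k, l) * \<xi> t l) + inverse t * (\<Sum>l\<in>{m + n..<N}. A2 $$ (k, l) * mat_fun N A3 (\<xi> t) l)"
            by (simp only: divide_inverse mult.commute[of _ "inverse t"] distrib_left)
          then show ?case
            by (simp add: T_eq power_int_minus sum_distrib_left divide_inverse mult_ac)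
        qed
        ultimately have "((\<lambda>t. (w t * \<xi> t k / t) - (\<Sum>l<m. A2 $$ (k, l) * (\<xi> t l / t))) \<longlongrightarrow> (\<Sum>l\<in>{m + n..<N}. A2 $$ (k, l) * M l)) (at 0)"
          by (rule Lim_transform_eventually)
        moreover have "((\<lambda>t. (w t * \<xi> t k / t) - (\<Sum>l<m. A2 $$ (k, l) * (\<xi> t l / t))) \<longlongrightarrow> g k) (at 0)"
          using glim[OF k(2)] k(1) by simp
        ultimately have "g k = (\<Sum>l\<in>{m + n..<N}. A2 $$ (k, l) * M l)" by (intro uniq)
        also have "\<dots> = 0" using M0 by (intro sum.neutral) auto
        finally show ?thesis using k \<sigma> D2(2) AL1 by (simp add: g_def)
      qed
      show False using L L2 L3 by (metis not_le)
    qed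
    have "- 1 + 1 = Poly_Mapping.lookup (divisor6 (curve A)) p - Poly_Mapping.lookup (divisor1 (curve A)) p"
      unfolding D2(1) lookup_divisors by simp
    then show ?thesis using \<open>has_order u (- 1)\<close> limM ne by blast
  next
    case (D3 u0)
    interpret C: curve_point m n r A p \<phi> "Fin u0" Infty Infty
      using carriers(5) good p \<phi> D3 by unfold_locales auto
    have an: "u analytic_on {0}" using C.analytic_u by (simp add: u C.u_def[abs_def])
    have ulim: "(u \<longlongrightarrow> u0) (at 0)"
      using analytic_tendsto[OF an] local_parametrization_0[OF \<phi>] D3(1) by (simp add: u)
    have u1: "\<forall>\<^sub>F t in at 0. u t \<noteq> 0" by (rule tendsto_imp_eventually_ne[OF ulim D3(2)])
    have clim: "(C.c \<longlongrightarrow> 0) (at 0)" using analytic_tendsto[OF C.analytic(3)] C.value_0 by (simp add: aff_def)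
    have near: "\<forall>\<^sub>F t in at 0. snd (snd (\<phi> t)) = cp1_of 1 (C.c t)"
      using C.near unfolding eventually_at_filter by eventually_elim auto
    \<comment> \<open>The curve has finitely many infinite points, so \<open>w\<close> is finite and
      \<open>c\<close> nonzero on a punctured neighbourhood.\<close>
    have wc: "\<forall>\<^sub>F t in at 0. w t = 1 / C.c t \<and> C.c t \<noteq> 0"
      using near fin by eventually_elim (auto simp: w aff_def cp1_of_def split: if_splits)
    have L23: "L i = 0" if i: "m \<le> i" "i < N" for i
    proof -
      have "((\<lambda>t. (C.c t / sel m n 1 (u t) 1 i) * mat_fun N A (\<xi> t) i) \<longlongrightarrow> (0 / sel m n 1 u0 1 i) * mat_fun N A L i) (at 0)"
        by (intro tendsto_mult tendsto_divide clim limA) (use ulim D3(2) in \<open>auto simp: sel_def\<close>)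
      moreover have "\<forall>\<^sub>F t in at 0. (C.c t / sel m n 1 (u t) 1 i) * mat_fun N A (\<xi> t) i = \<xi> t i"
        using eig wc u1 by eventually_elim (use i in \<open>auto simp: sel_def\<close>)
      ultimately have "((\<lambda>t. \<xi> t i) \<longlongrightarrow> (0 / sel m n 1 u0 1 i) * mat_fun N A L i) (at 0)" by (rule Lim_transform_eventually)
      then show ?thesis using uniq[OF lim[OF i(2)]] by simp
    qed
    \<comment> \<open>In block 2 the pole of \<open>w\<close> is compensated:
      \<open>w \<xi> = A \<xi> / u\<close> converges because \<open>u0 \<noteq> 0\<close>.\<close>
    define y where "y j = (if j < m then L j else mat_fun N A L j / sel m n 1 u0 1 j)" for j
    define M where "M i = (if m + n \<le> i then mat_fun N A3 L i else mat_fun N A1' y i)" for i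
    have ylim: "((\<lambda>t. (if j < m then 1 else w t) * \<xi> t j) \<longlongrightarrow> y j) (at 0)" if j: "j < N" for j
    proof (cases "j < m")
      case True
      then show ?thesis using lim[OF j] by (simp add: y_def)
    next
      case False
      have "((\<lambda>t. mat_fun N A (\<xi> t) j / sel m n 1 (u t) 1 j) \<longlongrightarrow> mat_fun N A L j / sel m n 1 u0 1 j) (at 0)"
        by (intro tendsto_divide limA) (use ulim D3(2) in \<open>auto simp: sel_def\<close>)
      moreover have "\<forall>\<^sub>F t in at 0. mat_fun N A (\<xi> t) j / sel m n 1 (u t) 1 j = w t * \<xi> t j"
        using eig u1 by eventually_elim (use j False in \<open>auto simp: sel_def\<close>)
      ultimately show ?thesis using False by (simp add: y_def) (rule Lim_transform_eventually)
    qed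
    have limM: "((\<lambda>t. t powi (- 0) * T (w t) (\<xi> t) i) \<longlongrightarrow> M i) (at 0)" for i
      using limA3[of i] mat_fun_tendsto[where M = A1' and i = i, OF ylim] by (cases "m + n \<le> i") (simp_all add: T_eq M_def)
    have ne: "\<exists>i<N. M i \<noteq> 0"
    proof (rule ccontr)
      assume "\<not> ?thesis"
      then have M0: "M i = 0" if "i < N" for i using that by blast
      have "mat_fun N A1' y i = 0" if "i < m + n" for i using M0[of i] that by (simp add: M_def)
      from A1'_kernel[OF this] have y0: "y j = 0" if "j < m + n" for j using that by blast
      have "L j = 0" if "j < m" for j using y0[of j] that by (simp add: y_def)
      then show False using L L23 by (metis not_le)
    qed
    have "0 + 0 = Poly_Mapping.lookup (divisor6 (curve A)) p - Poly_Mapping.lookup (divisor1 (curve A)) p"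
      unfolding D3(1) lookup_divisors by simp
    then show ?thesis using has_order_0[OF ulim D3(2)] limM ne by blast
  next
    case (D4 v0)
    interpret C: curve_point m n r A p \<phi> "Fin 0" "Fin v0" Infty
      using carriers(5) good p \<phi> D4 by unfold_locales auto
    define \<omega> where "\<omega> = deriv C.c 0"
    have \<omega>: "\<omega> \<noteq> 0" unfolding \<omega>_def using C.simple_pole_D4(1)[OF refl refl refl D4(2)] .
    have q: "((\<lambda>t. C.c t / t) \<longlongrightarrow> \<omega>) (at 0)" unfolding \<omega>_def
      by (rule difference_quotient[OF C.analytic(3)]) (use C.value_0 in \<open>auto simp: aff_def\<close>)
    have blim: "(C.b \<longlongrightarrow> v0) (at 0)" using analytic_tendsto[OF C.analytic(2)] C.value_0 by simp
    have clim: "(C.c \<longlongrightarrow> 0) (at 0)" using analytic_tendsto[OF C.analytic(3)] C.value_0 by (simp add: aff_def)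
    have wc: "\<forall>\<^sub>F t in at 0. w t = 1 / C.c t"
      using C.w_eq unfolding eventually_at_filter w by eventually_elim (auto simp: C.w_def)
    have c0: "\<forall>\<^sub>F t in at 0. C.c t \<noteq> 0"
      using tendsto_imp_eventually_ne[OF q \<omega>] by (auto elim: eventually_mono)
    have ubc: "\<forall>\<^sub>F t in at 0. u t = C.b t * C.c t"
    proof -
      have "\<forall>\<^sub>F t in nhds 0. u t = C.b t * C.c t"
        using C.u_eq C.simple_pole_D4(2)[OF refl refl refl D4(2)] by eventually_elim (auto simp: u C.u_def)
      then show ?thesis unfolding eventually_at_filter by eventually_elim auto
    qed
    have "has_order u 1"
    proof (rule has_orderI)
      show "((\<lambda>t. u t * t powi (- 1)) \<longlongrightarrow> v0 * \<omega>) (at 0)"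
      proof (rule Lim_transform_eventually)
        show "((\<lambda>t. C.b t * (C.c t / t)) \<longlongrightarrow> v0 * \<omega>) (at 0)" by (intro tendsto_mult blim q)
        show "\<forall>\<^sub>F t in at 0. C.b t * (C.c t / t) = u t * t powi (- 1)"
          using ubc by eventually_elim (simp add: power_int_minus divide_inverse)
      qed
    qed (use \<omega> D4(2) in simp)
    have ulim: "(u \<longlongrightarrow> 0) (at 0)"
    proof (rule Lim_transform_eventually)
      show "((\<lambda>t. C.b t * C.c t) \<longlongrightarrow> 0) (at 0)" using tendsto_mult[OF blim clim] by simp
      show "\<forall>\<^sub>F t in at 0. C.b t * C.c t = u t" using ubc by eventually_elim simp
    qed
    have L3: "L i = 0" if i: "m + n \<le> i" "i < N" for i
    proof -
      have "((\<lambda>t. C.c t * mat_fun N A (\<xi> t) i) \<longlongrightarrow> 0 * mat_fun N A L i) (at 0)"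
        by (intro tendsto_mult clim limA)
      moreover have "\<forall>\<^sub>F t in at 0. C.c t * mat_fun N A (\<xi> t) i = \<xi> t i"
        using eig wc c0 by eventually_elim (use i in \<open>auto simp: sel_def\<close>)
      ultimately have "((\<lambda>t. \<xi> t i) \<longlongrightarrow> 0 * mat_fun N A L i) (at 0)" by (rule Lim_transform_eventually)
      then show ?thesis using uniq[OF lim[OF i(2)]] by simp
    qed
    have AL1: "mat_fun N A L i = 0" if i: "i < m" for i
    proof (rule uniq[OF limA])
      have "((\<lambda>t. u t * \<xi> t i) \<longlongrightarrow> 0 * L i) (at 0)" by (intro tendsto_mult ulim lim) (use i in simp)
      moreover have "\<forall>\<^sub>F t in at 0. u t * \<xi> t i = mat_fun N A (\<xi> t) i"
        using eig by eventually_elim (use i in \<open>auto simp: sel_def\<close>)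
      ultimately show "((\<lambda>t. mat_fun N A (\<xi> t) i) \<longlongrightarrow> 0) (at 0)"
        by (simp add: Lim_transform_eventually)
    qed
    \<comment> \<open>Here \<open>t w\<close> tends to \<open>inverse \<omega>\<close>. After
      multiplication by \<open>t\<close> only block 2 of \<open>W \<xi>\<close> survives in blocks 1
      and 2, which is why the order of \<open>T \<xi>\<close> is -1.\<close>
    define y where "y j = (if j < m then 0 else inverse \<omega> * L j)" for j
    define M where "M i = (if m + n \<le> i then 0 else mat_fun N A1' y i)" for i
    have ylim: "((\<lambda>t. t * ((if j < m then 1 else w t) * \<xi> t j)) \<longlongrightarrow> y j) (at 0)" if j: "j < N" for j
    proof (cases "j < m")
      case True
      have "((\<lambda>t. t * \<xi> t j) \<longlongrightarrow> 0 * L j) (at 0)" by (intro tendsto_mult tendsto_ident_at lim j)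
      then show ?thesis using True by (simp add: y_def)
    next
      case False
      have "((\<lambda>t. inverse (C.c t / t) * \<xi> t j) \<longlongrightarrow> inverse \<omega> * L j) (at 0)"
        by (intro tendsto_mult tendsto_inverse q \<omega> lim j)
      moreover have "\<forall>\<^sub>F t in at 0. inverse (C.c t / t) * \<xi> t j = t * (w t * \<xi> t j)"
        using wc by eventually_elim simp
      ultimately have "((\<lambda>t. t * (w t * \<xi> t j)) \<longlongrightarrow> inverse \<omega> * L j) (at 0)" by (rule Lim_transform_eventually)
      then show ?thesis using False by (simp add: y_def)
    qed
    have limM: "((\<lambda>t. t powi (- (- 1)) * T (w t) (\<xi> t) i) \<longlongrightarrow> M i) (at 0)" for i
    proof (cases "m + n \<le> i")
      case True
      have "((\<lambda>t. t * mat_fun N A3 (\<xi> t) i) \<longlongrightarrow> 0 * mat_fun N A3 L i) (at 0)"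
        by (intro tendsto_mult tendsto_ident_at limA3)
      then show ?thesis using True by (simp add: T_eq M_def)
    next
      case False
      then show ?thesis using mat_fun_tendsto[where M = A1' and i = i, OF ylim] by (simp add: T_eq M_def mat_fun_scale)
    qed
    have ne: "\<exists>i<N. M i \<noteq> 0"
    proof (rule ccontr)
      assume "\<not> ?thesis"
      then have M0: "M i = 0" if "i < N" for i using that by blast
      have "mat_fun N A1' y i = 0" if "i < m + n" for i using M0[of i] that by (simp add: M_def)
      from A1'_kernel[OF this] have y0: "y j = 0" if "j < m + n" for j using that by blast
      have L2: "L j = 0" if "m \<le> j" "j < m + n" for j using y0[of j] that \<omega> by (simp add: y_def)
      have L23: "L j = 0" if "m \<le> j" "j < N" for j using L2[of j] L3[of j] that by (cases "j < m + n") auto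
      \<comment> \<open>\<open>L\<close> would lie in block 1 and be annihilated by the (1,1) block
        of \<open>A\<close>: the excluded point \<open>u = 0\<close>,
        \<open>v = w = \<infinity>\<close>.\<close>
      have "pdet A (sel m n 1 0 0) (sel m n 0 1 1) = 0"
        unfolding det_pencil_eq_0_iff using L AL1 L23 by (intro exI[of _ L]) (auto simp: sel_def not_less)
      then show False using good by (simp add: good_def)
    qed
    have "1 + - 1 = Poly_Mapping.lookup (divisor6 (curve A)) p - Poly_Mapping.lookup (divisor1 (curve A)) p"
      unfolding D4(1) lookup_divisors by simp
    then show ?thesis using \<open>has_order u 1\<close> limM ne by blast
  qed
qed

end

section \<open>Comparison of the two divisors\<close>

context block_sizes
begin

lemma normalized_eigenvector_cofinite:
  assumes M: "M \<in> carrier_mat N N" and "normalized_eigenvector m n r M X"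
  obtains E where "finite E" "\<And>p. p \<in> curve M - E \<Longrightarrow> \<exists>u w. p = (Fin u, Fin (u * w), Fin w) \<and> F M u w = 0 \<and>
    (\<forall>i<N. mat_fun N M (\<lambda>j. X p $ j) i = sel m n u (u * w) w i * X p $ i) \<and>
    (\<forall>y. (\<forall>i<N. mat_fun N M y i = sel m n u (u * w) w i * y i) \<longrightarrow> (\<forall>i<N. y i = y 0 * X p $ i))"
proof -
  define E where "E = {p \<in> curve M. \<not> (\<exists>u v w. p = (Fin u, Fin v, Fin w) \<and>
        {x \<in> carrier_vec N. M *\<^sub>v x = spectral_diag m n r u v w *\<^sub>v x} = {c \<cdot>\<^sub>v X p | c. True})}"
  have X: "\<And>p. p \<in> curve M \<Longrightarrow> X p \<in> carrier_vec N" "\<And>p. p \<in> curve M \<Longrightarrow> X p $ 0 = 1" "finite E"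
    using assms(2) unfolding normalized_eigenvector_def Let_def E_def by auto
  have "\<exists>u w. p = (Fin u, Fin (u * w), Fin w) \<and> F M u w = 0 \<and>
    (\<forall>i<N. mat_fun N M (\<lambda>j. X p $ j) i = sel m n u (u * w) w i * X p $ i) \<and>
    (\<forall>y. (\<forall>i<N. mat_fun N M y i = sel m n u (u * w) w i * y i) \<longrightarrow> (\<forall>i<N. y i = y 0 * X p $ i))"
    if p: "p \<in> curve M - E" for p
  proof -
    obtain u v w where uvw: "p = (Fin u, Fin v, Fin w)"
      "{x \<in> carrier_vec N. M *\<^sub>v x = spectral_diag m n r u v w *\<^sub>v x} = {c \<cdot>\<^sub>v X p | c. True}"
      using p unfolding E_def by blast
    have v: "v = u * w" and F: "F M u w = 0" using p uvw(1) Fin_in_curve_iff[OF M] by auto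
    have Xp: "X p \<in> carrier_vec N" "X p $ 0 = 1" using X p by auto
    have "1 \<cdot>\<^sub>v X p \<in> {x \<in> carrier_vec N. M *\<^sub>v x = spectral_diag m n r u v w *\<^sub>v x}"
      unfolding uvw(2) by blast
    then have eigX: "\<forall>i<N. mat_fun N M (\<lambda>j. X p $ j) i = sel m n u (u * w) w i * X p $ i"
      using eigenspace_iff[OF M Xp(1)] by (simp add: v)
    have "y i = y 0 * X p $ i" if y: "\<forall>i<N. mat_fun N M y i = sel m n u (u * w) w i * y i" and i: "i < N" for y i
    proof -
      define Y where "Y = Matrix.vec N y"
      have Y: "Y \<in> carrier_vec N" by (simp add: Y_def)
      have "mat_fun N M (\<lambda>j. Y $ j) k = mat_fun N M y k" for k
        by (rule mat_fun_cong) (simp add: Y_def)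
      then have "\<forall>i<N. mat_fun N M (\<lambda>j. Y $ j) i = sel m n u (u * w) w i * Y $ i"
        using y by (simp add: Y_def)
      then have "Y \<in> {x \<in> carrier_vec N. M *\<^sub>v x = spectral_diag m n r u v w *\<^sub>v x}"
        using eigenspace_iff[OF M Y] Y by (simp add: v)
      then obtain c where c: "Y = c \<cdot>\<^sub>v X p" unfolding uvw(2) by blast
      have N0: "0 < N" using m by simp
      have "y k = c * X p $ k" if "k < N" for k
        using arg_cong[OF c, of "\<lambda>v. v $ k"] that Xp(1) by (simp add: Y_def)
      then show ?thesis using i N0 Xp(2) by simp
    qed
    then show ?thesis using uvw(1) v F eigX by blast
  qed
  then show ?thesis using that X(3) by blast
qed

end

context refactorization
begin

text \<open>The eigenspaces of \<open>B\<close> are lines and \<open>Y\<close> has coordinate 0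
  equal to 1, so the factor in \<open>T X = h Y\<close> is coordinate 0 of \<open>T X\<close>. With
  \<open>d\<close> and \<open>e\<close> the multiplicities of the two divisors,
  \<open>t ^ d * X\<close>, \<open>t ^ e * Y\<close> and \<open>T (t ^ d * X)\<close> divided by
  \<open>t ^ k\<close> have nonzero limits, whence \<open>h\<close> has order
  \<open>k + e - d\<close>. The order \<open>s\<close> of \<open>u\<close> then enters through the
  known value of \<open>s + k\<close>.\<close>

lemma divisors_linearly_equivalent:
  assumes DA: "corresponding_divisor m n r A DA" and DB: "corresponding_divisor m n r B DB"
  shows "linearly_equivalent (curve A) DB (DA + divisor1 (curve A) - divisor6 (curve A))"
proof -
  obtain X where X: "normalized_eigenvector m n r A X" "is_pole_divisor (curve A) N X DA"
    using DA unfolding corresponding_divisor_def by blast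
  obtain Y where Y: "normalized_eigenvector m n r B Y" "is_pole_divisor (curve A) N Y DB"
    using DB unfolding corresponding_divisor_def curve_B by blast
  have merX: "meromorphic_on_curve (curve A) (\<lambda>p. X p $ i)" and merY: "meromorphic_on_curve (curve A) (\<lambda>p. Y p $ i)"
    if "i < N" for i
    using X(1) Y(1) that unfolding normalized_eigenvector_def Let_def curve_B by auto
  have X0: "X p $ 0 = 1" and Y0: "Y p $ 0 = 1" if "p \<in> curve A" for p
    using X(1) Y(1) that unfolding normalized_eigenvector_def Let_def curve_B by auto
  have N0: "0 < N" using m by simp
  obtain EA where EA: "finite EA" "\<And>p. p \<in> curve A - EA \<Longrightarrow> \<exists>u w. p = (Fin u, Fin (u * w), Fin w) \<and> F A u w = 0 \<and>
    (\<forall>i<N. mat_fun N A (\<lambda>j. X p $ j) i = sel m n u (u * w) w i * X p $ i) \<and>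
    (\<forall>y. (\<forall>i<N. mat_fun N A y i = sel m n u (u * w) w i * y i) \<longrightarrow> (\<forall>i<N. y i = y 0 * X p $ i))"
    by (rule normalized_eigenvector_cofinite[OF carriers(5) X(1)]) (rule that)
  obtain EB where EB: "finite EB" "\<And>p. p \<in> curve A - EB \<Longrightarrow> \<exists>u w. p = (Fin u, Fin (u * w), Fin w) \<and> F B u w = 0 \<and>
    (\<forall>i<N. mat_fun N B (\<lambda>j. Y p $ j) i = sel m n u (u * w) w i * Y p $ i) \<and>
    (\<forall>y. (\<forall>i<N. mat_fun N B y i = sel m n u (u * w) w i * y i) \<longrightarrow> (\<forall>i<N. y i = y 0 * Y p $ i))"
    by (rule normalized_eigenvector_cofinite[OF carriers(6) Y(1), unfolded curve_B]) (rule that)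
  define h where "h p = T (aff (snd (snd p))) (\<lambda>j. X p $ j) 0" for p
  define f where "f p = aff (fst p) * h p" for p
  have main: "(f \<circ> \<phi>) meromorphic_on {0} \<and> has_order (f \<circ> \<phi>) (Poly_Mapping.lookup DB p -
      Poly_Mapping.lookup (DA + divisor1 (curve A) - divisor6 (curve A)) p)"
    if p: "p \<in> curve A" and \<phi>: "local_parametrization (curve A) p \<phi>" for p \<phi>
  proof -
    obtain x y z where xyz: "p = (x, y, z)" by (cases p) auto
    interpret C: curve_point m n r A p \<phi> x y z
      using carriers(5) good p xyz \<phi> by unfold_locales
    let ?d = "Poly_Mapping.lookup DA p" and ?e = "Poly_Mapping.lookup DB p"
    have mX: "(\<lambda>t. X (\<phi> t) $ i) meromorphic_on {0}" and mY: "(\<lambda>t. Y (\<phi> t) $ i) meromorphic_on {0}" if "i < N" for i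
      using merX[OF that] merY[OF that] p \<phi> unfolding meromorphic_on_curve_def o_def by blast+
    have inc: "\<forall>\<^sub>F t in at 0. \<phi> t \<in> curve A - (EA \<union> EB)"
      by (rule local_parametrization_avoids[OF \<phi>]) (use EA EB in simp)
    have mh: "(\<lambda>t. h (\<phi> t)) meromorphic_on {0}"
    proof -
      interpret S: function_algebra "{f :: complex \<Rightarrow> complex. f meromorphic_on {0}}" by (rule meromorphic_algebra)
      have "(\<lambda>t. \<Sum>j<N. A1' $$ (0, j) * ((if j < m then 1 else C.w t) * X (\<phi> t) $ j)) \<in> {f. f meromorphic_on {0}}"
      proof (intro S.G.sum S.alg_mult S.alg_const)
        fix j assume "j \<in> {..<N}"
        then show "(\<lambda>t. X (\<phi> t) $ j) \<in> {f. f meromorphic_on {0}}" using mX by simp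
        show "(\<lambda>t. if j < m then 1 else C.w t) \<in> {f. f meromorphic_on {0}}"
          using S.alg_const C.meromorphic_w by (cases "j < m") auto
      qed
      moreover have "(\<lambda>t. h (\<phi> t)) = (\<lambda>t. \<Sum>j<N. A1' $$ (0, j) * ((if j < m then 1 else C.w t) * X (\<phi> t) $ j))"
        unfolding C.w_def using m by (simp add: h_def T_eq mat_fun_def)
      ultimately show ?thesis by simp
    qed
    have mf: "(f \<circ> \<phi>) meromorphic_on {0}"
      using meromorphic_on_mult[OF C.meromorphic_u mh] by (simp add: f_def o_def C.u_def)
    have one: "\<forall>\<^sub>F t in at 0. X (\<phi> t) $ 0 = 1" "\<forall>\<^sub>F t in at 0. Y (\<phi> t) $ 0 = 1"
      using inc by (eventually_elim, use X0 Y0 in auto)+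
    obtain L where L: "\<And>i. i < N \<Longrightarrow> ((\<lambda>t. t powi ?d * X (\<phi> t) $ i) \<longlongrightarrow> L i) (at 0)" "\<exists>i<N. L i \<noteq> 0"
      by (rule leading_vector[of N "\<lambda>i t. X (\<phi> t) $ i" ?d]) (use mX N0 one X(2) p \<phi> that in \<open>auto simp: is_pole_divisor_def\<close>)
    obtain L' where L': "\<And>i. i < N \<Longrightarrow> ((\<lambda>t. t powi ?e * Y (\<phi> t) $ i) \<longlongrightarrow> L' i) (at 0)" "\<exists>i<N. L' i \<noteq> 0"
      by (rule leading_vector[of N "\<lambda>i t. Y (\<phi> t) $ i" ?e]) (use mY N0 one Y(2) p \<phi> that in \<open>auto simp: is_pole_divisor_def\<close>)
    have eigX: "\<forall>i<N. mat_fun N A (\<lambda>j. X (\<phi> t) $ j) i = sel m n (C.u t) (C.u t * C.w t) (C.w t) i * X (\<phi> t) $ i"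
      if "\<phi> t \<in> curve A - (EA \<union> EB)" for t
      using EA(2)[of "\<phi> t"] that by (auto simp: C.u_def C.w_def)
    have eig: "\<forall>\<^sub>F t in at 0. \<forall>i<N. mat_fun N A (\<lambda>j. t powi ?d * X (\<phi> t) $ j) i =
        sel m n (C.u t) (C.u t * C.w t) (C.w t) i * (t powi ?d * X (\<phi> t) $ i)"
      using inc by eventually_elim (simp add: mat_fun_scale eigX)
    have hY: "\<forall>\<^sub>F t in at 0. \<forall>i<N. T (C.w t) (\<lambda>j. X (\<phi> t) $ j) i = h (\<phi> t) * Y (\<phi> t) $ i"
      using inc
    proof eventually_elim
      case (elim t)
      have "\<forall>i<N. mat_fun N B (T (C.w t) (\<lambda>j. X (\<phi> t) $ j)) i =
          sel m n (C.u t) (C.u t * C.w t) (C.w t) i * T (C.w t) (\<lambda>j. X (\<phi> t) $ j) i"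
        using T_eigenvector(1)[of "\<lambda>j. X (\<phi> t) $ j" "C.u t" "C.w t"] eigX[OF elim] by blast
      moreover from EB(2)[of "\<phi> t"] elim obtain u w where "\<phi> t = (Fin u, Fin (u * w), Fin w)"
        "\<And>y. (\<forall>i<N. mat_fun N B y i = sel m n u (u * w) w i * y i) \<Longrightarrow> (\<forall>i<N. y i = y 0 * Y (\<phi> t) $ i)" by auto
      moreover from this(1) have "u = C.u t" "w = C.w t" by (simp_all add: C.u_def C.w_def)
      ultimately have "\<forall>i<N. T (C.w t) (\<lambda>j. X (\<phi> t) $ j) i = T (C.w t) (\<lambda>j. X (\<phi> t) $ j) 0 * Y (\<phi> t) $ i" by blast
      then show ?case by (simp add: h_def C.w_def)
    qed
    have uw': "C.u = (\<lambda>t. aff (fst (\<phi> t)))" "C.w = (\<lambda>t. aff (snd (snd (\<phi> t))))"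
      by (simp_all add: C.u_def[abs_def] C.w_def[abs_def])
    have "\<exists>k s M. has_order C.u s \<and>
      (\<forall>i<N. ((\<lambda>t. t powi (- k) * T (C.w t) (\<lambda>j. t powi ?d * X (\<phi> t) $ j) i) \<longlongrightarrow> M i) (at 0)) \<and> (\<exists>i<N. M i \<noteq> 0) \<and>
      s + k = Poly_Mapping.lookup (divisor6 (curve A)) p - Poly_Mapping.lookup (divisor1 (curve A)) p"
      by (rule local_order[OF p \<phi> uw' _ L(2) eig]) (rule L(1))
    then obtain k s M where ks: "has_order C.u s"
      "\<forall>i<N. ((\<lambda>t. t powi (- k) * T (C.w t) (\<lambda>j. t powi ?d * X (\<phi> t) $ j) i) \<longlongrightarrow> M i) (at 0)"
      "\<exists>i<N. M i \<noteq> 0"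
      "s + k = Poly_Mapping.lookup (divisor6 (curve A)) p - Poly_Mapping.lookup (divisor1 (curve A)) p"
      by (elim exE conjE) (rule that, assumption+, blast, assumption)
    let ?g = "\<lambda>t. h (\<phi> t) * t powi (- (k + ?e - ?d))"
    have lim: "((\<lambda>t. ?g t * (t powi ?e * Y (\<phi> t) $ i)) \<longlongrightarrow> M i) (at 0)" if i: "i < N" for i
    proof (rule Lim_transform_eventually[OF mp[OF spec[OF ks(2)] i]])
      have "\<forall>\<^sub>F t in at 0. t \<noteq> (0 :: complex)" by (simp add: eventually_at_filter)
      with hY show "\<forall>\<^sub>F t in at 0. t powi (- k) * T (C.w t) (\<lambda>j. t powi ?d * X (\<phi> t) $ j) i = ?g t * (t powi ?e * Y (\<phi> t) $ i)"
      proof eventually_elim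
        case (elim t)
        have "t powi (- (k + ?e - ?d)) * t powi ?e = t powi (- k) * t powi ?d"
          using elim(2) by (simp flip: power_int_add)
        then show ?case using elim(1) i by (simp add: T_scale mult_ac)
      qed
    qed
    \<comment> \<open>A nonzero coordinate of \<open>L'\<close> yields the limit of the scalar
      factor; a nonzero coordinate of \<open>M\<close> shows that this limit is not 0.\<close>
    obtain i where i: "i < N" "L' i \<noteq> 0" using L'(2) by blast
    obtain j where j: "j < N" "M j \<noteq> 0" using ks(3) by blast
    have glim: "(?g \<longlongrightarrow> M i / L' i) (at 0)"
    proof (rule Lim_transform_eventually)
      show "((\<lambda>t. ?g t * (t powi ?e * Y (\<phi> t) $ i) / (t powi ?e * Y (\<phi> t) $ i)) \<longlongrightarrow> M i / L' i) (at 0)"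
        by (intro tendsto_divide lim L' i)
      show "\<forall>\<^sub>F t in at 0. ?g t * (t powi ?e * Y (\<phi> t) $ i) / (t powi ?e * Y (\<phi> t) $ i) = ?g t"
        using tendsto_imp_eventually_ne[OF L'(1)[OF i(1)] i(2)] by eventually_elim (rule nonzero_mult_div_cancel_right)
    qed
    have "M i / L' i \<noteq> 0"
    proof
      assume eq: "M i / L' i = 0"
      have "((\<lambda>t. ?g t * (t powi ?e * Y (\<phi> t) $ j)) \<longlongrightarrow> 0 * L' j) (at 0)"
        by (rule tendsto_mult[OF glim[unfolded eq] L'(1)[OF j(1)]])
      then have "M j = 0 * L' j" using lim[OF j(1)] by (intro tendsto_unique[OF trivial_limit_at[of "0 :: complex"]])
      then show False using j(2) by simp
    qed
    with glim have "has_order (\<lambda>t. h (\<phi> t)) (k + ?e - ?d)" by (rule has_orderI)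
    from has_order_mult[OF ks(1) this] have "has_order (f \<circ> \<phi>) (s + (k + ?e - ?d))"
      by (simp add: f_def o_def C.u_def)
    moreover have "s + (k + ?e - ?d) = ?e - Poly_Mapping.lookup (DA + divisor1 (curve A) - divisor6 (curve A)) p"
      using ks(4) by (simp add: lookup_add lookup_minus)
    ultimately show ?thesis using mf by simp
  qed
  show ?thesis unfolding linearly_equivalent_def
  proof (intro exI[of _ f] conjI ballI allI impI)
    show "meromorphic_on_curve (curve A) f" unfolding meromorphic_on_curve_def using main by blast
    fix p \<phi> assume p: "p \<in> curve A" and \<phi>: "local_parametrization (curve A) p \<phi>"
    note m = main[OF p \<phi>]
    show "\<forall>\<^sub>F t in at 0. f (\<phi> t) \<noteq> 0"
      using has_order_imp_eventually_nonzero[OF conjunct2[OF m]] by simp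
    show "zorder (f \<circ> \<phi>) 0 = Poly_Mapping.lookup DB p - Poly_Mapping.lookup (DA + divisor1 (curve A) - divisor6 (curve A)) p"
      using zorder_eq_has_order m by blast
  qed
qed

end

theorem mainTheorem4:
  fixes m n r :: nat
  assumes "m \<ge> 1" and "n \<ge> 1" and "r \<ge> 1"
  shows "for_generic_mat (m + n + r) (\<lambda>A.
    (\<exists>A1 A2 A3. factor12 m n r A1 \<and> factor13 m n r A2 \<and> factor23 m n r A3 \<and> A = A1 * A2 * A3) \<and>
    (\<exists>D. corresponding_divisor m n r A D) \<and>
    (\<forall>A1 A2 A3. factor12 m n r A1 \<and> factor13 m n r A2 \<and> factor23 m n r A3 \<and> A = A1 * A2 * A3 \<longrightarrow>
      (let B = A3 * A2 * A1; \<Gamma> = invariant_curve m n r A in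
        invariant_curve m n r B = \<Gamma> \<and>
        (\<exists>D'. corresponding_divisor m n r B D') \<and>
        (\<forall>D D'. corresponding_divisor m n r A D \<longrightarrow> corresponding_divisor m n r B D' \<longrightarrow>
           linearly_equivalent \<Gamma> D' (D + divisor1 \<Gamma> - divisor6 \<Gamma>)))))"
proof -
  interpret block_sizes m n r by unfold_locales (rule assms)+
  show ?thesis
  proof (rule generic_imp_for_generic_mat, rule generic_mono[OF generic_good])
    fix A assume A: "A \<in> carrier_mat (m + n + r) (m + n + r)" "good A"
    obtain A1 A2 A3 where "factor12 m n r A1" "factor13 m n r A2" "factor23 m n r A3" "A = A1 * A2 * A3"
      by (rule factorization_exists[OF A(1)]) (use A(2) in \<open>auto simp: good_def\<close>)
    moreover have "let B = A3 * A2 * A1; \<Gamma> = invariant_curve m n r A in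
        invariant_curve m n r B = \<Gamma> \<and> (\<exists>D'. corresponding_divisor m n r B D') \<and>
        (\<forall>D D'. corresponding_divisor m n r A D \<longrightarrow> corresponding_divisor m n r B D' \<longrightarrow>
           linearly_equivalent \<Gamma> D' (D + divisor1 \<Gamma> - divisor6 \<Gamma>))"
      if f: "factor12 m n r A1 \<and> factor13 m n r A2 \<and> factor23 m n r A3 \<and> A = A1 * A2 * A3" for A1 A2 A3
    proof -
      have acts: "acts_on N (\<lambda>i. i < m + n) A1" "acts_on N (\<lambda>i. i < m \<or> m + n \<le> i) A2" "acts_on N (\<lambda>i. m \<le> i) A3"
        using f by (simp_all add: factor12_iff factor13_iff factor23_iff)
      \<comment> \<open>Whatever the factorization, its factors are invertible because
        \<open>A\<close> is; this supplies the inverse \<open>A1'\<close> on which \<open>T\<close>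
        is built.\<close>
      have "Determinant.det A = Determinant.det A1 * Determinant.det A2 * Determinant.det A3"
        using f acts_onD[OF acts(1)] acts_onD[OF acts(2)] acts_onD[OF acts(3)] by (simp add: det_mult[of _ N])
      moreover have "Determinant.det A \<noteq> 0" using A pencil_one[OF A(1)] by (simp add: good_def)
      ultimately have "Determinant.det A1 \<noteq> 0" by auto
      then obtain A1' where A1': "acts_on N (\<lambda>i. i < m + n) A1'"
        "\<And>x i. i < N \<Longrightarrow> mat_fun N A1 (mat_fun N A1' x) i = x i"
        "\<And>x i. i < N \<Longrightarrow> mat_fun N A1' (mat_fun N A1 x) i = x i"
        by (rule acts_on_inverse[OF acts(1)]) (rule that)
      interpret refactorization m n r A A1 A2 A3 A1'
        using A(2) f acts A1' by unfold_locales auto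
      show ?thesis unfolding Let_def
        using curve_B corresponding_divisor_B divisors_linearly_equivalent by blast
    qed
    ultimately show "(\<exists>A1 A2 A3. factor12 m n r A1 \<and> factor13 m n r A2 \<and> factor23 m n r A3 \<and> A = A1 * A2 * A3) \<and>
      (\<exists>D. corresponding_divisor m n r A D) \<and>
      (\<forall>A1 A2 A3. factor12 m n r A1 \<and> factor13 m n r A2 \<and> factor23 m n r A3 \<and> A = A1 * A2 * A3 \<longrightarrow>
        (let B = A3 * A2 * A1; \<Gamma> = invariant_curve m n r A in
          invariant_curve m n r B = \<Gamma> \<and>
          (\<exists>D'. corresponding_divisor m n r B D') \<and>
          (\<forall>D D'. corresponding_divisor m n r A D \<longrightarrow> corresponding_divisor m n r B D' \<longrightarrow>
             linearly_equivalent \<Gamma> D' (D + divisor1 \<Gamma> - divisor6 \<Gamma>))))"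
      using corresponding_divisor_A[OF A] by blast
  qed
qed

end
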